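(* Let $H$ be a complex Hadamard matrix of size $n$ all of whose entries are $s$-th roots of unity ($s\in\mathbb N$). Then $\mathrm{Aut}^+_{H_n^{s+}}(H)\subseteq\mathrm{Aut}^+(\Gamma_H)$, i.e. $\mathrm{Aut}^+_{H_n^{s+}}(H)$ embeds as a quantum subgroup of $\mathrm{Aut}^+(\Gamma_H)$: there is a surjective homomorphism of Hopf $*$-algebras $\mathcal O(\mathrm{Aut}^+(\Gamma_H))\to\mathcal O(\mathrm{Aut}^+_{H_n^{s+}}(H))$.
   Context: A (complex) Hadamard matrix of size $n$ is $H\in M_n(\mathbb C)$ with entries of modulus one and $HH^\dagger=nI$. Let $\omega=e^{2\pi i/s}$. For a unital $*$-algebra $\mathcal A$, $u=(u_{ij})\in M_n(\mathcal A)$ is an order-$s$ quantum reflection matrix if $u$ and $\bar u=(u_{ij}^* )$ are unitary, each $u_{ij}$ is a normal partial isometry, and $u_{ij}^s=u_{ij}u_{ij}^*$. The compact quantum group $\mathrm{Aut}^+_{H_n^{s+}}(H)=H_n^{s+}\cap HH_n^{s+}H^{-1}$ is defined by the Hopf $*$-algebra $\mathcal O(\mathrm{Aut}^+_{H_n^{s+}}(H))$, the universal unital $*$-algebra generated by $p_{ij}$, $1\le i,j\le n$, subject to the relations that both $p=(p_{ij})$ and $H^{-1}pH$ are order-$s$ quantum reflection matrices, with comultiplication $\Delta(p_{ij})=\sum_kp_{ik}\otimes p_{kj}$. The Hadamard graph $\Gamma_H$ is the bipartite graph with vertex set $\{(r_i,\omega^k)\}\sqcup\{(c_j,\omega^l)\}$,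 $1\le i,j\le n$, $k,l\in\mathbb Z_s$, and adjacency $(r_i,\omega^k)\sim(c_j,\omega^l)\iff \omega^kH_{ij}=\omega^l$ (no edges inside the two parts). For a finite graph $\Gamma$ with adjacency matrix $A$ on $N$ vertices, $\mathrm{Aut}^+(\Gamma)$ is its quantum automorphism group: $\mathcal O(\mathrm{Aut}^+(\Gamma))$ is the universal unital $*$-algebra generated by the entries of an $N\times N$ magic unitary $U$ (entries are self-adjoint projections, rows and columns sum to $1$) with $AU=UA$, with comultiplication $\Delta(U_{ij})=\sum_kU_{ik}\otimes U_{kj}$.
   Formalization: "Universal unital *-algebra" is taken among *-algebras of Hilbert space operators (separated by positive functionals); for arbitrary *-algebras projections with sum 1 need not be orthogonal and the stated comultiplication need not exist (e.g. n=1, s=4). *)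

theory Defs
  imports
    "HOL-Analysis.Cartesian_Space"
    "HOL-Analysis.Complex_Transcendental"
    "HOL-Algebra.QuotRing"
    "HOL-Algebra.Module"
    "Graph_Theory.Pair_Digraph"
begin

section \<open>Unital \<open>*\<close>-algebras over the complex numbers\<close>

record 'a star_alg = "(complex, 'a) module" +
  star :: "'a \<Rightarrow> 'a"

definition complex_star_alg :: "complex star_alg" where
  "complex_star_alg =
    \<lparr>carrier = UNIV, monoid.mult = (*), one = 1, zero = 0, add = (+), smult = (*), star = cnj\<rparr>"

definition opposite :: "('a, 'x) star_alg_scheme \<Rightarrow> ('a, 'x) star_alg_scheme" where
  "opposite A = A\<lparr>monoid.mult := (\<lambda>a b. b \<otimes>\<^bsub>A\<^esub> a)\<rparr>"

definition star_hom ::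
  "('a, 'x) star_alg_scheme \<Rightarrow> ('b, 'y) star_alg_scheme \<Rightarrow> ('a \<Rightarrow> 'b) set" where
  "star_hom A B = {h \<in> ring_hom A B. \<forall>a\<in>carrier A.
     (\<forall>c. h (c \<odot>\<^bsub>A\<^esub> a) = c \<odot>\<^bsub>B\<^esub> h a) \<and> h (star A a) = star B (h a)}"

text \<open>No closure under scalars is needed below: in a unital algebra it follows from
  \<open>c a = (c 1) a\<close>.\<close>
definition star_ideal :: "'a set \<Rightarrow> ('a, 'x) star_alg_scheme \<Rightarrow> bool" where
  "star_ideal J A \<longleftrightarrow> ideal J A \<and> (\<forall>a\<in>J. star A a \<in> J)"

definition star_quot :: "('a, 'x) star_alg_scheme \<Rightarrow> 'a set \<Rightarrow> 'a set star_alg" where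
  "star_quot A J =
    \<lparr>carrier = carrier (A Quot J), monoid.mult = monoid.mult (A Quot J), one = one (A Quot J),
     zero = zero (A Quot J), add = add (A Quot J),
     smult = (\<lambda>c X. \<Union>a\<in>X. J +>\<^bsub>A\<^esub> (c \<odot>\<^bsub>A\<^esub> a)),
     star = (\<lambda>X. \<Union>a\<in>X. J +>\<^bsub>A\<^esub> star A a)\<rparr>"

text \<open>
  The smallest \<open>*\<close>-ideal \<open>J\<close> of \<open>A\<close> such that the relations \<open>R\<close> hold in \<open>A/J\<close>, where \<open>R Q \<pi>\<close>
  says that they hold in \<open>Q\<close> for the images under \<open>\<pi>\<close> of elements of \<open>A\<close>. The intersection
  itself has this property for all \<open>R\<close> used below: equations between elements are inherited
  from the quotients \<open>A/J\<close>, and so is \<open>reduced_star_alg\<close>.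
\<close>
definition relation_ideal ::
  "('a, 'x) star_alg_scheme \<Rightarrow> ('a set star_alg \<Rightarrow> ('a \<Rightarrow> 'a set) \<Rightarrow> bool) \<Rightarrow> 'a set" where
  "relation_ideal A R = \<Inter>{J. star_ideal J A \<and> R (star_quot A J) (\<lambda>a. J +>\<^bsub>A\<^esub> a)}"


section \<open>Free \<open>*\<close>-algebras and tensor products\<close>

text \<open>
  The monoid \<open>*\<close>-algebra \<open>\<complex>[M]\<close>: finitely supported functions on \<open>M\<close> under convolution, where
  \<open>\<tau>\<close> is the involution of \<open>M\<close> which is extended antilinearly.
\<close>
definition monoid_star_alg ::
  "('m, 'x) monoid_scheme \<Rightarrow> ('m \<Rightarrow> 'm) \<Rightarrow> ('m \<Rightarrow> complex) star_alg" where
  "monoid_star_alg M \<tau> =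
    \<lparr>carrier = {f. finite {x. f x \<noteq> 0} \<and> {x. f x \<noteq> 0} \<subseteq> carrier M},
     monoid.mult = (\<lambda>f g x. \<Sum>(y, z)\<in>{(y, z). f y \<noteq> 0 \<and> g z \<noteq> 0 \<and> y \<otimes>\<^bsub>M\<^esub> z = x}. f y * g z),
     one = (\<lambda>x. of_bool (x = \<one>\<^bsub>M\<^esub>)),
     zero = (\<lambda>x. 0),
     add = (\<lambda>f g x. f x + g x),
     smult = (\<lambda>c f x. c * f x),
     star = (\<lambda>f x. if x \<in> carrier M then cnj (f (\<tau> x)) else 0)\<rparr>"

definition basis_elt :: "'m \<Rightarrow> 'm \<Rightarrow> complex" where
  "basis_elt x = (\<lambda>y. of_bool (y = x))"

text \<open>
  The free unital \<open>*\<close>-algebra on \<open>X\<close> is spanned by the words in the letters \<open>x = (x, False)\<close> and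
  \<open>x\<^sup>* = (x, True)\<close> for \<open>x \<in> X\<close>.
\<close>
definition free_star_alg :: "'g set \<Rightarrow> (('g \<times> bool) list \<Rightarrow> complex) star_alg" where
  "free_star_alg X = monoid_star_alg
     \<lparr>carrier = lists (X \<times> UNIV), monoid.mult = (@), one = []\<rparr>
     (\<lambda>w. rev (map (\<lambda>(x, b). (x, \<not> b)) w))"

definition free_gen :: "'g \<Rightarrow> ('g \<times> bool) list \<Rightarrow> complex" where
  "free_gen x = basis_elt [(x, False)]"

definition bilinear_relations ::
  "('a, 'x) star_alg_scheme \<Rightarrow> ('b, 'y) star_alg_scheme \<Rightarrow> ('t, 'z) star_alg_scheme
    \<Rightarrow> ('a \<Rightarrow> 'b \<Rightarrow> 't) \<Rightarrow> bool" where
  "bilinear_relations A B T t \<longleftrightarrow>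
     (\<forall>a\<in>carrier A. \<forall>a'\<in>carrier A. \<forall>b\<in>carrier B. t (a \<oplus>\<^bsub>A\<^esub> a') b = t a b \<oplus>\<^bsub>T\<^esub> t a' b) \<and>
     (\<forall>a\<in>carrier A. \<forall>b\<in>carrier B. \<forall>b'\<in>carrier B. t a (b \<oplus>\<^bsub>B\<^esub> b') = t a b \<oplus>\<^bsub>T\<^esub> t a b') \<and>
     (\<forall>c. \<forall>a\<in>carrier A. \<forall>b\<in>carrier B.
        t (c \<odot>\<^bsub>A\<^esub> a) b = c \<odot>\<^bsub>T\<^esub> t a b \<and> t a (c \<odot>\<^bsub>B\<^esub> b) = c \<odot>\<^bsub>T\<^esub> t a b)"

text \<open>
  The algebraic tensor product: the vector space with basis \<open>A \<times> B\<close> modulo bilinearity. It is taken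
  as a quotient of the monoid \<open>*\<close>-algebra of \<open>A \<times> B\<close>, which gives it the product
  \<open>(a \<otimes> b) (a' \<otimes> b') = a a' \<otimes> b b'\<close> and the involution \<open>(a \<otimes> b)\<^sup>* = a\<^sup>* \<otimes> b\<^sup>*\<close>; the linear span of
  the bilinearity relators is already a \<open>*\<close>-ideal there.
\<close>
definition pretensor ::
  "('a, 'x) star_alg_scheme \<Rightarrow> ('b, 'y) star_alg_scheme \<Rightarrow> ('a \<times> 'b \<Rightarrow> complex) star_alg" where
  "pretensor A B = monoid_star_alg (A \<times>\<times> B) (map_prod (star A) (star B))"

definition tensor_ideal ::
  "('a, 'x) star_alg_scheme \<Rightarrow> ('b, 'y) star_alg_scheme \<Rightarrow> ('a \<times> 'b \<Rightarrow> complex) set" where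
  "tensor_ideal A B = relation_ideal (pretensor A B)
     (\<lambda>T \<pi>. bilinear_relations A B T (\<lambda>a b. \<pi> (basis_elt (a, b))))"

definition tensor ::
  "('a, 'x) star_alg_scheme \<Rightarrow> ('b, 'y) star_alg_scheme
    \<Rightarrow> ('a \<times> 'b \<Rightarrow> complex) set star_alg" where
  "tensor A B = star_quot (pretensor A B) (tensor_ideal A B)"

definition pure_tensor ::
  "('a, 'x) star_alg_scheme \<Rightarrow> ('b, 'y) star_alg_scheme
    \<Rightarrow> 'a \<Rightarrow> 'b \<Rightarrow> ('a \<times> 'b \<Rightarrow> complex) set" where
  "pure_tensor A B a b = tensor_ideal A B +>\<^bsub>pretensor A B\<^esub> basis_elt (a, b)"

text \<open>The homomorphism \<open>g \<otimes> h\<close>, determined on \<open>A \<otimes> A'\<close> by its values on pure tensors.\<close>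
definition tensor_hom ::
  "('a, 'x) star_alg_scheme \<Rightarrow> ('b, 'y) star_alg_scheme \<Rightarrow>
   ('c, 'z) star_alg_scheme \<Rightarrow> ('d, 'w) star_alg_scheme \<Rightarrow> ('a \<Rightarrow> 'c) \<Rightarrow> ('b \<Rightarrow> 'd) \<Rightarrow>
   ('a \<times> 'b \<Rightarrow> complex) set \<Rightarrow> ('c \<times> 'd \<Rightarrow> complex) set" where
  "tensor_hom A A' B B' g h = (SOME k. k \<in> star_hom (tensor A A') (tensor B B') \<and>
     (\<forall>a\<in>carrier A. \<forall>a'\<in>carrier A'.
        k (pure_tensor A A' a a') = pure_tensor B B' (g a) (h a')))"


section \<open>Compact matrix quantum groups given by generators and relations\<close>

record 'a hopf_star_alg = "'a star_alg" +
  comult :: "'a \<Rightarrow> ('a \<times> 'a \<Rightarrow> complex) set"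
  counit :: "'a \<Rightarrow> complex"
  antipode :: "'a \<Rightarrow> 'a"

definition hopf_star_hom ::
  "('a, 'x) hopf_star_alg_scheme \<Rightarrow> ('b, 'y) hopf_star_alg_scheme \<Rightarrow> ('a \<Rightarrow> 'b) set" where
  "hopf_star_hom A B = {h \<in> star_hom A B. \<forall>a\<in>carrier A.
     comult B (h a) = tensor_hom A A B B h h (comult A a) \<and>
     counit B (h a) = counit A a \<and>
     antipode B (h a) = h (antipode A a)}"

text \<open>A quantum group is represented by its Hopf \<open>*\<close>-algebra \<open>\<O>(G)\<close>; the inclusion of \<open>G\<close> in \<open>K\<close>
  is dual to the surjection \<open>\<O>(K) \<rightarrow> \<O>(G)\<close>.\<close>
definition quantum_subgroup ::
  "('a, 'x) hopf_star_alg_scheme \<Rightarrow> ('b, 'y) hopf_star_alg_scheme \<Rightarrow> bool" where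
  "quantum_subgroup G K \<longleftrightarrow> (\<exists>h\<in>hopf_star_hom K G. h ` carrier K = carrier G)"

definition positive_functional :: "('a, 'x) star_alg_scheme \<Rightarrow> ('a \<Rightarrow> complex) \<Rightarrow> bool" where
  "positive_functional A f \<longleftrightarrow>
     (\<forall>a\<in>carrier A. \<forall>b\<in>carrier A. f (a \<oplus>\<^bsub>A\<^esub> b) = f a + f b) \<and>
     (\<forall>c. \<forall>a\<in>carrier A. f (c \<odot>\<^bsub>A\<^esub> a) = c * f a) \<and>
     (\<forall>a\<in>carrier A. f (star A a \<otimes>\<^bsub>A\<^esub> a) \<in> \<real>\<^sub>\<ge>\<^sub>0)"

text \<open>
  By the GNS construction, \<open>A\<close> is reduced iff it is a \<open>*\<close>-algebra of operators on a pre-Hilbert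
  space. These operators are bounded if \<open>A\<close> is generated by partial isometries, so that \<open>A\<close> then
  is a \<open>*\<close>-subalgebra of a C*-algebra.
\<close>
definition reduced_star_alg :: "('a, 'x) star_alg_scheme \<Rightarrow> bool" where
  "reduced_star_alg A \<longleftrightarrow> (\<forall>a\<in>carrier A. a \<noteq> \<zero>\<^bsub>A\<^esub> \<longrightarrow>
     (\<exists>f. positive_functional A f \<and> f (star A a \<otimes>\<^bsub>A\<^esub> a) \<noteq> 0))"

type_synonym 'i coord = "((('i \<times> 'i) \<times> bool) list \<Rightarrow> complex) set"

text \<open>
  The coordinate algebra of the quantum group with fundamental representation
  \<open>u = (u\<^sub>i\<^sub>j)\<close>, \<open>i, j \<in> I\<close>, subject to the relations \<open>R\<close>. As usual for compact quantum groups,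
  ``universal'' refers to \<open>*\<close>-algebras of Hilbert space operators: \<open>\<O>(G)\<close> is generated by the
  \<open>u\<^sub>i\<^sub>j\<close> inside the universal C*-algebra of the relations. With arbitrary \<open>*\<close>-algebras instead,
  the comultiplication would not exist in general: algebraically, four or more projections with
  sum \<open>1\<close> need not be orthogonal, and then \<open>\<Sum>\<^sub>k u\<^sub>i\<^sub>k \<otimes> u\<^sub>k\<^sub>j\<close> need not be a projection for
  a magic unitary \<open>u\<close>.
\<close>
definition matrix_ideal ::
  "'i set \<Rightarrow> ('i coord star_alg \<Rightarrow> ('i \<Rightarrow> 'i \<Rightarrow> 'i coord) \<Rightarrow> bool)
    \<Rightarrow> ((('i \<times> 'i) \<times> bool) list \<Rightarrow> complex) set" where
  "matrix_ideal I R = relation_ideal (free_star_alg (I \<times> I))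
     (\<lambda>Q \<pi>. reduced_star_alg Q \<and> R Q (\<lambda>i j. \<pi> (free_gen (i, j))))"

definition matrix_star_alg ::
  "'i set \<Rightarrow> ('i coord star_alg \<Rightarrow> ('i \<Rightarrow> 'i \<Rightarrow> 'i coord) \<Rightarrow> bool) \<Rightarrow> 'i coord star_alg" where
  "matrix_star_alg I R = star_quot (free_star_alg (I \<times> I)) (matrix_ideal I R)"

definition matrix_gen ::
  "'i set \<Rightarrow> ('i coord star_alg \<Rightarrow> ('i \<Rightarrow> 'i \<Rightarrow> 'i coord) \<Rightarrow> bool) \<Rightarrow> 'i \<Rightarrow> 'i \<Rightarrow> 'i coord" where
  "matrix_gen I R i j = matrix_ideal I R +>\<^bsub>free_star_alg (I \<times> I)\<^esub> free_gen (i, j)"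

text \<open>
  The Hopf \<open>*\<close>-algebra structure: \<open>\<Delta>(u\<^sub>i\<^sub>j) = \<Sum>\<^sub>k u\<^sub>i\<^sub>k \<otimes> u\<^sub>k\<^sub>j\<close>, \<open>\<epsilon>(u\<^sub>i\<^sub>j) = \<delta>\<^sub>i\<^sub>j\<close> and
  \<open>S(u\<^sub>i\<^sub>j) = u\<^sub>j\<^sub>i\<^sup>*\<close>. The antipode commutes with the involution because the matrix \<open>(u\<^sub>i\<^sub>j\<^sup>*)\<close> is
  unitary, too, for all \<open>u\<close> considered here. Each of these maps is unique on the carrier, which
  is generated by the \<open>u\<^sub>i\<^sub>j\<close>.
\<close>
definition matrix_quantum_group ::
  "'i set \<Rightarrow> ('i coord star_alg \<Rightarrow> ('i \<Rightarrow> 'i \<Rightarrow> 'i coord) \<Rightarrow> bool)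
    \<Rightarrow> 'i coord hopf_star_alg" where
  "matrix_quantum_group I R = (let A = matrix_star_alg I R; u = matrix_gen I R in
     star_alg.extend A (hopf_star_alg.fields
       (SOME \<Delta>. \<Delta> \<in> star_hom A (tensor A A) \<and> (\<forall>i\<in>I. \<forall>j\<in>I.
          \<Delta> (u i j) = (\<Oplus>\<^bsub>tensor A A\<^esub>k\<in>I. pure_tensor A A (u i k) (u k j))))
       (SOME \<epsilon>. \<epsilon> \<in> star_hom A complex_star_alg \<and>
          (\<forall>i\<in>I. \<forall>j\<in>I. \<epsilon> (u i j) = of_bool (i = j)))
       (SOME S. S \<in> star_hom A (opposite A) \<and>
          (\<forall>i\<in>I. \<forall>j\<in>I. S (u i j) = star A (u j i)))))"


section \<open>Quantum automorphisms of Hadamard matrices\<close>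

definition unitary_matrix ::
  "('a, 'x) star_alg_scheme \<Rightarrow> 'i set \<Rightarrow> ('i \<Rightarrow> 'i \<Rightarrow> 'a) \<Rightarrow> bool" where
  "unitary_matrix A I u \<longleftrightarrow> (\<forall>i\<in>I. \<forall>j\<in>I.
     (\<Oplus>\<^bsub>A\<^esub>k\<in>I. u i k \<otimes>\<^bsub>A\<^esub> star A (u j k)) = (if i = j then \<one>\<^bsub>A\<^esub> else \<zero>\<^bsub>A\<^esub>) \<and>
     (\<Oplus>\<^bsub>A\<^esub>k\<in>I. star A (u k i) \<otimes>\<^bsub>A\<^esub> u k j) = (if i = j then \<one>\<^bsub>A\<^esub> else \<zero>\<^bsub>A\<^esub>))"

definition quantum_reflection_matrix ::
  "('a, 'x) star_alg_scheme \<Rightarrow> nat \<Rightarrow> 'i set \<Rightarrow> ('i \<Rightarrow> 'i \<Rightarrow> 'a) \<Rightarrow> bool" where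
  "quantum_reflection_matrix A s I u \<longleftrightarrow>
     (\<forall>i\<in>I. \<forall>j\<in>I. u i j \<in> carrier A) \<and>
     unitary_matrix A I u \<and> unitary_matrix A I (\<lambda>i j. star A (u i j)) \<and>
     (\<forall>i\<in>I. \<forall>j\<in>I.
        u i j \<otimes>\<^bsub>A\<^esub> star A (u i j) = star A (u i j) \<otimes>\<^bsub>A\<^esub> u i j \<and>
        u i j \<otimes>\<^bsub>A\<^esub> star A (u i j) \<otimes>\<^bsub>A\<^esub> u i j = u i j \<and>
        u i j [^]\<^bsub>A\<^esub> s = u i j \<otimes>\<^bsub>A\<^esub> star A (u i j))"

definition complex_hadamard :: "complex^'n^'n \<Rightarrow> bool" where
  "complex_hadamard H \<longleftrightarrow> (\<forall>i j. cmod (H $ i $ j) = 1) \<and>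
     H ** map_matrix cnj (transpose H) = mat (of_nat CARD('n))"

text \<open>The matrix \<open>H\<^sup>-\<^sup>1 p H\<close>.\<close>
definition conjugate_by ::
  "('a, 'x) star_alg_scheme \<Rightarrow> complex^'n^'n \<Rightarrow> ('n \<Rightarrow> 'n \<Rightarrow> 'a) \<Rightarrow> 'n \<Rightarrow> 'n \<Rightarrow> 'a" where
  "conjugate_by A H p i j =
     (\<Oplus>\<^bsub>A\<^esub>k\<in>UNIV. \<Oplus>\<^bsub>A\<^esub>l\<in>UNIV. (matrix_inv H $ i $ k * H $ l $ j) \<odot>\<^bsub>A\<^esub> p k l)"

definition quantum_aut_hadamard :: "nat \<Rightarrow> complex^'n^'n \<Rightarrow> 'n coord hopf_star_alg" where
  "quantum_aut_hadamard s H = matrix_quantum_group UNIV (\<lambda>A p.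
     quantum_reflection_matrix A s UNIV p \<and>
     quantum_reflection_matrix A s UNIV (conjugate_by A H p))"


section \<open>Quantum automorphisms of graphs\<close>

definition magic_unitary ::
  "('a, 'x) star_alg_scheme \<Rightarrow> 'v set \<Rightarrow> ('v \<Rightarrow> 'v \<Rightarrow> 'a) \<Rightarrow> bool" where
  "magic_unitary A V U \<longleftrightarrow>
     (\<forall>v\<in>V. \<forall>w\<in>V. U v w \<in> carrier A \<and>
        star A (U v w) = U v w \<and> U v w \<otimes>\<^bsub>A\<^esub> U v w = U v w) \<and>
     (\<forall>v\<in>V. (\<Oplus>\<^bsub>A\<^esub>w\<in>V. U v w) = \<one>\<^bsub>A\<^esub> \<and> (\<Oplus>\<^bsub>A\<^esub>w\<in>V. U w v) = \<one>\<^bsub>A\<^esub>)"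

definition adjacency_matrix :: "'v pair_pre_digraph \<Rightarrow> 'v \<Rightarrow> 'v \<Rightarrow> complex" where
  "adjacency_matrix G v w = of_bool ((v, w) \<in> parcs G)"

definition quantum_aut_graph :: "'v pair_pre_digraph \<Rightarrow> 'v coord hopf_star_alg" where
  "quantum_aut_graph G = matrix_quantum_group (pverts G) (\<lambda>A U.
     magic_unitary A (pverts G) U \<and>
     (\<forall>v\<in>pverts G. \<forall>w\<in>pverts G.
        (\<Oplus>\<^bsub>A\<^esub>x\<in>pverts G. adjacency_matrix G v x \<odot>\<^bsub>A\<^esub> U x w) =
        (\<Oplus>\<^bsub>A\<^esub>x\<in>pverts G. adjacency_matrix G x w \<odot>\<^bsub>A\<^esub> U v x)))"

text \<open>The vertex \<open>(r\<^sub>i, z)\<close> is \<open>Inl (i, z)\<close> and \<open>(c\<^sub>j, z)\<close> is \<open>Inr (j, z)\<close>.\<close>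
definition hadamard_graph ::
  "nat \<Rightarrow> complex^'n^'n \<Rightarrow> ('n \<times> complex + 'n \<times> complex) pair_pre_digraph" where
  "hadamard_graph s H = (let \<omega> = exp (2 * of_real pi * \<i> / of_nat s) in
     \<lparr>pverts = {Inl (i, \<omega> ^ k) | i k. k < s} \<union> {Inr (j, \<omega> ^ l) | j l. l < s},
      parcs = {(Inl (i, \<omega> ^ k), Inr (j, \<omega> ^ l)) | i j k l.
                 k < s \<and> l < s \<and> \<omega> ^ k * H $ i $ j = \<omega> ^ l} \<union>
              {(Inr (j, \<omega> ^ l), Inl (i, \<omega> ^ k)) | i j k l.
                 k < s \<and> l < s \<and> \<omega> ^ k * H $ i $ j = \<omega> ^ l}\<rparr>)"

end

theory Submission
  imports Defs
begin

text \<open>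
  In a \<open>*\<close>-algebra with enough positive functionals, projections with sum \<open>1\<close> are orthogonal. Hence
  distinct entries in a row or column of a quantum reflection matrix \<open>p\<close> multiply to \<open>0\<close>. Each entry \<open>x\<close>
  is a normal partial isometry with \<open>x\<^sup>s = x x\<^sup>*\<close>, so it has spectral projections
  \<open>P\<^sub>z(x) = 1/s \<Sum>\<^sub>m z\<^sup>-\<^sup>m x\<^sup>m\<close> for \<open>z\<^sup>s = 1\<close>, with \<open>x = \<Sum>\<^sub>z z P\<^sub>z(x)\<close>. With \<open>q = H\<^sup>-\<^sup>1 p H\<close>, the block
  diagonal matrix \<open>U\<close> with entries \<open>P\<^sub>w\<^sub>/\<^sub>z(p\<^sub>i\<^sub>j)\<close> at \<open>((r\<^sub>i, z), (r\<^sub>j, w))\<close> and \<open>P\<^sub>w\<^sub>/\<^sub>z(q\<^sub>i\<^sub>j)\<close> at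
  \<open>((c\<^sub>i, z), (c\<^sub>j, w))\<close> is a magic unitary, and its entries generate the algebra. That \<open>U\<close> commutes with
  the adjacency matrix means that both sides of \<open>H q = p H\<close> and of \<open>q H\<^sup>-\<^sup>1 = H\<^sup>-\<^sup>1 p\<close> have the same spectral
  projections; their powers can be taken term by term because of the orthogonality. The resulting
  homomorphism respects the Hopf structure, because an orthogonal decomposition \<open>x = \<Sum>\<^sub>z z G\<^sub>z\<close> determines
  the idempotents \<open>G\<^sub>z\<close>, and \<open>\<Sum>\<^sub>k U\<^sub>v\<^sub>k \<otimes> U\<^sub>k\<^sub>w\<close> provides such a decomposition of
  \<open>\<Sum>\<^sub>k p\<^sub>i\<^sub>k \<otimes> p\<^sub>k\<^sub>j\<close>.

  The comultiplications exist because a tensor product of algebras with enough positive functionals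
  has enough positive functionals: \<open>f \<otimes> g\<close> is positive by Schur's theorem on products of
  positive semidefinite kernels, and such functionals separate the elements.
\<close>

section \<open>Star algebras and their homomorphisms\<close>

text \<open>Two features of the definitions shape the proof. The universal algebras are quotients by
  intersections of ideals, so relations are evaluated only in quotients of one free algebra, while
  \<Delta>, \<epsilon> and S take values in algebras of other types. Relations are therefore
  transported along injective homomorphisms: to map O(G) to B, they are tested in the quotient of
  the free algebra by the kernel, which embeds in B. Moreover \<Delta>, \<epsilon>, S and g
  \<otimes> h are choices, which say nothing until suitable maps exist. Hence the relations of both
  quantum groups have to be verified in tensor squares, opposite algebras and the complex numbers;
  the nonlinear ones survive in tensor squares because of orthogonality. For the adjacency matrix,
  the only neighbour of (r_i, z) over column k is (c_k, z H_ik). So the entry of A U at ((r_i, z),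
  (c_j, y)) is the sum over k of the spectral projections of q_kj at y / (z H_ik), that is, of those
  of H_ik q_kj at y / z: the shift of the eigenvalue is absorbed in the element.\<close>

locale star_algebra = ring A for A :: "('a, 'x) star_alg_scheme" (structure) +
  assumes scale_closed [simp, intro]: "a \<in> carrier A \<Longrightarrow> c \<odot> a \<in> carrier A"
    and scale_add_left: "a \<in> carrier A \<Longrightarrow> (c + d) \<odot> a = c \<odot> a \<oplus> d \<odot> a"
    and scale_add_right: "a \<in> carrier A \<Longrightarrow> b \<in> carrier A \<Longrightarrow> c \<odot> (a \<oplus> b) = c \<odot> a \<oplus> c \<odot> b"
    and scale_scale [simp]: "a \<in> carrier A \<Longrightarrow> c \<odot> (d \<odot> a) = (c * d) \<odot> a"
    and scale_one [simp]: "a \<in> carrier A \<Longrightarrow> 1 \<odot> a = a"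
    and scale_mult_left [simp]: "a \<in> carrier A \<Longrightarrow> b \<in> carrier A \<Longrightarrow> (c \<odot> a) \<otimes> b = c \<odot> (a \<otimes> b)"
    and scale_mult_right [simp]: "a \<in> carrier A \<Longrightarrow> b \<in> carrier A \<Longrightarrow> a \<otimes> (c \<odot> b) = c \<odot> (a \<otimes> b)"
    and star_closed [simp, intro]: "a \<in> carrier A \<Longrightarrow> star A a \<in> carrier A"
    and star_add: "a \<in> carrier A \<Longrightarrow> b \<in> carrier A \<Longrightarrow> star A (a \<oplus> b) = star A a \<oplus> star A b"
    and star_mult: "a \<in> carrier A \<Longrightarrow> b \<in> carrier A \<Longrightarrow> star A (a \<otimes> b) = star A b \<otimes> star A a"
    and star_star [simp]: "a \<in> carrier A \<Longrightarrow> star A (star A a) = a"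
    and star_scale: "a \<in> carrier A \<Longrightarrow> star A (c \<odot> a) = cnj c \<odot> star A a"
begin

lemma scale_zero_left [simp]: "a \<in> carrier A \<Longrightarrow> 0 \<odot> a = \<zero>"
  using scale_add_left[of a 0 0] by (metis add.l_cancel_one' add_0 scale_closed)

lemma scale_zero_right [simp]: "c \<odot> \<zero> = \<zero>"
  using scale_scale[of \<zero> c 0] by simp

lemma minus_eq_scale: "a \<in> carrier A \<Longrightarrow> \<ominus> a = (-1) \<odot> a"
  using scale_add_left[of a "-1" 1] by (intro minus_equality) simp_all

lemma star_zero [simp]: "star A \<zero> = \<zero>"
  using star_scale[of \<zero> 0] by simp

lemma star_one [simp]: "star A \<one> = \<one>"
  by (metis l_one one_closed r_one star_closed star_mult star_star)

lemma star_pow: "a \<in> carrier A \<Longrightarrow> star A (a [^] (m::nat)) = star A a [^] m"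
  by (induction m) (simp_all add: star_mult flip: nat_pow_Suc2)

lemma fs_closed [simp, intro]: "(\<And>i. i \<in> S \<Longrightarrow> f i \<in> carrier A) \<Longrightarrow> finsum A f S \<in> carrier A"
  by (rule finsum_closed) auto

lemma fs_cong: "S = T \<Longrightarrow> (\<And>i. i \<in> T \<Longrightarrow> f i = g i) \<Longrightarrow> (\<And>i. i \<in> T \<Longrightarrow> g i \<in> carrier A)
  \<Longrightarrow> finsum A f S = finsum A g T"
  by (rule finsum_cong') auto

lemma fs_insert: "finite S \<Longrightarrow> n \<notin> S \<Longrightarrow> (\<And>i. i \<in> insert n S \<Longrightarrow> f i \<in> carrier A)
  \<Longrightarrow> finsum A f (insert n S) = f n \<oplus> finsum A f S"
  by (rule finsum_insert) auto

lemma fs_zero: "(\<And>i. i \<in> S \<Longrightarrow> f i = \<zero>) \<Longrightarrow> finsum A f S = \<zero>"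
  using fs_cong[of S S f "\<lambda>_. \<zero>"] by simp

lemma fs_add: "(\<And>i. i \<in> S \<Longrightarrow> f i \<in> carrier A) \<Longrightarrow> (\<And>i. i \<in> S \<Longrightarrow> g i \<in> carrier A)
  \<Longrightarrow> finsum A (\<lambda>i. f i \<oplus> g i) S = finsum A f S \<oplus> finsum A g S"
  by (rule finsum_addf) auto

text \<open>Only additivity is asked of \<open>h\<close>, and \<open>B\<close> is a separate
  algebra. So this covers scaling, multiplication on either side, the antilinear involution,
  homomorphisms, functionals with values in the complex numbers, and each slot of a pure
  tensor.\<close>

lemma fs_additive:
  assumes "\<And>i. i \<in> S \<Longrightarrow> f i \<in> carrier A" "h \<zero> = \<zero>\<^bsub>B\<^esub>" "star_algebra B"
    and "\<And>x y. x \<in> carrier A \<Longrightarrow> y \<in> carrier A \<Longrightarrow> h (x \<oplus> y) = h x \<oplus>\<^bsub>B\<^esub> h y"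
    and "\<And>x. x \<in> carrier A \<Longrightarrow> h x \<in> carrier B"
  shows "h (finsum A f S) = finsum B (\<lambda>i. h (f i)) S"
proof -
  interpret B: star_algebra B by fact
  show ?thesis
  proof (cases "finite S")
    case True
    then show ?thesis using assms(1)
      by (induction S) (simp_all add: fs_insert B.fs_insert assms)
  qed (simp add: assms)
qed

lemma fs_scale: "(\<And>i. i \<in> S \<Longrightarrow> f i \<in> carrier A) \<Longrightarrow> c \<odot> finsum A f S = finsum A (\<lambda>i. c \<odot> f i) S"
  by (rule fs_additive[where h="\<lambda>x. c \<odot> x"]) (auto simp: scale_add_right star_algebra_axioms)

lemma fs_mult_left: "(\<And>i. i \<in> S \<Longrightarrow> f i \<in> carrier A) \<Longrightarrow> x \<in> carrier A
  \<Longrightarrow> x \<otimes> finsum A f S = finsum A (\<lambda>i. x \<otimes> f i) S"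
  by (rule fs_additive[where h="\<lambda>y. x \<otimes> y"]) (auto simp: r_distr star_algebra_axioms)

lemma fs_mult_right: "(\<And>i. i \<in> S \<Longrightarrow> f i \<in> carrier A) \<Longrightarrow> x \<in> carrier A
  \<Longrightarrow> finsum A f S \<otimes> x = finsum A (\<lambda>i. f i \<otimes> x) S"
  by (rule fs_additive[where h="\<lambda>y. y \<otimes> x"]) (auto simp: l_distr star_algebra_axioms)

lemma fs_star: "(\<And>i. i \<in> S \<Longrightarrow> f i \<in> carrier A) \<Longrightarrow> star A (finsum A f S) = finsum A (\<lambda>i. star A (f i)) S"
  by (rule fs_additive[where h="star A"]) (auto simp: star_add star_algebra_axioms)

lemma fs_scale_left: "x \<in> carrier A \<Longrightarrow> finsum A (\<lambda>i. c i \<odot> x) S = sum c S \<odot> x"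
proof (cases "finite S")
  case True
  assume "x \<in> carrier A"
  with True show ?thesis by (induction S) (simp_all add: fs_insert scale_add_left)
qed simp

lemma fs_swap:
  assumes "finite S" "finite T" "\<And>i j. i \<in> S \<Longrightarrow> j \<in> T \<Longrightarrow> f i j \<in> carrier A"
  shows "finsum A (\<lambda>i. finsum A (f i) T) S = finsum A (\<lambda>j. finsum A (\<lambda>i. f i j) S) T"
  using assms(1,3)
proof (induction S)
  case empty
  then show ?case by simp
next
  case (insert n S)
  have "finsum A (\<lambda>j. finsum A (\<lambda>i. f i j) (insert n S)) T
      = finsum A (\<lambda>j. f n j \<oplus> finsum A (\<lambda>i. f i j) S) T"
    by (rule fs_cong) (use insert in \<open>auto simp: fs_insert\<close>)
  also have "\<dots> = finsum A (f n) T \<oplus> finsum A (\<lambda>j. finsum A (\<lambda>i. f i j) S) T"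
    by (rule fs_add) (use insert in auto)
  finally show ?case using insert by (simp add: fs_insert)
qed

lemma fs_delta:
  assumes "finite S" "n \<in> S" "\<And>i. i \<in> S \<Longrightarrow> i \<noteq> n \<Longrightarrow> f i = \<zero>" "f n \<in> carrier A"
  shows "finsum A f S = f n"
proof -
  have S: "S = insert n (S - {n})" using assms by auto
  have "finsum A f (insert n (S - {n})) = f n \<oplus> finsum A f (S - {n})"
    by (rule fs_insert) (use assms in auto, metis zero_closed)
  then show ?thesis using S assms fs_zero[of "S - {n}" f] by auto
qed

lemma fs_reindex: "bij_betw \<pi> S T \<Longrightarrow> (\<And>j. j \<in> T \<Longrightarrow> f j \<in> carrier A)
  \<Longrightarrow> finsum A f T = finsum A (\<lambda>i. f (\<pi> i)) S"
  using finsum_reindex[of f \<pi> S] by (auto simp: bij_betw_def)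

lemma fs_Un: "finite S \<Longrightarrow> finite T \<Longrightarrow> S \<inter> T = {} \<Longrightarrow> (\<And>i. i \<in> S \<union> T \<Longrightarrow> f i \<in> carrier A)
  \<Longrightarrow> finsum A f (S \<union> T) = finsum A f S \<oplus> finsum A f T"
  by (rule finsum_Un_disjoint) auto

lemma fs_superset:
  assumes "finite T" "S \<subseteq> T" "\<And>i. i \<in> S \<Longrightarrow> f i \<in> carrier A" "\<And>i. i \<in> T - S \<Longrightarrow> f i = \<zero>"
  shows "finsum A f S = finsum A f T"
proof -
  have "f i \<in> carrier A" if "i \<in> T" for i
    using assms that by (cases "i \<in> S") auto
  then have "finsum A f (S \<union> (T - S)) = finsum A f S \<oplus> finsum A f (T - S)"
    by (intro fs_Un) (use assms in \<open>auto intro: finite_subset\<close>)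
  moreover have "S \<union> (T - S) = T" using assms by auto
  ultimately show ?thesis using assms fs_zero[of "T - S" f] by simp
qed

end

locale star_algebra_hom = A: star_algebra A + B: star_algebra B
  for A :: "('a, 'x) star_alg_scheme" and B :: "('b, 'y) star_alg_scheme" +
  fixes h
  assumes h: "h \<in> star_hom A B"
begin

lemma hom_closed [simp, intro]: "a \<in> carrier A \<Longrightarrow> h a \<in> carrier B"
  and hom_add [simp]: "a \<in> carrier A \<Longrightarrow> b \<in> carrier A \<Longrightarrow> h (a \<oplus>\<^bsub>A\<^esub> b) = h a \<oplus>\<^bsub>B\<^esub> h b"
  and hom_mult [simp]: "a \<in> carrier A \<Longrightarrow> b \<in> carrier A \<Longrightarrow> h (a \<otimes>\<^bsub>A\<^esub> b) = h a \<otimes>\<^bsub>B\<^esub> h b"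
  and hom_one [simp]: "h \<one>\<^bsub>A\<^esub> = \<one>\<^bsub>B\<^esub>"
  and hom_scale [simp]: "a \<in> carrier A \<Longrightarrow> h (c \<odot>\<^bsub>A\<^esub> a) = c \<odot>\<^bsub>B\<^esub> h a"
  and hom_star [simp]: "a \<in> carrier A \<Longrightarrow> h (star A a) = star B (h a)"
  using h by (auto simp: star_hom_def ring_hom_def)

lemma hom_zero [simp]: "h \<zero>\<^bsub>A\<^esub> = \<zero>\<^bsub>B\<^esub>"
  using hom_scale[of "\<zero>\<^bsub>A\<^esub>" 0] by simp

lemma hom_minus: "a \<in> carrier A \<Longrightarrow> b \<in> carrier A \<Longrightarrow> h (a \<ominus>\<^bsub>A\<^esub> b) = h a \<ominus>\<^bsub>B\<^esub> h b"
  by (simp add: a_minus_def A.minus_eq_scale B.minus_eq_scale)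

lemma hom_pow [simp]: "a \<in> carrier A \<Longrightarrow> h (a [^]\<^bsub>A\<^esub> (m::nat)) = h a [^]\<^bsub>B\<^esub> m"
  by (induction m) auto

lemma hom_fs: "(\<And>i. i \<in> S \<Longrightarrow> f i \<in> carrier A)
  \<Longrightarrow> h (finsum A f S) = finsum B (\<lambda>i. h (f i)) S"
  by (rule A.fs_additive) (auto simp: B.star_algebra_axioms)

end

lemma star_homI:
  assumes "\<And>a. a \<in> carrier A \<Longrightarrow> h a \<in> carrier B"
    and "\<And>a b. a \<in> carrier A \<Longrightarrow> b \<in> carrier A \<Longrightarrow> h (a \<oplus>\<^bsub>A\<^esub> b) = h a \<oplus>\<^bsub>B\<^esub> h b"
    and "\<And>a b. a \<in> carrier A \<Longrightarrow> b \<in> carrier A \<Longrightarrow> h (a \<otimes>\<^bsub>A\<^esub> b) = h a \<otimes>\<^bsub>B\<^esub> h b"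
    and "h \<one>\<^bsub>A\<^esub> = \<one>\<^bsub>B\<^esub>"
    and "\<And>a c. a \<in> carrier A \<Longrightarrow> h (c \<odot>\<^bsub>A\<^esub> a) = c \<odot>\<^bsub>B\<^esub> h a"
    and "\<And>a. a \<in> carrier A \<Longrightarrow> h (star A a) = star B (h a)"
  shows "h \<in> star_hom A B"
  using assms by (auto simp: star_hom_def ring_hom_def)

lemma star_hom_comp:
  assumes "g \<in> star_hom A B" "h \<in> star_hom B C"
  shows "(\<lambda>a. h (g a)) \<in> star_hom A C"
  using assms unfolding star_hom_def ring_hom_def by (simp add: Pi_iff)

lemma star_algebra_hom_comp:
  "star_algebra_hom A B g \<Longrightarrow> star_algebra_hom B C h \<Longrightarrow> star_algebra_hom A C (\<lambda>a. h (g a))"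
  unfolding star_algebra_hom_def star_algebra_hom_axioms_def by (auto intro: star_hom_comp)

text \<open>The negative of \<open>a\<close> is given as \<open>(-1) \<odot> a\<close>, so that the
  ring laws become equations in the operations of the record. These are easy to check in concrete
  models and pass to surjective images.\<close>

lemma star_algebraI:
  assumes add: "\<And>a b. a \<in> carrier A \<Longrightarrow> b \<in> carrier A \<Longrightarrow> a \<oplus>\<^bsub>A\<^esub> b \<in> carrier A"
    "\<And>a b c. a \<in> carrier A \<Longrightarrow> b \<in> carrier A \<Longrightarrow> c \<in> carrier A
      \<Longrightarrow> (a \<oplus>\<^bsub>A\<^esub> b) \<oplus>\<^bsub>A\<^esub> c = a \<oplus>\<^bsub>A\<^esub> (b \<oplus>\<^bsub>A\<^esub> c)"
    "\<And>a b. a \<in> carrier A \<Longrightarrow> b \<in> carrier A \<Longrightarrow> a \<oplus>\<^bsub>A\<^esub> b = b \<oplus>\<^bsub>A\<^esub> a"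
    "\<zero>\<^bsub>A\<^esub> \<in> carrier A" "\<And>a. a \<in> carrier A \<Longrightarrow> \<zero>\<^bsub>A\<^esub> \<oplus>\<^bsub>A\<^esub> a = a"
    "\<And>a. a \<in> carrier A \<Longrightarrow> (-1) \<odot>\<^bsub>A\<^esub> a \<oplus>\<^bsub>A\<^esub> a = \<zero>\<^bsub>A\<^esub>"
    and mult: "\<And>a b. a \<in> carrier A \<Longrightarrow> b \<in> carrier A \<Longrightarrow> a \<otimes>\<^bsub>A\<^esub> b \<in> carrier A"
    "\<And>a b c. a \<in> carrier A \<Longrightarrow> b \<in> carrier A \<Longrightarrow> c \<in> carrier A
      \<Longrightarrow> (a \<otimes>\<^bsub>A\<^esub> b) \<otimes>\<^bsub>A\<^esub> c = a \<otimes>\<^bsub>A\<^esub> (b \<otimes>\<^bsub>A\<^esub> c)"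
    "\<one>\<^bsub>A\<^esub> \<in> carrier A" "\<And>a. a \<in> carrier A \<Longrightarrow> \<one>\<^bsub>A\<^esub> \<otimes>\<^bsub>A\<^esub> a = a"
    "\<And>a. a \<in> carrier A \<Longrightarrow> a \<otimes>\<^bsub>A\<^esub> \<one>\<^bsub>A\<^esub> = a"
    "\<And>a b c. a \<in> carrier A \<Longrightarrow> b \<in> carrier A \<Longrightarrow> c \<in> carrier A
      \<Longrightarrow> (a \<oplus>\<^bsub>A\<^esub> b) \<otimes>\<^bsub>A\<^esub> c = a \<otimes>\<^bsub>A\<^esub> c \<oplus>\<^bsub>A\<^esub> b \<otimes>\<^bsub>A\<^esub> c"
    "\<And>a b c. a \<in> carrier A \<Longrightarrow> b \<in> carrier A \<Longrightarrow> c \<in> carrier A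
      \<Longrightarrow> c \<otimes>\<^bsub>A\<^esub> (a \<oplus>\<^bsub>A\<^esub> b) = c \<otimes>\<^bsub>A\<^esub> a \<oplus>\<^bsub>A\<^esub> c \<otimes>\<^bsub>A\<^esub> b"
    and "star_algebra_axioms A"
  shows "star_algebra A"
proof -
  have scale: "\<And>a c. a \<in> carrier A \<Longrightarrow> c \<odot>\<^bsub>A\<^esub> a \<in> carrier A"
    using \<open>star_algebra_axioms A\<close> unfolding star_algebra_axioms_def by (elim conjE) simp
  have "abelian_group A"
  proof (rule abelian_groupI)
    show "\<exists>y\<in>carrier A. y \<oplus>\<^bsub>A\<^esub> x = \<zero>\<^bsub>A\<^esub>" if "x \<in> carrier A" for x
      using add(6)[OF that] scale[OF that] by blast
  qed (assumption | rule add)+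
  moreover have "Group.monoid A" by (rule monoidI) (assumption | rule mult)+
  ultimately have "ring A" by (rule ringI) (assumption | rule mult)+
  then show ?thesis using \<open>star_algebra_axioms A\<close> by (rule star_algebra.intro)
qed

text \<open>Every element of \<open>Q\<close> has a preimage, through which each law can be computed
  in \<open>A\<close>. A \<open>star_hom\<close> does not mention zero, and \<open>Q\<close> is not
  yet known to be a ring, hence the assumption \<open>z\<close>.\<close>

lemma star_algebra_image:
  assumes A: "star_algebra A" and Q: "carrier Q = \<pi> ` carrier A" and \<pi>: "\<pi> \<in> star_hom A Q"
    and z: "\<zero>\<^bsub>Q\<^esub> = \<pi> \<zero>\<^bsub>A\<^esub>"
  shows "star_algebra Q"
proof -
  interpret A: star_algebra A by fact
  have op: "\<pi> a \<oplus>\<^bsub>Q\<^esub> \<pi> b = \<pi> (a \<oplus>\<^bsub>A\<^esub> b)" "\<pi> a \<otimes>\<^bsub>Q\<^esub> \<pi> b = \<pi> (a \<otimes>\<^bsub>A\<^esub> b)" "c \<odot>\<^bsub>Q\<^esub> \<pi> a = \<pi> (c \<odot>\<^bsub>A\<^esub> a)"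
    "star Q (\<pi> a) = \<pi> (star A a)" and one: "\<one>\<^bsub>Q\<^esub> = \<pi> \<one>\<^bsub>A\<^esub>"
    if "a \<in> carrier A" "b \<in> carrier A" for a b c
    using \<pi> that by (auto simp: star_hom_def ring_hom_def)
  note one = one[OF A.zero_closed A.zero_closed]
  note op = op(1,2) op(3,4)[OF _ A.zero_closed] one
  have "(-1) \<odot>\<^bsub>A\<^esub> a \<oplus>\<^bsub>A\<^esub> a = \<zero>\<^bsub>A\<^esub>" if "a \<in> carrier A" for a
    using A.scale_add_left[OF that, of "-1" 1] that by simp
  then show ?thesis
    by (intro star_algebraI; (unfold star_algebra_axioms_def)?)
      (auto simp: Q z op A.a_assoc A.m_assoc A.l_distr A.r_distr A.scale_add_left
        A.scale_add_right A.star_add A.star_mult A.star_scale A.a_ac intro: imageI)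
qed

lemma star_algebra_complex: "star_algebra complex_star_alg"
  by (rule star_algebraI; unfold star_algebra_axioms_def complex_star_alg_def) (simp_all add: algebra_simps)

lemma star_algebra_opposite:
  assumes "star_algebra A" shows "star_algebra (opposite A)"
proof -
  interpret star_algebra A by fact
  have "(-1) \<odot>\<^bsub>A\<^esub> a \<oplus>\<^bsub>A\<^esub> a = \<zero>\<^bsub>A\<^esub>" if "a \<in> carrier A" for a
    using scale_add_left[OF that, of "-1" 1] that by simp
  then show ?thesis
    by (intro star_algebraI; (unfold star_algebra_axioms_def)?)
      (auto simp: opposite_def a_assoc m_assoc l_distr r_distr scale_add_left
        scale_add_right star_add star_mult star_scale a_ac)
qed

section \<open>Quotients by star ideals\<close>

lemma (in star_algebra) minus_eq_zero_iff:
  "a \<in> carrier A \<Longrightarrow> b \<in> carrier A \<Longrightarrow> a \<ominus> b = \<zero> \<longleftrightarrow> a = b"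
  by (metis a_minus_def add.inv_closed minus_equality minus_minus r_neg)

text \<open>An embedding of \<open>Q\<close> in the product of the targets, without forming the
  product. Equations and \<open>reduced_star_alg\<close> descend from the targets to
  \<open>Q\<close>. One-element families are embeddings, the quotients by all ideals of an
  intersection are the case behind \<open>relation_ideal\<close>, and the empty family forces
  \<open>Q\<close> to be zero.\<close>

definition jointly_injective ::
  "('a, 'x) star_alg_scheme \<Rightarrow> (('b, 'y) star_alg_scheme \<times> ('a \<Rightarrow> 'b)) set \<Rightarrow> bool" where
  "jointly_injective Q F \<longleftrightarrow> star_algebra Q \<and> (\<forall>(B, h)\<in>F. star_algebra_hom Q B h) \<and>
     (\<forall>a\<in>carrier Q. (\<forall>(B, h)\<in>F. h a = \<zero>\<^bsub>B\<^esub>) \<longrightarrow> a = \<zero>\<^bsub>Q\<^esub>)"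

lemma jointly_injective_hom: "jointly_injective Q F \<Longrightarrow> (B, h) \<in> F \<Longrightarrow> star_algebra_hom Q B h"
  by (auto simp: jointly_injective_def)

lemma jointly_injective_eqI:
  assumes F: "jointly_injective Q F" and xy: "x \<in> carrier Q" "y \<in> carrier Q"
    and "\<And>B h. (B, h) \<in> F \<Longrightarrow> star_algebra_hom Q B h \<Longrightarrow> h x = h y"
  shows "x = y"
proof -
  interpret Q: star_algebra Q using F by (simp add: jointly_injective_def)
  have "h (x \<ominus>\<^bsub>Q\<^esub> y) = \<zero>\<^bsub>B\<^esub>" if "(B, h) \<in> F" for B h
  proof -
    interpret h: star_algebra_hom Q B h using jointly_injective_hom[OF F that] .
    show ?thesis using assms(4)[OF that h.star_algebra_hom_axioms] xy
      by (simp add: h.hom_minus h.B.minus_eq_zero_iff)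
  qed
  then have "x \<ominus>\<^bsub>Q\<^esub> y = \<zero>\<^bsub>Q\<^esub>" using F xy by (auto simp: jointly_injective_def)
  then show ?thesis using xy by (simp add: Q.minus_eq_zero_iff)
qed

lemma jointly_injective_singleton:
  assumes "star_algebra_hom Q B h" "inj_on h (carrier Q)"
  shows "jointly_injective Q {(B, h)}"
proof -
  interpret star_algebra_hom Q B h by fact
  show ?thesis
    using assms inj_onD[OF assms(2), of _ "\<zero>\<^bsub>Q\<^esub>"] A.star_algebra_axioms by (auto simp: jointly_injective_def)
qed

locale star_ideal_quotient = star_algebra A for A :: "('a, 'x) star_alg_scheme" (structure) +
  fixes J
  assumes J: "star_ideal J A"
begin

lemma ideal_J: "ideal J A"
  using J by (simp add: star_ideal_def)

lemmas J_carrier = ideal.Icarr[OF ideal_J]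
  and J_subset = additive_subgroup.a_subset[OF ideal.axioms(1)[OF ideal_J]]

lemma star_in_J: "a \<in> J \<Longrightarrow> star A a \<in> J"
  using J by (simp add: star_ideal_def)

lemma scale_in_J: "a \<in> J \<Longrightarrow> c \<odot> a \<in> J"
  using ideal.I_l_closed[OF ideal_J, of a "c \<odot> \<one>"] J_carrier[of a] by simp

lemma coset_eq_iff: "a \<in> carrier A \<Longrightarrow> b \<in> carrier A \<Longrightarrow> J +> a = J +> b \<longleftrightarrow> a \<ominus> b \<in> J"
  using quotient_eq_iff_same_a_r_cos[OF ideal_J] by blast

lemma carrier_star_quot: "carrier (star_quot A J) = (\<lambda>a. J +> a) ` carrier A"
  by (auto simp: star_quot_def FactRing_def A_RCOSETS_def')

text \<open>The operations of \<open>star_quot\<close> are unions over all representatives. Such a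
  union collapses to a single term once the result does not depend on the representative.\<close>

lemma coset_Union:
  assumes "a \<in> carrier A" "\<And>b. b \<in> carrier A \<Longrightarrow> b \<ominus> a \<in> J \<Longrightarrow> g b = g a"
  shows "(\<Union>b\<in>J +> a. g b) = g a"
proof -
  interpret ideal J A by (rule ideal_J)
  have "g b = g a" if b: "b \<in> J +> a" for b
  proof -
    have bc: "b \<in> carrier A" using b assms(1) a_r_coset_subset_G[OF a_subset] by blast
    then have "J +> b = J +> a" using b assms(1) a_repr_independence[OF _ _ a_subgroup] by blast
    then show ?thesis using assms coset_eq_iff bc by auto
  qed
  moreover have "a \<in> J +> a" using a_rcos_self assms by blast
  ultimately show ?thesis by blast
qed

lemma minus_eq_scaled: "a \<in> carrier A \<Longrightarrow> b \<in> carrier A \<Longrightarrow> a \<ominus> b = a \<oplus> (-1) \<odot> b"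
  by (simp add: a_minus_def minus_eq_scale)

lemma coset_hom: "(\<lambda>a. J +> a) \<in> star_hom A (star_quot A J)"
proof (rule star_homI)
  interpret ideal J A by (rule ideal_J)
  show "(J +> a) \<in> carrier (star_quot A J)" if "a \<in> carrier A" for a
    using that by (simp add: carrier_star_quot)
  show "J +> (a \<oplus> b) = (J +> a) \<oplus>\<^bsub>star_quot A J\<^esub> (J +> b)"
    "J +> (a \<otimes> b) = (J +> a) \<otimes>\<^bsub>star_quot A J\<^esub> (J +> b)" if "a \<in> carrier A" "b \<in> carrier A" for a b
    using that by (simp_all add: star_quot_def FactRing_def rcoset_mult_add a_rcos_sum)
  fix a c assume a: "a \<in> carrier A"
  have "(\<Union>b\<in>J +> a. J +> (c \<odot> b)) = J +> (c \<odot> a)"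
  proof (rule coset_Union[OF a])
    fix b assume "b \<in> carrier A" "b \<ominus> a \<in> J"
    then show "J +> (c \<odot> b) = J +> (c \<odot> a)"
      using scale_in_J[of "b \<ominus> a" c] a
      by (simp add: coset_eq_iff minus_eq_scaled scale_add_right mult.commute)
  qed
  then show "J +> (c \<odot> a) = c \<odot>\<^bsub>star_quot A J\<^esub> (J +> a)" by (simp add: star_quot_def)
  have "(\<Union>b\<in>J +> a. J +> star A b) = J +> star A a"
  proof (rule coset_Union[OF a])
    fix b assume "b \<in> carrier A" "b \<ominus> a \<in> J"
    then show "J +> star A b = J +> star A a"
      using star_in_J[of "b \<ominus> a"] a
      by (simp add: coset_eq_iff minus_eq_scaled star_scale star_add)
  qed
  then show "J +> star A a = star (star_quot A J) (J +> a)" by (simp add: star_quot_def)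
qed (simp add: star_quot_def FactRing_def)

lemma zero_star_quot: "\<zero>\<^bsub>star_quot A J\<^esub> = J +> \<zero>"
  using a_coset_add_zero[OF J_subset] by (simp add: star_quot_def FactRing_def)

lemma star_algebra_quot: "star_algebra (star_quot A J)"
  using star_algebra_axioms carrier_star_quot coset_hom zero_star_quot by (rule star_algebra_image)

lemma star_algebra_hom_coset: "star_algebra_hom A (star_quot A J) (\<lambda>a. J +> a)"
  by (intro star_algebra_hom.intro star_algebra_hom_axioms.intro star_algebra_axioms star_algebra_quot coset_hom)

lemma coset_eq_zero_iff: "a \<in> carrier A \<Longrightarrow> J +> a = \<zero>\<^bsub>star_quot A J\<^esub> \<longleftrightarrow> a \<in> J"
  by (simp add: zero_star_quot coset_eq_iff minus_eq_scaled)

lemma factor: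
  assumes "star_algebra_hom A B \<phi>" and "\<And>a. a \<in> J \<Longrightarrow> \<phi> a = \<zero>\<^bsub>B\<^esub>"
  obtains \<psi> where "star_algebra_hom (star_quot A J) B \<psi>" "\<And>a. a \<in> carrier A \<Longrightarrow> \<psi> (J +> a) = \<phi> a"
proof -
  interpret \<phi>: star_algebra_hom A B \<phi> by fact
  interpret coset: star_algebra_hom A "star_quot A J" "\<lambda>a. J +> a" by (rule star_algebra_hom_coset)
  \<comment> \<open>An arbitrary representative is chosen; two of them differ by an element of
    \<open>J\<close>, on which \<open>\<phi>\<close> vanishes.\<close>
  define \<psi> where "\<psi> X = \<phi> (SOME a. a \<in> carrier A \<and> X = J +> a)" for X
  have \<psi>: "\<psi> (J +> a) = \<phi> a" if a: "a \<in> carrier A" for a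
  proof -
    define b where "b = (SOME b. b \<in> carrier A \<and> J +> a = J +> b)"
    have b: "b \<in> carrier A" "J +> a = J +> b"
      using someI[of "\<lambda>b. b \<in> carrier A \<and> J +> a = J +> b" a] a by (auto simp: b_def)
    then have "\<phi> (a \<ominus> b) = \<zero>\<^bsub>B\<^esub>" using a assms(2) by (simp add: coset_eq_iff)
    then have "\<phi> b = \<phi> a" using a b by (simp add: \<phi>.hom_minus \<phi>.B.minus_eq_zero_iff)
    then show ?thesis unfolding \<psi>_def b_def .
  qed
  have "\<psi> \<in> star_hom (star_quot A J) B"
    by (rule star_homI)
      (auto simp: carrier_star_quot \<psi> simp flip: coset.hom_add coset.hom_mult coset.hom_scale coset.hom_star coset.hom_one)
  then have "star_algebra_hom (star_quot A J) B \<psi>"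
    by (simp add: star_algebra_hom_def star_algebra_hom_axioms_def star_algebra_quot \<phi>.B.star_algebra_axioms)
  then show thesis using that \<psi> by blast
qed

end

section \<open>Kernels and the embedding of the quotient\<close>

context star_algebra_hom
begin

definition ker where "ker = {a \<in> carrier A. h a = \<zero>\<^bsub>B\<^esub>}"

lemma star_ideal_ker: "star_ideal ker A"
  unfolding star_ideal_def
proof
  show "ideal ker A"
  proof (rule idealI)
    show "subgroup ker (add_monoid A)"
      by (rule A.add.subgroupI) (auto simp: ker_def A.minus_eq_scale simp flip: a_inv_def)
  qed (auto simp: ker_def A.ring_axioms)
qed (auto simp: ker_def)

text \<open>The first isomorphism theorem. It replaces an arbitrary target \<open>B\<close> by a
  quotient of \<open>A\<close>, in which relations can be stated, together with an embedding in
  \<open>B\<close>.\<close>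

lemma quot_ker_injective:
  obtains \<theta> where "jointly_injective (star_quot A ker) {(B, \<theta>)}"
    "\<And>a. a \<in> carrier A \<Longrightarrow> \<theta> (ker +>\<^bsub>A\<^esub> a) = h a"
proof -
  interpret q: star_ideal_quotient A ker
    by (intro star_ideal_quotient.intro star_ideal_quotient_axioms.intro A.star_algebra_axioms star_ideal_ker)
  obtain \<theta> where \<theta>: "star_algebra_hom (star_quot A ker) B \<theta>"
    "\<And>a. a \<in> carrier A \<Longrightarrow> \<theta> (ker +>\<^bsub>A\<^esub> a) = h a"
    using q.factor[OF star_algebra_hom_axioms] by (auto simp: ker_def)
  have "inj_on \<theta> (carrier (star_quot A ker))"
  proof (rule inj_onI)
    fix x y assume "x \<in> carrier (star_quot A ker)" "y \<in> carrier (star_quot A ker)" and xy: "\<theta> x = \<theta> y"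
    then obtain a b where "a \<in> carrier A" "x = ker +>\<^bsub>A\<^esub> a" "b \<in> carrier A" "y = ker +>\<^bsub>A\<^esub> b"
      by (auto simp: q.carrier_star_quot)
    moreover from this have "h a = h b" using xy by (simp add: \<theta>)
    then have "a \<ominus>\<^bsub>A\<^esub> b \<in> ker" if "a \<in> carrier A" "b \<in> carrier A"
      using that by (simp add: ker_def hom_minus B.minus_eq_zero_iff)
    ultimately show "x = y" by (simp add: q.coset_eq_iff)
  qed
  then show thesis using that \<theta> jointly_injective_singleton by blast
qed

end

section \<open>Ideals generated by relations and their universal property\<close>

lemma star_ideal_Inter:
  assumes "star_algebra A" "\<J> \<noteq> {}" "\<And>J. J \<in> \<J> \<Longrightarrow> star_ideal J A"
  shows "star_ideal (\<Inter>\<J>) A"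
proof -
  interpret star_algebra A by fact
  show ?thesis using assms i_Intersect[of \<J>] by (auto simp: star_ideal_def)
qed

lemma relation_ideal_le:
  "star_ideal J A \<Longrightarrow> R (star_quot A J) (\<lambda>a. J +>\<^bsub>A\<^esub> a) \<Longrightarrow> relation_ideal A R \<subseteq> J"
  by (auto simp: relation_ideal_def)

text \<open>One ideal \<open>J\<close> with the relations has to be exhibited: the intersection of
  the empty family would be the whole type, which need not even lie in the carrier.\<close>

lemma star_ideal_relation_ideal:
  assumes "star_algebra A" "star_ideal J A" "R (star_quot A J) (\<lambda>a. J +>\<^bsub>A\<^esub> a)"
  shows "star_ideal (relation_ideal A R) A"
  unfolding relation_ideal_def using assms by (intro star_ideal_Inter) auto

text \<open>The quotient by an intersection embeds in the product of the quotients, so the relations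
  hold in it if they are inherited along jointly injective families. In \<open>transfer\<close> the
  images are compared with some \<open>\<pi>\<close> on the carrier only, because cosets of elements
  outside the carrier are not controlled.\<close>

lemma relation_ideal_holds:
  assumes A: "star_algebra A" and J: "star_ideal J A" "R (star_quot A J) (\<lambda>a. J +>\<^bsub>A\<^esub> a)"
    and transfer: "\<And>I F. star_ideal I A \<Longrightarrow> jointly_injective (star_quot A I) F
      \<Longrightarrow> (\<And>B h. (B, h) \<in> F \<Longrightarrow> \<exists>\<pi>. R B \<pi> \<and> (\<forall>a\<in>carrier A. h (I +>\<^bsub>A\<^esub> a) = \<pi> a))
      \<Longrightarrow> R (star_quot A I) (\<lambda>a. I +>\<^bsub>A\<^esub> a)"
  shows "R (star_quot A (relation_ideal A R)) (\<lambda>a. relation_ideal A R +>\<^bsub>A\<^esub> a)"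
proof -
  define I where "I = relation_ideal A R"
  have I: "star_ideal I A" unfolding I_def using assms by (intro star_ideal_relation_ideal)
  interpret q: star_ideal_quotient A I using A I by (simp add: star_ideal_quotient_def star_ideal_quotient_axioms_def)
  \<comment> \<open>The induced maps from A/I to the quotients A/K for all ideals \<open>K\<close>
    of the intersection; a class killed by all of them lies in every \<open>K\<close>, hence in
    \<open>I\<close>.\<close>
  define F where "F = {(star_quot A K, h) | K h. star_ideal K A \<and> R (star_quot A K) (\<lambda>a. K +>\<^bsub>A\<^esub> a) \<and>
    star_algebra_hom (star_quot A I) (star_quot A K) h \<and> (\<forall>a\<in>carrier A. h (I +>\<^bsub>A\<^esub> a) = K +>\<^bsub>A\<^esub> a)}"
  have "a \<in> I" if a: "a \<in> carrier A" and 0: "\<forall>(B, h)\<in>F. h (I +>\<^bsub>A\<^esub> a) = \<zero>\<^bsub>B\<^esub>" for a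
  proof -
    have "a \<in> K" if K: "star_ideal K A" "R (star_quot A K) (\<lambda>a. K +>\<^bsub>A\<^esub> a)" for K
    proof -
      interpret k: star_ideal_quotient A K using A K by (simp add: star_ideal_quotient_def star_ideal_quotient_axioms_def)
      obtain h where h: "star_algebra_hom (star_quot A I) (star_quot A K) h"
        "\<And>a. a \<in> carrier A \<Longrightarrow> h (I +>\<^bsub>A\<^esub> a) = K +>\<^bsub>A\<^esub> a"
      proof (rule q.factor[OF k.star_algebra_hom_coset])
        show "K +>\<^bsub>A\<^esub> a = \<zero>\<^bsub>star_quot A K\<^esub>" if "a \<in> I" for a
          using relation_ideal_le[of K A R, OF K] that q.J_carrier by (auto simp: k.coset_eq_zero_iff I_def)
      qed blast
      then have "(star_quot A K, h) \<in> F" using K by (auto simp: F_def)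
      then show ?thesis using 0 h a by (auto simp: k.coset_eq_zero_iff)
    qed
    then show ?thesis by (simp add: I_def relation_ideal_def)
  qed
  then have "jointly_injective (star_quot A I) F"
    unfolding jointly_injective_def using q.star_algebra_quot
    by (auto simp: q.carrier_star_quot q.coset_eq_zero_iff) (auto simp: F_def)
  then show ?thesis unfolding I_def[symmetric]
    by (rule transfer[OF I]) (auto simp: F_def)
qed

text \<open>The type of \<open>B\<close> is arbitrary, so \<open>R\<close> cannot be stated in
  \<open>B\<close> itself. It is tested in the quotient by the kernel of \<open>h\<close>, which
  \<open>\<theta>\<close> embeds in \<open>B\<close>; this makes the kernel one of the ideals of the
  intersection.\<close>

lemma relation_ideal_lift:
  assumes h: "star_algebra_hom A B h"
    and R: "\<And>\<theta> K. star_ideal K A \<Longrightarrow> jointly_injective (star_quot A K) {(B, \<theta>)}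
      \<Longrightarrow> (\<And>a. a \<in> carrier A \<Longrightarrow> \<theta> (K +>\<^bsub>A\<^esub> a) = h a)
      \<Longrightarrow> R (star_quot A K) (\<lambda>a. K +>\<^bsub>A\<^esub> a)"
  obtains \<psi> where "star_algebra_hom (star_quot A (relation_ideal A R)) B \<psi>"
    "\<And>a. a \<in> carrier A \<Longrightarrow> \<psi> (relation_ideal A R +>\<^bsub>A\<^esub> a) = h a"
    "star_ideal (relation_ideal A R) A"
proof -
  interpret star_algebra_hom A B h by fact
  obtain \<theta> where "jointly_injective (star_quot A ker) {(B, \<theta>)}"
    "\<And>a. a \<in> carrier A \<Longrightarrow> \<theta> (ker +>\<^bsub>A\<^esub> a) = h a"
    using quot_ker_injective by blast
  then have R: "R (star_quot A ker) (\<lambda>a. ker +>\<^bsub>A\<^esub> a)" by (rule R[OF star_ideal_ker])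
  have I: "star_ideal (relation_ideal A R) A"
    using A.star_algebra_axioms star_ideal_ker R by (rule star_ideal_relation_ideal)
  interpret q: star_ideal_quotient A "relation_ideal A R"
    using I by (simp add: star_ideal_quotient_def star_ideal_quotient_axioms_def A.star_algebra_axioms)
  have "h a = \<zero>\<^bsub>B\<^esub>" if "a \<in> relation_ideal A R" for a
    using relation_ideal_le[of ker A R, OF star_ideal_ker R] that by (auto simp: ker_def)
  then show thesis using q.factor[OF star_algebra_hom_axioms] that I by blast
qed

section \<open>Monoid star algebras\<close>

locale star_monoid = M: monoid M for M :: "('m, 'x) monoid_scheme" (structure) +
  fixes \<tau> :: "'m \<Rightarrow> 'm"
  assumes \<tau>_closed [simp, intro]: "x \<in> carrier M \<Longrightarrow> \<tau> x \<in> carrier M"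
    and \<tau>_\<tau> [simp]: "x \<in> carrier M \<Longrightarrow> \<tau> (\<tau> x) = x"
    and \<tau>_mult: "x \<in> carrier M \<Longrightarrow> y \<in> carrier M \<Longrightarrow> \<tau> (x \<otimes> y) = \<tau> y \<otimes> \<tau> x"

text \<open>The value at \<open>f\<close> of the linear functional which is \<open>\<phi>\<close> on
  the basis. Elements are compared by pairing them with every \<open>\<phi>\<close>; this turns
  convolution into iterated pairing and avoids sums over factorisations.\<close>

definition pair :: "('m \<Rightarrow> complex) \<Rightarrow> ('m \<Rightarrow> complex) \<Rightarrow> complex" where
  "pair f \<phi> = (\<Sum>x | f x \<noteq> 0. f x * \<phi> x)"

lemma pair_superset: "finite S \<Longrightarrow> {x. f x \<noteq> 0} \<subseteq> S \<Longrightarrow> pair f \<phi> = (\<Sum>x\<in>S. f x * \<phi> x)"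
  unfolding pair_def by (rule sum.mono_neutral_left) auto

lemma pair_cong: "(\<And>x. f x \<noteq> 0 \<Longrightarrow> \<phi> x = \<psi> x) \<Longrightarrow> pair f \<phi> = pair f \<psi>"
  unfolding pair_def by (rule sum.cong) auto

lemma pair_add_right: "pair f (\<lambda>x. \<phi> x + \<psi> x) = pair f \<phi> + pair f \<psi>"
  by (simp add: pair_def distrib_left sum.distrib)

lemma pair_scale_right: "pair f (\<lambda>x. c * \<phi> x) = c * pair f \<phi>"
  by (simp add: pair_def sum_distrib_left algebra_simps)

lemma pair_basis [simp]: "pair (basis_elt x) \<phi> = \<phi> x"
  by (subst pair_superset[of "{x}"]) (auto simp: basis_elt_def)

lemma pair_add_left:
  assumes "finite {x. f x \<noteq> 0}" "finite {x. g x \<noteq> 0}"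
  shows "pair (\<lambda>x. f x + g x) \<phi> = pair f \<phi> + pair g \<phi>"
proof -
  let ?S = "{x. f x \<noteq> 0} \<union> {x. g x \<noteq> 0}"
  have S: "finite ?S" using assms by simp
  show ?thesis
    by (subst (1 2 3) pair_superset[OF S]) (auto simp: distrib_right sum.distrib)
qed

lemma pair_scale_left: "pair (\<lambda>x. c * f x) \<phi> = c * pair f \<phi>"
  by (cases "c = 0") (simp_all add: pair_def sum_distrib_left algebra_simps)

lemma pair_indicator: "finite {x. f x \<noteq> 0} \<Longrightarrow> pair f (\<lambda>y. of_bool (y = x)) = f x"
  by (subst pair_superset[of "insert x {x. f x \<noteq> 0}"]) (auto simp: sum.remove)

context star_monoid
begin

abbreviation MA where "MA \<equiv> monoid_star_alg M \<tau>"

lemma carrier_MA: "f \<in> carrier MA \<longleftrightarrow> finite {x. f x \<noteq> 0} \<and> {x. f x \<noteq> 0} \<subseteq> carrier M"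
  by (simp add: monoid_star_alg_def)

lemma MA_ops: "f \<oplus>\<^bsub>MA\<^esub> g = (\<lambda>x. f x + g x)" "c \<odot>\<^bsub>MA\<^esub> f = (\<lambda>x. c * f x)" "\<zero>\<^bsub>MA\<^esub> = (\<lambda>x. 0)"
  "\<one>\<^bsub>MA\<^esub> = basis_elt \<one>"
  by (simp_all add: monoid_star_alg_def basis_elt_def)

lemma basis_closed [simp, intro]: "x \<in> carrier M \<Longrightarrow> basis_elt x \<in> carrier MA"
  by (auto simp: carrier_MA basis_elt_def)

lemma add_closed: "f \<in> carrier MA \<Longrightarrow> g \<in> carrier MA \<Longrightarrow> f \<oplus>\<^bsub>MA\<^esub> g \<in> carrier MA"
proof -
  assume fg: "f \<in> carrier MA" "g \<in> carrier MA"
  have s: "{x. f x + g x \<noteq> 0} \<subseteq> {x. f x \<noteq> 0} \<union> {x. g x \<noteq> 0}" by auto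
  have "finite {x. f x + g x \<noteq> 0}" using fg by (intro finite_subset[OF s]) (simp add: carrier_MA)
  moreover have "{x. f x + g x \<noteq> 0} \<subseteq> carrier M" using fg by (intro order_trans[OF s]) (simp add: carrier_MA)
  ultimately show ?thesis by (simp add: carrier_MA MA_ops)
qed

lemma smult_closed: "f \<in> carrier MA \<Longrightarrow> c \<odot>\<^bsub>MA\<^esub> f \<in> carrier MA"
  by (auto simp: carrier_MA MA_ops)

lemma zero_MA_closed: "\<zero>\<^bsub>MA\<^esub> \<in> carrier MA"
  by (auto simp: carrier_MA MA_ops)

lemma pair_ext:
  assumes "f \<in> carrier MA" "g \<in> carrier MA" "\<And>\<phi>. pair f \<phi> = pair g \<phi>"
  shows "f = g"
proof
  fix x show "f x = g x"
    using assms(3)[of "\<lambda>y. of_bool (y = x)"] assms(1,2) by (simp add: pair_indicator carrier_MA)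
qed

lemma supp_mult: "{x. (f \<otimes>\<^bsub>MA\<^esub> g) x \<noteq> 0} \<subseteq> (\<lambda>(y, z). y \<otimes> z) ` ({x. f x \<noteq> 0} \<times> {x. g x \<noteq> 0})"
proof
  fix x assume x: "x \<in> {x. (f \<otimes>\<^bsub>MA\<^esub> g) x \<noteq> 0}"
  have "(f \<otimes>\<^bsub>MA\<^esub> g) x = (\<Sum>(y, z)\<in>{(y, z). f y \<noteq> 0 \<and> g z \<noteq> 0 \<and> y \<otimes> z = x}. f y * g z)"
    by (simp add: monoid_star_alg_def)
  moreover have "(f \<otimes>\<^bsub>MA\<^esub> g) x \<noteq> 0" using x by simp
  ultimately have "{(y, z). f y \<noteq> 0 \<and> g z \<noteq> 0 \<and> y \<otimes> z = x} \<noteq> {}" by (intro notI) simp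
  then show "x \<in> (\<lambda>(y, z). y \<otimes> z) ` ({x. f x \<noteq> 0} \<times> {x. g x \<noteq> 0})" by force
qed

lemma mult_closed: "f \<in> carrier MA \<Longrightarrow> g \<in> carrier MA \<Longrightarrow> f \<otimes>\<^bsub>MA\<^esub> g \<in> carrier MA"
proof -
  assume fg: "f \<in> carrier MA" "g \<in> carrier MA"
  have "finite {x. (f \<otimes>\<^bsub>MA\<^esub> g) x \<noteq> 0}"
    using fg by (intro finite_subset[OF supp_mult]) (simp add: carrier_MA)
  moreover have "{x. (f \<otimes>\<^bsub>MA\<^esub> g) x \<noteq> 0} \<subseteq> carrier M"
    using fg by (intro order_trans[OF supp_mult]) (auto simp: carrier_MA)
  ultimately show ?thesis by (simp add: carrier_MA)
qed

text \<open>Convolution is the push-forward of the product weights under multiplication: the pairs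
  of support points are regrouped by their product.\<close>

lemma pair_mult:
  assumes "f \<in> carrier MA" "g \<in> carrier MA"
  shows "pair (f \<otimes>\<^bsub>MA\<^esub> g) \<phi> = pair f (\<lambda>y. pair g (\<lambda>z. \<phi> (y \<otimes> z)))"
proof -
  let ?P = "{x. f x \<noteq> 0} \<times> {x. g x \<noteq> 0}" and ?m = "\<lambda>(y, z). y \<otimes> z"
  let ?F = "\<lambda>(y, z). f y * g z"
  have P: "finite ?P" using assms by (simp add: carrier_MA)
  have m: "(f \<otimes>\<^bsub>MA\<^esub> g) x = sum ?F {p \<in> ?P. ?m p = x}" for x
    unfolding monoid_star_alg_def by (auto intro!: sum.cong)
  have "pair (f \<otimes>\<^bsub>MA\<^esub> g) \<phi> = (\<Sum>x\<in>?m ` ?P. (f \<otimes>\<^bsub>MA\<^esub> g) x * \<phi> x)"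
    by (rule pair_superset[OF _ supp_mult]) (use P in simp)
  also have "\<dots> = (\<Sum>x\<in>?m ` ?P. \<Sum>p\<in>{p \<in> ?P. ?m p = x}. ?F p * \<phi> (?m p))"
    by (intro sum.cong refl) (auto simp: m sum_distrib_right intro!: sum.cong)
  also have "\<dots> = (\<Sum>p\<in>?P. ?F p * \<phi> (?m p))"
    by (rule sum.image_gen[OF P, symmetric])
  also have "\<dots> = (\<Sum>y | f y \<noteq> 0. \<Sum>z | g z \<noteq> 0. f y * (g z * \<phi> (y \<otimes> z)))"
    by (simp add: sum.cartesian_product split_def mult.assoc)
  also have "\<dots> = pair f (\<lambda>y. pair g (\<lambda>z. \<phi> (y \<otimes> z)))"
    by (simp add: pair_def sum_distrib_left)
  finally show ?thesis .
qed

lemma supp_star: "f \<in> carrier MA \<Longrightarrow> {x. star MA f x \<noteq> 0} = \<tau> ` {x. f x \<noteq> 0}"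
  by (auto simp: carrier_MA monoid_star_alg_def image_iff split: if_splits) (metis \<tau>_\<tau>)

lemma star_MA_closed: "f \<in> carrier MA \<Longrightarrow> star MA f \<in> carrier MA"
  by (subst carrier_MA) (auto simp: supp_star carrier_MA)

lemma pair_star:
  assumes "f \<in> carrier MA"
  shows "pair (star MA f) \<phi> = cnj (pair f (\<lambda>x. cnj (\<phi> (\<tau> x))))"
proof -
  have "inj_on \<tau> {x. f x \<noteq> 0}"
    using assms by (intro inj_on_inverseI[of _ \<tau>]) (auto simp: carrier_MA)
  then have "pair (star MA f) \<phi> = (\<Sum>x | f x \<noteq> 0. star MA f (\<tau> x) * \<phi> (\<tau> x))"
    unfolding pair_def supp_star[OF assms] by (simp add: sum.reindex)
  also have "\<dots> = (\<Sum>x | f x \<noteq> 0. cnj (f x) * \<phi> (\<tau> x))"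
    using assms by (intro sum.cong) (auto simp: monoid_star_alg_def)
  finally show ?thesis by (simp add: pair_def)
qed

lemma pair_MA_simps:
  "f \<in> carrier MA \<Longrightarrow> g \<in> carrier MA \<Longrightarrow> pair (f \<oplus>\<^bsub>MA\<^esub> g) \<phi> = pair f \<phi> + pair g \<phi>"
  "pair (c \<odot>\<^bsub>MA\<^esub> f) \<phi> = c * pair f \<phi>"
  "pair \<one>\<^bsub>MA\<^esub> \<phi> = \<phi> \<one>" "pair \<zero>\<^bsub>MA\<^esub> \<phi> = 0"
  by (simp_all add: MA_ops pair_add_left pair_scale_left carrier_MA) (simp add: pair_def)

text \<open>The laws that involve products or the involution are checked by pairing both sides with
  an arbitrary \<open>\<phi>\<close>, where they become the laws of the monoid under the pairing;
  the linear ones hold pointwise.\<close>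

lemma star_algebra_MA: "star_algebra MA"
proof (rule star_algebraI)
  note cl = add_closed smult_closed mult_closed star_MA_closed zero_MA_closed
  note ps = pair_MA_simps pair_mult pair_star pair_add_right pair_scale_right cl
  have one: "\<one>\<^bsub>MA\<^esub> \<in> carrier MA" by (simp add: MA_ops)
  have supp: "x \<in> carrier M" if "f \<in> carrier MA" "f x \<noteq> 0" for f x
    using that by (auto simp: carrier_MA)
  show "\<one>\<^bsub>MA\<^esub> \<in> carrier MA" by (fact one)
  fix a assume a: "a \<in> carrier MA"
  show "\<one>\<^bsub>MA\<^esub> \<otimes>\<^bsub>MA\<^esub> a = a" "a \<otimes>\<^bsub>MA\<^esub> \<one>\<^bsub>MA\<^esub> = a"
    by (rule pair_ext; auto simp: ps a one supp[OF a] intro!: pair_cong)+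
  show "\<zero>\<^bsub>MA\<^esub> \<oplus>\<^bsub>MA\<^esub> a = a" "(-1) \<odot>\<^bsub>MA\<^esub> a \<oplus>\<^bsub>MA\<^esub> a = \<zero>\<^bsub>MA\<^esub>"
    by (simp_all add: MA_ops)
  fix b assume b: "b \<in> carrier MA"
  show "a \<oplus>\<^bsub>MA\<^esub> b = b \<oplus>\<^bsub>MA\<^esub> a" by (simp add: MA_ops add.commute)
  fix c assume c: "c \<in> carrier MA"
  show "a \<oplus>\<^bsub>MA\<^esub> b \<oplus>\<^bsub>MA\<^esub> c = a \<oplus>\<^bsub>MA\<^esub> (b \<oplus>\<^bsub>MA\<^esub> c)" by (simp add: MA_ops add.assoc)
  show "(a \<oplus>\<^bsub>MA\<^esub> b) \<otimes>\<^bsub>MA\<^esub> c = a \<otimes>\<^bsub>MA\<^esub> c \<oplus>\<^bsub>MA\<^esub> b \<otimes>\<^bsub>MA\<^esub> c"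
    by (rule pair_ext) (simp_all add: ps a b c)
  show "c \<otimes>\<^bsub>MA\<^esub> (a \<oplus>\<^bsub>MA\<^esub> b) = c \<otimes>\<^bsub>MA\<^esub> a \<oplus>\<^bsub>MA\<^esub> c \<otimes>\<^bsub>MA\<^esub> b"
    by (rule pair_ext) (simp_all add: ps a b c)
  show "(a \<otimes>\<^bsub>MA\<^esub> b) \<otimes>\<^bsub>MA\<^esub> c = a \<otimes>\<^bsub>MA\<^esub> (b \<otimes>\<^bsub>MA\<^esub> c)"
    by (rule pair_ext) (auto simp: ps a b c supp[OF a] supp[OF b] supp[OF c] M.m_assoc intro!: pair_cong)
next
  note cl = add_closed smult_closed mult_closed star_MA_closed zero_MA_closed
  note ps = pair_MA_simps pair_mult pair_star pair_add_right pair_scale_right cl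
  have supp: "x \<in> carrier M" if "f \<in> carrier MA" "f x \<noteq> 0" for f x
    using that by (auto simp: carrier_MA)
  \<comment> \<open>Finite sums commute; this exchanges the two factors when the involution reverses
    a product.\<close>
  have swap: "pair f (\<lambda>x. pair g (\<lambda>y. \<phi> x y)) = pair g (\<lambda>y. pair f (\<lambda>x. \<phi> x y))" for f g \<phi>
    unfolding pair_def sum_distrib_left by (subst sum.swap) (simp add: mult.left_commute)
  show "star_algebra_axioms MA"
  proof
    fix a assume a: "a \<in> carrier MA"
    show "star MA (star MA a) = a"
      by (rule pair_ext) (auto simp: ps a supp[OF a] intro!: pair_cong)
    fix c d
    show "star MA (c \<odot>\<^bsub>MA\<^esub> a) = cnj c \<odot>\<^bsub>MA\<^esub> star MA a"
      by (rule pair_ext) (simp_all add: ps a)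
    show "c \<odot>\<^bsub>MA\<^esub> a \<in> carrier MA" by (simp add: cl a)
    show "(c + d) \<odot>\<^bsub>MA\<^esub> a = c \<odot>\<^bsub>MA\<^esub> a \<oplus>\<^bsub>MA\<^esub> d \<odot>\<^bsub>MA\<^esub> a" "c \<odot>\<^bsub>MA\<^esub> (d \<odot>\<^bsub>MA\<^esub> a) = (c * d) \<odot>\<^bsub>MA\<^esub> a"
      "1 \<odot>\<^bsub>MA\<^esub> a = a" by (simp_all add: MA_ops distrib_right mult.assoc)
    show "star MA a \<in> carrier MA" by (simp add: cl a)
    fix b assume b: "b \<in> carrier MA"
    show "c \<odot>\<^bsub>MA\<^esub> (a \<oplus>\<^bsub>MA\<^esub> b) = c \<odot>\<^bsub>MA\<^esub> a \<oplus>\<^bsub>MA\<^esub> c \<odot>\<^bsub>MA\<^esub> b" by (simp add: MA_ops distrib_left)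
    show "(c \<odot>\<^bsub>MA\<^esub> a) \<otimes>\<^bsub>MA\<^esub> b = c \<odot>\<^bsub>MA\<^esub> (a \<otimes>\<^bsub>MA\<^esub> b)" "a \<otimes>\<^bsub>MA\<^esub> (c \<odot>\<^bsub>MA\<^esub> b) = c \<odot>\<^bsub>MA\<^esub> (a \<otimes>\<^bsub>MA\<^esub> b)"
      by (rule pair_ext; simp add: ps a b)+
    show "star MA (a \<oplus>\<^bsub>MA\<^esub> b) = star MA a \<oplus>\<^bsub>MA\<^esub> star MA b" by (rule pair_ext) (simp_all add: ps a b)
    show "star MA (a \<otimes>\<^bsub>MA\<^esub> b) = star MA b \<otimes>\<^bsub>MA\<^esub> star MA a"
    proof (rule pair_ext)
      fix \<phi>
      have "pair (star MA (a \<otimes>\<^bsub>MA\<^esub> b)) \<phi> = cnj (pair a (\<lambda>y. pair b (\<lambda>z. cnj (\<phi> (\<tau> (y \<otimes> z))))))"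
        by (simp add: ps a b)
      also have "\<dots> = cnj (pair a (\<lambda>y. pair b (\<lambda>z. cnj (\<phi> (\<tau> z \<otimes> \<tau> y)))))"
        by (intro arg_cong[of _ _ cnj] pair_cong) (auto simp: supp[OF a] supp[OF b] \<tau>_mult)
      also have "\<dots> = cnj (pair b (\<lambda>z. pair a (\<lambda>y. cnj (\<phi> (\<tau> z \<otimes> \<tau> y)))))"
        by (subst swap) (rule refl)
      also have "\<dots> = pair (star MA b \<otimes>\<^bsub>MA\<^esub> star MA a) \<phi>" by (simp add: ps a b)
      finally show "pair (star MA (a \<otimes>\<^bsub>MA\<^esub> b)) \<phi> = pair (star MA b \<otimes>\<^bsub>MA\<^esub> star MA a) \<phi>" .
    qed (simp_all add: cl a b)
  qed
qed (auto intro: add_closed mult_closed zero_MA_closed)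

lemma basis_mult: "x \<in> carrier M \<Longrightarrow> y \<in> carrier M
  \<Longrightarrow> basis_elt x \<otimes>\<^bsub>MA\<^esub> basis_elt y = basis_elt (x \<otimes> y)"
  by (rule pair_ext) (auto simp: mult_closed pair_mult)

lemma basis_star: "x \<in> carrier M \<Longrightarrow> star MA (basis_elt x) = basis_elt (\<tau> x)"
  by (rule pair_ext) (auto simp: star_MA_closed pair_star)

lemma MA_induct [consumes 1, case_names zero basis add]:
  assumes "f \<in> carrier MA" and zero: "P \<zero>\<^bsub>MA\<^esub>"
    and basis: "\<And>c x. x \<in> carrier M \<Longrightarrow> P (c \<odot>\<^bsub>MA\<^esub> basis_elt x)"
    and add: "\<And>f g. f \<in> carrier MA \<Longrightarrow> g \<in> carrier MA \<Longrightarrow> P f \<Longrightarrow> P g \<Longrightarrow> P (f \<oplus>\<^bsub>MA\<^esub> g)"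
  shows "P f"
proof -
  have "P f" if "finite S" "S \<subseteq> carrier M" "{x. f x \<noteq> 0} \<subseteq> S" for S f
    using that
  proof (induction S arbitrary: f)
    case empty
    then have "f = \<zero>\<^bsub>MA\<^esub>" by (auto simp: MA_ops)
    then show ?case using zero by simp
  next
    case (insert x S)
    let ?g = "f(x := 0)"
    have f: "f = f x \<odot>\<^bsub>MA\<^esub> basis_elt x \<oplus>\<^bsub>MA\<^esub> ?g"
      by (auto simp: MA_ops basis_elt_def)
    have g: "{y. ?g y \<noteq> 0} \<subseteq> S" using insert.prems by auto
    then have "P ?g" "?g \<in> carrier MA"
      using insert by (auto simp: carrier_MA intro: finite_subset)
    then have "P (f x \<odot>\<^bsub>MA\<^esub> basis_elt x \<oplus>\<^bsub>MA\<^esub> ?g)"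
      using insert.prems by (intro add basis smult_closed basis_closed) auto
    then show ?case using f by simp
  qed
  then show ?thesis using assms(1) carrier_MA by blast
qed

lemma lift_ex:
  assumes B: "star_algebra B" and \<psi>: "\<And>x. x \<in> carrier M \<Longrightarrow> \<psi> x \<in> carrier B"
    and \<psi>_mult: "\<And>x y. x \<in> carrier M \<Longrightarrow> y \<in> carrier M \<Longrightarrow> \<psi> (x \<otimes> y) = \<psi> x \<otimes>\<^bsub>B\<^esub> \<psi> y"
    and \<psi>_one: "\<psi> \<one> = \<one>\<^bsub>B\<^esub>"
    and \<psi>_star: "\<And>x. x \<in> carrier M \<Longrightarrow> \<psi> (\<tau> x) = star B (\<psi> x)"
  obtains h where "star_algebra_hom MA B h" "\<And>x. x \<in> carrier M \<Longrightarrow> h (basis_elt x) = \<psi> x"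
proof -
  interpret B: star_algebra B by fact
  interpret MA: star_algebra MA by (rule star_algebra_MA)
  define h where "h f = finsum B (\<lambda>x. f x \<odot>\<^bsub>B\<^esub> \<psi> x) {x. f x \<noteq> 0}" for f
  have sup: "h f = finsum B (\<lambda>x. f x \<odot>\<^bsub>B\<^esub> \<psi> x) S" if "finite S" "{x. f x \<noteq> 0} \<subseteq> S" "S \<subseteq> carrier M" for f S
    unfolding h_def using that \<psi> by (intro B.fs_superset) auto
  have cl: "h f \<in> carrier B" if "f \<in> carrier MA" for f
    unfolding h_def using that \<psi> by (auto simp: carrier_MA)
  have add: "h (f \<oplus>\<^bsub>MA\<^esub> g) = h f \<oplus>\<^bsub>B\<^esub> h g" if "f \<in> carrier MA" "g \<in> carrier MA" for f g
  proof -
    let ?S = "{x. f x \<noteq> 0} \<union> {x. g x \<noteq> 0}"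
    have S: "finite ?S" "?S \<subseteq> carrier M" using that by (auto simp: carrier_MA)
    have "h (f \<oplus>\<^bsub>MA\<^esub> g) = finsum B (\<lambda>x. f x \<odot>\<^bsub>B\<^esub> \<psi> x \<oplus>\<^bsub>B\<^esub> g x \<odot>\<^bsub>B\<^esub> \<psi> x) ?S"
      using S \<psi> by (subst sup[OF S(1) _ S(2)]) (auto simp: MA_ops B.scale_add_left intro!: B.fs_cong)
    also have "\<dots> = h f \<oplus>\<^bsub>B\<^esub> h g"
      using S \<psi> by (subst B.fs_add) (auto simp: sup[OF S(1) _ S(2)])
    finally show ?thesis .
  qed
  have scale: "h (c \<odot>\<^bsub>MA\<^esub> f) = c \<odot>\<^bsub>B\<^esub> h f" if "f \<in> carrier MA" for f c
  proof -
    let ?S = "{x. f x \<noteq> 0}"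
    have S: "finite ?S" "?S \<subseteq> carrier M" using that by (auto simp: carrier_MA)
    have "h (c \<odot>\<^bsub>MA\<^esub> f) = finsum B (\<lambda>x. c \<odot>\<^bsub>B\<^esub> (f x \<odot>\<^bsub>B\<^esub> \<psi> x)) ?S"
      using S \<psi> by (subst sup[OF S(1) _ S(2)]) (auto simp: MA_ops intro!: B.fs_cong)
    also have "\<dots> = c \<odot>\<^bsub>B\<^esub> h f"
      using S \<psi> unfolding h_def by (intro B.fs_scale[symmetric]) auto
    finally show ?thesis .
  qed
  have basis: "h (basis_elt x) = \<psi> x" if "x \<in> carrier M" for x
    using that \<psi> by (subst sup[of "{x}"]) (auto simp: basis_elt_def B.fs_insert)
  have zero: "h \<zero>\<^bsub>MA\<^esub> = \<zero>\<^bsub>B\<^esub>" by (simp add: h_def MA_ops)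
  have mult1: "h (f \<otimes>\<^bsub>MA\<^esub> basis_elt y) = h f \<otimes>\<^bsub>B\<^esub> \<psi> y" if "f \<in> carrier MA" "y \<in> carrier M" for f y
    using that
    by (induction f rule: MA_induct)
      (simp_all add: zero \<psi> cl add scale basis_mult basis \<psi>_mult MA.l_distr B.l_distr)
  have mult: "h (f \<otimes>\<^bsub>MA\<^esub> g) = h f \<otimes>\<^bsub>B\<^esub> h g" if "f \<in> carrier MA" "g \<in> carrier MA" for f g
    using that(2,1)
    by (induction g rule: MA_induct)
      (simp_all add: zero \<psi> cl add scale mult1 basis MA.r_distr B.r_distr)
  have star: "h (star MA f) = star B (h f)" if "f \<in> carrier MA" for f
    using that
    by (induction f rule: MA_induct)
      (simp_all add: zero \<psi> cl add scale basis_star basis \<psi>_star MA.star_scale B.star_scale MA.star_add B.star_add)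
  have "h \<in> star_hom MA B"
    by (rule star_homI) (simp_all add: cl add mult scale star basis \<psi>_one MA_ops(4))
  then have "star_algebra_hom MA B h"
    by (intro star_algebra_hom.intro star_algebra_hom_axioms.intro B star_algebra_MA)
  then show thesis using that basis by blast
qed

end

section \<open>The free star algebra\<close>

lemma star_monoid_words:
  "star_monoid \<lparr>carrier = lists (X \<times> UNIV), monoid.mult = (@), one = []\<rparr>
     (\<lambda>w. rev (map (\<lambda>(x, b). (x, \<not> b)) w))"
proof
  fix w :: "('a \<times> bool) list"
  have "map (\<lambda>(x, b). (x, \<not> b)) (map (\<lambda>(x, b). (x, \<not> b)) w) = w" by (induction w) auto
  then show "rev (map (\<lambda>(x, b). (x, \<not> b)) (rev (map (\<lambda>(x, b). (x, \<not> b)) w))) = w"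
    by (simp add: rev_map)
qed auto

lemma star_algebra_free: "star_algebra (free_star_alg X)"
  unfolding free_star_alg_def by (rule star_monoid.star_algebra_MA[OF star_monoid_words])

lemma free_gen_closed: "x \<in> X \<Longrightarrow> free_gen x \<in> carrier (free_star_alg X)"
  unfolding free_star_alg_def free_gen_def
  by (rule star_monoid.basis_closed[OF star_monoid_words]) auto

text \<open>Words are products of letters, and a letter is a generator or its adjoint. The cases
  \<open>mult\<close> and \<open>star\<close> hide the model by words from the applications.\<close>

lemma free_star_alg_induct [consumes 1, case_names one gen add mult scale star]:
  assumes f: "f \<in> carrier (free_star_alg X)" and one: "P \<one>\<^bsub>free_star_alg X\<^esub>"
    and gen: "\<And>x. x \<in> X \<Longrightarrow> P (free_gen x)"
    and add: "\<And>f g. f \<in> carrier (free_star_alg X) \<Longrightarrow> g \<in> carrier (free_star_alg X)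
      \<Longrightarrow> P f \<Longrightarrow> P g \<Longrightarrow> P (f \<oplus>\<^bsub>free_star_alg X\<^esub> g)"
    and mult: "\<And>f g. f \<in> carrier (free_star_alg X) \<Longrightarrow> g \<in> carrier (free_star_alg X)
      \<Longrightarrow> P f \<Longrightarrow> P g \<Longrightarrow> P (f \<otimes>\<^bsub>free_star_alg X\<^esub> g)"
    and scale: "\<And>c f. f \<in> carrier (free_star_alg X) \<Longrightarrow> P f \<Longrightarrow> P (c \<odot>\<^bsub>free_star_alg X\<^esub> f)"
    and star: "\<And>f. f \<in> carrier (free_star_alg X) \<Longrightarrow> P f \<Longrightarrow> P (star (free_star_alg X) f)"
  shows "P f"
proof -
  interpret W: star_monoid "\<lparr>carrier = lists (X \<times> UNIV), monoid.mult = (@), one = []\<rparr>"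
    "\<lambda>w. rev (map (\<lambda>(x, b). (x, \<not> b)) w)" by (rule star_monoid_words)
  interpret F: star_algebra "free_star_alg X" by (rule star_algebra_free)
  have MA: "W.MA = free_star_alg X" by (simp add: free_star_alg_def)
  note WF = W.basis_mult[unfolded MA] W.basis_star[unfolded MA] W.MA_ops(4)[unfolded MA]
    W.basis_closed[unfolded MA]
  have letter: "P (basis_elt [(x, b)])" "basis_elt [(x, b)] \<in> carrier (free_star_alg X)" if "x \<in> X" for x b
  proof -
    have "star (free_star_alg X) (free_gen x) = basis_elt [(x, True)]"
      using WF(2)[of "[(x, False)]"] that by (simp add: free_gen_def)
    then show "P (basis_elt [(x, b)])" "basis_elt [(x, b)] \<in> carrier (free_star_alg X)"
      using gen[OF that] star[OF free_gen_closed gen, OF that that] free_gen_closed[OF that]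
        F.star_closed[OF free_gen_closed[OF that]]
      by (cases b; simp add: free_gen_def)+
  qed
  have word: "P (basis_elt w)" if "w \<in> lists (X \<times> UNIV)" for w
    using that
  proof (induction w)
    case Nil
    then show ?case using one WF(3) by simp
  next
    case (Cons p w)
    obtain x b where p: "p = (x, b)" by force
    have "basis_elt (p # w) = basis_elt [(x, b)] \<otimes>\<^bsub>free_star_alg X\<^esub> basis_elt w"
      using WF(1)[of "[(x, b)]" w] Cons p by simp
    moreover have "basis_elt w \<in> carrier (free_star_alg X)" using WF(4)[of w] Cons by simp
    ultimately show ?case using mult[OF letter(2) _ letter(1) Cons.IH] Cons p by auto
  qed
  have 0: "P \<zero>\<^bsub>free_star_alg X\<^esub>" using scale[OF F.one_closed one, of 0] by simp
  show ?thesis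
    using f unfolding MA[symmetric]
    by (induction f rule: W.MA_induct) (use 0 word scale add WF(4) in \<open>auto simp: MA\<close>)
qed

text \<open>The letter \<open>(x, True)\<close> goes to the adjoint of \<open>f x\<close>, so that
  reversing a word and flipping its marks matches the involution of \<open>B\<close>.\<close>

lemma free_star_alg_lift:
  assumes B: "star_algebra B" and f: "\<And>x. x \<in> X \<Longrightarrow> f x \<in> carrier B"
  obtains h where "star_algebra_hom (free_star_alg X) B h" "\<And>x. x \<in> X \<Longrightarrow> h (free_gen x) = f x"
proof -
  interpret W: star_monoid "\<lparr>carrier = lists (X \<times> UNIV), monoid.mult = (@), one = []\<rparr>"
    "\<lambda>w. rev (map (\<lambda>(x, b). (x, \<not> b)) w)" by (rule star_monoid_words)
  interpret B: star_algebra B by fact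
  define l where "l = (\<lambda>(x, b). if b then star B (f x) else f x)"
  define e where "e w = foldr (\<lambda>p t. l p \<otimes>\<^bsub>B\<^esub> t) w \<one>\<^bsub>B\<^esub>" for w
  have l: "l p \<in> carrier B" "l (case p of (x, b) \<Rightarrow> (x, \<not> b)) = star B (l p)" if "p \<in> X \<times> UNIV" for p
    using that f by (auto simp: l_def)
  have e_closed: "e w \<in> carrier B" if "w \<in> lists (X \<times> UNIV)" for w
    using that by (induction w) (auto simp: e_def l)
  have e_append: "e (v @ w) = e v \<otimes>\<^bsub>B\<^esub> e w" if "v \<in> lists (X \<times> UNIV)" "w \<in> lists (X \<times> UNIV)" for v w
    using that e_closed by (induction v) (auto simp: e_def l B.m_assoc)
  have e_star: "e (rev (map (\<lambda>(x, b). (x, \<not> b)) w)) = star B (e w)" if "w \<in> lists (X \<times> UNIV)" for w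
    using that
  proof (induction w)
    case (Cons p w)
    have "e (rev (map (\<lambda>(x, b). (x, \<not> b)) w) @ [case p of (x, b) \<Rightarrow> (x, \<not> b)])
        = e (rev (map (\<lambda>(x, b). (x, \<not> b)) w)) \<otimes>\<^bsub>B\<^esub> e [case p of (x, b) \<Rightarrow> (x, \<not> b)]"
      using Cons by (intro e_append) auto
    also have "e [case p of (x, b) \<Rightarrow> (x, \<not> b)] = star B (l p)"
      using l[of p] Cons by (simp add: e_def)
    finally have "e (rev (map (\<lambda>(x, b). (x, \<not> b)) (p # w))) = star B (e w) \<otimes>\<^bsub>B\<^esub> star B (l p)"
      using Cons by simp
    also have "\<dots> = star B (l p \<otimes>\<^bsub>B\<^esub> e w)"
      using Cons by (subst B.star_mult) (auto simp: l e_closed)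
    finally show ?case by (simp add: e_def)
  qed (simp add: e_def)
  obtain h where h: "star_algebra_hom W.MA B h" "\<And>w. w \<in> lists (X \<times> UNIV) \<Longrightarrow> h (basis_elt w) = e w"
    using W.lift_ex[of B e] B e_closed e_append e_star by (auto simp: e_def)
  have "h (free_gen x) = f x" if "x \<in> X" for x
    using h(2)[of "[(x, False)]"] that f by (simp add: free_gen_def e_def l_def)
  then show thesis using that h(1) by (simp add: free_star_alg_def)
qed

section \<open>Positive semidefinite kernels and positive functionals\<close>

definition psd :: "'i set \<Rightarrow> ('i \<Rightarrow> 'i \<Rightarrow> complex) \<Rightarrow> bool" where
  "psd S K \<longleftrightarrow> (\<forall>c. (\<Sum>i\<in>S. \<Sum>j\<in>S. cnj (c i) * c j * K i j) \<in> \<real>\<^sub>\<ge>\<^sub>0)"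

lemma psd_subset:
  assumes "psd S K" "T \<subseteq> S" "finite S"
  shows "psd T K"
  unfolding psd_def
proof
  fix c :: "'a \<Rightarrow> complex"
  define d where "d i = (if i \<in> T then c i else 0)" for i
  have inner: "(\<Sum>j\<in>S. cnj (d i) * d j * K i j) = (\<Sum>j\<in>T. cnj (d i) * d j * K i j)" for i
    using assms by (intro sum.mono_neutral_right) (auto simp: d_def)
  have "(\<Sum>i\<in>S. \<Sum>j\<in>S. cnj (d i) * d j * K i j) = (\<Sum>i\<in>T. \<Sum>j\<in>T. cnj (d i) * d j * K i j)"
    unfolding inner using assms by (intro sum.mono_neutral_right) (auto simp: d_def)
  also have "\<dots> = (\<Sum>i\<in>T. \<Sum>j\<in>T. cnj (c i) * c j * K i j)" by (simp add: d_def)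
  finally have eq: "(\<Sum>i\<in>S. \<Sum>j\<in>S. cnj (d i) * d j * K i j) = (\<Sum>i\<in>T. \<Sum>j\<in>T. cnj (c i) * c j * K i j)" .
  have "(\<Sum>i\<in>S. \<Sum>j\<in>S. cnj (d i) * d j * K i j) \<in> \<real>\<^sub>\<ge>\<^sub>0"
    using assms(1) unfolding psd_def by (rule spec)
  then show "(\<Sum>i\<in>T. \<Sum>j\<in>T. cnj (c i) * c j * K i j) \<in> \<real>\<^sub>\<ge>\<^sub>0" unfolding eq .
qed

lemma psd_diag: "psd S K \<Longrightarrow> finite S \<Longrightarrow> i \<in> S \<Longrightarrow> K i i \<in> \<real>\<^sub>\<ge>\<^sub>0"
  using psd_subset[of S K "{i}"] by (auto simp: psd_def dest: spec[of _ "\<lambda>_. 1"])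

lemma psd_two:
  assumes "psd S K" "finite S" "i \<in> S" "j \<in> S" "i \<noteq> j"
  shows "cnj x * x * K i i + cnj x * y * K i j + (cnj y * x * K j i + cnj y * y * K j j) \<in> \<real>\<^sub>\<ge>\<^sub>0"
proof -
  have "psd {i, j} K" using assms by (intro psd_subset[OF assms(1)]) auto
  then have "(\<Sum>k\<in>{i, j}. \<Sum>l\<in>{i, j}. cnj ((\<lambda>k. if k = i then x else y) k) * (\<lambda>k. if k = i then x else y) l * K k l) \<in> \<real>\<^sub>\<ge>\<^sub>0"
    unfolding psd_def by (rule spec)
  then show ?thesis using assms(5) by simp
qed

text \<open>Off the diagonal, the form is real at the vectors (1, 1) and (1, \<i>) supported on
  \<open>i\<close> and \<open>j\<close>; this fixes the imaginary part of
  \<open>K i j + K j i\<close> and the real part of \<open>K i j - K j i\<close>.\<close>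

lemma psd_hermitian:
  assumes "psd S K" "finite S" "i \<in> S" "j \<in> S"
  shows "K j i = cnj (K i j)"
proof (cases "i = j")
  case True
  then show ?thesis using psd_diag[OF assms(1,2,3)] by (auto simp: complex_nonneg_Reals_iff complex_eq_iff)
next
  case False
  note two = psd_two[OF assms False]
  show ?thesis
    using two[of 1 1] two[of 1 \<i>] psd_diag[OF assms(1,2,3)] psd_diag[OF assms(1,2,4)]
    by (auto simp: complex_nonneg_Reals_iff complex_eq_iff)
qed

text \<open>The degenerate case of the Cauchy-Schwarz inequality: with a zero at \<open>j\<close>
  the form is affine in a multiple of the coordinate \<open>j\<close>, hence unbounded below unless
  the mixed entry vanishes.\<close>

lemma psd_null:
  assumes "psd S K" "finite S" "i \<in> S" "j \<in> S" "K j j = 0"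
  shows "K i j = 0" "K j i = 0"
proof -
  show "K i j = 0"
  proof (rule ccontr)
    assume nz: "K i j \<noteq> 0"
    then have ij: "i \<noteq> j" using assms(5) by auto
    have h: "K j i = cnj (K i j)" by (rule psd_hermitian[OF assms(1-4)])
    define m where "m = K i j * cnj (K i j)"
    have m: "m = of_real ((cmod (K i j))\<^sup>2)" by (simp only: m_def complex_norm_square)
    \<comment> \<open>Large enough to make the form negative: its real part becomes
      \<open>- Re (K i i) - 2\<close>.\<close>
    define r where "r = (Re (K i i) + 1) / (cmod (K i j))\<^sup>2"
    have "K i i - 2 * of_real r * m \<in> \<real>\<^sub>\<ge>\<^sub>0"
      using psd_two[OF assms(1-4) ij, of 1 "- of_real r * cnj (K i j)"] assms(5)
      by (simp add: h m_def algebra_simps)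
    then have "Re (K i i) - 2 * r * (cmod (K i j))\<^sup>2 \<ge> 0"
      by (simp add: m complex_nonneg_Reals_iff)
    moreover have "r * (cmod (K i j))\<^sup>2 = Re (K i i) + 1" using nz by (simp add: r_def)
    moreover have "Re (K i i) \<ge> 0" using psd_diag[OF assms(1-3)] by (simp add: complex_nonneg_Reals_iff)
    ultimately show False by linarith
  qed
  then show "K j i = 0" using psd_hermitian[OF assms(1-4)] by simp
qed

text \<open>Schur's product theorem, by induction on the size of the kernels via the Schur complement of
  a diagonal entry.\<close>
lemma psd_sum_mult:
  assumes "finite S" "psd S K" "psd S L"
  shows "(\<Sum>i\<in>S. \<Sum>j\<in>S. K i j * L i j) \<in> \<real>\<^sub>\<ge>\<^sub>0"
  using assms
proof (induction S arbitrary: K)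
  case empty
  then show ?case by simp
next
  case (insert n S)
  have fin: "finite (insert n S)" using insert by simp
  have LS: "psd S L" using insert psd_subset[OF _ subset_insertI fin] by blast
  have split: "(\<Sum>i\<in>insert n S. \<Sum>j\<in>insert n S. M i j) = M n n + (\<Sum>j\<in>S. M n j) + (\<Sum>i\<in>S. M i n)
      + (\<Sum>i\<in>S. \<Sum>j\<in>S. M i j)" for M :: "'a \<Rightarrow> 'a \<Rightarrow> complex"
    using insert(1,2) by (simp add: sum.distrib algebra_simps)
  have herm: "K i n = cnj (K n i)" if "i \<in> S" for i
    by (rule psd_hermitian[OF insert.prems(1) fin]) (use that in auto)
  show ?case
  proof (cases "K n n = 0")
    case True
    then have 0: "K n i = 0" "K i n = 0" if "i \<in> S" for i
      using psd_null[OF insert.prems(1) fin _ _ True, of i] that by auto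
    have "psd S K" using insert psd_subset[OF _ subset_insertI fin] by blast
    then have "(\<Sum>i\<in>S. \<Sum>j\<in>S. K i j * L i j) \<in> \<real>\<^sub>\<ge>\<^sub>0" using insert.IH LS by blast
    then show ?thesis by (simp add: split 0 True)
  next
    case False
    let ?k = "K n n"
    have kr: "cnj ?k = ?k" using psd_hermitian[OF insert.prems(1) fin, of n n] by simp
    define K' where "K' i j = K i j - K i n * K n j / ?k" for i j
    have "psd S K'"
      unfolding psd_def
    proof
      fix c :: "'a \<Rightarrow> complex"
      define \<sigma> where "\<sigma> = (\<Sum>j\<in>S. c j * K n j)"
      \<comment> \<open>The coordinate at \<open>n\<close> minimises the form of \<open>K\<close>
        for given \<open>c\<close>; the minimum is the form of \<open>K'\<close> at
        \<open>c\<close>.\<close>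
      define d where "d = c(n := - \<sigma> / ?k)"
      have dS: "d i = c i" if "i \<in> S" for i using that insert(2) by (auto simp: d_def)
      have c\<sigma>: "(\<Sum>i\<in>S. cnj (c i) * K i n) = cnj \<sigma>" by (simp add: \<sigma>_def herm)
      have dn: "d n = - \<sigma> / ?k" by (simp add: d_def)
      have s1: "(\<Sum>j\<in>S. cnj (d n) * d j * K n j) = cnj (d n) * \<sigma>"
        by (simp add: \<sigma>_def sum_distrib_left dS mult.assoc)
      have s2: "(\<Sum>i\<in>S. cnj (d i) * d n * K i n) = d n * cnj \<sigma>"
        unfolding c\<sigma>[symmetric] sum_distrib_left by (rule sum.cong) (auto simp: dS)
      have s3: "(\<Sum>i\<in>S. \<Sum>j\<in>S. cnj (d i) * d j * K i j) = (\<Sum>i\<in>S. \<Sum>j\<in>S. cnj (c i) * c j * K i j)"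
        by (simp add: dS)
      have "(\<Sum>i\<in>S. \<Sum>j\<in>S. cnj (c i) * c j * K' i j) = (\<Sum>i\<in>S. \<Sum>j\<in>S. cnj (c i) * c j * K i j)
          - (\<Sum>i\<in>S. \<Sum>j\<in>S. (cnj (c i) * K i n) * (c j * K n j)) / ?k"
        by (simp add: K'_def right_diff_distrib sum_subtractf sum_divide_distrib algebra_simps)
      also have "(\<Sum>i\<in>S. \<Sum>j\<in>S. (cnj (c i) * K i n) * (c j * K n j)) = cnj \<sigma> * \<sigma>"
        unfolding c\<sigma>[symmetric] by (simp add: \<sigma>_def sum_product)
      also have "(\<Sum>i\<in>S. \<Sum>j\<in>S. cnj (c i) * c j * K i j) - cnj \<sigma> * \<sigma> / ?k
          = (\<Sum>i\<in>insert n S. \<Sum>j\<in>insert n S. cnj (d i) * d j * K i j)"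
        unfolding split s1 s2 s3 unfolding dn using False by (simp add: kr field_simps)
      also have "\<dots> \<in> \<real>\<^sub>\<ge>\<^sub>0" using insert.prems(1) unfolding psd_def by (rule spec)
      finally show "(\<Sum>i\<in>S. \<Sum>j\<in>S. cnj (c i) * c j * K' i j) \<in> \<real>\<^sub>\<ge>\<^sub>0" .
    qed
    then have 1: "(\<Sum>i\<in>S. \<Sum>j\<in>S. K' i j * L i j) \<in> \<real>\<^sub>\<ge>\<^sub>0" using insert.IH LS by blast
    have "(\<Sum>i\<in>insert n S. \<Sum>j\<in>insert n S. cnj (K n i) * K n j * L i j) \<in> \<real>\<^sub>\<ge>\<^sub>0"
      using insert.prems(2) unfolding psd_def by (rule spec)
    moreover have "inverse ?k \<in> \<real>\<^sub>\<ge>\<^sub>0"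
      using psd_diag[OF insert.prems(1) fin, of n] by simp
    ultimately have 2: "inverse ?k * (\<Sum>i\<in>insert n S. \<Sum>j\<in>insert n S. cnj (K n i) * K n j * L i j) \<in> \<real>\<^sub>\<ge>\<^sub>0"
      by (rule nonneg_Reals_mult_I[rotated])
    \<comment> \<open>\<open>K\<close> is \<open>K'\<close> plus a rank one kernel, and
      \<open>K'\<close> vanishes in row and column \<open>n\<close>. The rank one part multiplied by
      \<open>L\<close> sums to the form of \<open>L\<close> at the vector \<open>K n\<close>, up to
      the positive factor \<open>inverse ?k\<close>.\<close>
    have r: "(\<Sum>i\<in>insert n S. \<Sum>j\<in>insert n S. K i j * L i j)
      = (\<Sum>i\<in>S. \<Sum>j\<in>S. K' i j * L i j)
        + inverse ?k * (\<Sum>i\<in>insert n S. \<Sum>j\<in>insert n S. cnj (K n i) * K n j * L i j)"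
    proof -
      have "inverse ?k * (\<Sum>i\<in>insert n S. \<Sum>j\<in>insert n S. cnj (K n i) * K n j * L i j)
        = (\<Sum>i\<in>insert n S. \<Sum>j\<in>insert n S. K i n * K n j / ?k * L i j)"
        unfolding sum_distrib_left
        by (intro sum.cong refl) (use herm kr in \<open>auto simp: field_simps\<close>)
      also have "\<dots> = ?k * L n n + (\<Sum>j\<in>S. K n j * L n j) + (\<Sum>i\<in>S. K i n * L i n)
        + (\<Sum>i\<in>S. \<Sum>j\<in>S. K i n * K n j / ?k * L i j)"
        unfolding split using False by simp
      finally show ?thesis
        unfolding split by (simp add: K'_def left_diff_distrib sum_subtractf)
    qed
    show ?thesis unfolding r using 1 2 by (rule nonneg_Reals_add_I)
  qed
qed

section \<open>Positive functionals and reduced algebras\<close>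

lemma finsum_complex [simp]: "finsum complex_star_alg f S = sum f S"
proof -
  interpret C: star_algebra complex_star_alg by (rule star_algebra_complex)
  have C: "carrier complex_star_alg = UNIV" "\<And>x y. x \<oplus>\<^bsub>complex_star_alg\<^esub> y = x + y" "\<zero>\<^bsub>complex_star_alg\<^esub> = 0"
    by (simp_all add: complex_star_alg_def)
  show ?thesis
  proof (cases "finite S")
    case True
    then show ?thesis by (induction S) (simp_all add: C.fs_insert C)
  qed (simp add: C)
qed

context star_algebra
begin

lemma fs_functional:
  fixes f :: "'a \<Rightarrow> complex"
  assumes "\<And>i. i \<in> S \<Longrightarrow> a i \<in> carrier A" "f \<zero> = 0"
    and "\<And>x y. x \<in> carrier A \<Longrightarrow> y \<in> carrier A \<Longrightarrow> f (x \<oplus> y) = f x + f y"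
  shows "f (finsum A a S) = (\<Sum>i\<in>S. f (a i))"
  using fs_additive[where h=f and B=complex_star_alg, OF assms(1) _ star_algebra_complex] assms
  by (simp add: complex_star_alg_def[THEN arg_cong[of _ _ carrier]] complex_star_alg_def[THEN arg_cong[of _ _ add]]
      complex_star_alg_def[THEN arg_cong[of _ _ zero]])

lemma positive_functional_simps:
  assumes "positive_functional A f"
  shows "a \<in> carrier A \<Longrightarrow> b \<in> carrier A \<Longrightarrow> f (a \<oplus> b) = f a + f b"
    and "a \<in> carrier A \<Longrightarrow> f (c \<odot> a) = c * f a"
    and "f \<zero> = 0"
    and "a \<in> carrier A \<Longrightarrow> f (star A a \<otimes> a) \<in> \<real>\<^sub>\<ge>\<^sub>0"
    and "(\<And>i. i \<in> S \<Longrightarrow> g i \<in> carrier A) \<Longrightarrow> f (finsum A g S) = (\<Sum>i\<in>S. f (g i))"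
proof -
  show *: "a \<in> carrier A \<Longrightarrow> b \<in> carrier A \<Longrightarrow> f (a \<oplus> b) = f a + f b" for a b
    using assms by (simp add: positive_functional_def)
  show s: "a \<in> carrier A \<Longrightarrow> f (c \<odot> a) = c * f a" for a c
    using assms by (simp add: positive_functional_def)
  show "a \<in> carrier A \<Longrightarrow> f (star A a \<otimes> a) \<in> \<real>\<^sub>\<ge>\<^sub>0"
    using assms by (simp add: positive_functional_def)
  show z: "f \<zero> = 0" using s[of \<zero> 0] by simp
  show "(\<And>i. i \<in> S \<Longrightarrow> g i \<in> carrier A) \<Longrightarrow> f (finsum A g S) = (\<Sum>i\<in>S. f (g i))"
    using fs_functional[of S g f] * z by blast
qed

lemma fs_star_mult:
  assumes "\<And>i. i \<in> S \<Longrightarrow> a i \<in> carrier A" "\<And>j. j \<in> T \<Longrightarrow> b j \<in> carrier A"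
  shows "star A (finsum A a S) \<otimes> finsum A b T = finsum A (\<lambda>i. finsum A (\<lambda>j. star A (a i) \<otimes> b j) T) S"
proof -
  have "star A (finsum A a S) \<otimes> finsum A b T = finsum A (\<lambda>i. star A (a i)) S \<otimes> finsum A b T"
    using assms by (simp add: fs_star)
  also have "\<dots> = finsum A (\<lambda>i. star A (a i) \<otimes> finsum A b T) S"
    using assms by (intro fs_mult_right) auto
  also have "\<dots> = finsum A (\<lambda>i. finsum A (\<lambda>j. star A (a i) \<otimes> b j) T) S"
    using assms by (intro fs_cong fs_mult_left) auto
  finally show ?thesis .
qed

text \<open>A Gram kernel: its form at \<open>c\<close> is the value of \<open>f\<close> at
  \<open>star A x \<otimes> x\<close>, where \<open>x\<close> is the combination of the
  \<open>a i\<close> with coefficients \<open>c\<close>.\<close>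

lemma psd_positive_functional:
  assumes f: "positive_functional A f" and a: "\<And>i. i \<in> S \<Longrightarrow> a i \<in> carrier A"
  shows "psd S (\<lambda>i j. f (star A (a i) \<otimes> a j))"
  unfolding psd_def
proof
  fix c :: "_ \<Rightarrow> complex"
  note F = positive_functional_simps[OF f]
  let ?x = "finsum A (\<lambda>i. c i \<odot> a i) S"
  have "f (star A ?x \<otimes> ?x) = (\<Sum>i\<in>S. \<Sum>j\<in>S. f (star A (c i \<odot> a i) \<otimes> (c j \<odot> a j)))"
    using a by (subst fs_star_mult) (auto simp: F(5))
  also have "\<dots> = (\<Sum>i\<in>S. \<Sum>j\<in>S. cnj (c i) * c j * f (star A (a i) \<otimes> a j))"
    using a by (intro sum.cong refl) (simp add: star_scale F)
  finally show "(\<Sum>i\<in>S. \<Sum>j\<in>S. cnj (c i) * c j * f (star A (a i) \<otimes> a j)) \<in> \<real>\<^sub>\<ge>\<^sub>0"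
    using F(4)[of ?x] a by auto
qed

text \<open>Cauchy-Schwarz for the form of the GNS construction: the Gram kernel of \<open>a\<close>
  and \<open>star A b\<close> has a zero on the diagonal.\<close>

lemma positive_functional_null:
  assumes f: "positive_functional A f" and "a \<in> carrier A" "b \<in> carrier A" "f (star A a \<otimes> a) = 0"
  shows "f (b \<otimes> a) = 0"
proof -
  have "psd (UNIV :: bool set) (\<lambda>i j. f (star A (if i then a else star A b) \<otimes> (if j then a else star A b)))"
    using assms by (intro psd_positive_functional) auto
  from psd_null(1)[OF this, of False True] show ?thesis using assms by simp
qed

end

lemma reduced_star_algD:
  assumes "star_algebra A" "reduced_star_alg A" "a \<in> carrier A"
    and "\<And>f. positive_functional A f \<Longrightarrow> f (star A a \<otimes>\<^bsub>A\<^esub> a) = 0"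
  shows "a = \<zero>\<^bsub>A\<^esub>"
  using assms unfolding reduced_star_alg_def by blast

text \<open>Some \<open>h\<close> of the family does not kill a given nonzero element; a functional
  on its target that detects the image is pulled back.\<close>

lemma reduced_jointly_injective:
  assumes F: "jointly_injective Q F" and red: "\<And>B h. (B, h) \<in> F \<Longrightarrow> reduced_star_alg B"
  shows "reduced_star_alg Q"
  unfolding reduced_star_alg_def
proof (intro ballI impI)
  fix a assume a: "a \<in> carrier Q" "a \<noteq> \<zero>\<^bsub>Q\<^esub>"
  then obtain p where "p \<in> F" "snd p a \<noteq> \<zero>\<^bsub>fst p\<^esub>" using F unfolding jointly_injective_def split_def by blast
  then obtain B h where Bh: "(B, h) \<in> F" "h a \<noteq> \<zero>\<^bsub>B\<^esub>" by (cases p) auto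
  interpret star_algebra_hom Q B h by (rule jointly_injective_hom[OF F Bh(1)])
  obtain f where f: "positive_functional B f" "f (star B (h a) \<otimes>\<^bsub>B\<^esub> h a) \<noteq> 0"
    using red[OF Bh(1)] Bh(2) a(1) unfolding reduced_star_alg_def by blast
  have "positive_functional Q (\<lambda>x. f (h x))"
    using f(1) by (simp add: positive_functional_def flip: hom_star hom_mult) (simp add: positive_functional_def)
  then show "\<exists>f. positive_functional Q f \<and> f (star Q a \<otimes>\<^bsub>Q\<^esub> a) \<noteq> 0"
    using f(2) a(1) by (intro exI[of _ "\<lambda>x. f (h x)"]) simp
qed

lemma reduced_complex: "reduced_star_alg complex_star_alg"
  unfolding reduced_star_alg_def positive_functional_def
proof (intro ballI impI exI[of _ "\<lambda>x. x"] conjI allI)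
  fix a assume "a \<in> carrier complex_star_alg" "a \<noteq> \<zero>\<^bsub>complex_star_alg\<^esub>"
  then show "star complex_star_alg a \<otimes>\<^bsub>complex_star_alg\<^esub> a \<noteq> 0" by (simp add: complex_star_alg_def)
next
  fix a :: complex
  have "cnj a * a = of_real ((cmod a)\<^sup>2)" by (metis complex_norm_square mult.commute)
  then show "star complex_star_alg a \<otimes>\<^bsub>complex_star_alg\<^esub> a \<in> \<real>\<^sub>\<ge>\<^sub>0"
    by (simp add: complex_star_alg_def)
qed (simp_all add: complex_star_alg_def)

text \<open>A positive functional stays positive, because \<open>a \<otimes> star A a\<close> has
  the form required for the element \<open>star A a\<close>. For the same reason, \<open>a\<close>
  is detected in the opposite algebra by a functional that detects \<open>star A a\<close> in
  \<open>A\<close>.\<close>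

lemma reduced_opposite:
  assumes A: "star_algebra A" and red: "reduced_star_alg A"
  shows "reduced_star_alg (opposite A)"
  unfolding reduced_star_alg_def
proof (intro ballI impI)
  interpret star_algebra A by fact
  have o: "carrier (opposite A) = carrier A" "add (opposite A) = add A" "smult (opposite A) = smult A"
    "star (opposite A) = star A" "zero (opposite A) = zero A" "a \<otimes>\<^bsub>opposite A\<^esub> b = b \<otimes>\<^bsub>A\<^esub> a" for a b
    by (simp_all add: opposite_def)
  fix a assume a: "a \<in> carrier (opposite A)" "a \<noteq> \<zero>\<^bsub>opposite A\<^esub>"
  then have "star A a \<in> carrier A" "star A a \<noteq> \<zero>\<^bsub>A\<^esub>"
    by (auto simp: o) (metis star_star star_zero)
  then obtain f where f: "positive_functional A f" "f (star A (star A a) \<otimes>\<^bsub>A\<^esub> star A a) \<noteq> 0"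
    using red unfolding reduced_star_alg_def by blast
  have "f (a \<otimes>\<^bsub>A\<^esub> star A a) \<in> \<real>\<^sub>\<ge>\<^sub>0" if "a \<in> carrier A" for a
    using positive_functional_simps(4)[OF f(1), of "star A a"] that by simp
  then have "positive_functional (opposite A) f"
    using f(1) by (simp add: positive_functional_def o)
  then show "\<exists>f. positive_functional (opposite A) f \<and> f (star (opposite A) a \<otimes>\<^bsub>opposite A\<^esub> a) \<noteq> 0"
    using f(2) a by (auto simp: o)
qed

section \<open>Tensor products\<close>

locale star_algebra_pair = A: star_algebra A + B: star_algebra B
  for A :: "('a, 'x) star_alg_scheme" and B :: "('b, 'y) star_alg_scheme"
begin

abbreviation "PT \<equiv> pretensor A B"
abbreviation "TI \<equiv> tensor_ideal A B"
abbreviation "T \<equiv> tensor A B"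
abbreviation "t \<equiv> pure_tensor A B"

lemma star_monoid_pair: "star_monoid (A \<times>\<times> B) (map_prod (star A) (star B))"
proof (intro star_monoid.intro star_monoid_axioms.intro)
  show "Group.monoid (A \<times>\<times> B)" by (rule DirProd_monoid) (rule A.monoid_axioms B.monoid_axioms)+
qed (auto simp: DirProd_def A.star_mult B.star_mult)

lemma star_algebra_PT: "star_algebra PT"
  unfolding pretensor_def by (rule star_monoid.star_algebra_MA[OF star_monoid_pair])

lemmas pretensor_facts =
  star_monoid.basis_closed[OF star_monoid_pair, folded pretensor_def]
  star_monoid.basis_mult[OF star_monoid_pair, folded pretensor_def]
  star_monoid.basis_star[OF star_monoid_pair, folded pretensor_def]
  star_monoid.pair_mult[OF star_monoid_pair, folded pretensor_def]
  star_monoid.pair_star[OF star_monoid_pair, folded pretensor_def]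
  star_monoid.pair_MA_simps[OF star_monoid_pair, folded pretensor_def]
  star_monoid.MA_ops(4)[OF star_monoid_pair, folded pretensor_def]

lemma carrier_PT: "F \<in> carrier PT \<longleftrightarrow> finite {x. F x \<noteq> 0} \<and> {x. F x \<noteq> 0} \<subseteq> carrier A \<times> carrier B"
  using star_monoid.carrier_MA[OF star_monoid_pair] by (simp add: pretensor_def DirProd_def)

lemma carrier_DirProd': "(a, b) \<in> carrier (A \<times>\<times> B) \<longleftrightarrow> a \<in> carrier A \<and> b \<in> carrier B"
  by (simp add: DirProd_def)

definition bilinear :: "('a \<Rightarrow> 'b \<Rightarrow> complex) \<Rightarrow> bool" where
  "bilinear \<beta> \<longleftrightarrow>
     (\<forall>a\<in>carrier A. \<forall>a'\<in>carrier A. \<forall>b\<in>carrier B. \<beta> (a \<oplus>\<^bsub>A\<^esub> a') b = \<beta> a b + \<beta> a' b) \<and>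
     (\<forall>a\<in>carrier A. \<forall>b\<in>carrier B. \<forall>b'\<in>carrier B. \<beta> a (b \<oplus>\<^bsub>B\<^esub> b') = \<beta> a b + \<beta> a b') \<and>
     (\<forall>c. \<forall>a\<in>carrier A. \<forall>b\<in>carrier B. \<beta> (c \<odot>\<^bsub>A\<^esub> a) b = c * \<beta> a b \<and> \<beta> a (c \<odot>\<^bsub>B\<^esub> b) = c * \<beta> a b)"

text \<open>A posteriori, this is the tensor ideal.\<close>
definition bilinear_null :: "('a \<times> 'b \<Rightarrow> complex) set" where
  "bilinear_null = {F \<in> carrier PT. \<forall>\<beta>. bilinear \<beta> \<longrightarrow> pair F (\<lambda>(a, b). \<beta> a b) = 0}"

text \<open>Bilinear forms are stable under the operations dual to those of the ideal: multiplying
  both arguments by fixed elements, finite combinations of these, and conjugation after applying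
  both involutions.\<close>

lemma star_ideal_bilinear_null: "star_ideal bilinear_null PT"
  unfolding star_ideal_def
proof (intro conjI ballI)
  interpret PT: star_algebra PT by (rule star_algebra_PT)
  note ps = pretensor_facts
  have supp: "fst x \<in> carrier A" "snd x \<in> carrier B" if "F \<in> carrier PT" "F x \<noteq> 0" for F x
    using that by (auto simp: carrier_PT mem_Times_iff)
  show "ideal bilinear_null PT"
  proof (rule idealI)
    show "ring PT" by (rule PT.ring_axioms)
    show "subgroup bilinear_null (add_monoid PT)"
      by (rule PT.add.subgroupI) (auto simp: bilinear_null_def ps PT.minus_eq_scale simp flip: a_inv_def
        intro!: exI[of _ "\<zero>\<^bsub>PT\<^esub>"])
  next
    fix F G assume F: "F \<in> bilinear_null" and G: "G \<in> carrier PT"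
    then have Fc: "F \<in> carrier PT" by (simp add: bilinear_null_def)
    have supp2: "a \<in> carrier A" "b \<in> carrier B" if "G (a, b) \<noteq> 0" for a b
      using supp[OF G that] by simp_all
    have 1: "pair (G \<otimes>\<^bsub>PT\<^esub> F) (\<lambda>(a, b). \<beta> a b) = 0" if \<beta>: "bilinear \<beta>" for \<beta>
    proof -
      have "pair (G \<otimes>\<^bsub>PT\<^esub> F) (\<lambda>(a, b). \<beta> a b) = pair G (\<lambda>y. pair F (\<lambda>z. (\<lambda>(a, b). \<beta> a b) (y \<otimes>\<^bsub>A \<times>\<times> B\<^esub> z)))"
        using G Fc by (rule ps)
      also have "\<dots> = pair G (\<lambda>y. 0)"
      proof (rule pair_cong)
        fix y assume y: "G y \<noteq> 0"
        have "bilinear (\<lambda>a b. \<beta> (fst y \<otimes>\<^bsub>A\<^esub> a) (snd y \<otimes>\<^bsub>B\<^esub> b))"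
          using \<beta> supp[OF G y] by (simp add: bilinear_def A.r_distr B.r_distr)
        then have "pair F (\<lambda>(a, b). \<beta> (fst y \<otimes>\<^bsub>A\<^esub> a) (snd y \<otimes>\<^bsub>B\<^esub> b)) = 0"
          using F by (simp add: bilinear_null_def)
        then show "pair F (\<lambda>z. (\<lambda>(a, b). \<beta> a b) (y \<otimes>\<^bsub>A \<times>\<times> B\<^esub> z)) = 0"
          by (simp add: DirProd_def split_def)
      qed
      finally show ?thesis by (simp add: pair_def)
    qed
    have 2: "pair (F \<otimes>\<^bsub>PT\<^esub> G) (\<lambda>(a, b). \<beta> a b) = 0" if \<beta>: "bilinear \<beta>" for \<beta>
    proof -
      have "pair (F \<otimes>\<^bsub>PT\<^esub> G) (\<lambda>(a, b). \<beta> a b) = pair F (\<lambda>y. pair G (\<lambda>z. (\<lambda>(a, b). \<beta> a b) (y \<otimes>\<^bsub>A \<times>\<times> B\<^esub> z)))"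
        using Fc G by (rule ps)
      also have "\<dots> = pair F (\<lambda>(a, b). pair G (\<lambda>z. \<beta> (a \<otimes>\<^bsub>A\<^esub> fst z) (b \<otimes>\<^bsub>B\<^esub> snd z)))"
        by (simp add: DirProd_def split_def)
      also have "\<dots> = 0"
      proof -
        have "bilinear (\<lambda>a b. pair G (\<lambda>z. \<beta> (a \<otimes>\<^bsub>A\<^esub> fst z) (b \<otimes>\<^bsub>B\<^esub> snd z)))"
          unfolding bilinear_def pair_add_right[symmetric] pair_scale_right[symmetric]
          using \<beta> by (auto intro!: pair_cong simp: supp2 bilinear_def A.l_distr B.l_distr)
        then show ?thesis using F by (simp add: bilinear_null_def)
      qed
      finally show ?thesis .
    qed
    show "G \<otimes>\<^bsub>PT\<^esub> F \<in> bilinear_null" "F \<otimes>\<^bsub>PT\<^esub> G \<in> bilinear_null"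
      using 1 2 Fc G by (simp_all add: bilinear_null_def)
  qed
  fix F assume F: "F \<in> bilinear_null"
  then have Fc: "F \<in> carrier PT" by (simp add: bilinear_null_def)
  have "pair (star PT F) (\<lambda>(a, b). \<beta> a b) = 0" if \<beta>: "bilinear \<beta>" for \<beta>
  proof -
    have "bilinear (\<lambda>a b. cnj (\<beta> (star A a) (star B b)))"
      using \<beta> by (simp add: bilinear_def A.star_add B.star_add A.star_scale B.star_scale)
    then have "pair F (\<lambda>(a, b). cnj (\<beta> (star A a) (star B b))) = 0"
      using F by (simp add: bilinear_null_def)
    then show ?thesis using Fc by (simp add: ps split_def)
  qed
  then show "star PT F \<in> bilinear_null" using Fc by (simp add: bilinear_null_def)
qed

lemma bilinear_relations_null:
  "bilinear_relations A B (star_quot PT bilinear_null) (\<lambda>a b. bilinear_null +>\<^bsub>PT\<^esub> basis_elt (a, b))"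
proof -
  interpret PT: star_algebra PT by (rule star_algebra_PT)
  interpret N: star_ideal_quotient PT bilinear_null
    by (intro star_ideal_quotient.intro star_ideal_quotient_axioms.intro star_algebra_PT star_ideal_bilinear_null)
  interpret \<pi>: star_algebra_hom PT "star_quot PT bilinear_null" "\<lambda>F. bilinear_null +>\<^bsub>PT\<^esub> F"
    by (rule N.star_algebra_hom_coset)
  have eq: "bilinear_null +>\<^bsub>PT\<^esub> F = bilinear_null +>\<^bsub>PT\<^esub> G" if "F \<in> carrier PT" "G \<in> carrier PT"
    "\<And>\<beta>. bilinear \<beta> \<Longrightarrow> pair F (\<lambda>(a, b). \<beta> a b) = pair G (\<lambda>(a, b). \<beta> a b)" for F G
    using that by (simp add: N.coset_eq_iff N.minus_eq_scaled) (simp add: bilinear_null_def pretensor_facts)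
  have cl: "basis_elt (a, b) \<in> carrier PT" if "a \<in> carrier A" "b \<in> carrier B" for a b
    using pretensor_facts(1) that by (simp add: carrier_DirProd')
  show ?thesis
    unfolding bilinear_relations_def
  proof (intro conjI ballI allI)
    fix a a' b assume ab: "a \<in> carrier A" "a' \<in> carrier A" "b \<in> carrier B"
    show "bilinear_null +>\<^bsub>PT\<^esub> basis_elt (a \<oplus>\<^bsub>A\<^esub> a', b)
      = (bilinear_null +>\<^bsub>PT\<^esub> basis_elt (a, b)) \<oplus>\<^bsub>star_quot PT bilinear_null\<^esub> (bilinear_null +>\<^bsub>PT\<^esub> basis_elt (a', b))"
      unfolding \<pi>.hom_add[OF cl[OF ab(1,3)] cl[OF ab(2,3)], symmetric]
      by (rule eq) (use ab in \<open>simp_all add: cl pretensor_facts bilinear_def\<close>)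
  next
    fix a b b' assume ab: "a \<in> carrier A" "b \<in> carrier B" "b' \<in> carrier B"
    show "bilinear_null +>\<^bsub>PT\<^esub> basis_elt (a, b \<oplus>\<^bsub>B\<^esub> b')
      = (bilinear_null +>\<^bsub>PT\<^esub> basis_elt (a, b)) \<oplus>\<^bsub>star_quot PT bilinear_null\<^esub> (bilinear_null +>\<^bsub>PT\<^esub> basis_elt (a, b'))"
      unfolding \<pi>.hom_add[OF cl[OF ab(1,2)] cl[OF ab(1,3)], symmetric]
      by (rule eq) (use ab in \<open>simp_all add: cl pretensor_facts bilinear_def\<close>)
  next
    fix c a b assume ab: "a \<in> carrier A" "b \<in> carrier B"
    show "bilinear_null +>\<^bsub>PT\<^esub> basis_elt (c \<odot>\<^bsub>A\<^esub> a, b)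
      = c \<odot>\<^bsub>star_quot PT bilinear_null\<^esub> (bilinear_null +>\<^bsub>PT\<^esub> basis_elt (a, b))"
      "bilinear_null +>\<^bsub>PT\<^esub> basis_elt (a, c \<odot>\<^bsub>B\<^esub> b)
      = c \<odot>\<^bsub>star_quot PT bilinear_null\<^esub> (bilinear_null +>\<^bsub>PT\<^esub> basis_elt (a, b))"
      unfolding \<pi>.hom_scale[OF cl[OF ab], symmetric]
      by (rule eq; use ab in \<open>simp add: cl pretensor_facts bilinear_def\<close>)+
  qed
qed

lemma bilinear_relations_transfer:
  assumes F: "jointly_injective Q F" and s: "\<And>a b. a \<in> carrier A \<Longrightarrow> b \<in> carrier B \<Longrightarrow> s a b \<in> carrier Q"
    and *: "\<And>C h. (C, h) \<in> F \<Longrightarrow> \<exists>s'. bilinear_relations A B C s' \<and>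
      (\<forall>a\<in>carrier A. \<forall>b\<in>carrier B. h (s a b) = s' a b)"
  shows "bilinear_relations A B Q s"
proof -
  interpret Q: star_algebra Q using F by (simp add: jointly_injective_def)
  have "x = y" if xy: "x \<in> carrier Q" "y \<in> carrier Q"
    and e: "\<And>C h s'. (C, h) \<in> F \<Longrightarrow> star_algebra_hom Q C h \<Longrightarrow> bilinear_relations A B C s' \<Longrightarrow>
      (\<And>a b. a \<in> carrier A \<Longrightarrow> b \<in> carrier B \<Longrightarrow> h (s a b) = s' a b) \<Longrightarrow> h x = h y" for x y
  proof (rule jointly_injective_eqI[OF F xy])
    fix C h assume C: "(C, h) \<in> F" "star_algebra_hom Q C h"
    obtain s' where "bilinear_relations A B C s'" "\<forall>a\<in>carrier A. \<forall>b\<in>carrier B. h (s a b) = s' a b"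
      using *[OF C(1)] by blast
    then show "h x = h y" using e[OF C, of s'] by blast
  qed
  note eq = this
  note hs = star_algebra_hom.hom_add star_algebra_hom.hom_scale
  show ?thesis
    unfolding bilinear_relations_def
  proof (intro conjI ballI allI)
    fix a a' b assume ab: "a \<in> carrier A" "a' \<in> carrier A" "b \<in> carrier B"
    show "s (a \<oplus>\<^bsub>A\<^esub> a') b = s a b \<oplus>\<^bsub>Q\<^esub> s a' b"
      by (rule eq) (use ab in \<open>auto simp: s hs bilinear_relations_def\<close>)
  next
    fix a b b' assume ab: "a \<in> carrier A" "b \<in> carrier B" "b' \<in> carrier B"
    show "s a (b \<oplus>\<^bsub>B\<^esub> b') = s a b \<oplus>\<^bsub>Q\<^esub> s a b'"
      by (rule eq) (use ab in \<open>auto simp: s hs bilinear_relations_def\<close>)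
  next
    fix c a b assume ab: "a \<in> carrier A" "b \<in> carrier B"
    show "s (c \<odot>\<^bsub>A\<^esub> a) b = c \<odot>\<^bsub>Q\<^esub> s a b" "s a (c \<odot>\<^bsub>B\<^esub> b) = c \<odot>\<^bsub>Q\<^esub> s a b"
      by (rule eq; use ab in \<open>auto simp: s hs bilinear_relations_def\<close>)+
  qed
qed

lemma basis_PT: "a \<in> carrier A \<Longrightarrow> b \<in> carrier B \<Longrightarrow> basis_elt (a, b) \<in> carrier PT"
  using pretensor_facts(1) by (simp add: carrier_DirProd')

lemma star_ideal_TI: "star_ideal TI PT"
  unfolding tensor_ideal_def
  using star_algebra_PT star_ideal_bilinear_null bilinear_relations_null by (rule star_ideal_relation_ideal)

text \<open>Bilinear forms thus vanish on the tensor ideal and descend to \<open>T\<close>. This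
  bounds the ideal from above and yields functionals on the tensor product.\<close>

lemma TI_null: "TI \<subseteq> bilinear_null"
  unfolding tensor_ideal_def using star_ideal_bilinear_null bilinear_relations_null by (rule relation_ideal_le)

lemma quotient_TI: "star_ideal_quotient PT TI"
  by (intro star_ideal_quotient.intro star_ideal_quotient_axioms.intro star_algebra_PT star_ideal_TI)

lemma star_algebra_T: "star_algebra T"
  unfolding tensor_def by (rule star_ideal_quotient.star_algebra_quot[OF quotient_TI])

lemma hom_PT_T: "star_algebra_hom PT T (\<lambda>F. TI +>\<^bsub>PT\<^esub> F)"
  unfolding tensor_def by (rule star_ideal_quotient.star_algebra_hom_coset[OF quotient_TI])

lemma bilinear_relations_T: "bilinear_relations A B T t"
proof -
  have "bilinear_relations A B (star_quot PT TI) (\<lambda>a b. TI +>\<^bsub>PT\<^esub> basis_elt (a, b))"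
    unfolding tensor_ideal_def
  proof (rule relation_ideal_holds[where R="\<lambda>T \<pi>. bilinear_relations A B T (\<lambda>a b. \<pi> (basis_elt (a, b)))",
      OF star_algebra_PT star_ideal_bilinear_null bilinear_relations_null])
    fix I and F :: "(('a \<times> 'b \<Rightarrow> complex) set star_alg \<times> (('a \<times> 'b \<Rightarrow> complex) set \<Rightarrow> ('a \<times> 'b \<Rightarrow> complex) set)) set"
    assume I: "star_ideal I PT" and F: "jointly_injective (star_quot PT I) F"
      and *: "\<And>B' h. (B', h) \<in> F \<Longrightarrow> \<exists>\<pi>. bilinear_relations A B B' (\<lambda>a b. \<pi> (basis_elt (a, b))) \<and>
        (\<forall>a\<in>carrier PT. h (I +>\<^bsub>PT\<^esub> a) = \<pi> a)"
    interpret I: star_ideal_quotient PT I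
      by (intro star_ideal_quotient.intro star_ideal_quotient_axioms.intro star_algebra_PT I)
    show "bilinear_relations A B (star_quot PT I) (\<lambda>a b. I +>\<^bsub>PT\<^esub> basis_elt (a, b))"
    proof (rule bilinear_relations_transfer[OF F])
      fix C h assume "(C, h) \<in> F"
      from *[OF this] obtain \<pi> where "bilinear_relations A B C (\<lambda>a b. \<pi> (basis_elt (a, b)))"
        "\<forall>a\<in>carrier PT. h (I +>\<^bsub>PT\<^esub> a) = \<pi> a" by (elim exE conjE)
      then show "\<exists>s'. bilinear_relations A B C s' \<and>
        (\<forall>a\<in>carrier A. \<forall>b\<in>carrier B. h (I +>\<^bsub>PT\<^esub> basis_elt (a, b)) = s' a b)"
        by (intro exI[of _ "\<lambda>a b. \<pi> (basis_elt (a, b))"]) (simp add: basis_PT)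
    qed (simp add: I.carrier_star_quot basis_PT)
  qed
  then show ?thesis unfolding tensor_def pure_tensor_def .
qed

lemma t_closed [simp, intro]: "a \<in> carrier A \<Longrightarrow> b \<in> carrier B \<Longrightarrow> t a b \<in> carrier T"
  using star_algebra_hom.hom_closed[OF hom_PT_T basis_PT] by (simp add: pure_tensor_def)

lemma t_add_left: "a \<in> carrier A \<Longrightarrow> a' \<in> carrier A \<Longrightarrow> b \<in> carrier B \<Longrightarrow> t (a \<oplus>\<^bsub>A\<^esub> a') b = t a b \<oplus>\<^bsub>T\<^esub> t a' b"
  and t_add_right: "a \<in> carrier A \<Longrightarrow> b \<in> carrier B \<Longrightarrow> b' \<in> carrier B \<Longrightarrow> t a (b \<oplus>\<^bsub>B\<^esub> b') = t a b \<oplus>\<^bsub>T\<^esub> t a b'"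
  and t_scale_left: "a \<in> carrier A \<Longrightarrow> b \<in> carrier B \<Longrightarrow> t (c \<odot>\<^bsub>A\<^esub> a) b = c \<odot>\<^bsub>T\<^esub> t a b"
  and t_scale_right: "a \<in> carrier A \<Longrightarrow> b \<in> carrier B \<Longrightarrow> t a (c \<odot>\<^bsub>B\<^esub> b) = c \<odot>\<^bsub>T\<^esub> t a b"
  using bilinear_relations_T by (auto simp: bilinear_relations_def)

lemma t_mult: "a \<in> carrier A \<Longrightarrow> a' \<in> carrier A \<Longrightarrow> b \<in> carrier B \<Longrightarrow> b' \<in> carrier B
  \<Longrightarrow> t a b \<otimes>\<^bsub>T\<^esub> t a' b' = t (a \<otimes>\<^bsub>A\<^esub> a') (b \<otimes>\<^bsub>B\<^esub> b')"
  using pretensor_facts(2)[of "(a, b)" "(a', b')"]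
  by (simp add: pure_tensor_def carrier_DirProd' basis_PT mult_DirProd flip: star_algebra_hom.hom_mult[OF hom_PT_T])

lemma t_star: "a \<in> carrier A \<Longrightarrow> b \<in> carrier B \<Longrightarrow> star T (t a b) = t (star A a) (star B b)"
  using pretensor_facts(3)[of "(a, b)"]
  by (simp add: pure_tensor_def carrier_DirProd' basis_PT flip: star_algebra_hom.hom_star[OF hom_PT_T])

lemma t_one: "t \<one>\<^bsub>A\<^esub> \<one>\<^bsub>B\<^esub> = \<one>\<^bsub>T\<^esub>"
  using star_algebra_hom.hom_one[OF hom_PT_T] pretensor_facts(10) by (simp add: pure_tensor_def)

lemma t_zero [simp]: "b \<in> carrier B \<Longrightarrow> t \<zero>\<^bsub>A\<^esub> b = \<zero>\<^bsub>T\<^esub>" "a \<in> carrier A \<Longrightarrow> t a \<zero>\<^bsub>B\<^esub> = \<zero>\<^bsub>T\<^esub>"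
proof -
  interpret T: star_algebra T by (rule star_algebra_T)
  show "b \<in> carrier B \<Longrightarrow> t \<zero>\<^bsub>A\<^esub> b = \<zero>\<^bsub>T\<^esub>" using t_scale_left[of "\<zero>\<^bsub>A\<^esub>" b 0] by simp
  show "a \<in> carrier A \<Longrightarrow> t a \<zero>\<^bsub>B\<^esub> = \<zero>\<^bsub>T\<^esub>" using t_scale_right[of a "\<zero>\<^bsub>B\<^esub>" 0] by simp
qed

lemma t_fs_left: "(\<And>i. i \<in> S \<Longrightarrow> a i \<in> carrier A) \<Longrightarrow> b \<in> carrier B
  \<Longrightarrow> t (finsum A a S) b = finsum T (\<lambda>i. t (a i) b) S"
  by (rule A.fs_additive[where h="\<lambda>x. t x b"]) (auto simp: t_add_left star_algebra_T)

lemma t_fs_right: "(\<And>i. i \<in> S \<Longrightarrow> b i \<in> carrier B) \<Longrightarrow> a \<in> carrier A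
  \<Longrightarrow> t a (finsum B b S) = finsum T (\<lambda>i. t a (b i)) S"
  by (rule B.fs_additive[where h="\<lambda>x. t a x"]) (auto simp: t_add_right star_algebra_T)

lemma T_decomp:
  assumes "x \<in> carrier T"
  obtains S :: "('a \<times> 'b) set" and a b where "finite S" "\<And>i. i \<in> S \<Longrightarrow> a i \<in> carrier A"
    "\<And>i. i \<in> S \<Longrightarrow> b i \<in> carrier B" "x = finsum T (\<lambda>i. t (a i) (b i)) S"
proof -
  interpret PT: star_algebra PT by (rule star_algebra_PT)
  interpret \<pi>: star_algebra_hom PT T "\<lambda>F. TI +>\<^bsub>PT\<^esub> F" by (rule hom_PT_T)
  obtain F where F: "F \<in> carrier PT" "x = TI +>\<^bsub>PT\<^esub> F"
    using assms star_ideal_quotient.carrier_star_quot[OF quotient_TI] by (auto simp: tensor_def)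
  let ?S = "{p. F p \<noteq> 0}"
  have S: "finite ?S" "\<And>p. p \<in> ?S \<Longrightarrow> fst p \<in> carrier A" "\<And>p. p \<in> ?S \<Longrightarrow> snd p \<in> carrier B"
    using F by (auto simp: carrier_PT mem_Times_iff)
  have b: "basis_elt p \<in> carrier PT" if "p \<in> ?S" for p
    using basis_PT[OF S(2,3)[OF that]] by simp
  have "F = finsum PT (\<lambda>p. F p \<odot>\<^bsub>PT\<^esub> basis_elt p) ?S"
  proof (rule star_monoid.pair_ext[OF star_monoid_pair, folded pretensor_def])
    show "finsum PT (\<lambda>p. F p \<odot>\<^bsub>PT\<^esub> basis_elt p) ?S \<in> carrier PT" using b by auto
    fix \<phi>
    have "pair (finsum PT (\<lambda>p. F p \<odot>\<^bsub>PT\<^esub> basis_elt p) ?S) \<phi> = (\<Sum>p\<in>?S. pair (F p \<odot>\<^bsub>PT\<^esub> basis_elt p) \<phi>)"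
      by (rule PT.fs_functional) (use b in \<open>auto simp: pretensor_facts\<close>)
    also have "\<dots> = pair F \<phi>" by (simp add: pretensor_facts) (simp add: pair_def)
    finally show "pair F \<phi> = pair (finsum PT (\<lambda>p. F p \<odot>\<^bsub>PT\<^esub> basis_elt p) ?S) \<phi>" ..
  qed (rule F)
  then have "x = TI +>\<^bsub>PT\<^esub> finsum PT (\<lambda>p. F p \<odot>\<^bsub>PT\<^esub> basis_elt p) ?S" using F(2) by simp
  also have "\<dots> = finsum T (\<lambda>p. TI +>\<^bsub>PT\<^esub> (F p \<odot>\<^bsub>PT\<^esub> basis_elt p)) ?S"
    by (rule \<pi>.hom_fs) (use b in simp)
  also have "\<dots> = finsum T (\<lambda>p. F p \<odot>\<^bsub>T\<^esub> (TI +>\<^bsub>PT\<^esub> basis_elt p)) ?S"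
    by (rule \<pi>.B.fs_cong) (use b in simp_all)
  also have "\<dots> = finsum T (\<lambda>p. t (F p \<odot>\<^bsub>A\<^esub> fst p) (snd p)) ?S"
  proof (rule \<pi>.B.fs_cong)
    fix p assume p: "p \<in> ?S"
    then show "F p \<odot>\<^bsub>T\<^esub> (TI +>\<^bsub>PT\<^esub> basis_elt p) = t (F p \<odot>\<^bsub>A\<^esub> fst p) (snd p)"
      using t_scale_left[OF S(2,3)[OF p], of "F p"] by (simp add: pure_tensor_def)
    show "t (F p \<odot>\<^bsub>A\<^esub> fst p) (snd p) \<in> carrier T" using S(2,3)[OF p] by auto
  qed simp
  finally show thesis using S that[of ?S "\<lambda>p. F p \<odot>\<^bsub>A\<^esub> fst p" snd] by auto
qed

text \<open>Pairing a representative with \<open>\<beta>\<close> does not depend on the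
  representative, as two of them differ by an element of \<open>bilinear_null\<close>.\<close>

lemma linear_functional_T:
  assumes \<beta>: "bilinear \<beta>"
  obtains L :: "('a \<times> 'b \<Rightarrow> complex) set \<Rightarrow> complex" where
    "\<And>x y. x \<in> carrier T \<Longrightarrow> y \<in> carrier T \<Longrightarrow> L (x \<oplus>\<^bsub>T\<^esub> y) = L x + L y"
    "\<And>c x. x \<in> carrier T \<Longrightarrow> L (c \<odot>\<^bsub>T\<^esub> x) = c * L x"
    "\<And>a b. a \<in> carrier A \<Longrightarrow> b \<in> carrier B \<Longrightarrow> L (t a b) = \<beta> a b"
proof -
  interpret PT: star_algebra PT by (rule star_algebra_PT)
  interpret TI: star_ideal_quotient PT TI by (rule quotient_TI)
  interpret \<pi>: star_algebra_hom PT T "\<lambda>F. TI +>\<^bsub>PT\<^esub> F" by (rule hom_PT_T)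
  define L where "L x = pair (SOME F. F \<in> carrier PT \<and> x = TI +>\<^bsub>PT\<^esub> F) (\<lambda>(a, b). \<beta> a b)" for x
  have L: "L (TI +>\<^bsub>PT\<^esub> F) = pair F (\<lambda>(a, b). \<beta> a b)" if F: "F \<in> carrier PT" for F
  proof -
    define G where "G = (SOME G. G \<in> carrier PT \<and> TI +>\<^bsub>PT\<^esub> F = TI +>\<^bsub>PT\<^esub> G)"
    have G: "G \<in> carrier PT \<and> TI +>\<^bsub>PT\<^esub> F = TI +>\<^bsub>PT\<^esub> G"
      unfolding G_def using F by (rule someI[of "\<lambda>G. G \<in> carrier PT \<and> TI +>\<^bsub>PT\<^esub> F = TI +>\<^bsub>PT\<^esub> G", OF conjI]) simp_all
    then have "F \<ominus>\<^bsub>PT\<^esub> G \<in> bilinear_null" using F TI_null TI.coset_eq_iff by blast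
    then have "pair (F \<ominus>\<^bsub>PT\<^esub> G) (\<lambda>(a, b). \<beta> a b) = 0" using \<beta> by (simp add: bilinear_null_def)
    then have "pair G (\<lambda>(a, b). \<beta> a b) = pair F (\<lambda>(a, b). \<beta> a b)"
      using F G by (simp add: TI.minus_eq_scaled pretensor_facts)
    then show ?thesis unfolding L_def G_def .
  qed
  have T: "carrier T = (\<lambda>F. TI +>\<^bsub>PT\<^esub> F) ` carrier PT"
    by (simp add: tensor_def TI.carrier_star_quot)
  show thesis
  proof (rule that[of L])
    fix x y assume "x \<in> carrier T" "y \<in> carrier T"
    then obtain F G where "F \<in> carrier PT" "x = TI +>\<^bsub>PT\<^esub> F" "G \<in> carrier PT" "y = TI +>\<^bsub>PT\<^esub> G"
      unfolding T by blast
    then show "L (x \<oplus>\<^bsub>T\<^esub> y) = L x + L y"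
      by (simp add: L pretensor_facts flip: \<pi>.hom_add)
  next
    fix c x assume "x \<in> carrier T"
    then obtain F where "F \<in> carrier PT" "x = TI +>\<^bsub>PT\<^esub> F"
      unfolding T by blast
    then show "L (c \<odot>\<^bsub>T\<^esub> x) = c * L x"
      by (simp add: L pretensor_facts flip: \<pi>.hom_scale)
  qed (simp add: pure_tensor_def L basis_PT)
qed

text \<open>For a sum of pure tensors \<open>x\<close>, the value at
  \<open>star T x \<otimes> x\<close> is the sum of the entries of the product of two Gram kernels,
  one for \<open>f\<close> and one for \<open>g\<close>; \<open>psd_sum_mult\<close>
  applies.\<close>

lemma positive_functional_T:
  assumes f: "positive_functional A f" and g: "positive_functional B g"
  obtains L where "positive_functional T L"
    "\<And>a b. a \<in> carrier A \<Longrightarrow> b \<in> carrier B \<Longrightarrow> L (t a b) = f a * g b"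
proof -
  interpret T: star_algebra T by (rule star_algebra_T)
  note F = A.positive_functional_simps[OF f] and G = B.positive_functional_simps[OF g]
  have "bilinear (\<lambda>a b. f a * g b)" by (simp add: bilinear_def F G algebra_simps)
  then obtain L where L: "\<And>x y. x \<in> carrier T \<Longrightarrow> y \<in> carrier T \<Longrightarrow> L (x \<oplus>\<^bsub>T\<^esub> y) = L x + L y"
    "\<And>c x. x \<in> carrier T \<Longrightarrow> L (c \<odot>\<^bsub>T\<^esub> x) = c * L x"
    "\<And>a b. a \<in> carrier A \<Longrightarrow> b \<in> carrier B \<Longrightarrow> L (t a b) = f a * g b"
    using linear_functional_T by blast
  have L0: "L \<zero>\<^bsub>T\<^esub> = 0" using L(2)[of "\<zero>\<^bsub>T\<^esub>" 0] by simp
  have "L (star T x \<otimes>\<^bsub>T\<^esub> x) \<in> \<real>\<^sub>\<ge>\<^sub>0" if x: "x \<in> carrier T" for x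
  proof -
    obtain S :: "('a \<times> 'b) set" and a b where S: "finite S" "\<And>i. i \<in> S \<Longrightarrow> a i \<in> carrier A"
      "\<And>i. i \<in> S \<Longrightarrow> b i \<in> carrier B" "x = finsum T (\<lambda>i. t (a i) (b i)) S"
      by (rule T_decomp[OF x]) (rule that; assumption)
    have "L (star T x \<otimes>\<^bsub>T\<^esub> x) = L (finsum T (\<lambda>i. finsum T (\<lambda>j. star T (t (a i) (b i)) \<otimes>\<^bsub>T\<^esub> t (a j) (b j)) S) S)"
      unfolding S(4) using S(2,3) by (subst T.fs_star_mult) auto
    also have "\<dots> = (\<Sum>i\<in>S. \<Sum>j\<in>S. L (star T (t (a i) (b i)) \<otimes>\<^bsub>T\<^esub> t (a j) (b j)))"
    proof -
      note LS = T.fs_functional[where f=L, OF _ L0 L(1)]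
      have "L (finsum T (\<lambda>i. finsum T (\<lambda>j. star T (t (a i) (b i)) \<otimes>\<^bsub>T\<^esub> t (a j) (b j)) S) S)
        = (\<Sum>i\<in>S. L (finsum T (\<lambda>j. star T (t (a i) (b i)) \<otimes>\<^bsub>T\<^esub> t (a j) (b j)) S))"
        by (rule LS) (use S(2,3) in simp_all)
      also have "\<dots> = (\<Sum>i\<in>S. \<Sum>j\<in>S. L (star T (t (a i) (b i)) \<otimes>\<^bsub>T\<^esub> t (a j) (b j)))"
        by (intro sum.cong refl LS) (use S(2,3) in simp_all)
      finally show ?thesis .
    qed
    also have "\<dots> = (\<Sum>i\<in>S. \<Sum>j\<in>S. f (star A (a i) \<otimes>\<^bsub>A\<^esub> a j) * g (star B (b i) \<otimes>\<^bsub>B\<^esub> b j))"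
      using S(2,3) by (intro sum.cong refl) (simp add: t_star t_mult L)
    also have "\<dots> \<in> \<real>\<^sub>\<ge>\<^sub>0"
      using S(1) A.psd_positive_functional[OF f S(2)] B.psd_positive_functional[OF g S(3)]
      by (rule psd_sum_mult)
    finally show ?thesis .
  qed
  then have "positive_functional T L" using L(1,2) by (simp add: positive_functional_def)
  then show thesis using L(3) by (rule that)
qed

text \<open>Minimal tensor representations: if all product functionals vanish on a sum of pure tensors, then
  the left factors are linearly dependent, and the sum can be shortened.\<close>
lemma separation:
  assumes "finite S" "reduced_star_alg A" "reduced_star_alg B"
    and "\<And>i. i \<in> S \<Longrightarrow> a i \<in> carrier A" "\<And>i. i \<in> S \<Longrightarrow> b i \<in> carrier B"
    and "\<And>f g x y. positive_functional A f \<Longrightarrow> positive_functional B g \<Longrightarrow> x \<in> carrier A \<Longrightarrow> y \<in> carrier B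
      \<Longrightarrow> (\<Sum>i\<in>S. f (x \<otimes>\<^bsub>A\<^esub> a i) * g (y \<otimes>\<^bsub>B\<^esub> b i)) = 0"
  shows "finsum T (\<lambda>i. t (a i) (b i)) S = \<zero>\<^bsub>T\<^esub>"
  using assms(1,4-)
\<comment> \<open>Shortening the sum changes the right factors and keeps the left ones.\<close>
proof (induction S arbitrary: b)
  case empty
  interpret T: star_algebra T by (rule star_algebra_T)
  show ?case by simp
next
  interpret T: star_algebra T by (rule star_algebra_T)
  case (insert n S)
  have a: "a i \<in> carrier A" and b: "b i \<in> carrier B" if "i \<in> insert n S" for i
    using insert.prems that by auto
  note Ap = A.positive_functional_simps and Bp = B.positive_functional_simps
  have split: "finsum T (\<lambda>i. t (a i) (b i)) (insert n S) = t (a n) (b n) \<oplus>\<^bsub>T\<^esub> finsum T (\<lambda>i. t (a i) (b i)) S"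
    using insert(1,2) a b by (intro T.fs_insert) auto
  show ?case
  proof (cases "b n = \<zero>\<^bsub>B\<^esub>")
    case True
    have "finsum T (\<lambda>i. t (a i) (b i)) S = \<zero>\<^bsub>T\<^esub>"
    proof (rule insert.IH)
      fix f g x y assume *: "positive_functional A f" "positive_functional B g" "x \<in> carrier A" "y \<in> carrier B"
      show "(\<Sum>i\<in>S. f (x \<otimes>\<^bsub>A\<^esub> a i) * g (y \<otimes>\<^bsub>B\<^esub> b i)) = 0"
        using insert.prems(3)[OF *] insert(1,2) True * by (simp add: Bp)
    qed (use a b in auto)
    then show ?thesis using split a[of n] True by simp
  next
    case False
    then obtain g0 where g0: "positive_functional B g0" "g0 (star B (b n) \<otimes>\<^bsub>B\<^esub> b n) \<noteq> 0"
      using assms(3) b[of n] unfolding reduced_star_alg_def by blast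
    \<comment> \<open>With \<open>g0\<close> and \<open>star B (b n)\<close> the hypothesis says
      that f(x c) = 0 for all \<open>f\<close> and \<open>x\<close>, where c is the combination of
      the \<open>a i\<close> with coefficients \<open>\<mu> i\<close>. The choice x = c^* gives c =
      0 since \<open>A\<close> is reduced, and as \<open>\<mu> n\<close> is nonzero this can be
      solved for \<open>a n\<close>.\<close>
    define \<mu> where "\<mu> i = g0 (star B (b n) \<otimes>\<^bsub>B\<^esub> b i)" for i
    define l where "l i = - \<mu> i / \<mu> n" for i
    have \<mu>n: "\<mu> n \<noteq> 0" using g0(2) by (simp add: \<mu>_def)
    let ?c = "finsum A (\<lambda>i. \<mu> i \<odot>\<^bsub>A\<^esub> a i) (insert n S)"
    have c: "?c \<in> carrier A" using a by auto
    have "?c = \<zero>\<^bsub>A\<^esub>"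
    proof (rule reduced_star_algD[OF A.star_algebra_axioms assms(2) c])
      fix f assume f: "positive_functional A f"
      have "f (star A ?c \<otimes>\<^bsub>A\<^esub> ?c) = f (finsum A (\<lambda>i. \<mu> i \<odot>\<^bsub>A\<^esub> (star A ?c \<otimes>\<^bsub>A\<^esub> a i)) (insert n S))"
        using a c by (subst A.fs_mult_left) (auto intro!: arg_cong[of _ _ f] A.fs_cong)
      also have "\<dots> = (\<Sum>i\<in>insert n S. f (star A ?c \<otimes>\<^bsub>A\<^esub> a i) * g0 (star B (b n) \<otimes>\<^bsub>B\<^esub> b i))"
        using a c by (subst Ap(5)[OF f]) (auto simp: Ap(2)[OF f] \<mu>_def intro!: sum.cong)
      also have "\<dots> = 0"
        using insert.prems(3)[OF f g0(1)] c b[of n] by simp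
      finally show "f (star A ?c \<otimes>\<^bsub>A\<^esub> ?c) = 0" .
    qed
    then have "\<mu> n \<odot>\<^bsub>A\<^esub> a n \<oplus>\<^bsub>A\<^esub> finsum A (\<lambda>i. \<mu> i \<odot>\<^bsub>A\<^esub> a i) S = \<zero>\<^bsub>A\<^esub>"
      using insert(1,2) a by (simp add: A.fs_insert)
    then have "\<mu> n \<odot>\<^bsub>A\<^esub> a n = (-1) \<odot>\<^bsub>A\<^esub> finsum A (\<lambda>i. \<mu> i \<odot>\<^bsub>A\<^esub> a i) S"
      using a A.minus_equality[of "\<mu> n \<odot>\<^bsub>A\<^esub> a n" "finsum A (\<lambda>i. \<mu> i \<odot>\<^bsub>A\<^esub> a i) S"]
      by (simp add: A.minus_eq_scale)
    then have "(1 / \<mu> n) \<odot>\<^bsub>A\<^esub> (\<mu> n \<odot>\<^bsub>A\<^esub> a n) = (1 / \<mu> n) \<odot>\<^bsub>A\<^esub> ((-1) \<odot>\<^bsub>A\<^esub> finsum A (\<lambda>i. \<mu> i \<odot>\<^bsub>A\<^esub> a i) S)"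
      by simp
    then have "a n = (- 1 / \<mu> n) \<odot>\<^bsub>A\<^esub> finsum A (\<lambda>i. \<mu> i \<odot>\<^bsub>A\<^esub> a i) S"
      using a \<mu>n by simp
    also have "\<dots> = finsum A (\<lambda>i. l i \<odot>\<^bsub>A\<^esub> a i) S"
      using a by (subst A.fs_scale) (auto simp: l_def intro!: A.fs_cong)
    finally have an: "a n = finsum A (\<lambda>i. l i \<odot>\<^bsub>A\<^esub> a i) S" .
    \<comment> \<open>Replacing \<open>a n\<close> by the combination of the other
      \<open>a i\<close> moves \<open>b n\<close> into their right factors.\<close>
    let ?b = "\<lambda>i. b i \<oplus>\<^bsub>B\<^esub> l i \<odot>\<^bsub>B\<^esub> b n"
    have "finsum T (\<lambda>i. t (a i) (?b i)) S = \<zero>\<^bsub>T\<^esub>"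
    proof (rule insert.IH)
      fix f g x y assume *: "positive_functional A f" "positive_functional B g" "x \<in> carrier A" "y \<in> carrier B"
      have "f (x \<otimes>\<^bsub>A\<^esub> a n) = f (finsum A (\<lambda>i. l i \<odot>\<^bsub>A\<^esub> (x \<otimes>\<^bsub>A\<^esub> a i)) S)"
        unfolding an using a * by (subst A.fs_mult_left) (auto intro!: arg_cong[of _ _ f] A.fs_cong)
      also have "\<dots> = (\<Sum>i\<in>S. l i * f (x \<otimes>\<^bsub>A\<^esub> a i))"
        using a * by (subst Ap(5)[OF *(1)]) (auto simp: Ap(2)[OF *(1)] intro!: sum.cong)
      finally have fan: "f (x \<otimes>\<^bsub>A\<^esub> a n) = (\<Sum>i\<in>S. l i * f (x \<otimes>\<^bsub>A\<^esub> a i))" .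
      have "(\<Sum>i\<in>S. f (x \<otimes>\<^bsub>A\<^esub> a i) * g (y \<otimes>\<^bsub>B\<^esub> ?b i))
        = (\<Sum>i\<in>S. f (x \<otimes>\<^bsub>A\<^esub> a i) * g (y \<otimes>\<^bsub>B\<^esub> b i) + (l i * f (x \<otimes>\<^bsub>A\<^esub> a i)) * g (y \<otimes>\<^bsub>B\<^esub> b n))"
        using a b * by (intro sum.cong refl) (simp add: B.r_distr Bp(1,2)[OF *(2)] algebra_simps)
      also have "\<dots> = (\<Sum>i\<in>insert n S. f (x \<otimes>\<^bsub>A\<^esub> a i) * g (y \<otimes>\<^bsub>B\<^esub> b i))"
        using insert(1,2) by (simp add: sum.distrib fan sum_distrib_right)
      finally show "(\<Sum>i\<in>S. f (x \<otimes>\<^bsub>A\<^esub> a i) * g (y \<otimes>\<^bsub>B\<^esub> ?b i)) = 0"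
        using insert.prems(3)[OF *] by simp
    qed (use a b in auto)
    moreover have "finsum T (\<lambda>i. t (a i) (?b i)) S
      = finsum T (\<lambda>i. t (a i) (b i) \<oplus>\<^bsub>T\<^esub> t (l i \<odot>\<^bsub>A\<^esub> a i) (b n)) S"
      using a b by (intro T.fs_cong) (auto simp: t_add_right t_scale_left t_scale_right)
    moreover have "\<dots> = finsum T (\<lambda>i. t (a i) (b i)) S \<oplus>\<^bsub>T\<^esub> t (a n) (b n)"
      using a b by (subst T.fs_add) (auto simp: an t_fs_left)
    moreover have "finsum T (\<lambda>i. t (a i) (b i)) S \<in> carrier T" "t (a n) (b n) \<in> carrier T" using a b by auto
    ultimately show ?thesis by (simp add: split T.a_comm)
  qed
qed

text \<open>If every positive functional vanishes at \<open>star T x \<otimes> x\<close>, then by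
  Cauchy-Schwarz the product functionals vanish on \<open>t u v \<otimes> x\<close> for all
  \<open>u\<close> and \<open>v\<close>. This is the hypothesis of
  \<open>separation\<close>.\<close>

lemma reduced_T:
  assumes red: "reduced_star_alg A" "reduced_star_alg B"
  shows "reduced_star_alg T"
proof -
  interpret T: star_algebra T by (rule star_algebra_T)
  have "x = \<zero>\<^bsub>T\<^esub>" if x: "x \<in> carrier T" and 0: "\<And>L. positive_functional T L \<Longrightarrow> L (star T x \<otimes>\<^bsub>T\<^esub> x) = 0" for x
  proof -
    obtain S :: "('a \<times> 'b) set" and a b where S: "finite S" "\<And>i. i \<in> S \<Longrightarrow> a i \<in> carrier A"
      "\<And>i. i \<in> S \<Longrightarrow> b i \<in> carrier B" "x = finsum T (\<lambda>i. t (a i) (b i)) S"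
      by (rule T_decomp[OF x]) (rule that; assumption)
    show ?thesis unfolding S(4)
    proof (rule separation[OF S(1) red S(2,3)])
      fix f g u v assume *: "positive_functional A f" "positive_functional B g" "u \<in> carrier A" "v \<in> carrier B"
      obtain L where L: "positive_functional T L"
        "\<And>a b. a \<in> carrier A \<Longrightarrow> b \<in> carrier B \<Longrightarrow> L (t a b) = f a * g b"
        using positive_functional_T[OF *(1,2)] by blast
      have "0 = L (t u v \<otimes>\<^bsub>T\<^esub> x)"
        using T.positive_functional_null[OF L(1) x _ 0[OF L(1)]] * by simp
      also have "t u v \<otimes>\<^bsub>T\<^esub> x = finsum T (\<lambda>i. t u v \<otimes>\<^bsub>T\<^esub> t (a i) (b i)) S"
        unfolding S(4) by (rule T.fs_mult_left) (use S(2,3) * in simp_all)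
      also have "\<dots> = finsum T (\<lambda>i. t (u \<otimes>\<^bsub>A\<^esub> a i) (v \<otimes>\<^bsub>B\<^esub> b i)) S"
        by (rule T.fs_cong) (use S(2,3) * in \<open>simp_all add: t_mult\<close>)
      also have "L (finsum T (\<lambda>i. t (u \<otimes>\<^bsub>A\<^esub> a i) (v \<otimes>\<^bsub>B\<^esub> b i)) S) = (\<Sum>i\<in>S. f (u \<otimes>\<^bsub>A\<^esub> a i) * g (v \<otimes>\<^bsub>B\<^esub> b i))"
        using S(2,3) * by (subst T.positive_functional_simps(5)[OF L(1)]) (auto simp: L(2))
      finally show "(\<Sum>i\<in>S. f (u \<otimes>\<^bsub>A\<^esub> a i) * g (v \<otimes>\<^bsub>B\<^esub> b i)) = 0" ..
    qed
  qed
  then show ?thesis unfolding reduced_star_alg_def by blast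
qed

lemma T_lift:
  assumes E: "star_algebra E" and s: "\<And>a b. a \<in> carrier A \<Longrightarrow> b \<in> carrier B \<Longrightarrow> s a b \<in> carrier E"
    and bil: "bilinear_relations A B E s"
    and mult: "\<And>a a' b b'. a \<in> carrier A \<Longrightarrow> a' \<in> carrier A \<Longrightarrow> b \<in> carrier B \<Longrightarrow> b' \<in> carrier B
      \<Longrightarrow> s (a \<otimes>\<^bsub>A\<^esub> a') (b \<otimes>\<^bsub>B\<^esub> b') = s a b \<otimes>\<^bsub>E\<^esub> s a' b'"
    and one: "s \<one>\<^bsub>A\<^esub> \<one>\<^bsub>B\<^esub> = \<one>\<^bsub>E\<^esub>"
    and star: "\<And>a b. a \<in> carrier A \<Longrightarrow> b \<in> carrier B \<Longrightarrow> s (star A a) (star B b) = star E (s a b)"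
  obtains h where "star_algebra_hom T E h" "\<And>a b. a \<in> carrier A \<Longrightarrow> b \<in> carrier B \<Longrightarrow> h (t a b) = s a b"
proof -
  obtain k where k: "star_algebra_hom PT E k" "\<And>p. p \<in> carrier (A \<times>\<times> B) \<Longrightarrow> k (basis_elt p) = (\<lambda>(a, b). s a b) p"
  proof (rule star_monoid.lift_ex[OF star_monoid_pair E, folded pretensor_def])
    show "(\<lambda>(a, b). s a b) p \<in> carrier E" if "p \<in> carrier (A \<times>\<times> B)" for p
      using that s by (auto simp: DirProd_def)
    show "(\<lambda>(a, b). s a b) (p \<otimes>\<^bsub>A \<times>\<times> B\<^esub> q) = (\<lambda>(a, b). s a b) p \<otimes>\<^bsub>E\<^esub> (\<lambda>(a, b). s a b) q"
      if "p \<in> carrier (A \<times>\<times> B)" "q \<in> carrier (A \<times>\<times> B)" for p q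
      using that mult by (auto simp: DirProd_def)
    show "(\<lambda>(a, b). s a b) \<one>\<^bsub>A \<times>\<times> B\<^esub> = \<one>\<^bsub>E\<^esub>" using one by (simp add: DirProd_def)
    show "(\<lambda>(a, b). s a b) (map_prod (star A) (star B) p) = star E ((\<lambda>(a, b). s a b) p)"
      if "p \<in> carrier (A \<times>\<times> B)" for p
      using that star by (auto simp: DirProd_def)
  qed blast
  have kb: "k (basis_elt (a, b)) = s a b" if "a \<in> carrier A" "b \<in> carrier B" for a b
    using k(2)[of "(a, b)"] that by (simp add: DirProd_def)
  obtain h where h: "star_algebra_hom (star_quot PT TI) E h" "\<And>F. F \<in> carrier PT \<Longrightarrow> h (TI +>\<^bsub>PT\<^esub> F) = k F"
    unfolding tensor_ideal_def
  proof (rule relation_ideal_lift[where R="\<lambda>T \<pi>. bilinear_relations A B T (\<lambda>a b. \<pi> (basis_elt (a, b)))", OF k(1)])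
    fix \<theta> K assume K: "star_ideal K PT" "jointly_injective (star_quot PT K) {(E, \<theta>)}"
      and \<theta>: "\<And>F. F \<in> carrier PT \<Longrightarrow> \<theta> (K +>\<^bsub>PT\<^esub> F) = k F"
    interpret K: star_ideal_quotient PT K
      by (intro star_ideal_quotient.intro star_ideal_quotient_axioms.intro star_algebra_PT K)
    show "bilinear_relations A B (star_quot PT K) (\<lambda>a b. K +>\<^bsub>PT\<^esub> basis_elt (a, b))"
      by (rule bilinear_relations_transfer[OF K(2)])
        (use bil kb \<theta> basis_PT in \<open>simp_all add: K.carrier_star_quot, blast\<close>)
  qed blast
  show thesis by (rule that[of h]) (use h kb in \<open>auto simp: tensor_def pure_tensor_def basis_PT\<close>)
qed

end

text \<open>The constant \<open>tensor_hom\<close> is a choice, so it has its defining properties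
  only because \<open>T_lift\<close> provides such a map.\<close>

lemma tensor_hom:
  assumes "star_algebra_hom A C g" "star_algebra_hom B D h"
  shows "star_algebra_hom (tensor A B) (tensor C D) (tensor_hom A B C D g h)"
    and "\<And>a b. a \<in> carrier A \<Longrightarrow> b \<in> carrier B
      \<Longrightarrow> tensor_hom A B C D g h (pure_tensor A B a b) = pure_tensor C D (g a) (h b)"
proof -
  interpret g: star_algebra_hom A C g by fact
  interpret h: star_algebra_hom B D h by fact
  interpret AB: star_algebra_pair A B
    by (intro star_algebra_pair.intro g.A.star_algebra_axioms h.A.star_algebra_axioms)
  interpret CD: star_algebra_pair C D
    by (intro star_algebra_pair.intro g.B.star_algebra_axioms h.B.star_algebra_axioms)
  obtain k where k: "star_algebra_hom (tensor A B) (tensor C D) k"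
    "\<And>a b. a \<in> carrier A \<Longrightarrow> b \<in> carrier B \<Longrightarrow> k (pure_tensor A B a b) = pure_tensor C D (g a) (h b)"
  proof (rule AB.T_lift[OF CD.star_algebra_T])
    show "bilinear_relations A B (tensor C D) (\<lambda>a b. pure_tensor C D (g a) (h b))"
      using CD.bilinear_relations_T by (simp add: bilinear_relations_def g.hom_closed h.hom_closed)
  qed (auto simp: CD.t_mult CD.t_star CD.t_one)
  let ?P = "\<lambda>k. k \<in> star_hom (tensor A B) (tensor C D) \<and>
     (\<forall>a\<in>carrier A. \<forall>b\<in>carrier B. k (pure_tensor A B a b) = pure_tensor C D (g a) (h b))"
  have "?P k" using k star_algebra_hom.h by blast
  then have "?P (SOME k. ?P k)" by (rule someI[of ?P])
  then have "?P (tensor_hom A B C D g h)" unfolding tensor_hom_def .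
  then show "star_algebra_hom (tensor A B) (tensor C D) (tensor_hom A B C D g h)"
    "\<And>a b. a \<in> carrier A \<Longrightarrow> b \<in> carrier B
      \<Longrightarrow> tensor_hom A B C D g h (pure_tensor A B a b) = pure_tensor C D (g a) (h b)"
    by (auto intro!: star_algebra_hom.intro star_algebra_hom_axioms.intro AB.star_algebra_T CD.star_algebra_T)
qed

section \<open>Matrix quantum groups\<close>

text \<open>The elements \<open>w\<^sub>i\<^sub>j\<close> of \<open>B\<close> satisfy the relations \<open>R\<close>. As \<open>R\<close> is given for one type of algebras
  only, this is expressed via all algebras of that type embedded in \<open>B\<close>.\<close>
definition satisfies ::
  "'i set \<Rightarrow> ('i coord star_alg \<Rightarrow> ('i \<Rightarrow> 'i \<Rightarrow> 'i coord) \<Rightarrow> bool)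
    \<Rightarrow> ('b, 'y) star_alg_scheme \<Rightarrow> ('i \<Rightarrow> 'i \<Rightarrow> 'b) \<Rightarrow> bool" where
  "satisfies I R B w \<longleftrightarrow> star_algebra B \<and> reduced_star_alg B \<and> (\<forall>i\<in>I. \<forall>j\<in>I. w i j \<in> carrier B) \<and>
     (\<forall>Q \<theta> v. jointly_injective Q {(B, \<theta>)} \<longrightarrow>
        (\<forall>i\<in>I. \<forall>j\<in>I. v i j \<in> carrier Q \<and> \<theta> (v i j) = w i j) \<longrightarrow> R Q v)"

text \<open>What makes generators and relations well behaved: the relations are inherited along
  jointly injective families, and the trivial representation satisfies them. The latter gives a
  proper instance of an ideal with these relations, and the counit.\<close>

locale matrix_relations =
  fixes I :: "'i set" and R :: "'i coord star_alg \<Rightarrow> ('i \<Rightarrow> 'i \<Rightarrow> 'i coord) \<Rightarrow> bool"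
  assumes finite_I: "finite I"
    and transfer: "\<And>Q F v. jointly_injective Q F \<Longrightarrow> (\<And>i j. i \<in> I \<Longrightarrow> j \<in> I \<Longrightarrow> v i j \<in> carrier Q)
      \<Longrightarrow> (\<And>B h. (B, h) \<in> F \<Longrightarrow> \<exists>w. R B w \<and> (\<forall>i\<in>I. \<forall>j\<in>I. h (v i j) = w i j)) \<Longrightarrow> R Q v"
    and counit_relations: "satisfies I R complex_star_alg (\<lambda>i j. of_bool (i = j))"
begin

abbreviation "FA \<equiv> free_star_alg (I \<times> I)"
abbreviation "MI \<equiv> matrix_ideal I R"
abbreviation "OG \<equiv> matrix_star_alg I R"
abbreviation "u \<equiv> matrix_gen I R"

text \<open>The universal property, before the quotient is known to be an algebra: any
  \<open>w\<close> that satisfies the relations also shows that \<open>MI\<close> is an ideal, which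
  \<open>star_algebra_O\<close> rests on.\<close>

lemma lift0:
  assumes "satisfies I R B w"
  obtains h where "star_algebra_hom (star_quot FA MI) B h"
    "\<And>i j. i \<in> I \<Longrightarrow> j \<in> I \<Longrightarrow> h (MI +>\<^bsub>FA\<^esub> free_gen (i, j)) = w i j" "star_ideal MI FA"
proof -
  have B: "star_algebra B" and red: "reduced_star_alg B" and w: "\<And>i j. i \<in> I \<Longrightarrow> j \<in> I \<Longrightarrow> w i j \<in> carrier B"
    and R: "\<And>Q \<theta> v. jointly_injective Q {(B, \<theta>)} \<Longrightarrow>
        (\<And>i j. i \<in> I \<Longrightarrow> j \<in> I \<Longrightarrow> v i j \<in> carrier Q \<and> \<theta> (v i j) = w i j) \<Longrightarrow> R Q v"
    using assms by (simp_all add: satisfies_def)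
  obtain k where k: "star_algebra_hom FA B k" "\<And>p. p \<in> I \<times> I \<Longrightarrow> k (free_gen p) = (\<lambda>(i, j). w i j) p"
  proof (rule free_star_alg_lift[OF B, of "I \<times> I" "\<lambda>(i, j). w i j"])
    show "(\<lambda>(i, j). w i j) p \<in> carrier B" if "p \<in> I \<times> I" for p using that w by auto
  qed blast
  let ?R = "\<lambda>Q \<pi>. reduced_star_alg Q \<and> R Q (\<lambda>i j. \<pi> (free_gen (i, j)))"
  have *: "?R (star_quot FA K) (\<lambda>a. K +>\<^bsub>FA\<^esub> a)"
    if K: "star_ideal K FA" "jointly_injective (star_quot FA K) {(B, \<theta>)}"
      and \<theta>: "\<And>F. F \<in> carrier FA \<Longrightarrow> \<theta> (K +>\<^bsub>FA\<^esub> F) = k F" for \<theta> K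
  proof
    interpret K: star_ideal_quotient FA K
      by (intro star_ideal_quotient.intro star_ideal_quotient_axioms.intro star_algebra_free K)
    show "reduced_star_alg (star_quot FA K)"
      by (rule reduced_jointly_injective[OF K(2)]) (use red in simp)
    show "R (star_quot FA K) (\<lambda>i j. K +>\<^bsub>FA\<^esub> free_gen (i, j))"
      by (rule R[OF K(2)]) (simp add: K.carrier_star_quot \<theta> free_gen_closed k(2))
  qed
  obtain h where hom: "star_algebra_hom (star_quot FA MI) B h"
    and h: "\<And>F. F \<in> carrier FA \<Longrightarrow> h (MI +>\<^bsub>FA\<^esub> F) = k F" and MI: "star_ideal MI FA"
    unfolding matrix_ideal_def
  proof (rule relation_ideal_lift[where R="?R", OF k(1)])
    fix \<theta> K
    assume "star_ideal K FA" "jointly_injective (star_quot FA K) {(B, \<theta>)}"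
      "\<And>F. F \<in> carrier FA \<Longrightarrow> \<theta> (K +>\<^bsub>FA\<^esub> F) = k F"
    then show "?R (star_quot FA K) (\<lambda>a. K +>\<^bsub>FA\<^esub> a)" by (rule *)
  qed (rule that[unfolded matrix_ideal_def]; assumption)
  have "h (MI +>\<^bsub>FA\<^esub> free_gen (i, j)) = w i j" if "i \<in> I" "j \<in> I" for i j
    using that h[OF free_gen_closed] k(2) by simp
  then show thesis using hom MI by (intro that)
qed

lemma star_ideal_MI: "star_ideal MI FA"
  by (rule lift0[OF counit_relations])

lemma quotient_MI: "star_ideal_quotient FA MI"
  by (intro star_ideal_quotient.intro star_ideal_quotient_axioms.intro star_algebra_free star_ideal_MI)

lemma star_algebra_O: "star_algebra OG"
  unfolding matrix_star_alg_def by (rule star_ideal_quotient.star_algebra_quot[OF quotient_MI])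

lemma hom_FA_O: "star_algebra_hom FA OG (\<lambda>F. MI +>\<^bsub>FA\<^esub> F)"
  unfolding matrix_star_alg_def by (rule star_ideal_quotient.star_algebra_hom_coset[OF quotient_MI])

lemma carrier_O: "carrier OG = (\<lambda>F. MI +>\<^bsub>FA\<^esub> F) ` carrier FA"
  unfolding matrix_star_alg_def by (rule star_ideal_quotient.carrier_star_quot[OF quotient_MI])

lemma u_closed [simp, intro]: "i \<in> I \<Longrightarrow> j \<in> I \<Longrightarrow> u i j \<in> carrier OG"
  by (simp add: carrier_O matrix_gen_def free_gen_closed)

lemma lift:
  assumes "satisfies I R B w"
  obtains h where "star_algebra_hom OG B h" "\<And>i j. i \<in> I \<Longrightarrow> j \<in> I \<Longrightarrow> h (u i j) = w i j"
proof (rule lift0[OF assms])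
  fix h assume "star_algebra_hom (star_quot FA MI) B h"
    "\<And>i j. i \<in> I \<Longrightarrow> j \<in> I \<Longrightarrow> h (MI +>\<^bsub>FA\<^esub> free_gen (i, j)) = w i j"
  then show thesis by (intro that[of h]) (simp_all add: matrix_star_alg_def matrix_gen_def)
qed

lemma O_induct [consumes 1, case_names one gen add mult scale star]:
  assumes x: "x \<in> carrier OG" and one: "P \<one>\<^bsub>OG\<^esub>"
    and gen: "\<And>i j. i \<in> I \<Longrightarrow> j \<in> I \<Longrightarrow> P (u i j)"
    and add: "\<And>x y. x \<in> carrier OG \<Longrightarrow> y \<in> carrier OG \<Longrightarrow> P x \<Longrightarrow> P y \<Longrightarrow> P (x \<oplus>\<^bsub>OG\<^esub> y)"
    and mult: "\<And>x y. x \<in> carrier OG \<Longrightarrow> y \<in> carrier OG \<Longrightarrow> P x \<Longrightarrow> P y \<Longrightarrow> P (x \<otimes>\<^bsub>OG\<^esub> y)"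
    and scale: "\<And>c x. x \<in> carrier OG \<Longrightarrow> P x \<Longrightarrow> P (c \<odot>\<^bsub>OG\<^esub> x)"
    and star: "\<And>x. x \<in> carrier OG \<Longrightarrow> P x \<Longrightarrow> P (star OG x)"
  shows "P x"
proof -
  interpret \<pi>: star_algebra_hom FA OG "\<lambda>F. MI +>\<^bsub>FA\<^esub> F" by (rule hom_FA_O)
  have "P (MI +>\<^bsub>FA\<^esub> F)" if "F \<in> carrier FA" for F
    using that
  proof (induction F rule: free_star_alg_induct)
    case one
    then show ?case using assms(2) by simp
  next
    case (gen p)
    then show ?case using assms(3)[of "fst p" "snd p"] by (cases p) (simp add: matrix_gen_def)
  next
    case (add f g)
    then show ?case using assms(4)[of "MI +>\<^bsub>FA\<^esub> f" "MI +>\<^bsub>FA\<^esub> g"] by (simp add: \<pi>.hom_closed)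
  next
    case (mult f g)
    then show ?case using assms(5)[of "MI +>\<^bsub>FA\<^esub> f" "MI +>\<^bsub>FA\<^esub> g"] by (simp add: \<pi>.hom_closed)
  next
    case (scale c f)
    then show ?case using assms(6)[of "MI +>\<^bsub>FA\<^esub> f" c] by (simp add: \<pi>.hom_closed)
  next
    case (star f)
    then show ?case using assms(7)[of "MI +>\<^bsub>FA\<^esub> f"] by (simp add: \<pi>.hom_closed)
  qed
  then show ?thesis using x by (auto simp: carrier_O)
qed

lemma hom_eqI:
  assumes "star_algebra_hom OG B g" "star_algebra_hom OG B h"
    and "\<And>i j. i \<in> I \<Longrightarrow> j \<in> I \<Longrightarrow> g (u i j) = h (u i j)" and "x \<in> carrier OG"
  shows "g x = h x"
proof -
  interpret g: star_algebra_hom OG B g by fact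
  interpret h: star_algebra_hom OG B h by fact
  show ?thesis using assms(4)
    by (induction x rule: O_induct) (simp_all add: assms(3))
qed

lemma reduced_O: "reduced_star_alg OG"
  and relations_O: "R OG u"
proof -
  let ?R = "\<lambda>Q \<pi>. reduced_star_alg Q \<and> R Q (\<lambda>i j. \<pi> (free_gen (i, j)))"
  \<comment> \<open>The improper ideal, whose quotient is zero: it is vacuously reduced, and by the
    empty jointly injective family it has the relations. It serves as the ideal that
    \<open>relation_ideal_holds\<close> asks for.\<close>
  define K where "K = carrier FA"
  interpret FA: star_algebra FA by (rule star_algebra_free)
  have K: "star_ideal K FA" unfolding star_ideal_def K_def using FA.oneideal by simp
  interpret K: star_ideal_quotient FA K
    by (intro star_ideal_quotient.intro star_ideal_quotient_axioms.intro star_algebra_free K)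
  have z: "x = \<zero>\<^bsub>star_quot FA K\<^esub>" if "x \<in> carrier (star_quot FA K)" for x
  proof -
    from that obtain F where F: "F \<in> carrier FA" "x = K +>\<^bsub>FA\<^esub> F" unfolding K.carrier_star_quot by blast
    then show ?thesis using K.coset_eq_zero_iff[OF F(1)] by (simp add: K_def)
  qed
  have "jointly_injective (star_quot FA K) ({} :: ('i coord star_alg \<times> ('i coord \<Rightarrow> 'i coord)) set)"
    unfolding jointly_injective_def using z K.star_algebra_quot by blast
  then have "R (star_quot FA K) (\<lambda>i j. K +>\<^bsub>FA\<^esub> free_gen (i, j))"
    by (rule transfer) (simp_all add: K.carrier_star_quot free_gen_closed)
  moreover have "reduced_star_alg (star_quot FA K)" unfolding reduced_star_alg_def using z by blast
  ultimately have RK: "?R (star_quot FA K) (\<lambda>a. K +>\<^bsub>FA\<^esub> a)" by simp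
  have "?R (star_quot FA MI) (\<lambda>a. MI +>\<^bsub>FA\<^esub> a)"
    unfolding matrix_ideal_def
  proof (rule relation_ideal_holds[where R="?R", OF star_algebra_free K RK])
    fix J and F :: "('i coord star_alg \<times> ('i coord \<Rightarrow> 'i coord)) set"
    assume J: "star_ideal J FA" and F: "jointly_injective (star_quot FA J) F"
      and *: "\<And>B h. (B, h) \<in> F \<Longrightarrow> \<exists>\<pi>. (reduced_star_alg B \<and> R B (\<lambda>i j. \<pi> (free_gen (i, j)))) \<and>
        (\<forall>a\<in>carrier FA. h (J +>\<^bsub>FA\<^esub> a) = \<pi> a)"
    interpret J: star_ideal_quotient FA J
      by (intro star_ideal_quotient.intro star_ideal_quotient_axioms.intro star_algebra_free J)
    have "reduced_star_alg (star_quot FA J)"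
      by (rule reduced_jointly_injective[OF F]) (use * in blast)
    moreover have "R (star_quot FA J) (\<lambda>i j. J +>\<^bsub>FA\<^esub> free_gen (i, j))"
    proof (rule transfer[OF F])
      fix B h assume "(B, h) \<in> F"
      from *[OF this] obtain \<pi> where "R B (\<lambda>i j. \<pi> (free_gen (i, j)))"
        "\<forall>a\<in>carrier FA. h (J +>\<^bsub>FA\<^esub> a) = \<pi> a" by (elim exE conjE)
      then show "\<exists>w. R B w \<and> (\<forall>i\<in>I. \<forall>j\<in>I. h (J +>\<^bsub>FA\<^esub> free_gen (i, j)) = w i j)"
        by (intro exI[of _ "\<lambda>i j. \<pi> (free_gen (i, j))"]) (simp add: free_gen_closed)
    qed (simp add: J.carrier_star_quot free_gen_closed)
    ultimately show "?R (star_quot FA J) (\<lambda>a. J +>\<^bsub>FA\<^esub> a)" by simp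
  qed
  then show "reduced_star_alg OG" "R OG u" unfolding matrix_star_alg_def matrix_gen_def by simp_all
qed

lemma pair_O: "star_algebra_pair OG OG"
  by (intro star_algebra_pair.intro star_algebra_O)

end

text \<open>These two conditions speak of the opposite and of the tensor square of
  \<open>OG\<close>, hence a second locale on top of the construction of \<open>OG\<close>.\<close>

locale matrix_hopf = matrix_relations +
  assumes antipode_relations: "satisfies I R (opposite OG) (\<lambda>i j. star OG (u j i))"
    and comult_relations: "satisfies I R (tensor OG OG)
      (\<lambda>i j. \<Oplus>\<^bsub>tensor OG OG\<^esub>k\<in>I. pure_tensor OG OG (u i k) (u k j))"
begin

abbreviation "HO \<equiv> matrix_quantum_group I R"

lemma HO_ops: "carrier HO = carrier OG" "add HO = add OG" "monoid.mult HO = monoid.mult OG" "one HO = one OG"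
  "zero HO = zero OG" "smult HO = smult OG" "star HO = star OG"
  by (simp_all add: matrix_quantum_group_def Let_def star_alg.defs hopf_star_alg.defs)

text \<open>All three structure maps are choices. The universal property shows that a map with the
  prescribed values on generators exists, so the chosen one has these values.\<close>

lemma comult:
  "star_algebra_hom OG (tensor OG OG) (comult HO)"
  "\<And>i j. i \<in> I \<Longrightarrow> j \<in> I \<Longrightarrow> comult HO (u i j) = (\<Oplus>\<^bsub>tensor OG OG\<^esub>k\<in>I. pure_tensor OG OG (u i k) (u k j))"
proof -
  let ?P = "\<lambda>\<Delta>. \<Delta> \<in> star_hom OG (tensor OG OG) \<and> (\<forall>i\<in>I. \<forall>j\<in>I.
          \<Delta> (u i j) = (\<Oplus>\<^bsub>tensor OG OG\<^esub>k\<in>I. pure_tensor OG OG (u i k) (u k j)))"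
  obtain h where "star_algebra_hom OG (tensor OG OG) h"
    "\<And>i j. i \<in> I \<Longrightarrow> j \<in> I \<Longrightarrow> h (u i j) = (\<Oplus>\<^bsub>tensor OG OG\<^esub>k\<in>I. pure_tensor OG OG (u i k) (u k j))"
    using lift[OF comult_relations] by blast
  then have "?P h" by (simp add: star_algebra_hom.h)
  then have "?P (SOME h. ?P h)" by (rule someI[of ?P])
  moreover have "comult HO = (SOME h. ?P h)"
    by (simp add: matrix_quantum_group_def Let_def star_alg.defs hopf_star_alg.defs)
  ultimately have *: "?P (comult HO)" by simp
  then show "star_algebra_hom OG (tensor OG OG) (comult HO)"
    by (intro star_algebra_hom.intro star_algebra_hom_axioms.intro star_algebra_O
        star_algebra_pair.star_algebra_T pair_O) simp
  show "\<And>i j. i \<in> I \<Longrightarrow> j \<in> I \<Longrightarrow> comult HO (u i j) = (\<Oplus>\<^bsub>tensor OG OG\<^esub>k\<in>I. pure_tensor OG OG (u i k) (u k j))"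
    using * by simp
qed

lemma counit:
  "star_algebra_hom OG complex_star_alg (counit HO)"
  "\<And>i j. i \<in> I \<Longrightarrow> j \<in> I \<Longrightarrow> counit HO (u i j) = of_bool (i = j)"
proof -
  let ?P = "\<lambda>\<epsilon>. \<epsilon> \<in> star_hom OG complex_star_alg \<and> (\<forall>i\<in>I. \<forall>j\<in>I. \<epsilon> (u i j) = of_bool (i = j))"
  obtain h where "star_algebra_hom OG complex_star_alg h" "\<And>i j. i \<in> I \<Longrightarrow> j \<in> I \<Longrightarrow> h (u i j) = of_bool (i = j)"
    using lift[OF counit_relations] by blast
  then have "?P h" by (simp add: star_algebra_hom.h)
  then have "?P (SOME h. ?P h)" by (rule someI[of ?P])
  moreover have "counit HO = (SOME h. ?P h)"
    by (simp add: matrix_quantum_group_def Let_def star_alg.defs hopf_star_alg.defs)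
  ultimately have *: "?P (counit HO)" by simp
  then show "star_algebra_hom OG complex_star_alg (counit HO)"
    by (intro star_algebra_hom.intro star_algebra_hom_axioms.intro star_algebra_O star_algebra_complex) simp
  show "\<And>i j. i \<in> I \<Longrightarrow> j \<in> I \<Longrightarrow> counit HO (u i j) = of_bool (i = j)"
    using * by simp
qed

lemma antipode:
  "star_algebra_hom OG (opposite OG) (antipode HO)"
  "\<And>i j. i \<in> I \<Longrightarrow> j \<in> I \<Longrightarrow> antipode HO (u i j) = star OG (u j i)"
proof -
  let ?P = "\<lambda>S. S \<in> star_hom OG (opposite OG) \<and> (\<forall>i\<in>I. \<forall>j\<in>I. S (u i j) = star OG (u j i))"
  obtain h where "star_algebra_hom OG (opposite OG) h" "\<And>i j. i \<in> I \<Longrightarrow> j \<in> I \<Longrightarrow> h (u i j) = star OG (u j i)"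
    using lift[OF antipode_relations] by blast
  then have "?P h" by (simp add: star_algebra_hom.h)
  then have "?P (SOME h. ?P h)" by (rule someI[of ?P])
  moreover have "antipode HO = (SOME h. ?P h)"
    by (simp add: matrix_quantum_group_def Let_def star_alg.defs hopf_star_alg.defs)
  ultimately have *: "?P (antipode HO)" by simp
  then show "star_algebra_hom OG (opposite OG) (antipode HO)"
    by (intro star_algebra_hom.intro star_algebra_hom_axioms.intro star_algebra_O star_algebra_opposite) simp
  show "\<And>i j. i \<in> I \<Longrightarrow> j \<in> I \<Longrightarrow> antipode HO (u i j) = star OG (u j i)"
    using * by simp
qed

end

text \<open>The Hopf algebra record \<open>HO\<close> extends \<open>OG\<close> by further fields
  and so has another type. \<open>hopf_star_hom\<close> forms tensor products over
  \<open>HO\<close>, the constructions above over \<open>OG\<close>; they coincide because only the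
  common operations enter.\<close>

lemma tensor_cong_ops:
  assumes "carrier A' = carrier A" "add A' = add A" "monoid.mult A' = monoid.mult A" "one A' = one A"
    "smult A' = smult A" "star A' = star A"
    and "carrier B' = carrier B" "add B' = add B" "monoid.mult B' = monoid.mult B" "one B' = one B"
    "smult B' = smult B" "star B' = star B"
  shows "tensor A' B' = tensor A B" "pure_tensor A' B' = pure_tensor A B"
proof -
  have p: "pretensor A' B' = pretensor A B" by (simp add: pretensor_def DirProd_def assms)
  have i: "tensor_ideal A' B' = tensor_ideal A B"
    unfolding tensor_ideal_def p bilinear_relations_def assms ..
  show "tensor A' B' = tensor A B" "pure_tensor A' B' = pure_tensor A B"
    by (simp_all add: tensor_def pure_tensor_def p i fun_eq_iff)
qed

text \<open>Both sides of each Hopf identity are homomorphisms on the source, so they need to be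
  compared on generators only. The last assumption puts the generators of the target in the range,
  which gives surjectivity.\<close>

lemma quantum_subgroupI:
  assumes K: "matrix_hopf I R" and G: "matrix_hopf J S"
    and sat: "satisfies I R (matrix_star_alg J S) W"
    and comult: "\<And>i j. i \<in> I \<Longrightarrow> j \<in> I \<Longrightarrow> comult (matrix_quantum_group J S) (W i j) =
      (\<Oplus>\<^bsub>tensor (matrix_star_alg J S) (matrix_star_alg J S)\<^esub>k\<in>I.
        pure_tensor (matrix_star_alg J S) (matrix_star_alg J S) (W i k) (W k j))"
    and counit: "\<And>i j. i \<in> I \<Longrightarrow> j \<in> I \<Longrightarrow> counit (matrix_quantum_group J S) (W i j) = of_bool (i = j)"
    and antipode: "\<And>i j. i \<in> I \<Longrightarrow> j \<in> I \<Longrightarrow>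
      antipode (matrix_quantum_group J S) (W i j) = star (matrix_star_alg J S) (W j i)"
    and gen: "\<And>i j. i \<in> J \<Longrightarrow> j \<in> J \<Longrightarrow> \<exists>c. matrix_gen J S i j =
      (\<Oplus>\<^bsub>matrix_star_alg J S\<^esub>p\<in>I \<times> I. c p \<odot>\<^bsub>matrix_star_alg J S\<^esub> W (fst p) (snd p))"
  shows "quantum_subgroup (matrix_quantum_group J S) (matrix_quantum_group I R)"
proof -
  interpret K: matrix_hopf I R by fact
  interpret G: matrix_hopf J S by fact
  let ?A = "K.OG" and ?B = "G.OG"
  obtain h where h: "star_algebra_hom ?A ?B h" "\<And>i j. i \<in> I \<Longrightarrow> j \<in> I \<Longrightarrow> h (K.u i j) = W i j"
    using K.lift[OF sat] by blast
  interpret h: star_algebra_hom ?A ?B h by (rule h)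
  interpret BB: star_algebra_pair ?B ?B by (rule G.pair_O)
  interpret AA: star_algebra_pair ?A ?A by (rule K.pair_O)
  interpret TB: star_algebra "tensor ?B ?B" by (rule BB.star_algebra_T)
  let ?hh = "tensor_hom ?A ?A ?B ?B h h"
  note hh = tensor_hom[OF h(1) h(1)]
  interpret hh: star_algebra_hom "tensor ?A ?A" "tensor ?B ?B" ?hh by (rule hh)
  have W: "W i j \<in> carrier ?B" if "i \<in> I" "j \<in> I" for i j
    using sat that by (simp add: satisfies_def)
  have 1: "comult G.HO (h a) = ?hh (comult K.HO a)" if "a \<in> carrier ?A" for a
  proof (rule K.hom_eqI[OF star_algebra_hom_comp[OF h(1) G.comult(1)] star_algebra_hom_comp[OF K.comult(1) hh(1)] _ that])
    fix i j assume ij: "i \<in> I" "j \<in> I"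
    have "?hh (comult K.HO (K.u i j)) = (\<Oplus>\<^bsub>tensor ?B ?B\<^esub>k\<in>I. ?hh (pure_tensor ?A ?A (K.u i k) (K.u k j)))"
      using ij by (simp add: K.comult(2)) (rule hh.hom_fs, simp)
    also have "\<dots> = (\<Oplus>\<^bsub>tensor ?B ?B\<^esub>k\<in>I. pure_tensor ?B ?B (W i k) (W k j))"
      using ij by (intro TB.fs_cong) (simp_all add: hh(2) h(2) W)
    finally show "comult G.HO (h (K.u i j)) = ?hh (comult K.HO (K.u i j))"
      using ij by (simp add: h(2) comult)
  qed
  have 2: "counit G.HO (h a) = counit K.HO a" if "a \<in> carrier ?A" for a
    by (rule K.hom_eqI[OF star_algebra_hom_comp[OF h(1) G.counit(1)] K.counit(1) _ that])
      (simp add: h(2) counit K.counit(2))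
  \<comment> \<open>Antipodes reverse products, so the comparison takes place in the opposite
    algebra, where \<open>h\<close> is a homomorphism as well.\<close>
  have hop: "star_algebra_hom (opposite ?A) (opposite ?B) h"
  proof (intro star_algebra_hom.intro star_algebra_hom_axioms.intro star_algebra_opposite K.star_algebra_O G.star_algebra_O)
    show "h \<in> star_hom (opposite ?A) (opposite ?B)"
      by (rule star_homI) (simp_all add: opposite_def h.hom_closed)
  qed
  have 3: "antipode G.HO (h a) = h (antipode K.HO a)" if "a \<in> carrier ?A" for a
    by (rule K.hom_eqI[OF star_algebra_hom_comp[OF h(1) G.antipode(1)] star_algebra_hom_comp[OF K.antipode(1) hop] _ that])
      (simp add: h(2) antipode K.antipode(2))
  have th: "tensor_hom K.HO K.HO G.HO G.HO h h = ?hh"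
    unfolding tensor_hom_def K.HO_ops
      tensor_cong_ops[of K.HO ?A K.HO ?A, OF K.HO_ops(1-4,6,7) K.HO_ops(1-4,6,7)]
      tensor_cong_ops[of G.HO ?B G.HO ?B, OF G.HO_ops(1-4,6,7) G.HO_ops(1-4,6,7)] ..
  have "h \<in> star_hom K.HO G.HO"
    by (rule star_homI) (simp_all add: K.HO_ops G.HO_ops h.hom_closed)
  then have "h \<in> hopf_star_hom K.HO G.HO"
    by (simp add: hopf_star_hom_def K.HO_ops th 1 2 3)
  moreover have "h ` carrier K.HO = carrier G.HO"
    unfolding K.HO_ops G.HO_ops
  proof
    show "h ` carrier ?A \<subseteq> carrier ?B" by (simp add: image_subset_iff h.hom_closed)
    have "x \<in> h ` carrier ?A" if "x \<in> carrier ?B" for x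
      using that
    proof (induction x rule: G.O_induct)
      case (gen i j)
      then obtain c where c: "G.u i j = (\<Oplus>\<^bsub>?B\<^esub>p\<in>I \<times> I. c p \<odot>\<^bsub>?B\<^esub> W (fst p) (snd p))" using assms(7) by blast
      let ?y = "\<Oplus>\<^bsub>?A\<^esub>p\<in>I \<times> I. c p \<odot>\<^bsub>?A\<^esub> K.u (fst p) (snd p)"
      have y: "?y \<in> carrier ?A" by (rule h.A.fs_closed) (simp add: mem_Times_iff)
      have "h ?y = (\<Oplus>\<^bsub>?B\<^esub>p\<in>I \<times> I. h (c p \<odot>\<^bsub>?A\<^esub> K.u (fst p) (snd p)))"
        by (rule h.hom_fs) (simp add: mem_Times_iff)
      also have "\<dots> = (\<Oplus>\<^bsub>?B\<^esub>p\<in>I \<times> I. c p \<odot>\<^bsub>?B\<^esub> W (fst p) (snd p))"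
        by (rule h.B.fs_cong) (auto simp: h(2) W)
      finally have "G.u i j = h ?y" using c by (rule trans[OF _ sym, rotated])
      then show ?case using y by (rule image_eqI)
    next
      case one
      show ?case by (rule image_eqI[of _ _ "\<one>\<^bsub>?A\<^esub>"]) simp_all
    next
      case (add x y)
      then obtain a b where "a \<in> carrier ?A" "x = h a" "b \<in> carrier ?A" "y = h b" by blast
      then show ?case by (intro image_eqI[of _ _ "a \<oplus>\<^bsub>?A\<^esub> b"]) simp_all
    next
      case (mult x y)
      then obtain a b where "a \<in> carrier ?A" "x = h a" "b \<in> carrier ?A" "y = h b" by blast
      then show ?case by (intro image_eqI[of _ _ "a \<otimes>\<^bsub>?A\<^esub> b"]) simp_all
    next
      case (scale c x)
      then obtain a where "a \<in> carrier ?A" "x = h a" by blast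
      then show ?case by (intro image_eqI[of _ _ "c \<odot>\<^bsub>?A\<^esub> a"]) simp_all
    next
      case (star x)
      then obtain a where "a \<in> carrier ?A" "x = h a" by blast
      then show ?case by (intro image_eqI[of _ _ "star ?A a"]) simp_all
    qed
    then show "carrier ?B \<subseteq> h ` carrier ?A" by blast
  qed
  ultimately show ?thesis unfolding quantum_subgroup_def by blast
qed

section \<open>Projections and spectral projections\<close>

context star_algebra
begin

text \<open>A positive functional takes nonnegative values on the summands, and these add up to
  zero; so each is zero for every functional.\<close>

lemma sum_star_mult_eq_zero:
  assumes red: "reduced_star_alg A" and S: "finite S" "\<And>i. i \<in> S \<Longrightarrow> a i \<in> carrier A"
    and 0: "(\<Oplus>i\<in>S. star A (a i) \<otimes> a i) = \<zero>" and n: "n \<in> S"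
  shows "a n = \<zero>"
proof (rule reduced_star_algD[OF star_algebra_axioms red S(2)[OF n]])
  fix f assume f: "positive_functional A f"
  note F = positive_functional_simps[OF f]
  have pos: "f (star A (a i) \<otimes> a i) \<in> \<real>\<^sub>\<ge>\<^sub>0" if "i \<in> S" for i using F(4) S(2) that by blast
  have "(\<Sum>i\<in>S. f (star A (a i) \<otimes> a i)) = f (\<Oplus>i\<in>S. star A (a i) \<otimes> a i)"
    by (rule F(5)[symmetric]) (simp add: S)
  also have "\<dots> = 0" by (simp add: 0 F)
  finally have "(\<Sum>i\<in>S. Re (f (star A (a i) \<otimes> a i))) = 0" by (metis Re_sum zero_complex.simps(1))
  then have "Re (f (star A (a n) \<otimes> a n)) = 0"
    using S(1) n pos by (subst (asm) sum_nonneg_eq_0_iff) (auto simp: complex_nonneg_Reals_iff)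
  then show "f (star A (a n) \<otimes> a n) = 0" using pos[OF n] by (simp add: complex_nonneg_Reals_iff complex_eq_iff)
qed

text \<open>Compressing the sum by \<open>e l\<close> shows that the terms
  \<open>e l \<otimes> e i \<otimes> e l\<close> with i \<noteq> l add up to zero. Each is the
  square \<open>star A (e i \<otimes> e l) \<otimes> (e i \<otimes> e l)\<close>, hence vanishes in
  a reduced algebra.\<close>

lemma projections_orthogonal:
  assumes red: "reduced_star_alg A" and S: "finite S" "\<And>i. i \<in> S \<Longrightarrow> e i \<in> carrier A"
    and e: "\<And>i. i \<in> S \<Longrightarrow> star A (e i) = e i" "\<And>i. i \<in> S \<Longrightarrow> e i \<otimes> e i = e i"
    and sum: "(\<Oplus>i\<in>S. e i) = \<one>" and kl: "k \<in> S" "l \<in> S" "k \<noteq> l"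
  shows "e k \<otimes> e l = \<zero>"
proof -
  let ?S = "S - {l}" and ?g = "\<lambda>i. e l \<otimes> e i \<otimes> e l"
  have ins: "insert l ?S = S" using kl by auto
  have el: "e l \<in> carrier A" using S kl by simp
  have cl: "finsum A ?g ?S \<in> carrier A" using S el by (intro fs_closed) auto
  have "e l = e l \<otimes> finsum A e S \<otimes> e l" by (simp add: sum el e kl)
  also have "e l \<otimes> finsum A e S = finsum A (\<lambda>i. e l \<otimes> e i) S" by (rule fs_mult_left) (use S el in simp_all)
  also have "\<dots> \<otimes> e l = finsum A ?g S" by (rule fs_mult_right) (use S el in simp_all)
  also have "\<dots> = ?g l \<oplus> finsum A ?g ?S"
    using fs_insert[of ?S l ?g] S el ins by auto
  also have "?g l = e l" by (simp add: e kl el)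
  finally have "e l \<oplus> finsum A ?g ?S = e l" by (rule sym)
  then have "finsum A ?g ?S = \<zero>" by (rule iffD1[OF add.l_cancel_one[OF el cl]])
  also have "finsum A ?g ?S = finsum A (\<lambda>i. star A (e i \<otimes> e l) \<otimes> (e i \<otimes> e l)) ?S"
  proof (rule fs_cong)
    fix i assume i: "i \<in> ?S"
    then have ei: "e i \<in> carrier A" using S by simp
    have "star A (e i \<otimes> e l) \<otimes> (e i \<otimes> e l) = e l \<otimes> (e i \<otimes> e i) \<otimes> e l"
      using i kl ei el by (simp add: star_mult e m_assoc del: e(2))
    then show "?g i = star A (e i \<otimes> e l) \<otimes> (e i \<otimes> e l)" using i e(2)[of i] by simp
    show "star A (e i \<otimes> e l) \<otimes> (e i \<otimes> e l) \<in> carrier A" using ei el by simp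
  qed simp
  finally show ?thesis
    using sum_star_mult_eq_zero[OF red, of ?S "\<lambda>i. e i \<otimes> e l" k] S kl el by simp
qed

text \<open>All mixed products vanish. The exponent is positive because the zeroth power of the sum
  is the unit, not a sum of units.\<close>

lemma orthogonal_sum_pow:
  assumes S: "finite S" "\<And>i. i \<in> S \<Longrightarrow> x i \<in> carrier A"
    and orth: "\<And>i j. i \<in> S \<Longrightarrow> j \<in> S \<Longrightarrow> i \<noteq> j \<Longrightarrow> x i \<otimes> x j = \<zero>"
  shows "(\<Oplus>i\<in>S. c i \<odot> x i) [^] Suc m = (\<Oplus>i\<in>S. (c i ^ Suc m) \<odot> (x i [^] Suc m))"
proof (induction m)
  case 0
  have "(\<Oplus>i\<in>S. (c i ^ Suc 0) \<odot> (x i [^] Suc 0)) = (\<Oplus>i\<in>S. c i \<odot> x i)"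
    by (rule fs_cong) (use S in simp_all)
  then show ?case using S by (simp add: nat_pow_Suc)
next
  case (Suc m)
  let ?y = "\<Oplus>i\<in>S. c i \<odot> x i" and ?z = "\<lambda>i. (c i ^ Suc m) \<odot> (x i [^] Suc m)"
  have z: "?z i \<in> carrier A" if "i \<in> S" for i using S that by simp
  have y: "?y \<in> carrier A" using S by simp
  have "?y [^] Suc (Suc m) = finsum A ?z S \<otimes> ?y" using Suc by simp
  also have "\<dots> = (\<Oplus>i\<in>S. ?z i \<otimes> ?y)" by (rule fs_mult_right) (use z y in simp_all)
  also have "\<dots> = (\<Oplus>i\<in>S. (c i ^ Suc (Suc m)) \<odot> (x i [^] Suc (Suc m)))"
  proof (rule fs_cong)
    fix i assume i: "i \<in> S"
    have "?z i \<otimes> ?y = (\<Oplus>j\<in>S. ?z i \<otimes> (c j \<odot> x j))" by (rule fs_mult_left) (use S z i in simp_all)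
    also have "\<dots> = ?z i \<otimes> (c i \<odot> x i)"
    proof (rule fs_delta)
      fix j assume j: "j \<in> S" "j \<noteq> i"
      then have "x i [^] Suc m \<otimes> x j = \<zero>" using orth[of i j] S i by (simp add: m_assoc)
      moreover have "x i [^] Suc m \<in> carrier A" using S i by simp
      ultimately show "?z i \<otimes> (c j \<odot> x j) = \<zero>" using j S i by (simp del: nat_pow_Suc)
    qed (use S i z in simp_all)
    also have "\<dots> = (c i ^ Suc (Suc m)) \<odot> (x i [^] Suc (Suc m))"
      using S i by (simp add: mult.commute)
    finally show "?z i \<otimes> ?y = (c i ^ Suc (Suc m)) \<odot> (x i [^] Suc (Suc m))" .
    show "(c i ^ Suc (Suc m)) \<odot> (x i [^] Suc (Suc m)) \<in> carrier A" using S i by simp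
  qed simp
  finally show ?case .
qed

end

section \<open>Roots of unity and spectral projections\<close>

text \<open>Fourier inversion on \<open>\<int>/s\<close>. The powers run from \<open>1\<close> to \<open>s\<close>, not from \<open>0\<close>, because \<open>x\<close> generates
  a group with unit \<open>x\<^sup>s = x x\<^sup>*\<close>, which differs from \<open>1\<close>.\<close>
definition spectral_projection :: "('a, 'x) star_alg_scheme \<Rightarrow> nat \<Rightarrow> complex \<Rightarrow> 'a \<Rightarrow> 'a" where
  "spectral_projection A s z x = (\<Oplus>\<^bsub>A\<^esub>m\<in>{1..s}. (inverse z ^ m / of_nat s) \<odot>\<^bsub>A\<^esub> (x [^]\<^bsub>A\<^esub> m))"

definition unity_roots :: "nat \<Rightarrow> complex set" where
  "unity_roots s = {z. z ^ s = 1}"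

lemma unity_root_nonzero: "s \<ge> 1 \<Longrightarrow> z \<in> unity_roots s \<Longrightarrow> z \<noteq> 0"
  by (auto simp: unity_roots_def power_0_left)

lemma unity_roots_mult: "z \<in> unity_roots s \<Longrightarrow> w \<in> unity_roots s \<Longrightarrow> z * w \<in> unity_roots s"
  and unity_roots_divide: "z \<in> unity_roots s \<Longrightarrow> w \<in> unity_roots s \<Longrightarrow> z / w \<in> unity_roots s"
  and unity_roots_one: "1 \<in> unity_roots s"
  by (simp_all add: unity_roots_def power_mult_distrib power_divide)

lemma unity_roots_cnj: "s \<ge> 1 \<Longrightarrow> z \<in> unity_roots s \<Longrightarrow> cnj z = inverse z"
proof -
  assume s: "s \<ge> 1" and z: "z \<in> unity_roots s"
  then have "cmod z = 1" using power_eq_1_iff[of z s] by (auto simp: unity_roots_def)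
  then have "z * cnj z = 1" using complex_norm_square[of z] by simp
  then show ?thesis by (rule inverse_unique[symmetric])
qed

lemma finite_unity_roots: "s \<ge> 1 \<Longrightarrow> finite (unity_roots s)"
  unfolding unity_roots_def by (rule finite_roots_unity)

lemma sum_unity_root_powers:
  assumes "s \<ge> 1" "z \<in> unity_roots s"
  shows "(\<Sum>m\<in>{1..s}. z ^ m) = (if z = 1 then of_nat s else 0)"
proof (cases "z = 1")
  case False
  have "(\<Sum>m\<in>{1..s}. z ^ m) = (\<Sum>m<s. z ^ Suc m)"
    by (rule sum.reindex_bij_witness[of _ Suc "\<lambda>m. m - 1"]) auto
  also have "\<dots> = z * (\<Sum>m<s. z ^ m)" by (simp add: sum_distrib_left)
  also have "(\<Sum>m<s. z ^ m) = 0"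
    using assms False by (subst geometric_sum) (auto simp: unity_roots_def)
  finally show ?thesis using False by simp
qed simp

text \<open>For m < s, replacing z by w z with the primitive root w permutes the roots and
  multiplies the sum by the inverse of \<open>w ^ m\<close>, which is not 1.\<close>

lemma sum_unity_roots_power:
  assumes s: "s \<ge> 1" and m: "m \<in> {1..s}"
  shows "(\<Sum>z\<in>unity_roots s. inverse z ^ m) = (if m = s then of_nat s else 0)"
proof (cases "m = s")
  case True
  have "card (unity_roots s) = s" unfolding unity_roots_def using s by (intro card_roots_unity_eq) simp
  then show ?thesis using True by (simp add: unity_roots_def power_inverse)
next
  case False
  define w where "w = exp (2 * of_real pi * \<i> * of_nat 1 / of_nat s)"
  have w: "w \<in> unity_roots s"
    using s complex_root_unity[of s 1] by (simp add: unity_roots_def w_def)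
  have wm: "w ^ m \<noteq> 1"
  proof -
    have "w ^ m = exp (2 * of_real pi * \<i> * of_nat m / of_nat s)"
      by (simp add: w_def flip: exp_of_nat_mult) (simp add: algebra_simps)
    moreover have "\<not> s dvd m" using m False by (auto dest: dvd_imp_le)
    ultimately show ?thesis using complex_root_unity_eq_1[OF s, of m] by simp
  qed
  have wn: "w \<noteq> 0" using unity_root_nonzero[OF s w] .
  have "bij_betw (\<lambda>z. w * z) (unity_roots s) (unity_roots s)"
    by (rule bij_betw_byWitness[of _ "\<lambda>z. z / w"]) (use w wn in \<open>auto intro: unity_roots_mult unity_roots_divide\<close>)
  then have "(\<Sum>z\<in>unity_roots s. inverse z ^ m) = (\<Sum>z\<in>unity_roots s. inverse (w * z) ^ m)"
    by (rule sum.reindex_bij_betw[symmetric])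
  also have "\<dots> = inverse w ^ m * (\<Sum>z\<in>unity_roots s. inverse z ^ m)"
    by (simp add: sum_distrib_left power_mult_distrib)
  finally have "(1 - inverse w ^ m) * (\<Sum>z\<in>unity_roots s. inverse z ^ m) = 0" by (simp add: algebra_simps)
  moreover have "inverse w ^ m \<noteq> 1" using wm by (simp add: power_inverse inverse_eq_1_iff)
  ultimately show ?thesis using False by simp
qed

context star_algebra
begin

lemma spectral_projection_closed [simp, intro]: "x \<in> carrier A \<Longrightarrow> spectral_projection A s z x \<in> carrier A"
  unfolding spectral_projection_def by (intro fs_closed) simp

text \<open>The \<open>m\<close>-th power of \<open>x\<close> is the sum of the
  \<open>(\<mu> w ^ m) \<odot> G w\<close>, and the Fourier sum selects one eigenvalue. This
  identifies the images of spectral projections under homomorphisms. The eigenvalues are an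
  injective function of the index because in the graph the index y of a vertex has eigenvalue y /
  z.\<close>

lemma spectral_projection_unique:
  assumes s: "s \<ge> 1" and S: "finite S" "\<And>w. w \<in> S \<Longrightarrow> G w \<in> carrier A"
    and orth: "\<And>v w. v \<in> S \<Longrightarrow> w \<in> S \<Longrightarrow> v \<noteq> w \<Longrightarrow> G v \<otimes> G w = \<zero>"
    and idem: "\<And>w. w \<in> S \<Longrightarrow> G w \<otimes> G w = G w"
    and \<mu>: "inj_on \<mu> S" "\<And>w. w \<in> S \<Longrightarrow> \<mu> w \<in> unity_roots s"
    and x: "x = (\<Oplus>w\<in>S. \<mu> w \<odot> G w)" and w: "w \<in> S"
  shows "spectral_projection A s (\<mu> w) x = G w"
proof -
  have Gpow: "G v [^] Suc m = G v" if "v \<in> S" for v m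
    using that S by (induction m) (simp_all add: idem)
  have pow: "x [^] m = (\<Oplus>v\<in>S. (\<mu> v ^ m) \<odot> G v)" if "m \<in> {1..s}" for m
  proof -
    obtain k where k: "m = Suc k" using \<open>m \<in> {1..s}\<close> by (cases m) auto
    have "x [^] m = (\<Oplus>v\<in>S. (\<mu> v ^ m) \<odot> (G v [^] m))"
      unfolding x k using S orth by (rule orthogonal_sum_pow)
    also have "\<dots> = (\<Oplus>v\<in>S. (\<mu> v ^ m) \<odot> G v)"
      by (rule fs_cong) (use S Gpow k in \<open>simp_all del: nat_pow_Suc\<close>)
    finally show ?thesis .
  qed
  have c: "(\<Sum>m\<in>{1..s}. inverse (\<mu> w) ^ m / of_nat s * \<mu> v ^ m) = of_bool (v = w)" if v: "v \<in> S" for v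
  proof -
    have "(\<Sum>m\<in>{1..s}. inverse (\<mu> w) ^ m / of_nat s * \<mu> v ^ m) = (\<Sum>m\<in>{1..s}. (\<mu> v / \<mu> w) ^ m) / of_nat s"
      by (simp add: sum_divide_distrib power_divide power_inverse field_simps)
    also have "\<dots> = of_bool (\<mu> v / \<mu> w = 1)"
      using sum_unity_root_powers[OF s, of "\<mu> v / \<mu> w"] unity_roots_divide[OF \<mu>(2)[OF v] \<mu>(2)[OF w]] s by simp
    also have "\<dots> = of_bool (v = w)"
      using \<mu>(1) v w unity_root_nonzero[OF s \<mu>(2)[OF w]] by (auto dest: inj_onD)
    finally show ?thesis .
  qed
  have "spectral_projection A s (\<mu> w) x
    = (\<Oplus>m\<in>{1..s}. \<Oplus>v\<in>S. (inverse (\<mu> w) ^ m / of_nat s * \<mu> v ^ m) \<odot> G v)"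
    unfolding spectral_projection_def
  proof (rule fs_cong)
    fix m assume m: "m \<in> {1..s}"
    show "(inverse (\<mu> w) ^ m / of_nat s) \<odot> (x [^] m) = (\<Oplus>v\<in>S. (inverse (\<mu> w) ^ m / of_nat s * \<mu> v ^ m) \<odot> G v)"
      unfolding pow[OF m] by (subst fs_scale) (use S in \<open>auto intro!: fs_cong\<close>)
    show "(\<Oplus>v\<in>S. (inverse (\<mu> w) ^ m / of_nat s * \<mu> v ^ m) \<odot> G v) \<in> carrier A"
      using S by (intro fs_closed) simp
  qed simp
  also have "\<dots> = (\<Oplus>v\<in>S. \<Oplus>m\<in>{1..s}. (inverse (\<mu> w) ^ m / of_nat s * \<mu> v ^ m) \<odot> G v)"
    by (rule fs_swap) (use S in simp_all)
  also have "\<dots> = (\<Oplus>v\<in>S. of_bool (v = w) \<odot> G v)"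
    by (rule fs_cong) (use S c in \<open>simp_all add: fs_scale_left\<close>)
  also have "\<dots> = of_bool (w = w) \<odot> G w" by (rule fs_delta) (use S w in simp_all)
  finally show ?thesis using S w by simp
qed

end

locale reflection = star_algebra A for A :: "('a, 'x) star_alg_scheme" (structure) +
  fixes s :: nat and x
  assumes s: "s \<ge> 1" and x [simp, intro]: "x \<in> carrier A"
    and normal: "x \<otimes> star A x = star A x \<otimes> x"
    and partial_isometry: "x \<otimes> star A x \<otimes> x = x"
    and pow_s: "x [^] s = x \<otimes> star A x"
begin

abbreviation "e \<equiv> x \<otimes> star A x"
abbreviation "P z \<equiv> spectral_projection A s z x"

lemma e_x [simp]: "e \<otimes> x = x"
  by (fact partial_isometry)

lemma x_e [simp]: "x \<otimes> e = x"
proof -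
  have "x \<otimes> e = x \<otimes> (star A x \<otimes> x)" by (simp only: normal)
  also have "\<dots> = e \<otimes> x" by (rule m_assoc[symmetric]) simp_all
  finally show ?thesis by simp
qed

lemma e_star [simp]: "star A e = e"
  by (simp add: star_mult)

lemma e_star_x [simp]: "e \<otimes> star A x = star A x" and star_x_e [simp]: "star A x \<otimes> e = star A x"
proof -
  have "star A (x \<otimes> e) = star A e \<otimes> star A x" by (rule star_mult) simp_all
  then show "e \<otimes> star A x = star A x" by (simp only: x_e e_star)
  have "star A (e \<otimes> x) = star A x \<otimes> star A e" by (rule star_mult) simp_all
  then show "star A x \<otimes> e = star A x" by (simp only: e_x e_star)
qed

lemma e_idem: "e \<otimes> e = e"
  by (simp flip: m_assoc)

lemma pow_Suc_s: "x [^] Suc s = x"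
  by (simp add: pow_s)

text \<open>Every power in the Fourier sum is positive and so is absorbed by the support projection
  \<open>e\<close>; a constant term would not be.\<close>

lemma e_P: "e \<otimes> P z = P z"
proof -
  have "e \<otimes> x [^] m = x [^] m" if "m \<in> {1..s}" for m
  proof -
    obtain k where "m = Suc k" using \<open>m \<in> {1..s}\<close> by (cases m) auto
    moreover have "e \<otimes> (x \<otimes> x [^] k) = e \<otimes> x \<otimes> x [^] k" by (rule m_assoc[symmetric]) simp_all
    ultimately show ?thesis using nat_pow_Suc2[OF x, of k] by (simp only: e_x)
  qed
  then show ?thesis
    unfolding spectral_projection_def by (subst fs_mult_left) (auto intro!: fs_cong)
qed

lemma x_P:
  assumes z: "z \<in> unity_roots s"
  shows "x \<otimes> P z = z \<odot> P z"
proof -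
  have zn: "z \<noteq> 0" by (rule unity_root_nonzero[OF s z])
  define f where "f m = (z * inverse z ^ m / of_nat s) \<odot> (x [^] m)" for m
  have f: "f m \<in> carrier A" for m by (simp add: f_def)
  have "x \<otimes> P z = (\<Oplus>m\<in>{1..s}. f (Suc m))"
    unfolding spectral_projection_def
  proof (subst fs_mult_left)
    show "(\<Oplus>m\<in>{1..s}. x \<otimes> ((inverse z ^ m / of_nat s) \<odot> (x [^] m))) = (\<Oplus>m\<in>{1..s}. f (Suc m))"
    proof (rule fs_cong)
      fix m
      have "x \<otimes> (x [^] m) = x [^] Suc m" by (rule nat_pow_Suc2[OF x, symmetric])
      moreover have "z * inverse z ^ Suc m = inverse z ^ m" using zn by (simp flip: mult.assoc)
      ultimately show "x \<otimes> ((inverse z ^ m / of_nat s) \<odot> (x [^] m)) = f (Suc m)"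
        unfolding f_def by (simp del: nat_pow_Suc power_Suc)
    qed (simp_all add: f)
  qed simp_all
  also have "\<dots> = finsum A f {2..Suc s}"
    by (rule fs_reindex[symmetric]) (auto simp: f intro!: bij_betw_byWitness[of _ "\<lambda>m. m - 1"])
  also have "{2..Suc s} = insert (Suc s) {2..s}" using s by auto
  also have "finsum A f \<dots> = f (Suc s) \<oplus> finsum A f {2..s}" by (rule fs_insert) (simp_all add: f)
  \<comment> \<open>Multiplication by \<open>x\<close> has shifted the exponents to 2, ..., s + 1.
    The last one wraps around because \<open>x [^] Suc s = x\<close> and
    \<open>z ^ s = 1\<close>.\<close>
  also have "f (Suc s) = f 1"
  proof -
    have "z ^ s = 1" using z by (simp add: unity_roots_def)
    then show ?thesis unfolding f_def pow_Suc_s using zn by (simp add: power_inverse)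
  qed
  also have "f 1 \<oplus> finsum A f {2..s} = finsum A f (insert 1 {2..s})" by (rule fs_insert[symmetric]) (simp_all add: f)
  also have "insert 1 {2..s} = {1..s}" using s by auto
  also have "finsum A f {1..s} = z \<odot> P z"
    unfolding spectral_projection_def by (subst fs_scale) (auto simp: f_def intro!: fs_cong)
  finally show ?thesis .
qed

lemma pow_P:
  assumes z: "z \<in> unity_roots s"
  shows "x [^] (m::nat) \<otimes> P z = (z ^ m) \<odot> P z"
proof (induction m)
  case (Suc m)
  then show ?case using x_P[OF z] by (simp add: m_assoc)
qed simp

text \<open>The eigenvalue of the adjoint comes from P = e P = x^* x P = z x^* P.\<close>

lemma star_pow_P:
  assumes z: "z \<in> unity_roots s"
  shows "star A x [^] (m::nat) \<otimes> P z = (inverse z ^ m) \<odot> P z"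
proof -
  have zn: "z \<noteq> 0" by (rule unity_root_nonzero[OF s z])
  have "P z = star A x \<otimes> (x \<otimes> P z)" using e_P[of z] by (simp add: normal m_assoc)
  also have "\<dots> = z \<odot> (star A x \<otimes> P z)" by (simp add: x_P[OF z])
  finally have "inverse z \<odot> P z = inverse z \<odot> (z \<odot> (star A x \<otimes> P z))" by simp
  then have 1: "star A x \<otimes> P z = inverse z \<odot> P z" using zn by simp
  show ?thesis by (induction m) (simp_all add: 1 m_assoc)
qed

lemma sum_scaled_P:
  assumes w: "w \<in> unity_roots s"
  shows "(\<Oplus>m\<in>{1..s}. (c m) \<odot> P w) = (\<Sum>m\<in>{1..s}. c m) \<odot> P w"
  by (rule fs_scale_left) simp

text \<open>Since \<open>x\<close> acts on \<open>P w\<close> as \<open>w\<close>, the element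
  \<open>P z\<close> acts on it as a scalar, which is a normalised character sum.\<close>

lemma P_mult:
  assumes z: "z \<in> unity_roots s" and w: "w \<in> unity_roots s"
  shows "P z \<otimes> P w = (if z = w then P z else \<zero>)"
proof -
  have "P z \<otimes> P w = (\<Oplus>m\<in>{1..s}. ((inverse z ^ m / of_nat s) \<odot> (x [^] m)) \<otimes> P w)"
    unfolding spectral_projection_def[of A s z] by (rule fs_mult_right) simp_all
  also have "\<dots> = (\<Oplus>m\<in>{1..s}. (inverse z ^ m / of_nat s * w ^ m) \<odot> P w)"
    by (rule fs_cong) (simp_all add: pow_P[OF w])
  also have "\<dots> = (\<Sum>m\<in>{1..s}. inverse z ^ m / of_nat s * w ^ m) \<odot> P w" by (rule sum_scaled_P[OF w])
  also have "(\<Sum>m\<in>{1..s}. inverse z ^ m / of_nat s * w ^ m) = (\<Sum>m\<in>{1..s}. (w / z) ^ m) / of_nat s"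
    by (simp add: sum_divide_distrib power_divide power_inverse field_simps)
  also have "\<dots> = of_bool (w / z = 1)"
    using sum_unity_root_powers[OF s unity_roots_divide[OF w z]] s by simp
  finally show ?thesis using unity_root_nonzero[OF s z] by auto
qed

text \<open>Each of the \<open>s\<close> summands of \<open>star A (P z)\<close> acts on
  \<open>P z\<close> as the scalar 1 / s, so \<open>P z\<close> equals
  \<open>star A (P z) \<otimes> P z\<close>, which is self-adjoint.\<close>

lemma P_star:
  assumes z: "z \<in> unity_roots s"
  shows "star A (P z) = P z"
proof -
  have zn: "z \<noteq> 0" by (rule unity_root_nonzero[OF s z])
  have "star A (P z) \<otimes> P z = (\<Oplus>m\<in>{1..s}. star A ((inverse z ^ m / of_nat s) \<odot> (x [^] m))) \<otimes> P z"
    unfolding spectral_projection_def[of A s z] by (subst fs_star) simp_all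
  also have "\<dots> = (\<Oplus>m\<in>{1..s}. star A ((inverse z ^ m / of_nat s) \<odot> (x [^] m)) \<otimes> P z)"
    by (rule fs_mult_right) simp_all
  also have "\<dots> = (\<Oplus>m\<in>{1..s}. (1 / of_nat s) \<odot> P z)"
  proof (rule fs_cong)
    fix m
    show "star A ((inverse z ^ m / of_nat s) \<odot> (x [^] m)) \<otimes> P z = (1 / of_nat s) \<odot> P z"
      using zn by (simp add: star_scale star_pow star_pow_P[OF z] power_inverse unity_roots_cnj[OF s z])
  qed simp_all
  also have "\<dots> = P z" using s by (subst sum_scaled_P[OF z]) simp
  finally have *: "star A (P z) \<otimes> P z = P z" .
  then have "star A (star A (P z) \<otimes> P z) = star A (P z)" by simp
  then have "star A (P z) \<otimes> P z = star A (P z)" by (simp add: star_mult)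
  with * show ?thesis by simp
qed

lemma sum_P: "(\<Oplus>z\<in>unity_roots s. c z \<odot> P z)
  = (\<Oplus>m\<in>{1..s}. ((\<Sum>z\<in>unity_roots s. c z * inverse z ^ m) / of_nat s) \<odot> (x [^] m))"
proof -
  have "(\<Oplus>z\<in>unity_roots s. c z \<odot> P z)
    = (\<Oplus>z\<in>unity_roots s. \<Oplus>m\<in>{1..s}. (c z * inverse z ^ m / of_nat s) \<odot> (x [^] m))"
  proof (rule fs_cong)
    fix z
    show "c z \<odot> P z = (\<Oplus>m\<in>{1..s}. (c z * inverse z ^ m / of_nat s) \<odot> (x [^] m))"
      unfolding spectral_projection_def by (subst fs_scale) (auto intro!: fs_cong)
  qed simp_all
  also have "\<dots> = (\<Oplus>m\<in>{1..s}. \<Oplus>z\<in>unity_roots s. (c z * inverse z ^ m / of_nat s) \<odot> (x [^] m))"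
    by (rule fs_swap) (simp_all add: finite_unity_roots[OF s])
  also have "\<dots> = (\<Oplus>m\<in>{1..s}. ((\<Sum>z\<in>unity_roots s. c z * inverse z ^ m) / of_nat s) \<odot> (x [^] m))"
    by (rule fs_cong) (simp_all add: fs_scale_left sum_divide_distrib)
  finally show ?thesis .
qed

lemma sum_P_eq_e: "(\<Oplus>z\<in>unity_roots s. P z) = e"
proof -
  have "(\<Oplus>z\<in>unity_roots s. P z) = (\<Oplus>z\<in>unity_roots s. 1 \<odot> P z)" by (rule fs_cong) simp_all
  also have "\<dots> = (\<Oplus>m\<in>{1..s}. ((\<Sum>z\<in>unity_roots s. inverse z ^ m) / of_nat s) \<odot> (x [^] m))"
    using sum_P[of "\<lambda>_. 1"] by simp
  also have "\<dots> = (\<Oplus>m\<in>{1..s}. of_bool (m = s) \<odot> (x [^] m))"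
    by (rule fs_cong) (use s in \<open>simp_all add: sum_unity_roots_power\<close>)
  also have "\<dots> = of_bool (s = s) \<odot> (x [^] s)" by (rule fs_delta) (use s in simp_all)
  finally show ?thesis by (simp add: pow_s)
qed

lemma sum_eigenvalue_P: "(\<Oplus>z\<in>unity_roots s. z \<odot> P z) = x"
proof -
  have "(\<Oplus>z\<in>unity_roots s. z \<odot> P z) = (\<Oplus>z\<in>unity_roots s. x \<otimes> P z)"
    by (rule fs_cong) (simp_all add: x_P)
  also have "\<dots> = x \<otimes> (\<Oplus>z\<in>unity_roots s. P z)" by (rule fs_mult_left[symmetric]) simp_all
  finally show ?thesis by (simp add: sum_P_eq_e)
qed

end

section \<open>The relations of the quantum automorphism group of a graph\<close>

text \<open>Orthogonality in the left factor is enough to remove the mixed terms. With it the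
  nonlinear relations are checked for matrices of the form \<Delta>(u).\<close>

lemma (in star_algebra_pair) diagonal_mult:
  assumes "finite S" "\<And>k. k \<in> S \<Longrightarrow> a k \<in> carrier A" "\<And>k. k \<in> S \<Longrightarrow> b k \<in> carrier B"
    "\<And>k. k \<in> S \<Longrightarrow> c k \<in> carrier A" "\<And>k. k \<in> S \<Longrightarrow> d k \<in> carrier B"
    and orth: "\<And>k l. k \<in> S \<Longrightarrow> l \<in> S \<Longrightarrow> k \<noteq> l \<Longrightarrow> a k \<otimes>\<^bsub>A\<^esub> c l = \<zero>\<^bsub>A\<^esub>"
  shows "(\<Oplus>\<^bsub>T\<^esub>k\<in>S. t (a k) (b k)) \<otimes>\<^bsub>T\<^esub> (\<Oplus>\<^bsub>T\<^esub>k\<in>S. t (c k) (d k))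
    = (\<Oplus>\<^bsub>T\<^esub>k\<in>S. t (a k \<otimes>\<^bsub>A\<^esub> c k) (b k \<otimes>\<^bsub>B\<^esub> d k))"
proof -
  interpret T: star_algebra T by (rule star_algebra_T)
  have "(\<Oplus>\<^bsub>T\<^esub>k\<in>S. t (a k) (b k)) \<otimes>\<^bsub>T\<^esub> (\<Oplus>\<^bsub>T\<^esub>k\<in>S. t (c k) (d k))
    = (\<Oplus>\<^bsub>T\<^esub>k\<in>S. t (a k) (b k) \<otimes>\<^bsub>T\<^esub> (\<Oplus>\<^bsub>T\<^esub>k\<in>S. t (c k) (d k)))"
    by (rule T.fs_mult_right) (use assms in simp_all)
  also have "\<dots> = (\<Oplus>\<^bsub>T\<^esub>k\<in>S. t (a k \<otimes>\<^bsub>A\<^esub> c k) (b k \<otimes>\<^bsub>B\<^esub> d k))"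
  proof (rule T.fs_cong)
    fix k assume k: "k \<in> S"
    have "t (a k) (b k) \<otimes>\<^bsub>T\<^esub> (\<Oplus>\<^bsub>T\<^esub>k\<in>S. t (c k) (d k)) = (\<Oplus>\<^bsub>T\<^esub>l\<in>S. t (a k) (b k) \<otimes>\<^bsub>T\<^esub> t (c l) (d l))"
      by (rule T.fs_mult_left) (use assms k in simp_all)
    also have "\<dots> = t (a k) (b k) \<otimes>\<^bsub>T\<^esub> t (c k) (d k)"
    proof (rule T.fs_delta)
      fix l assume l: "l \<in> S" "l \<noteq> k"
      have "t (a k) (b k) \<otimes>\<^bsub>T\<^esub> t (c l) (d l) = t (a k \<otimes>\<^bsub>A\<^esub> c l) (b k \<otimes>\<^bsub>B\<^esub> d l)"
        by (rule t_mult) (use assms k l in simp_all)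
      also have "\<dots> = \<zero>\<^bsub>T\<^esub>" using orth[OF k l(1)] l assms k by simp
      finally show "t (a k) (b k) \<otimes>\<^bsub>T\<^esub> t (c l) (d l) = \<zero>\<^bsub>T\<^esub>" .
    qed (use assms k in simp_all)
    also have "\<dots> = t (a k \<otimes>\<^bsub>A\<^esub> c k) (b k \<otimes>\<^bsub>B\<^esub> d k)"
      by (rule t_mult) (use assms k in simp_all)
    finally show "t (a k) (b k) \<otimes>\<^bsub>T\<^esub> (\<Oplus>\<^bsub>T\<^esub>k\<in>S. t (c k) (d k)) = t (a k \<otimes>\<^bsub>A\<^esub> c k) (b k \<otimes>\<^bsub>B\<^esub> d k)" .
    show "t (a k \<otimes>\<^bsub>A\<^esub> c k) (b k \<otimes>\<^bsub>B\<^esub> d k) \<in> carrier T" using assms k by simp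
  qed simp
  finally show ?thesis .
qed

lemma (in star_algebra_pair) diagonal_star:
  assumes "\<And>k. k \<in> S \<Longrightarrow> a k \<in> carrier A" "\<And>k. k \<in> S \<Longrightarrow> b k \<in> carrier B"
  shows "star T (\<Oplus>\<^bsub>T\<^esub>k\<in>S. t (a k) (b k)) = (\<Oplus>\<^bsub>T\<^esub>k\<in>S. t (star A (a k)) (star B (b k)))"
proof -
  interpret T: star_algebra T by (rule star_algebra_T)
  have "star T (\<Oplus>\<^bsub>T\<^esub>k\<in>S. t (a k) (b k)) = (\<Oplus>\<^bsub>T\<^esub>k\<in>S. star T (t (a k) (b k)))"
    by (rule T.fs_star) (use assms in simp_all)
  also have "\<dots> = (\<Oplus>\<^bsub>T\<^esub>k\<in>S. t (star A (a k)) (star B (b k)))"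
    by (rule T.fs_cong) (use assms in \<open>simp_all add: t_star\<close>)
  finally show ?thesis .
qed

text \<open>The relations of \<open>quantum_aut_graph\<close> for algebras of any type, since they
  are also checked in tensor products, opposites and the complex numbers.\<close>

definition graph_relations ::
  "'v pair_pre_digraph \<Rightarrow> ('a, 'x) star_alg_scheme \<Rightarrow> ('v \<Rightarrow> 'v \<Rightarrow> 'a) \<Rightarrow> bool" where
  "graph_relations G A U \<longleftrightarrow> magic_unitary A (pverts G) U \<and>
     (\<forall>v\<in>pverts G. \<forall>w\<in>pverts G.
        (\<Oplus>\<^bsub>A\<^esub>x\<in>pverts G. adjacency_matrix G v x \<odot>\<^bsub>A\<^esub> U x w) =
        (\<Oplus>\<^bsub>A\<^esub>x\<in>pverts G. adjacency_matrix G x w \<odot>\<^bsub>A\<^esub> U v x))"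

lemma graph_relationsD:
  assumes "graph_relations G A U" "v \<in> pverts G" "w \<in> pverts G"
  shows "U v w \<in> carrier A" "star A (U v w) = U v w" "U v w \<otimes>\<^bsub>A\<^esub> U v w = U v w"
    "(\<Oplus>\<^bsub>A\<^esub>w\<in>pverts G. U v w) = \<one>\<^bsub>A\<^esub>" "(\<Oplus>\<^bsub>A\<^esub>w\<in>pverts G. U w v) = \<one>\<^bsub>A\<^esub>"
    "(\<Oplus>\<^bsub>A\<^esub>x\<in>pverts G. adjacency_matrix G v x \<odot>\<^bsub>A\<^esub> U x w) =
        (\<Oplus>\<^bsub>A\<^esub>x\<in>pverts G. adjacency_matrix G x w \<odot>\<^bsub>A\<^esub> U v x)"
  using assms by (simp_all add: graph_relations_def magic_unitary_def)

lemma graph_relationsI: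
  assumes "\<And>v w. v \<in> pverts G \<Longrightarrow> w \<in> pverts G \<Longrightarrow> U v w \<in> carrier A"
    "\<And>v w. v \<in> pverts G \<Longrightarrow> w \<in> pverts G \<Longrightarrow> star A (U v w) = U v w"
    "\<And>v w. v \<in> pverts G \<Longrightarrow> w \<in> pverts G \<Longrightarrow> U v w \<otimes>\<^bsub>A\<^esub> U v w = U v w"
    "\<And>v. v \<in> pverts G \<Longrightarrow> (\<Oplus>\<^bsub>A\<^esub>w\<in>pverts G. U v w) = \<one>\<^bsub>A\<^esub>"
    "\<And>v. v \<in> pverts G \<Longrightarrow> (\<Oplus>\<^bsub>A\<^esub>w\<in>pverts G. U w v) = \<one>\<^bsub>A\<^esub>"
    "\<And>v w. v \<in> pverts G \<Longrightarrow> w \<in> pverts G \<Longrightarrow> (\<Oplus>\<^bsub>A\<^esub>x\<in>pverts G. adjacency_matrix G v x \<odot>\<^bsub>A\<^esub> U x w) =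
        (\<Oplus>\<^bsub>A\<^esub>x\<in>pverts G. adjacency_matrix G x w \<odot>\<^bsub>A\<^esub> U v x)"
  shows "graph_relations G A U"
  using assms by (simp add: graph_relations_def magic_unitary_def)

lemma graph_relations_orthogonal:
  assumes A: "star_algebra A" "reduced_star_alg A" and fin: "finite (pverts G)"
    and U: "graph_relations G A U" and v: "v \<in> pverts G" "w \<in> pverts G" "w' \<in> pverts G" "w \<noteq> w'"
  shows "U v w \<otimes>\<^bsub>A\<^esub> U v w' = \<zero>\<^bsub>A\<^esub>" "U w v \<otimes>\<^bsub>A\<^esub> U w' v = \<zero>\<^bsub>A\<^esub>"
proof -
  note D = graph_relationsD[OF U]
  show "U v w \<otimes>\<^bsub>A\<^esub> U v w' = \<zero>\<^bsub>A\<^esub>"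
    by (rule star_algebra.projections_orthogonal[OF A fin, where e="U v"]) (use v D in simp_all)
  show "U w v \<otimes>\<^bsub>A\<^esub> U w' v = \<zero>\<^bsub>A\<^esub>"
    by (rule star_algebra.projections_orthogonal[OF A fin, where e="\<lambda>w. U w v"]) (use v D in simp_all)
qed

lemma graph_relations_cong:
  assumes A: "star_algebra A" and U: "graph_relations G A U"
    and eq: "\<And>v w. v \<in> pverts G \<Longrightarrow> w \<in> pverts G \<Longrightarrow> U' v w = U v w"
  shows "graph_relations G A U'"
proof -
  interpret star_algebra A by fact
  note D = graph_relationsD[OF U]
  have s: "finsum A (\<lambda>w. U' v w) (pverts G) = finsum A (\<lambda>w. U v w) (pverts G)"
    "finsum A (\<lambda>w. U' w v) (pverts G) = finsum A (\<lambda>w. U w v) (pverts G)"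
    "(\<Oplus>\<^bsub>A\<^esub>x\<in>pverts G. adjacency_matrix G w x \<odot>\<^bsub>A\<^esub> U' x v) = (\<Oplus>\<^bsub>A\<^esub>x\<in>pverts G. adjacency_matrix G w x \<odot>\<^bsub>A\<^esub> U x v)"
    "(\<Oplus>\<^bsub>A\<^esub>x\<in>pverts G. adjacency_matrix G x w \<odot>\<^bsub>A\<^esub> U' v x) = (\<Oplus>\<^bsub>A\<^esub>x\<in>pverts G. adjacency_matrix G x w \<odot>\<^bsub>A\<^esub> U v x)"
    if "v \<in> pverts G" for v w
    by (rule fs_cong; use that eq D in simp)+
  show ?thesis
    by (rule graph_relationsI) (simp_all add: s eq D)
qed

text \<open>All relations are equations, and an equation in \<open>Q\<close> may be checked after
  every homomorphism of a jointly injective family.\<close>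

lemma graph_relations_transfer:
  fixes Q :: "('a, 'x) star_alg_scheme" and F :: "(('b, 'y) star_alg_scheme \<times> ('a \<Rightarrow> 'b)) set"
  assumes F: "jointly_injective Q F" and U: "\<And>v w. v \<in> pverts G \<Longrightarrow> w \<in> pverts G \<Longrightarrow> U v w \<in> carrier Q"
    and *: "\<And>B h. (B, h) \<in> F \<Longrightarrow> \<exists>W. graph_relations G B W \<and> (\<forall>v\<in>pverts G. \<forall>w\<in>pverts G. h (U v w) = W v w)"
  shows "graph_relations G Q U"
proof -
  interpret Q: star_algebra Q using F by (simp add: jointly_injective_def)
  have eq: "x = y" if xy: "x \<in> carrier Q" "y \<in> carrier Q"
    and e: "\<And>(B :: ('b, 'y) star_alg_scheme) h. star_algebra_hom Q B h \<Longrightarrow> graph_relations G B (\<lambda>v w. h (U v w)) \<Longrightarrow> h x = h y" for x y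
  proof (rule jointly_injective_eqI[OF F xy])
    fix B h assume B: "(B, h) \<in> F" "star_algebra_hom Q B h"
    interpret h: star_algebra_hom Q B h by fact
    obtain W where W: "graph_relations G B W" "\<forall>v\<in>pverts G. \<forall>w\<in>pverts G. h (U v w) = W v w"
      using *[OF B(1)] by blast
    have "graph_relations G B (\<lambda>v w. h (U v w))"
      by (rule graph_relations_cong[OF h.B.star_algebra_axioms W(1)]) (simp add: W)
    then show "h x = h y" using e[OF B(2)] by blast
  qed
  have hs: "h (\<Oplus>\<^bsub>Q\<^esub>x\<in>pverts G. c x \<odot>\<^bsub>Q\<^esub> f x) = (\<Oplus>\<^bsub>B\<^esub>x\<in>pverts G. c x \<odot>\<^bsub>B\<^esub> h (f x))"
    if "star_algebra_hom Q B h" "\<And>x. x \<in> pverts G \<Longrightarrow> f x \<in> carrier Q"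
    for B :: "('b, 'y) star_alg_scheme" and h c f
  proof -
    interpret h: star_algebra_hom Q B h by fact
    have "h (\<Oplus>\<^bsub>Q\<^esub>x\<in>pverts G. c x \<odot>\<^bsub>Q\<^esub> f x) = (\<Oplus>\<^bsub>B\<^esub>x\<in>pverts G. h (c x \<odot>\<^bsub>Q\<^esub> f x))"
      by (rule h.hom_fs) (use that in simp)
    also have "\<dots> = (\<Oplus>\<^bsub>B\<^esub>x\<in>pverts G. c x \<odot>\<^bsub>B\<^esub> h (f x))"
      by (rule h.B.fs_cong) (use that in simp_all)
    finally show ?thesis .
  qed
  show ?thesis
  proof (rule graph_relationsI)
    fix v w assume vw: "v \<in> pverts G" "w \<in> pverts G"
    show "U v w \<in> carrier Q" by (rule U[OF vw])
    show "star Q (U v w) = U v w" "U v w \<otimes>\<^bsub>Q\<^esub> U v w = U v w"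
    proof -
      have "h (star Q (U v w)) = h (U v w)" "h (U v w \<otimes>\<^bsub>Q\<^esub> U v w) = h (U v w)"
        if B: "star_algebra_hom Q B h" "graph_relations G B (\<lambda>v w. h (U v w))"
        for B :: "('b, 'y) star_alg_scheme" and h
        using graph_relationsD(2,3)[OF B(2) vw] U[OF vw]
        by (simp_all add: star_algebra_hom.hom_star[OF B(1)] star_algebra_hom.hom_mult[OF B(1)])
      then show "star Q (U v w) = U v w" "U v w \<otimes>\<^bsub>Q\<^esub> U v w = U v w"
        using U[OF vw] by (auto intro!: eq)
    qed
    show "(\<Oplus>\<^bsub>Q\<^esub>x\<in>pverts G. adjacency_matrix G v x \<odot>\<^bsub>Q\<^esub> U x w) =
        (\<Oplus>\<^bsub>Q\<^esub>x\<in>pverts G. adjacency_matrix G x w \<odot>\<^bsub>Q\<^esub> U v x)"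
    proof (rule eq)
      fix B :: "('b, 'y) star_alg_scheme" and h assume B: "star_algebra_hom Q B h" "graph_relations G B (\<lambda>v w. h (U v w))"
      show "h (\<Oplus>\<^bsub>Q\<^esub>x\<in>pverts G. adjacency_matrix G v x \<odot>\<^bsub>Q\<^esub> U x w) =
        h (\<Oplus>\<^bsub>Q\<^esub>x\<in>pverts G. adjacency_matrix G x w \<odot>\<^bsub>Q\<^esub> U v x)"
        using graph_relationsD(6)[OF B(2) vw] by (simp add: hs[OF B(1)] U vw)
    qed (use U vw in simp_all)
  next
    fix v assume v: "v \<in> pverts G"
    show "(\<Oplus>\<^bsub>Q\<^esub>w\<in>pverts G. U v w) = \<one>\<^bsub>Q\<^esub>"
    proof (rule eq)
      fix B :: "('b, 'y) star_alg_scheme" and h assume B: "star_algebra_hom Q B h" "graph_relations G B (\<lambda>v w. h (U v w))"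
      interpret h: star_algebra_hom Q B h by fact
      have "h (\<Oplus>\<^bsub>Q\<^esub>w\<in>pverts G. U v w) = (\<Oplus>\<^bsub>B\<^esub>w\<in>pverts G. h (U v w))" by (rule h.hom_fs) (simp add: U v)
      then show "h (\<Oplus>\<^bsub>Q\<^esub>w\<in>pverts G. U v w) = h \<one>\<^bsub>Q\<^esub>" using graph_relationsD(4)[OF B(2) v v] by simp
    qed (use U v in simp_all)
    show "(\<Oplus>\<^bsub>Q\<^esub>w\<in>pverts G. U w v) = \<one>\<^bsub>Q\<^esub>"
    proof (rule eq)
      fix B :: "('b, 'y) star_alg_scheme" and h assume B: "star_algebra_hom Q B h" "graph_relations G B (\<lambda>v w. h (U v w))"
      interpret h: star_algebra_hom Q B h by fact
      have "h (\<Oplus>\<^bsub>Q\<^esub>w\<in>pverts G. U w v) = (\<Oplus>\<^bsub>B\<^esub>w\<in>pverts G. h (U w v))" by (rule h.hom_fs) (simp add: U v)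
      then show "h (\<Oplus>\<^bsub>Q\<^esub>w\<in>pverts G. U w v) = h \<one>\<^bsub>Q\<^esub>" using graph_relationsD(5)[OF B(2) v v] by simp
    qed (use U v in simp_all)
  qed
qed

lemma satisfies_graph_relations:
  assumes B: "star_algebra B" "reduced_star_alg B" and W: "graph_relations G B W"
  shows "satisfies (pverts G) (graph_relations G) B W"
  unfolding satisfies_def
proof (intro conjI allI impI B ballI)
  fix Q \<theta> v assume F: "jointly_injective Q {(B, \<theta>)}"
    and v: "\<forall>i\<in>pverts G. \<forall>j\<in>pverts G. v i j \<in> carrier Q \<and> \<theta> (v i j) = W i j"
  show "graph_relations G Q v"
    by (rule graph_relations_transfer[OF F]) (use v W in auto)
qed (rule graph_relationsD(1)[OF W])

lemma graph_relations_complex: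
  assumes "finite (pverts G)"
  shows "graph_relations G complex_star_alg (\<lambda>i j. of_bool (i = j))"
proof -
  have c: "carrier complex_star_alg = UNIV" "star complex_star_alg = cnj" "x \<otimes>\<^bsub>complex_star_alg\<^esub> y = x * y"
    "\<one>\<^bsub>complex_star_alg\<^esub> = 1" "x \<odot>\<^bsub>complex_star_alg\<^esub> y = x * y" for x y
    by (simp_all add: complex_star_alg_def)
  show ?thesis
    by (rule graph_relationsI) (use assms in \<open>simp_all add: c\<close>)
qed

lemma finsum_opposite [simp]: "finsum (opposite A) f S = finsum A f S"
  by (simp add: finsum_def opposite_def)

text \<open>Transposing A U = U A turns it into the same relation for the transposed matrix because
  the adjacency matrix is symmetric; the involution is invisible on self-adjoint entries.\<close>

lemma graph_relations_opposite:
  assumes A: "star_algebra A" and U: "graph_relations G A U"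
    and sym: "\<And>v w. (v, w) \<in> parcs G \<Longrightarrow> (w, v) \<in> parcs G"
  shows "graph_relations G (opposite A) (\<lambda>i j. star A (U j i))"
proof -
  interpret star_algebra A by fact
  note D = graph_relationsD[OF U]
  have o: "carrier (opposite A) = carrier A" "smult (opposite A) = smult A" "one (opposite A) = one A"
    "star (opposite A) = star A" "a \<otimes>\<^bsub>opposite A\<^esub> b = b \<otimes>\<^bsub>A\<^esub> a" for a b
    by (simp_all add: opposite_def)
  have s: "adjacency_matrix G v w = adjacency_matrix G w v" for v w
    using sym by (auto simp: adjacency_matrix_def)
  have "graph_relations G (opposite A) (\<lambda>i j. U j i)"
  proof (rule graph_relationsI)
    fix v w assume vw: "v \<in> pverts G" "w \<in> pverts G"
    show "(\<Oplus>\<^bsub>opposite A\<^esub>x\<in>pverts G. adjacency_matrix G v x \<odot>\<^bsub>opposite A\<^esub> U w x) =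
        (\<Oplus>\<^bsub>opposite A\<^esub>x\<in>pverts G. adjacency_matrix G x w \<odot>\<^bsub>opposite A\<^esub> U x v)"
      using D(6)[OF vw(2,1)] s[of v] s[of w] by (simp add: o)
  qed (simp_all add: o D)
  then show ?thesis
    by (rule graph_relations_cong[OF star_algebra_opposite[OF A]]) (simp add: D)
qed

text \<open>Idempotency uses that the entries in a row of \<open>U\<close> are orthogonal, and hence
  that \<open>A\<close> is reduced. The remaining relations are linear in each tensor factor; the
  adjacency matrix is moved past the left factor and then past the right one.\<close>

lemma graph_relations_tensor:
  assumes A: "star_algebra A" "reduced_star_alg A" and fin: "finite (pverts G)" and U: "graph_relations G A U"
  shows "graph_relations G (tensor A A) (\<lambda>i j. \<Oplus>\<^bsub>tensor A A\<^esub>k\<in>pverts G. pure_tensor A A (U i k) (U k j))"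
proof -
  interpret star_algebra_pair A A by (intro star_algebra_pair.intro A)
  interpret T: star_algebra T by (rule star_algebra_T)
  let ?V = "pverts G"
  note D = graph_relationsD[OF U]
  have [simp]: "U v w \<in> carrier A" if "v \<in> ?V" "w \<in> ?V" for v w using D(1)[OF that] .
  let ?N = "\<lambda>v w. \<Oplus>\<^bsub>T\<^esub>k\<in>?V. t (U v k) (U k w)"
  note orth = graph_relations_orthogonal[OF A fin U]
  show ?thesis
  proof (rule graph_relationsI)
    fix v w assume vw: "v \<in> ?V" "w \<in> ?V"
    show "?N v w \<in> carrier T" using vw by simp
    show "star T (?N v w) = ?N v w"
    proof -
      have "star T (?N v w) = (\<Oplus>\<^bsub>T\<^esub>k\<in>?V. t (star A (U v k)) (star A (U k w)))"
        by (rule diagonal_star) (use vw in simp_all)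
      also have "\<dots> = ?N v w" by (rule T.fs_cong) (use vw in \<open>simp_all add: D(2)\<close>)
      finally show ?thesis .
    qed
    have "?N v w \<otimes>\<^bsub>T\<^esub> ?N v w = (\<Oplus>\<^bsub>T\<^esub>k\<in>?V. t (U v k \<otimes>\<^bsub>A\<^esub> U v k) (U k w \<otimes>\<^bsub>A\<^esub> U k w))"
      by (rule diagonal_mult) (use fin vw orth in simp_all)
    also have "\<dots> = ?N v w"
      by (rule T.fs_cong) (use vw in \<open>simp_all add: D(3)\<close>)
    finally show "?N v w \<otimes>\<^bsub>T\<^esub> ?N v w = ?N v w" .
    let ?a = "adjacency_matrix G"
    have "(\<Oplus>\<^bsub>T\<^esub>x\<in>?V. ?a v x \<odot>\<^bsub>T\<^esub> ?N x w) = (\<Oplus>\<^bsub>T\<^esub>x\<in>?V. \<Oplus>\<^bsub>T\<^esub>k\<in>?V. t (?a v x \<odot>\<^bsub>A\<^esub> U x k) (U k w))"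
    proof (rule T.fs_cong)
      fix x assume x: "x \<in> ?V"
      have "?a v x \<odot>\<^bsub>T\<^esub> ?N x w = (\<Oplus>\<^bsub>T\<^esub>k\<in>?V. ?a v x \<odot>\<^bsub>T\<^esub> t (U x k) (U k w))"
        by (rule T.fs_scale) (use x vw in simp)
      also have "\<dots> = (\<Oplus>\<^bsub>T\<^esub>k\<in>?V. t (?a v x \<odot>\<^bsub>A\<^esub> U x k) (U k w))"
        by (rule T.fs_cong) (use x vw in \<open>simp_all add: t_scale_left\<close>)
      finally show "?a v x \<odot>\<^bsub>T\<^esub> ?N x w = (\<Oplus>\<^bsub>T\<^esub>k\<in>?V. t (?a v x \<odot>\<^bsub>A\<^esub> U x k) (U k w))" .
    qed (use vw in simp_all)
    also have "\<dots> = (\<Oplus>\<^bsub>T\<^esub>k\<in>?V. \<Oplus>\<^bsub>T\<^esub>x\<in>?V. t (?a v x \<odot>\<^bsub>A\<^esub> U x k) (U k w))"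
      by (rule T.fs_swap) (use fin vw in simp_all)
    \<comment> \<open>The adjacency matrix passes the left factor and now stands between the two
      factors.\<close>
    also have "\<dots> = (\<Oplus>\<^bsub>T\<^esub>k\<in>?V. \<Oplus>\<^bsub>T\<^esub>x\<in>?V. ?a x k \<odot>\<^bsub>T\<^esub> t (U v x) (U k w))"
    proof (rule T.fs_cong)
      fix k assume k: "k \<in> ?V"
      have "(\<Oplus>\<^bsub>T\<^esub>x\<in>?V. t (?a v x \<odot>\<^bsub>A\<^esub> U x k) (U k w)) = t (\<Oplus>\<^bsub>A\<^esub>x\<in>?V. ?a v x \<odot>\<^bsub>A\<^esub> U x k) (U k w)"
        by (rule t_fs_left[symmetric]) (use k vw in simp_all)
      also have "\<dots> = t (\<Oplus>\<^bsub>A\<^esub>x\<in>?V. ?a x k \<odot>\<^bsub>A\<^esub> U v x) (U k w)" by (simp only: D(6)[OF vw(1) k])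
      also have "\<dots> = (\<Oplus>\<^bsub>T\<^esub>x\<in>?V. t (?a x k \<odot>\<^bsub>A\<^esub> U v x) (U k w))"
        by (rule t_fs_left) (use k vw in simp_all)
      also have "\<dots> = (\<Oplus>\<^bsub>T\<^esub>x\<in>?V. ?a x k \<odot>\<^bsub>T\<^esub> t (U v x) (U k w))"
        by (rule T.fs_cong) (use k vw in \<open>simp_all add: t_scale_left\<close>)
      finally show "(\<Oplus>\<^bsub>T\<^esub>x\<in>?V. t (?a v x \<odot>\<^bsub>A\<^esub> U x k) (U k w)) = (\<Oplus>\<^bsub>T\<^esub>x\<in>?V. ?a x k \<odot>\<^bsub>T\<^esub> t (U v x) (U k w))" .
    qed (use vw in simp_all)
    also have "\<dots> = (\<Oplus>\<^bsub>T\<^esub>x\<in>?V. \<Oplus>\<^bsub>T\<^esub>k\<in>?V. ?a x k \<odot>\<^bsub>T\<^esub> t (U v x) (U k w))"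
      by (rule T.fs_swap) (use fin vw in simp_all)
    \<comment> \<open>The adjacency matrix passes the right factor. The bound names trade places:
      the outer \<open>k\<close> is the former \<open>x\<close>.\<close>
    also have "\<dots> = (\<Oplus>\<^bsub>T\<^esub>k\<in>?V. \<Oplus>\<^bsub>T\<^esub>x\<in>?V. ?a x w \<odot>\<^bsub>T\<^esub> t (U v k) (U k x))"
    proof (rule T.fs_cong)
      fix k assume k: "k \<in> ?V"
      have "(\<Oplus>\<^bsub>T\<^esub>x\<in>?V. ?a k x \<odot>\<^bsub>T\<^esub> t (U v k) (U x w)) = (\<Oplus>\<^bsub>T\<^esub>x\<in>?V. t (U v k) (?a k x \<odot>\<^bsub>A\<^esub> U x w))"
        by (rule T.fs_cong) (use k vw in \<open>simp_all add: t_scale_right\<close>)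
      also have "\<dots> = t (U v k) (\<Oplus>\<^bsub>A\<^esub>x\<in>?V. ?a k x \<odot>\<^bsub>A\<^esub> U x w)"
        by (rule t_fs_right[symmetric]) (use k vw in simp_all)
      also have "\<dots> = t (U v k) (\<Oplus>\<^bsub>A\<^esub>x\<in>?V. ?a x w \<odot>\<^bsub>A\<^esub> U k x)" by (simp only: D(6)[OF k vw(2)])
      also have "\<dots> = (\<Oplus>\<^bsub>T\<^esub>x\<in>?V. t (U v k) (?a x w \<odot>\<^bsub>A\<^esub> U k x))"
        by (rule t_fs_right) (use k vw in simp_all)
      also have "\<dots> = (\<Oplus>\<^bsub>T\<^esub>x\<in>?V. ?a x w \<odot>\<^bsub>T\<^esub> t (U v k) (U k x))"
        by (rule T.fs_cong) (use k vw in \<open>simp_all add: t_scale_right\<close>)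
      finally show "(\<Oplus>\<^bsub>T\<^esub>x\<in>?V. ?a k x \<odot>\<^bsub>T\<^esub> t (U v k) (U x w)) = (\<Oplus>\<^bsub>T\<^esub>x\<in>?V. ?a x w \<odot>\<^bsub>T\<^esub> t (U v k) (U k x))" .
    qed (use vw in simp_all)
    also have "\<dots> = (\<Oplus>\<^bsub>T\<^esub>x\<in>?V. \<Oplus>\<^bsub>T\<^esub>k\<in>?V. ?a x w \<odot>\<^bsub>T\<^esub> t (U v k) (U k x))"
      by (rule T.fs_swap) (use fin vw in simp_all)
    also have "\<dots> = (\<Oplus>\<^bsub>T\<^esub>x\<in>?V. ?a x w \<odot>\<^bsub>T\<^esub> ?N v x)"
      by (rule T.fs_cong) (use vw in \<open>simp_all add: T.fs_scale\<close>)
    finally show "(\<Oplus>\<^bsub>T\<^esub>x\<in>?V. ?a v x \<odot>\<^bsub>T\<^esub> ?N x w) = (\<Oplus>\<^bsub>T\<^esub>x\<in>?V. ?a x w \<odot>\<^bsub>T\<^esub> ?N v x)" .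
  next
    fix v assume v: "v \<in> ?V"
    have "(\<Oplus>\<^bsub>T\<^esub>w\<in>?V. ?N v w) = (\<Oplus>\<^bsub>T\<^esub>k\<in>?V. \<Oplus>\<^bsub>T\<^esub>w\<in>?V. t (U v k) (U k w))"
      by (rule T.fs_swap) (use fin v in simp_all)
    also have "\<dots> = (\<Oplus>\<^bsub>T\<^esub>k\<in>?V. t (U v k) \<one>\<^bsub>A\<^esub>)"
      by (rule T.fs_cong) (use v D(4) in \<open>simp_all flip: t_fs_right\<close>)
    also have "\<dots> = t (\<Oplus>\<^bsub>A\<^esub>k\<in>?V. U v k) \<one>\<^bsub>A\<^esub>" by (rule t_fs_left[symmetric]) (use v in simp_all)
    finally show "(\<Oplus>\<^bsub>T\<^esub>w\<in>?V. ?N v w) = \<one>\<^bsub>T\<^esub>" using D(4)[OF v v] by (simp add: t_one)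
    have "(\<Oplus>\<^bsub>T\<^esub>w\<in>?V. ?N w v) = (\<Oplus>\<^bsub>T\<^esub>k\<in>?V. \<Oplus>\<^bsub>T\<^esub>w\<in>?V. t (U w k) (U k v))"
      by (rule T.fs_swap) (use fin v in simp_all)
    also have "\<dots> = (\<Oplus>\<^bsub>T\<^esub>k\<in>?V. t \<one>\<^bsub>A\<^esub> (U k v))"
      by (rule T.fs_cong) (use v D(5) in \<open>simp_all flip: t_fs_left\<close>)
    also have "\<dots> = t \<one>\<^bsub>A\<^esub> (\<Oplus>\<^bsub>A\<^esub>k\<in>?V. U k v)" by (rule t_fs_right[symmetric]) (use v in simp_all)
    finally show "(\<Oplus>\<^bsub>T\<^esub>w\<in>?V. ?N w v) = \<one>\<^bsub>T\<^esub>" using D(5)[OF v v] by (simp add: t_one)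
  qed
qed

lemma matrix_hopf_graph:
  assumes fin: "finite (pverts G)" and sym: "\<And>v w. (v, w) \<in> parcs G \<Longrightarrow> (w, v) \<in> parcs G"
  shows "matrix_hopf (pverts G) (graph_relations G)"
proof -
  interpret matrix_relations "pverts G" "graph_relations G"
  proof
    show "satisfies (pverts G) (graph_relations G) complex_star_alg (\<lambda>i j. of_bool (i = j))"
      by (intro satisfies_graph_relations star_algebra_complex reduced_complex graph_relations_complex fin)
    fix Q :: "'a coord star_alg" and v and F :: "('a coord star_alg \<times> ('a coord \<Rightarrow> 'a coord)) set"
    assume F: "jointly_injective Q F" and v: "\<And>i j. i \<in> pverts G \<Longrightarrow> j \<in> pverts G \<Longrightarrow> v i j \<in> carrier Q"
      and *: "\<And>B h. (B, h) \<in> F \<Longrightarrow> \<exists>w. graph_relations G B w \<and> (\<forall>i\<in>pverts G. \<forall>j\<in>pverts G. h (v i j) = w i j)"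
    show "graph_relations G Q v"
      using F v * by (rule graph_relations_transfer)
  qed (rule fin)
  have "satisfies (pverts G) (graph_relations G) (opposite OG) (\<lambda>i j. star OG (u j i))"
    using star_algebra_opposite[OF star_algebra_O] reduced_opposite[OF star_algebra_O reduced_O]
      graph_relations_opposite[OF star_algebra_O relations_O sym]
    by (rule satisfies_graph_relations)
  moreover have "satisfies (pverts G) (graph_relations G) (tensor OG OG)
      (\<lambda>i j. \<Oplus>\<^bsub>tensor OG OG\<^esub>k\<in>pverts G. pure_tensor OG OG (u i k) (u k j))"
    using star_algebra_pair.star_algebra_T[OF pair_O] star_algebra_pair.reduced_T[OF pair_O reduced_O reduced_O]
      graph_relations_tensor[OF star_algebra_O reduced_O fin relations_O]
    by (rule satisfies_graph_relations)
  ultimately show ?thesis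
    by (intro matrix_hopf.intro matrix_hopf_axioms.intro matrix_relations_axioms)
qed

section \<open>The relations of the quantum automorphism group of a Hadamard matrix\<close>

lemma quantum_reflection_matrixD:
  assumes "quantum_reflection_matrix A s I u" "i \<in> I" "j \<in> I"
  shows "u i j \<in> carrier A"
    "(\<Oplus>\<^bsub>A\<^esub>k\<in>I. u i k \<otimes>\<^bsub>A\<^esub> star A (u j k)) = (if i = j then \<one>\<^bsub>A\<^esub> else \<zero>\<^bsub>A\<^esub>)"
    "(\<Oplus>\<^bsub>A\<^esub>k\<in>I. star A (u k i) \<otimes>\<^bsub>A\<^esub> u k j) = (if i = j then \<one>\<^bsub>A\<^esub> else \<zero>\<^bsub>A\<^esub>)"
    "(\<Oplus>\<^bsub>A\<^esub>k\<in>I. star A (u i k) \<otimes>\<^bsub>A\<^esub> star A (star A (u j k))) = (if i = j then \<one>\<^bsub>A\<^esub> else \<zero>\<^bsub>A\<^esub>)"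
    "(\<Oplus>\<^bsub>A\<^esub>k\<in>I. star A (star A (u k i)) \<otimes>\<^bsub>A\<^esub> star A (u k j)) = (if i = j then \<one>\<^bsub>A\<^esub> else \<zero>\<^bsub>A\<^esub>)"
    "u i j \<otimes>\<^bsub>A\<^esub> star A (u i j) = star A (u i j) \<otimes>\<^bsub>A\<^esub> u i j"
    "u i j \<otimes>\<^bsub>A\<^esub> star A (u i j) \<otimes>\<^bsub>A\<^esub> u i j = u i j"
    "u i j [^]\<^bsub>A\<^esub> s = u i j \<otimes>\<^bsub>A\<^esub> star A (u i j)"
  using assms unfolding quantum_reflection_matrix_def unitary_matrix_def by blast+

lemma quantum_reflection_matrixI:
  assumes "\<And>i j. i \<in> I \<Longrightarrow> j \<in> I \<Longrightarrow> u i j \<in> carrier A"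
    "\<And>i j. i \<in> I \<Longrightarrow> j \<in> I \<Longrightarrow> (\<Oplus>\<^bsub>A\<^esub>k\<in>I. u i k \<otimes>\<^bsub>A\<^esub> star A (u j k)) = (if i = j then \<one>\<^bsub>A\<^esub> else \<zero>\<^bsub>A\<^esub>)"
    "\<And>i j. i \<in> I \<Longrightarrow> j \<in> I \<Longrightarrow> (\<Oplus>\<^bsub>A\<^esub>k\<in>I. star A (u k i) \<otimes>\<^bsub>A\<^esub> u k j) = (if i = j then \<one>\<^bsub>A\<^esub> else \<zero>\<^bsub>A\<^esub>)"
    "\<And>i j. i \<in> I \<Longrightarrow> j \<in> I \<Longrightarrow> (\<Oplus>\<^bsub>A\<^esub>k\<in>I. star A (u i k) \<otimes>\<^bsub>A\<^esub> star A (star A (u j k))) = (if i = j then \<one>\<^bsub>A\<^esub> else \<zero>\<^bsub>A\<^esub>)"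
    "\<And>i j. i \<in> I \<Longrightarrow> j \<in> I \<Longrightarrow> (\<Oplus>\<^bsub>A\<^esub>k\<in>I. star A (star A (u k i)) \<otimes>\<^bsub>A\<^esub> star A (u k j)) = (if i = j then \<one>\<^bsub>A\<^esub> else \<zero>\<^bsub>A\<^esub>)"
    "\<And>i j. i \<in> I \<Longrightarrow> j \<in> I \<Longrightarrow> u i j \<otimes>\<^bsub>A\<^esub> star A (u i j) = star A (u i j) \<otimes>\<^bsub>A\<^esub> u i j"
    "\<And>i j. i \<in> I \<Longrightarrow> j \<in> I \<Longrightarrow> u i j \<otimes>\<^bsub>A\<^esub> star A (u i j) \<otimes>\<^bsub>A\<^esub> u i j = u i j"
    "\<And>i j. i \<in> I \<Longrightarrow> j \<in> I \<Longrightarrow> u i j [^]\<^bsub>A\<^esub> s = u i j \<otimes>\<^bsub>A\<^esub> star A (u i j)"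
  shows "quantum_reflection_matrix A s I u"
  using assms unfolding quantum_reflection_matrix_def unitary_matrix_def by (intro conjI ballI)

lemma reflection_entry:
  assumes "star_algebra A" "s \<ge> 1" "quantum_reflection_matrix A s I u" "i \<in> I" "j \<in> I"
  shows "reflection A s (u i j)"
  using assms quantum_reflection_matrixD(1,6,7,8)[OF assms(3-5)]
  by (intro reflection.intro reflection_axioms.intro)

text \<open>The support projections u_ij u_ij^* add up to 1 along rows and, by normality, along
  columns, so they are orthogonal. An entry absorbs its support projection on both sides, which
  carries the orthogonality over to the entries and their adjoints.\<close>

lemma quantum_reflection_orthogonal:
  assumes A: "star_algebra A" "reduced_star_alg A" and s: "s \<ge> 1" and fin: "finite I"
    and u: "quantum_reflection_matrix A s I u" and i: "i \<in> I" "k \<in> I" "l \<in> I" "k \<noteq> l"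
  shows "u i k \<otimes>\<^bsub>A\<^esub> u i l = \<zero>\<^bsub>A\<^esub>" "u i k \<otimes>\<^bsub>A\<^esub> star A (u i l) = \<zero>\<^bsub>A\<^esub>" "star A (u i k) \<otimes>\<^bsub>A\<^esub> u i l = \<zero>\<^bsub>A\<^esub>"
    "u k i \<otimes>\<^bsub>A\<^esub> u l i = \<zero>\<^bsub>A\<^esub>"
proof -
  interpret star_algebra A by fact
  note D = quantum_reflection_matrixD[OF u]
  have [simp]: "u i j \<in> carrier A" if "i \<in> I" "j \<in> I" for i j using D(1)[OF that] .
  let ?e = "\<lambda>i j. u i j \<otimes>\<^bsub>A\<^esub> star A (u i j)"
  have ref: "reflection A s (u i j)" if "i \<in> I" "j \<in> I" for i j
    using reflection_entry[OF A(1) s u that] .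
  note E = reflection.e_star[OF ref] reflection.e_idem[OF ref]
  have col: "(\<Oplus>\<^bsub>A\<^esub>j\<in>I. ?e j i) = \<one>\<^bsub>A\<^esub>"
  proof -
    have "(\<Oplus>\<^bsub>A\<^esub>j\<in>I. ?e j i) = (\<Oplus>\<^bsub>A\<^esub>j\<in>I. star A (u j i) \<otimes>\<^bsub>A\<^esub> u j i)"
      by (rule fs_cong) (use i D(6) in simp_all)
    then show ?thesis using D(3)[OF i(1) i(1)] by simp
  qed
  have row: "(\<Oplus>\<^bsub>A\<^esub>j\<in>I. ?e i j) = \<one>\<^bsub>A\<^esub>" using D(2)[OF i(1) i(1)] by simp
  have 1: "?e i k \<otimes>\<^bsub>A\<^esub> ?e i l = \<zero>\<^bsub>A\<^esub>"
    by (rule projections_orthogonal[OF A(2) fin, where e="?e i"]) (use i E row in simp_all)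
  have 2: "?e k i \<otimes>\<^bsub>A\<^esub> ?e l i = \<zero>\<^bsub>A\<^esub>"
    by (rule projections_orthogonal[OF A(2) fin, where e="\<lambda>j. ?e j i"]) (use i E col in simp_all)
  have z: "x \<otimes>\<^bsub>A\<^esub> y = \<zero>\<^bsub>A\<^esub>" if "x \<in> carrier A" "y \<in> carrier A" "a \<in> carrier A" "b \<in> carrier A"
    "a \<otimes>\<^bsub>A\<^esub> b = \<zero>\<^bsub>A\<^esub>" "x \<otimes>\<^bsub>A\<^esub> a = x" "b \<otimes>\<^bsub>A\<^esub> y = y" for x y a b
  proof -
    have "x \<otimes>\<^bsub>A\<^esub> y = (x \<otimes>\<^bsub>A\<^esub> a) \<otimes>\<^bsub>A\<^esub> (b \<otimes>\<^bsub>A\<^esub> y)" using that by simp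
    also have "\<dots> = x \<otimes>\<^bsub>A\<^esub> ((a \<otimes>\<^bsub>A\<^esub> b) \<otimes>\<^bsub>A\<^esub> y)" using that(1-4) by (simp only: m_assoc m_closed)
    finally show ?thesis using that by simp
  qed
  note X = reflection.x_e[OF ref] reflection.e_x[OF ref] reflection.e_star_x[OF ref] reflection.star_x_e[OF ref]
  show "u i k \<otimes>\<^bsub>A\<^esub> u i l = \<zero>\<^bsub>A\<^esub>" by (rule z[OF _ _ _ _ 1]) (use i X in simp_all)
  show "u i k \<otimes>\<^bsub>A\<^esub> star A (u i l) = \<zero>\<^bsub>A\<^esub>" by (rule z[OF _ _ _ _ 1]) (use i X in simp_all)
  show "star A (u i k) \<otimes>\<^bsub>A\<^esub> u i l = \<zero>\<^bsub>A\<^esub>" by (rule z[OF _ _ _ _ 1]) (use i X in simp_all)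
  show "u k i \<otimes>\<^bsub>A\<^esub> u l i = \<zero>\<^bsub>A\<^esub>" by (rule z[OF _ _ _ _ 2]) (use i X in simp_all)
qed

lemma quantum_reflection_matrix_transfer:
  fixes Q :: "('a, 'x) star_alg_scheme" and F :: "(('b, 'y) star_alg_scheme \<times> ('a \<Rightarrow> 'b)) set"
  assumes F: "jointly_injective Q F" and U: "\<And>v w. v \<in> I \<Longrightarrow> w \<in> I \<Longrightarrow> U v w \<in> carrier Q"
    and *: "\<And>B h. (B, h) \<in> F \<Longrightarrow> quantum_reflection_matrix B s I (\<lambda>v w. h (U v w))"
  shows "quantum_reflection_matrix Q s I U"
proof -
  interpret Q: star_algebra Q using F by (simp add: jointly_injective_def)
  have eq: "x = y" if xy: "x \<in> carrier Q" "y \<in> carrier Q"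
    and e: "\<And>(B :: ('b, 'y) star_alg_scheme) h. star_algebra_hom Q B h \<Longrightarrow>
      quantum_reflection_matrix B s I (\<lambda>v w. h (U v w)) \<Longrightarrow> h x = h y" for x y
    by (rule jointly_injective_eqI[OF F xy]) (rule e, assumption, rule *)
  note hs = star_algebra_hom.hom_fs star_algebra_hom.hom_star star_algebra_hom.hom_mult
    star_algebra_hom.hom_one star_algebra_hom.hom_zero
  \<comment> \<open>This serves all four unitarity equations. The function \<open>g\<close> is the
    summand as it reads in \<open>B\<close> once \<open>h\<close> has been moved inside.\<close>
  have sum: "finsum Q f I = (if i = j then \<one>\<^bsub>Q\<^esub> else \<zero>\<^bsub>Q\<^esub>)"
    if f: "\<And>k. k \<in> I \<Longrightarrow> f k \<in> carrier Q"
      and fB: "\<And>(B :: ('b, 'y) star_alg_scheme) h. star_algebra_hom Q B h \<Longrightarrow>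
      quantum_reflection_matrix B s I (\<lambda>v w. h (U v w)) \<Longrightarrow>
      \<exists>g. (\<forall>k\<in>I. h (f k) = g k) \<and> finsum B g I = (if i = j then \<one>\<^bsub>B\<^esub> else \<zero>\<^bsub>B\<^esub>)" for f i j
  proof (rule eq)
    fix B :: "('b, 'y) star_alg_scheme" and h
    assume B: "star_algebra_hom Q B h" "quantum_reflection_matrix B s I (\<lambda>v w. h (U v w))"
    interpret h: star_algebra_hom Q B h by fact
    obtain g where g: "\<forall>k\<in>I. h (f k) = g k" "finsum B g I = (if i = j then \<one>\<^bsub>B\<^esub> else \<zero>\<^bsub>B\<^esub>)"
      using fB[OF B] by blast
    have "h (finsum Q f I) = finsum B (\<lambda>k. h (f k)) I" by (rule h.hom_fs) (use f in simp)
    also have "\<dots> = finsum B g I"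
    proof (rule h.B.fs_cong)
      show "g k \<in> carrier B" if "k \<in> I" for k using h.hom_closed[OF f[OF that]] g(1) that by simp
    qed (use g in simp_all)
    finally show "h (finsum Q f I) = h (if i = j then \<one>\<^bsub>Q\<^esub> else \<zero>\<^bsub>Q\<^esub>)" by (simp add: g)
  qed (use f in auto)
  show ?thesis
  proof (rule quantum_reflection_matrixI)
    fix i j assume ij: "i \<in> I" "j \<in> I"
    show "U i j \<in> carrier Q" by (rule U[OF ij])
    show "(\<Oplus>\<^bsub>Q\<^esub>k\<in>I. U i k \<otimes>\<^bsub>Q\<^esub> star Q (U j k)) = (if i = j then \<one>\<^bsub>Q\<^esub> else \<zero>\<^bsub>Q\<^esub>)"
    proof (rule sum)
      fix B :: "('b, 'y) star_alg_scheme" and h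
      assume B: "star_algebra_hom Q B h" "quantum_reflection_matrix B s I (\<lambda>v w. h (U v w))"
      show "\<exists>g. (\<forall>k\<in>I. h (U i k \<otimes>\<^bsub>Q\<^esub> star Q (U j k)) = g k) \<and> finsum B g I = (if i = j then \<one>\<^bsub>B\<^esub> else \<zero>\<^bsub>B\<^esub>)"
        by (rule exI, rule conjI[rotated], rule quantum_reflection_matrixD(2)[OF B(2) ij])
          (use ij U in \<open>simp add: hs[OF B(1)]\<close>)
    qed (use ij U in simp)
    show "(\<Oplus>\<^bsub>Q\<^esub>k\<in>I. star Q (U k i) \<otimes>\<^bsub>Q\<^esub> U k j) = (if i = j then \<one>\<^bsub>Q\<^esub> else \<zero>\<^bsub>Q\<^esub>)"
    proof (rule sum)
      fix B :: "('b, 'y) star_alg_scheme" and h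
      assume B: "star_algebra_hom Q B h" "quantum_reflection_matrix B s I (\<lambda>v w. h (U v w))"
      show "\<exists>g. (\<forall>k\<in>I. h (star Q (U k i) \<otimes>\<^bsub>Q\<^esub> U k j) = g k) \<and> finsum B g I = (if i = j then \<one>\<^bsub>B\<^esub> else \<zero>\<^bsub>B\<^esub>)"
        by (rule exI, rule conjI[rotated], rule quantum_reflection_matrixD(3)[OF B(2) ij])
          (use ij U in \<open>simp add: hs[OF B(1)]\<close>)
    qed (use ij U in simp)
    show "(\<Oplus>\<^bsub>Q\<^esub>k\<in>I. star Q (U i k) \<otimes>\<^bsub>Q\<^esub> star Q (star Q (U j k))) = (if i = j then \<one>\<^bsub>Q\<^esub> else \<zero>\<^bsub>Q\<^esub>)"
    proof (rule sum)
      fix B :: "('b, 'y) star_alg_scheme" and h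
      assume B: "star_algebra_hom Q B h" "quantum_reflection_matrix B s I (\<lambda>v w. h (U v w))"
      show "\<exists>g. (\<forall>k\<in>I. h (star Q (U i k) \<otimes>\<^bsub>Q\<^esub> star Q (star Q (U j k))) = g k) \<and> finsum B g I = (if i = j then \<one>\<^bsub>B\<^esub> else \<zero>\<^bsub>B\<^esub>)"
        by (rule exI, rule conjI[rotated], rule quantum_reflection_matrixD(4)[OF B(2) ij])
          (use ij U in \<open>simp add: hs[OF B(1)] del: Q.star_star\<close>)
    qed (use ij U in simp)
    show "(\<Oplus>\<^bsub>Q\<^esub>k\<in>I. star Q (star Q (U k i)) \<otimes>\<^bsub>Q\<^esub> star Q (U k j)) = (if i = j then \<one>\<^bsub>Q\<^esub> else \<zero>\<^bsub>Q\<^esub>)"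
    proof (rule sum)
      fix B :: "('b, 'y) star_alg_scheme" and h
      assume B: "star_algebra_hom Q B h" "quantum_reflection_matrix B s I (\<lambda>v w. h (U v w))"
      show "\<exists>g. (\<forall>k\<in>I. h (star Q (star Q (U k i)) \<otimes>\<^bsub>Q\<^esub> star Q (U k j)) = g k) \<and> finsum B g I = (if i = j then \<one>\<^bsub>B\<^esub> else \<zero>\<^bsub>B\<^esub>)"
        by (rule exI, rule conjI[rotated], rule quantum_reflection_matrixD(5)[OF B(2) ij])
          (use ij U in \<open>simp add: hs[OF B(1)] del: Q.star_star\<close>)
    qed (use ij U in simp)
    have h: "h (U i j \<otimes>\<^bsub>Q\<^esub> star Q (U i j)) = h (star Q (U i j) \<otimes>\<^bsub>Q\<^esub> U i j)"
      "h (U i j \<otimes>\<^bsub>Q\<^esub> star Q (U i j) \<otimes>\<^bsub>Q\<^esub> U i j) = h (U i j)"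
      "h (U i j [^]\<^bsub>Q\<^esub> s) = h (U i j \<otimes>\<^bsub>Q\<^esub> star Q (U i j))"
      if B: "star_algebra_hom Q B h" "quantum_reflection_matrix B s I (\<lambda>v w. h (U v w))"
      for B :: "('b, 'y) star_alg_scheme" and h
      using quantum_reflection_matrixD(6,7,8)[OF B(2) ij] U[OF ij]
      by (simp_all add: hs[OF B(1)] star_algebra_hom.hom_pow[OF B(1)])
    show "U i j \<otimes>\<^bsub>Q\<^esub> star Q (U i j) = star Q (U i j) \<otimes>\<^bsub>Q\<^esub> U i j"
      by (rule eq[OF _ _ h(1)]) (use U[OF ij] in simp_all)
    show "U i j \<otimes>\<^bsub>Q\<^esub> star Q (U i j) \<otimes>\<^bsub>Q\<^esub> U i j = U i j"
      by (rule eq[OF _ _ h(2)]) (use U[OF ij] in simp_all)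
    show "U i j [^]\<^bsub>Q\<^esub> s = U i j \<otimes>\<^bsub>Q\<^esub> star Q (U i j)"
      by (rule eq[OF _ _ h(3)]) (use U[OF ij] in simp_all)
  qed
qed

lemma quantum_reflection_matrix_complex:
  assumes "finite I" "s \<ge> 1"
  shows "quantum_reflection_matrix complex_star_alg s I (\<lambda>i j. of_bool (i = j))"
proof -
  have c: "carrier complex_star_alg = UNIV" "star complex_star_alg = cnj" "x \<otimes>\<^bsub>complex_star_alg\<^esub> y = x * y"
    "\<one>\<^bsub>complex_star_alg\<^esub> = 1" "\<zero>\<^bsub>complex_star_alg\<^esub> = 0" "x \<odot>\<^bsub>complex_star_alg\<^esub> y = x * y" for x y
    by (simp_all add: complex_star_alg_def)
  have p: "x [^]\<^bsub>complex_star_alg\<^esub> (m::nat) = x ^ m" for x m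
    by (induction m) (simp_all add: c mult.commute)
  have b: "(of_bool P :: complex) * of_bool R = of_bool (P \<and> R)" for P R by simp
  show ?thesis
    by (rule quantum_reflection_matrixI)
      (use assms in \<open>simp_all add: c p power_0_left sum.delta' of_bool_def if_distrib[of cnj] mult_delta_left mult_delta_right cong: if_cong\<close>)
qed

lemma pow_opposite:
  assumes "star_algebra A" "x \<in> carrier A"
  shows "x [^]\<^bsub>opposite A\<^esub> (m::nat) = x [^]\<^bsub>A\<^esub> m"
proof -
  interpret star_algebra A by fact
  interpret o: star_algebra "opposite A" by (rule star_algebra_opposite[OF assms(1)])
  show ?thesis
  proof (induction m)
    case 0
    then show ?case by (simp add: opposite_def)
  next
    case (Suc m)
    have "x [^]\<^bsub>opposite A\<^esub> Suc m = x \<otimes>\<^bsub>A\<^esub> (x [^]\<^bsub>opposite A\<^esub> m)" by (simp add: opposite_def)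
    also have "\<dots> = x \<otimes>\<^bsub>A\<^esub> (x [^]\<^bsub>A\<^esub> m)" by (simp only: Suc)
    also have "\<dots> = x [^]\<^bsub>A\<^esub> Suc m" by (rule nat_pow_Suc2[OF assms(2), symmetric])
    finally show ?case .
  qed
qed

text \<open>The matrix consists of the adjoints of the transposed entries. In the opposite algebra
  its unitarity is that of the conjugate of \<open>u\<close>, and the unitarity of its conjugate is
  that of \<open>u\<close>: the two halves of the definition are exchanged.\<close>

lemma quantum_reflection_matrix_opposite:
  assumes A: "star_algebra A" and u: "quantum_reflection_matrix A s I u"
  shows "quantum_reflection_matrix (opposite A) s I (\<lambda>i j. star A (u j i))"
proof -
  interpret star_algebra A by fact
  note D = quantum_reflection_matrixD[OF u]
  have [simp]: "u i j \<in> carrier A" if "i \<in> I" "j \<in> I" for i j using D(1)[OF that] .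
  have o: "carrier (opposite A) = carrier A" "one (opposite A) = one A" "zero (opposite A) = zero A"
    "star (opposite A) = star A" "a \<otimes>\<^bsub>opposite A\<^esub> b = b \<otimes>\<^bsub>A\<^esub> a" for a b
    by (simp_all add: opposite_def)
  have c: "finsum A f I = x" if "finsum A g I = x" "\<And>k. k \<in> I \<Longrightarrow> f k = g k" "\<And>k. k \<in> I \<Longrightarrow> g k \<in> carrier A" for f g x
    using fs_cong[of I I f g] that by auto
  show ?thesis
  proof (rule quantum_reflection_matrixI; unfold o finsum_opposite)
    fix i j assume ij: "i \<in> I" "j \<in> I"
    have e: "(if i = j then \<one>\<^bsub>A\<^esub> else \<zero>\<^bsub>A\<^esub>) = (if j = i then \<one>\<^bsub>A\<^esub> else \<zero>\<^bsub>A\<^esub>)" by auto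
    show "star A (u j i) \<in> carrier A" using ij by simp
    show "(\<Oplus>\<^bsub>A\<^esub>k\<in>I. star A (star A (u k j)) \<otimes>\<^bsub>A\<^esub> star A (u k i)) = (if i = j then \<one>\<^bsub>A\<^esub> else \<zero>\<^bsub>A\<^esub>)"
      unfolding e by (rule D(5)[OF ij(2,1)])
    show "(\<Oplus>\<^bsub>A\<^esub>k\<in>I. star A (u j k) \<otimes>\<^bsub>A\<^esub> star A (star A (u i k))) = (if i = j then \<one>\<^bsub>A\<^esub> else \<zero>\<^bsub>A\<^esub>)"
      unfolding e by (rule D(4)[OF ij(2,1)])
    show "(\<Oplus>\<^bsub>A\<^esub>k\<in>I. star A (star A (star A (u k j))) \<otimes>\<^bsub>A\<^esub> star A (star A (u k i))) = (if i = j then \<one>\<^bsub>A\<^esub> else \<zero>\<^bsub>A\<^esub>)"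
      unfolding e by (rule c[OF D(3)[OF ij(2,1)]]) (use ij in simp_all)
    show "(\<Oplus>\<^bsub>A\<^esub>k\<in>I. star A (star A (u j k)) \<otimes>\<^bsub>A\<^esub> star A (star A (star A (u i k)))) = (if i = j then \<one>\<^bsub>A\<^esub> else \<zero>\<^bsub>A\<^esub>)"
      unfolding e by (rule c[OF D(2)[OF ij(2,1)]]) (use ij in simp_all)
    show "star A (star A (u j i)) \<otimes>\<^bsub>A\<^esub> star A (u j i) = star A (u j i) \<otimes>\<^bsub>A\<^esub> star A (star A (u j i))"
      using D(6)[OF ij(2,1)] ij by simp
    have "star A (u j i \<otimes>\<^bsub>A\<^esub> star A (u j i) \<otimes>\<^bsub>A\<^esub> u j i) = star A (u j i)" using D(7)[OF ij(2,1)] by simp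
    then show "star A (u j i) \<otimes>\<^bsub>A\<^esub> (star A (star A (u j i)) \<otimes>\<^bsub>A\<^esub> star A (u j i)) = star A (u j i)"
      using ij by (simp add: star_mult)
    have "star A (u j i) [^]\<^bsub>opposite A\<^esub> s = star A (u j i [^]\<^bsub>A\<^esub> s)"
      using ij by (simp add: pow_opposite[OF A] star_pow)
    then show "star A (u j i) [^]\<^bsub>opposite A\<^esub> s = star A (star A (u j i)) \<otimes>\<^bsub>A\<^esub> star A (u j i)"
      using ij by (simp add: D(8) star_mult)
  qed
qed

section \<open>Quantum reflection matrices in tensor squares\<close>

context star_algebra_pair
begin

lemma t_sums_mult:
  assumes "\<And>k. k \<in> S \<Longrightarrow> a k \<in> carrier A" "\<And>k. k \<in> S \<Longrightarrow> b k \<in> carrier B"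
    "\<And>k. k \<in> S' \<Longrightarrow> c k \<in> carrier A" "\<And>k. k \<in> S' \<Longrightarrow> d k \<in> carrier B"
  shows "(\<Oplus>\<^bsub>T\<^esub>k\<in>S. t (a k) (b k)) \<otimes>\<^bsub>T\<^esub> (\<Oplus>\<^bsub>T\<^esub>l\<in>S'. t (c l) (d l))
    = (\<Oplus>\<^bsub>T\<^esub>k\<in>S. \<Oplus>\<^bsub>T\<^esub>l\<in>S'. t (a k \<otimes>\<^bsub>A\<^esub> c l) (b k \<otimes>\<^bsub>B\<^esub> d l))"
proof -
  interpret T: star_algebra T by (rule star_algebra_T)
  have "(\<Oplus>\<^bsub>T\<^esub>k\<in>S. t (a k) (b k)) \<otimes>\<^bsub>T\<^esub> (\<Oplus>\<^bsub>T\<^esub>k\<in>S'. t (c k) (d k))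
    = (\<Oplus>\<^bsub>T\<^esub>k\<in>S. t (a k) (b k) \<otimes>\<^bsub>T\<^esub> (\<Oplus>\<^bsub>T\<^esub>k\<in>S'. t (c k) (d k)))"
    by (rule T.fs_mult_right) (use assms in simp_all)
  also have "\<dots> = (\<Oplus>\<^bsub>T\<^esub>k\<in>S. \<Oplus>\<^bsub>T\<^esub>l\<in>S'. t (a k \<otimes>\<^bsub>A\<^esub> c l) (b k \<otimes>\<^bsub>B\<^esub> d l))"
  proof (rule T.fs_cong)
    fix k assume k: "k \<in> S"
    have "t (a k) (b k) \<otimes>\<^bsub>T\<^esub> (\<Oplus>\<^bsub>T\<^esub>k\<in>S'. t (c k) (d k)) = (\<Oplus>\<^bsub>T\<^esub>l\<in>S'. t (a k) (b k) \<otimes>\<^bsub>T\<^esub> t (c l) (d l))"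
      by (rule T.fs_mult_left) (use assms k in simp_all)
    also have "\<dots> = (\<Oplus>\<^bsub>T\<^esub>l\<in>S'. t (a k \<otimes>\<^bsub>A\<^esub> c l) (b k \<otimes>\<^bsub>B\<^esub> d l))"
      by (rule T.fs_cong) (use assms k in \<open>simp_all add: t_mult\<close>)
    finally show "t (a k) (b k) \<otimes>\<^bsub>T\<^esub> (\<Oplus>\<^bsub>T\<^esub>k\<in>S'. t (c k) (d k)) = (\<Oplus>\<^bsub>T\<^esub>l\<in>S'. t (a k \<otimes>\<^bsub>A\<^esub> c l) (b k \<otimes>\<^bsub>B\<^esub> d l))" .
  qed (use assms in simp_all)
  finally show ?thesis .
qed

text \<open>The shared outer index \<open>k\<close> occurs in the right tensor factor only. Summing
  over it identifies the inner indices \<open>a\<close> and \<open>b\<close> by unitarity and leaves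
  a product in the left factor.\<close>

lemma t_contract_right:
  assumes fin: "finite S" and x: "\<And>a. a \<in> S \<Longrightarrow> x a \<in> carrier A" "\<And>a. a \<in> S \<Longrightarrow> x' a \<in> carrier A"
    and y: "\<And>a k. a \<in> S \<Longrightarrow> k \<in> S \<Longrightarrow> y a k \<in> carrier B" "\<And>a k. a \<in> S \<Longrightarrow> k \<in> S \<Longrightarrow> y' a k \<in> carrier B"
    and d: "\<And>a b. a \<in> S \<Longrightarrow> b \<in> S \<Longrightarrow> (\<Oplus>\<^bsub>B\<^esub>k\<in>S. y a k \<otimes>\<^bsub>B\<^esub> y' b k) = (if a = b then \<one>\<^bsub>B\<^esub> else \<zero>\<^bsub>B\<^esub>)"
  shows "(\<Oplus>\<^bsub>T\<^esub>k\<in>S. (\<Oplus>\<^bsub>T\<^esub>a\<in>S. t (x a) (y a k)) \<otimes>\<^bsub>T\<^esub> (\<Oplus>\<^bsub>T\<^esub>b\<in>S. t (x' b) (y' b k)))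
    = t (\<Oplus>\<^bsub>A\<^esub>a\<in>S. x a \<otimes>\<^bsub>A\<^esub> x' a) \<one>\<^bsub>B\<^esub>"
proof -
  interpret T: star_algebra T by (rule star_algebra_T)
  let ?f = "\<lambda>k a b. t (x a \<otimes>\<^bsub>A\<^esub> x' b) (y a k \<otimes>\<^bsub>B\<^esub> y' b k)"
  have "(\<Oplus>\<^bsub>T\<^esub>k\<in>S. (\<Oplus>\<^bsub>T\<^esub>a\<in>S. t (x a) (y a k)) \<otimes>\<^bsub>T\<^esub> (\<Oplus>\<^bsub>T\<^esub>b\<in>S. t (x' b) (y' b k)))
    = (\<Oplus>\<^bsub>T\<^esub>k\<in>S. \<Oplus>\<^bsub>T\<^esub>a\<in>S. \<Oplus>\<^bsub>T\<^esub>b\<in>S. ?f k a b)"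
    by (rule T.fs_cong) (use x y in \<open>simp_all add: t_sums_mult\<close>)
  also have "\<dots> = (\<Oplus>\<^bsub>T\<^esub>a\<in>S. \<Oplus>\<^bsub>T\<^esub>k\<in>S. \<Oplus>\<^bsub>T\<^esub>b\<in>S. ?f k a b)"
    by (rule T.fs_swap) (use fin x y in simp_all)
  also have "\<dots> = (\<Oplus>\<^bsub>T\<^esub>a\<in>S. t (x a \<otimes>\<^bsub>A\<^esub> x' a) \<one>\<^bsub>B\<^esub>)"
  proof (rule T.fs_cong)
    fix a assume a: "a \<in> S"
    have "(\<Oplus>\<^bsub>T\<^esub>k\<in>S. \<Oplus>\<^bsub>T\<^esub>b\<in>S. ?f k a b) = (\<Oplus>\<^bsub>T\<^esub>b\<in>S. \<Oplus>\<^bsub>T\<^esub>k\<in>S. ?f k a b)"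
      by (rule T.fs_swap) (use fin x y a in simp_all)
    also have "\<dots> = (\<Oplus>\<^bsub>T\<^esub>b\<in>S. t (x a \<otimes>\<^bsub>A\<^esub> x' b) (if a = b then \<one>\<^bsub>B\<^esub> else \<zero>\<^bsub>B\<^esub>))"
      by (rule T.fs_cong) (use x y a in \<open>simp_all flip: t_fs_right d\<close>)
    also have "\<dots> = t (x a \<otimes>\<^bsub>A\<^esub> x' a) (if a = a then \<one>\<^bsub>B\<^esub> else \<zero>\<^bsub>B\<^esub>)"
      by (rule T.fs_delta) (use fin x a in simp_all)
    finally show "(\<Oplus>\<^bsub>T\<^esub>k\<in>S. \<Oplus>\<^bsub>T\<^esub>b\<in>S. ?f k a b) = t (x a \<otimes>\<^bsub>A\<^esub> x' a) \<one>\<^bsub>B\<^esub>" by simp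
  qed (use x in simp_all)
  also have "\<dots> = t (\<Oplus>\<^bsub>A\<^esub>a\<in>S. x a \<otimes>\<^bsub>A\<^esub> x' a) \<one>\<^bsub>B\<^esub>"
    by (rule t_fs_left[symmetric]) (use x in simp_all)
  finally show ?thesis .
qed

lemma t_contract_left:
  assumes fin: "finite S" and x: "\<And>a. a \<in> S \<Longrightarrow> x a \<in> carrier B" "\<And>a. a \<in> S \<Longrightarrow> x' a \<in> carrier B"
    and y: "\<And>a k. a \<in> S \<Longrightarrow> k \<in> S \<Longrightarrow> y a k \<in> carrier A" "\<And>a k. a \<in> S \<Longrightarrow> k \<in> S \<Longrightarrow> y' a k \<in> carrier A"
    and d: "\<And>a b. a \<in> S \<Longrightarrow> b \<in> S \<Longrightarrow> (\<Oplus>\<^bsub>A\<^esub>k\<in>S. y a k \<otimes>\<^bsub>A\<^esub> y' b k) = (if a = b then \<one>\<^bsub>A\<^esub> else \<zero>\<^bsub>A\<^esub>)"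
  shows "(\<Oplus>\<^bsub>T\<^esub>k\<in>S. (\<Oplus>\<^bsub>T\<^esub>a\<in>S. t (y a k) (x a)) \<otimes>\<^bsub>T\<^esub> (\<Oplus>\<^bsub>T\<^esub>b\<in>S. t (y' b k) (x' b)))
    = t \<one>\<^bsub>A\<^esub> (\<Oplus>\<^bsub>B\<^esub>a\<in>S. x a \<otimes>\<^bsub>B\<^esub> x' a)"
proof -
  interpret T: star_algebra T by (rule star_algebra_T)
  let ?f = "\<lambda>k a b. t (y a k \<otimes>\<^bsub>A\<^esub> y' b k) (x a \<otimes>\<^bsub>B\<^esub> x' b)"
  have "(\<Oplus>\<^bsub>T\<^esub>k\<in>S. (\<Oplus>\<^bsub>T\<^esub>a\<in>S. t (y a k) (x a)) \<otimes>\<^bsub>T\<^esub> (\<Oplus>\<^bsub>T\<^esub>b\<in>S. t (y' b k) (x' b)))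
    = (\<Oplus>\<^bsub>T\<^esub>k\<in>S. \<Oplus>\<^bsub>T\<^esub>a\<in>S. \<Oplus>\<^bsub>T\<^esub>b\<in>S. ?f k a b)"
    by (rule T.fs_cong) (use x y in \<open>simp_all add: t_sums_mult\<close>)
  also have "\<dots> = (\<Oplus>\<^bsub>T\<^esub>a\<in>S. \<Oplus>\<^bsub>T\<^esub>k\<in>S. \<Oplus>\<^bsub>T\<^esub>b\<in>S. ?f k a b)"
    by (rule T.fs_swap) (use fin x y in simp_all)
  also have "\<dots> = (\<Oplus>\<^bsub>T\<^esub>a\<in>S. t \<one>\<^bsub>A\<^esub> (x a \<otimes>\<^bsub>B\<^esub> x' a))"
  proof (rule T.fs_cong)
    fix a assume a: "a \<in> S"
    have "(\<Oplus>\<^bsub>T\<^esub>k\<in>S. \<Oplus>\<^bsub>T\<^esub>b\<in>S. ?f k a b) = (\<Oplus>\<^bsub>T\<^esub>b\<in>S. \<Oplus>\<^bsub>T\<^esub>k\<in>S. ?f k a b)"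
      by (rule T.fs_swap) (use fin x y a in simp_all)
    also have "\<dots> = (\<Oplus>\<^bsub>T\<^esub>b\<in>S. t (if a = b then \<one>\<^bsub>A\<^esub> else \<zero>\<^bsub>A\<^esub>) (x a \<otimes>\<^bsub>B\<^esub> x' b))"
      by (rule T.fs_cong) (use x y a in \<open>simp_all flip: t_fs_left d\<close>)
    also have "\<dots> = t (if a = a then \<one>\<^bsub>A\<^esub> else \<zero>\<^bsub>A\<^esub>) (x a \<otimes>\<^bsub>B\<^esub> x' a)"
      by (rule T.fs_delta) (use fin x a in simp_all)
    finally show "(\<Oplus>\<^bsub>T\<^esub>k\<in>S. \<Oplus>\<^bsub>T\<^esub>b\<in>S. ?f k a b) = t \<one>\<^bsub>A\<^esub> (x a \<otimes>\<^bsub>B\<^esub> x' a)" by simp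
  qed (use x in simp_all)
  also have "\<dots> = t \<one>\<^bsub>A\<^esub> (\<Oplus>\<^bsub>B\<^esub>a\<in>S. x a \<otimes>\<^bsub>B\<^esub> x' a)"
    by (rule t_fs_right[symmetric]) (use x in simp_all)
  finally show ?thesis .
qed

lemma t_pow: "a \<in> carrier A \<Longrightarrow> b \<in> carrier B \<Longrightarrow> t a b [^]\<^bsub>T\<^esub> (m::nat) = t (a [^]\<^bsub>A\<^esub> m) (b [^]\<^bsub>B\<^esub> m)"
proof (induction m)
  interpret T: star_algebra T by (rule star_algebra_T)
  case 0
  then show ?case by (simp add: t_one)
next
  interpret T: star_algebra T by (rule star_algebra_T)
  case (Suc m)
  then show ?case by (simp add: t_mult)
qed

end

text \<open>Unitarity follows by contracting one tensor factor after the other. Normality, the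
  partial isometry law and the power law need products of the entries \<Delta>(u_ij) to be diagonal
  sums, which the orthogonality within the rows of \<open>u\<close> provides.\<close>

lemma quantum_reflection_matrix_tensor:
  assumes A: "star_algebra A" "reduced_star_alg A" and s: "s \<ge> 1" and fin: "finite I"
    and u: "quantum_reflection_matrix A s I u"
  shows "quantum_reflection_matrix (tensor A A) s I (\<lambda>i j. \<Oplus>\<^bsub>tensor A A\<^esub>k\<in>I. pure_tensor A A (u i k) (u k j))"
proof -
  interpret star_algebra_pair A A by (intro star_algebra_pair.intro A)
  interpret T: star_algebra T by (rule star_algebra_T)
  note D = quantum_reflection_matrixD[OF u]
  have [simp]: "u v w \<in> carrier A" if "v \<in> I" "w \<in> I" for v w using D(1)[OF that] .
  let ?N = "\<lambda>i j. \<Oplus>\<^bsub>T\<^esub>k\<in>I. t (u i k) (u k j)"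
  let ?M = "\<lambda>i j. \<Oplus>\<^bsub>T\<^esub>k\<in>I. t (star A (u i k)) (star A (u k j))"
  have starN: "star T (?N i j) = ?M i j" if "i \<in> I" "j \<in> I" for i j
    by (rule diagonal_star) (use that in simp_all)
  have starM: "star T (?M i j) = ?N i j" if "i \<in> I" "j \<in> I" for i j
    unfolding starN[OF that, symmetric] using that by simp
  have N: "?N i j \<in> carrier T" "?M i j \<in> carrier T" if "i \<in> I" "j \<in> I" for i j using that by simp_all
  note orth = quantum_reflection_orthogonal[OF A s fin u]
  have one: "t (if P then \<one>\<^bsub>A\<^esub> else \<zero>\<^bsub>A\<^esub>) \<one>\<^bsub>A\<^esub> = (if P then \<one>\<^bsub>T\<^esub> else \<zero>\<^bsub>T\<^esub>)"
    "t \<one>\<^bsub>A\<^esub> (if P then \<one>\<^bsub>A\<^esub> else \<zero>\<^bsub>A\<^esub>) = (if P then \<one>\<^bsub>T\<^esub> else \<zero>\<^bsub>T\<^esub>)" for P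
    by (simp_all add: t_one)
  have c: "finsum T f I = x" if "finsum T g I = x" "\<And>k. k \<in> I \<Longrightarrow> f k = g k" "\<And>k. k \<in> I \<Longrightarrow> g k \<in> carrier T" for f g x
    using T.fs_cong[of I I f g] that by auto
  show ?thesis
  proof (rule quantum_reflection_matrixI)
    fix i j assume ij: "i \<in> I" "j \<in> I"
    show "?N i j \<in> carrier T" using ij by simp
    have "(\<Oplus>\<^bsub>T\<^esub>k\<in>I. ?N i k \<otimes>\<^bsub>T\<^esub> ?M j k) = t (\<Oplus>\<^bsub>A\<^esub>k\<in>I. u i k \<otimes>\<^bsub>A\<^esub> star A (u j k)) \<one>\<^bsub>A\<^esub>"
      by (rule t_contract_right) (use fin ij D(2) in simp_all)
    then have *: "(\<Oplus>\<^bsub>T\<^esub>k\<in>I. ?N i k \<otimes>\<^bsub>T\<^esub> ?M j k) = (if i = j then \<one>\<^bsub>T\<^esub> else \<zero>\<^bsub>T\<^esub>)"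
      by (simp only: D(2)[OF ij] one)
    show "(\<Oplus>\<^bsub>T\<^esub>k\<in>I. ?N i k \<otimes>\<^bsub>T\<^esub> star T (?N j k)) = (if i = j then \<one>\<^bsub>T\<^esub> else \<zero>\<^bsub>T\<^esub>)"
      by (rule c[OF *]) (use ij in \<open>simp_all add: starN\<close>)
    have "(\<Oplus>\<^bsub>T\<^esub>k\<in>I. ?M k i \<otimes>\<^bsub>T\<^esub> ?N k j) = t \<one>\<^bsub>A\<^esub> (\<Oplus>\<^bsub>A\<^esub>k\<in>I. star A (u k i) \<otimes>\<^bsub>A\<^esub> u k j)"
      by (rule t_contract_left) (use fin ij D(3) in simp_all)
    then have *: "(\<Oplus>\<^bsub>T\<^esub>k\<in>I. ?M k i \<otimes>\<^bsub>T\<^esub> ?N k j) = (if i = j then \<one>\<^bsub>T\<^esub> else \<zero>\<^bsub>T\<^esub>)"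
      by (simp only: D(3)[OF ij] one)
    show "(\<Oplus>\<^bsub>T\<^esub>k\<in>I. star T (?N k i) \<otimes>\<^bsub>T\<^esub> ?N k j) = (if i = j then \<one>\<^bsub>T\<^esub> else \<zero>\<^bsub>T\<^esub>)"
      by (rule c[OF *]) (use ij in \<open>simp_all add: starN\<close>)
    have D4: "(\<Oplus>\<^bsub>A\<^esub>k\<in>I. star A (u i k) \<otimes>\<^bsub>A\<^esub> u j k) = (if i = j then \<one>\<^bsub>A\<^esub> else \<zero>\<^bsub>A\<^esub>)"
      if "i \<in> I" "j \<in> I" for i j
      unfolding D(4)[OF that, symmetric] by (rule A.fs_cong) (use that in simp_all)
    have D5: "(\<Oplus>\<^bsub>A\<^esub>k\<in>I. u k i \<otimes>\<^bsub>A\<^esub> star A (u k j)) = (if i = j then \<one>\<^bsub>A\<^esub> else \<zero>\<^bsub>A\<^esub>)"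
      if "i \<in> I" "j \<in> I" for i j
      unfolding D(5)[OF that, symmetric] by (rule A.fs_cong) (use that in simp_all)
    have "(\<Oplus>\<^bsub>T\<^esub>k\<in>I. ?M i k \<otimes>\<^bsub>T\<^esub> ?N j k) = t (\<Oplus>\<^bsub>A\<^esub>k\<in>I. star A (u i k) \<otimes>\<^bsub>A\<^esub> u j k) \<one>\<^bsub>A\<^esub>"
      by (rule t_contract_right) (use fin ij D4 in simp_all)
    then have *: "(\<Oplus>\<^bsub>T\<^esub>k\<in>I. ?M i k \<otimes>\<^bsub>T\<^esub> ?N j k) = (if i = j then \<one>\<^bsub>T\<^esub> else \<zero>\<^bsub>T\<^esub>)"
      by (simp only: D4[OF ij] one)
    show "(\<Oplus>\<^bsub>T\<^esub>k\<in>I. star T (?N i k) \<otimes>\<^bsub>T\<^esub> star T (star T (?N j k))) = (if i = j then \<one>\<^bsub>T\<^esub> else \<zero>\<^bsub>T\<^esub>)"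
      by (rule c[OF *]) (use ij in \<open>simp_all add: starN starM\<close>)
    have "(\<Oplus>\<^bsub>T\<^esub>k\<in>I. ?N k i \<otimes>\<^bsub>T\<^esub> ?M k j) = t \<one>\<^bsub>A\<^esub> (\<Oplus>\<^bsub>A\<^esub>k\<in>I. u k i \<otimes>\<^bsub>A\<^esub> star A (u k j))"
      by (rule t_contract_left) (use fin ij D5 in simp_all)
    then have *: "(\<Oplus>\<^bsub>T\<^esub>k\<in>I. ?N k i \<otimes>\<^bsub>T\<^esub> ?M k j) = (if i = j then \<one>\<^bsub>T\<^esub> else \<zero>\<^bsub>T\<^esub>)"
      by (simp only: D5[OF ij] one)
    show "(\<Oplus>\<^bsub>T\<^esub>k\<in>I. star T (star T (?N k i)) \<otimes>\<^bsub>T\<^esub> star T (?N k j)) = (if i = j then \<one>\<^bsub>T\<^esub> else \<zero>\<^bsub>T\<^esub>)"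
      by (rule c[OF *]) (use ij in \<open>simp_all add: starN starM\<close>)
    let ?e = "\<lambda>i j. u i j \<otimes>\<^bsub>A\<^esub> star A (u i j)"
    have NM: "?N i j \<otimes>\<^bsub>T\<^esub> ?M i j = (\<Oplus>\<^bsub>T\<^esub>k\<in>I. t (?e i k) (?e k j))"
      by (rule diagonal_mult) (use fin ij orth in simp_all)
    have "?M i j \<otimes>\<^bsub>T\<^esub> ?N i j = (\<Oplus>\<^bsub>T\<^esub>k\<in>I. t (star A (u i k) \<otimes>\<^bsub>A\<^esub> u i k) (star A (u k j) \<otimes>\<^bsub>A\<^esub> u k j))"
      by (rule diagonal_mult) (use fin ij orth in simp_all)
    also have "\<dots> = (\<Oplus>\<^bsub>T\<^esub>k\<in>I. t (?e i k) (?e k j))"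
      by (rule T.fs_cong) (use ij D(6) in simp_all)
    finally show "?N i j \<otimes>\<^bsub>T\<^esub> star T (?N i j) = star T (?N i j) \<otimes>\<^bsub>T\<^esub> ?N i j"
      unfolding starN[OF ij] NM by (rule sym)
    have "(\<Oplus>\<^bsub>T\<^esub>k\<in>I. t (?e i k) (?e k j)) \<otimes>\<^bsub>T\<^esub> ?N i j = (\<Oplus>\<^bsub>T\<^esub>k\<in>I. t (?e i k \<otimes>\<^bsub>A\<^esub> u i k) (?e k j \<otimes>\<^bsub>A\<^esub> u k j))"
      by (rule diagonal_mult) (use fin ij orth in \<open>simp_all add: A.m_assoc\<close>)
    also have "\<dots> = ?N i j"
      by (rule T.fs_cong) (use ij D(7) in simp_all)
    finally show "?N i j \<otimes>\<^bsub>T\<^esub> star T (?N i j) \<otimes>\<^bsub>T\<^esub> ?N i j = ?N i j"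
      unfolding starN[OF ij] NM .
    \<comment> \<open>\<open>orthogonal_sum_pow\<close> expects a successor exponent and explicit
      coefficients, here all equal to 1.\<close>
    obtain m where m: "s = Suc m" using s by (cases s) auto
    have "?N i j = (\<Oplus>\<^bsub>T\<^esub>k\<in>I. 1 \<odot>\<^bsub>T\<^esub> t (u i k) (u k j))"
      by (rule T.fs_cong) (use ij in simp_all)
    then have "?N i j [^]\<^bsub>T\<^esub> s = (\<Oplus>\<^bsub>T\<^esub>k\<in>I. 1 \<odot>\<^bsub>T\<^esub> t (u i k) (u k j)) [^]\<^bsub>T\<^esub> Suc m" by (simp only: m)
    also have "\<dots> = (\<Oplus>\<^bsub>T\<^esub>k\<in>I. (1 ^ Suc m) \<odot>\<^bsub>T\<^esub> (t (u i k) (u k j) [^]\<^bsub>T\<^esub> Suc m))"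
      by (rule T.orthogonal_sum_pow) (use fin ij orth in \<open>simp_all add: t_mult\<close>)
    also have "\<dots> = (\<Oplus>\<^bsub>T\<^esub>k\<in>I. t (?e i k) (?e k j))"
    proof (rule T.fs_cong)
      fix k assume k: "k \<in> I"
      have "t (u i k) (u k j) [^]\<^bsub>T\<^esub> s = t (u i k [^]\<^bsub>A\<^esub> s) (u k j [^]\<^bsub>A\<^esub> s)"
        by (rule t_pow) (use ij k in simp_all)
      then have "t (u i k) (u k j) [^]\<^bsub>T\<^esub> s = t (?e i k) (?e k j)" by (simp only: D(8)[OF ij(1) k] D(8)[OF k ij(2)])
      then show "(1 ^ Suc m) \<odot>\<^bsub>T\<^esub> (t (u i k) (u k j) [^]\<^bsub>T\<^esub> Suc m) = t (?e i k) (?e k j)"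
        unfolding m power_one using k ij by (simp del: nat_pow_Suc)
    qed (use ij in simp_all)
    finally show "?N i j [^]\<^bsub>T\<^esub> s = ?N i j \<otimes>\<^bsub>T\<^esub> star T (?N i j)"
      unfolding starN[OF ij] NM .
  qed
qed

section \<open>Conjugation by a Hadamard matrix\<close>

lemma hadamard_inverse:
  fixes H :: "complex^'n^'n"
  assumes "complex_hadamard H"
  shows "matrix_inv H $ i $ j = cnj (H $ j $ i) / of_nat CARD('n)"
    "(\<Sum>k\<in>UNIV. H $ i $ k * matrix_inv H $ k $ j) = of_bool (i = j)"
    "(\<Sum>k\<in>UNIV. matrix_inv H $ i $ k * H $ k $ j) = of_bool (i = j)"
proof -
  define K :: "complex^'n^'n" where "K = (\<chi> i j. cnj (H $ j $ i) / of_nat CARD('n))"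
  have HH: "H ** map_matrix cnj (transpose H) = mat (of_nat CARD('n))"
    using assms by (simp add: complex_hadamard_def)
  have HK: "H ** K = mat 1"
  proof -
    have "(\<Sum>k\<in>UNIV. H $ a $ k * cnj (H $ b $ k)) = (if a = b then of_nat CARD('n) else 0)" for a b
      using arg_cong[OF HH, of "\<lambda>M. M $ a $ b"]
      by (simp add: matrix_matrix_mult_def mat_def transpose_def map_matrix_def)
    then have "(\<Sum>k\<in>UNIV. H $ a $ k * (cnj (H $ b $ k) / of_nat CARD('n))) = (if a = b then 1 else 0)" for a b
      by (simp flip: sum_divide_distrib)
    then show ?thesis
      by (simp add: K_def matrix_matrix_mult_def mat_def vec_eq_iff)
  qed
  \<comment> \<open>A right inverse of a square matrix is two-sided, so the choice made by
    \<open>matrix_inv\<close> can only be \<open>K\<close>, the adjoint of \<open>H\<close> divided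
    by n.\<close>
  then have KH: "K ** H = mat 1" using matrix_left_right_inverse by blast
  have "H ** matrix_inv H = mat 1"
    using someI[of "\<lambda>B. H ** B = mat 1 \<and> B ** H = mat 1" K] HK KH by (simp add: matrix_inv_def)
  then have "K ** (H ** matrix_inv H) = K" by simp
  then have inv: "matrix_inv H = K" by (simp add: matrix_mul_assoc KH)
  show "matrix_inv H $ i $ j = cnj (H $ j $ i) / of_nat CARD('n)" by (simp add: inv K_def)
  show "(\<Sum>k\<in>UNIV. H $ i $ k * matrix_inv H $ k $ j) = of_bool (i = j)"
    using arg_cong[OF HK, of "\<lambda>M. M $ i $ j"] by (simp add: inv matrix_matrix_mult_def mat_def of_bool_def)
  show "(\<Sum>k\<in>UNIV. matrix_inv H $ i $ k * H $ k $ j) = of_bool (i = j)"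
    using arg_cong[OF KH, of "\<lambda>M. M $ i $ j"] by (simp add: inv matrix_matrix_mult_def mat_def of_bool_def)
qed

lemma (in star_algebra) fs_scale_double:
  assumes "finite S" "finite K" "finite L" and x: "\<And>k l. k \<in> K \<Longrightarrow> l \<in> L \<Longrightarrow> x k l \<in> carrier A"
  shows "(\<Oplus>m\<in>S. c m \<odot> (\<Oplus>k\<in>K. \<Oplus>l\<in>L. g m k l \<odot> x k l)) = (\<Oplus>k\<in>K. \<Oplus>l\<in>L. (\<Sum>m\<in>S. c m * g m k l) \<odot> x k l)"
proof -
  have "(\<Oplus>m\<in>S. c m \<odot> (\<Oplus>k\<in>K. \<Oplus>l\<in>L. g m k l \<odot> x k l)) = (\<Oplus>m\<in>S. \<Oplus>k\<in>K. \<Oplus>l\<in>L. (c m * g m k l) \<odot> x k l)"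
  proof (rule fs_cong)
    fix m
    have "c m \<odot> (\<Oplus>k\<in>K. \<Oplus>l\<in>L. g m k l \<odot> x k l) = (\<Oplus>k\<in>K. c m \<odot> (\<Oplus>l\<in>L. g m k l \<odot> x k l))"
      by (rule fs_scale) (use x in simp)
    also have "\<dots> = (\<Oplus>k\<in>K. \<Oplus>l\<in>L. (c m * g m k l) \<odot> x k l)"
    proof (rule fs_cong)
      fix k assume k: "k \<in> K"
      have "c m \<odot> (\<Oplus>l\<in>L. g m k l \<odot> x k l) = (\<Oplus>l\<in>L. c m \<odot> (g m k l \<odot> x k l))"
        by (rule fs_scale) (use x k in simp)
      also have "\<dots> = (\<Oplus>l\<in>L. (c m * g m k l) \<odot> x k l)" by (rule fs_cong) (use x k in simp_all)
      finally show "c m \<odot> (\<Oplus>l\<in>L. g m k l \<odot> x k l) = (\<Oplus>l\<in>L. (c m * g m k l) \<odot> x k l)" .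
    qed (use x in simp_all)
    finally show "c m \<odot> (\<Oplus>k\<in>K. \<Oplus>l\<in>L. g m k l \<odot> x k l) = (\<Oplus>k\<in>K. \<Oplus>l\<in>L. (c m * g m k l) \<odot> x k l)" .
  qed (use x in simp_all)
  also have "\<dots> = (\<Oplus>k\<in>K. \<Oplus>m\<in>S. \<Oplus>l\<in>L. (c m * g m k l) \<odot> x k l)"
    by (rule fs_swap) (use assms in simp_all)
  also have "\<dots> = (\<Oplus>k\<in>K. \<Oplus>l\<in>L. (\<Sum>m\<in>S. c m * g m k l) \<odot> x k l)"
  proof (rule fs_cong)
    fix k assume k: "k \<in> K"
    have "(\<Oplus>m\<in>S. \<Oplus>l\<in>L. (c m * g m k l) \<odot> x k l) = (\<Oplus>l\<in>L. \<Oplus>m\<in>S. (c m * g m k l) \<odot> x k l)"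
      by (rule fs_swap) (use assms k in simp_all)
    also have "\<dots> = (\<Oplus>l\<in>L. (\<Sum>m\<in>S. c m * g m k l) \<odot> x k l)"
      by (rule fs_cong) (use x k in \<open>simp_all add: fs_scale_left\<close>)
    finally show "(\<Oplus>m\<in>S. \<Oplus>l\<in>L. (c m * g m k l) \<odot> x k l) = (\<Oplus>l\<in>L. (\<Sum>m\<in>S. c m * g m k l) \<odot> x k l)" .
  qed (use x in simp_all)
  finally show ?thesis .
qed

context star_algebra
begin

lemma fs_cong2:
  assumes "\<And>k l. k \<in> K \<Longrightarrow> l \<in> L \<Longrightarrow> f k l = g k l" "\<And>k l. k \<in> K \<Longrightarrow> l \<in> L \<Longrightarrow> g k l \<in> carrier A"
  shows "(\<Oplus>k\<in>K. \<Oplus>l\<in>L. f k l) = (\<Oplus>k\<in>K. \<Oplus>l\<in>L. g k l)"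
  by (intro fs_cong refl fs_closed) (use assms in simp_all)

lemma conjugate_by_closed [simp, intro]:
  "(\<And>i j. p i j \<in> carrier A) \<Longrightarrow> conjugate_by A H p i j \<in> carrier A"
  unfolding conjugate_by_def by simp

text \<open>These are the entries of H q = p H and, since the inverse of H is its adjoint divided by
  n, those of q H^-1 = H^-1 p with the factor 1 / n cleared.\<close>

lemma hadamard_commute:
  fixes H :: "complex^'n^'n"
  assumes H: "complex_hadamard H" and p: "\<And>i j. p i j \<in> carrier A"
  shows "(\<Oplus>k\<in>UNIV. H $ i $ k \<odot> conjugate_by A H p k j) = (\<Oplus>k\<in>UNIV. H $ k $ j \<odot> p i k)"
    "(\<Oplus>k\<in>UNIV. cnj (H $ i $ k) \<odot> conjugate_by A H p j k) = (\<Oplus>k\<in>UNIV. cnj (H $ k $ j) \<odot> p k i)"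
proof -
  note I = hadamard_inverse[OF H]
  have "(\<Oplus>k\<in>UNIV. H $ i $ k \<odot> conjugate_by A H p k j)
    = (\<Oplus>k\<in>UNIV. \<Oplus>l\<in>UNIV. (\<Sum>m\<in>UNIV. H $ i $ m * (matrix_inv H $ m $ k * H $ l $ j)) \<odot> p k l)"
    unfolding conjugate_by_def by (rule fs_scale_double) (simp_all add: p)
  also have "\<dots> = (\<Oplus>k\<in>UNIV. \<Oplus>l\<in>UNIV. (of_bool (i = k) * H $ l $ j) \<odot> p k l)"
    by (rule fs_cong2) (simp_all add: p flip: sum_distrib_right mult.assoc I(2))
  also have "\<dots> = (\<Oplus>l\<in>UNIV. (of_bool (i = i) * H $ l $ j) \<odot> p i l)"
    by (rule fs_delta) (simp_all add: p)
  finally show "(\<Oplus>k\<in>UNIV. H $ i $ k \<odot> conjugate_by A H p k j) = (\<Oplus>k\<in>UNIV. H $ k $ j \<odot> p i k)" by simp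
  \<comment> \<open>The factor 1 / n is moved from the entry \<open>matrix_inv H $ j $ k\<close> to
    the conjugate of \<open>H $ i $ m\<close>, which turns the latter into
    \<open>matrix_inv H $ m $ i\<close>.\<close>
  have n: "(\<Sum>m\<in>UNIV. cnj (H $ i $ m) * (matrix_inv H $ j $ k * H $ l $ m)) = of_bool (l = i) * cnj (H $ k $ j)" for k l
  proof -
    have "(\<Sum>m\<in>UNIV. cnj (H $ i $ m) * (matrix_inv H $ j $ k * H $ l $ m))
      = (\<Sum>m\<in>UNIV. H $ l $ m * matrix_inv H $ m $ i) * cnj (H $ k $ j)"
      unfolding sum_distrib_right by (rule sum.cong) (simp_all add: I(1) mult_ac)
    then show ?thesis by (simp add: I(2))
  qed
  have "(\<Oplus>k\<in>UNIV. cnj (H $ i $ k) \<odot> conjugate_by A H p j k)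
    = (\<Oplus>k\<in>UNIV. \<Oplus>l\<in>UNIV. (\<Sum>m\<in>UNIV. cnj (H $ i $ m) * (matrix_inv H $ j $ k * H $ l $ m)) \<odot> p k l)"
    unfolding conjugate_by_def by (rule fs_scale_double) (simp_all add: p)
  also have "\<dots> = (\<Oplus>k\<in>UNIV. \<Oplus>l\<in>UNIV. (of_bool (l = i) * cnj (H $ k $ j)) \<odot> p k l)"
    unfolding n ..
  also have "\<dots> = (\<Oplus>k\<in>UNIV. cnj (H $ k $ j) \<odot> p k i)"
  proof (rule fs_cong)
    fix k
    have "(\<Oplus>l\<in>UNIV. (of_bool (l = i) * cnj (H $ k $ j)) \<odot> p k l) = (of_bool (i = i) * cnj (H $ k $ j)) \<odot> p k i"
      by (rule fs_delta) (simp_all add: p)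
    then show "(\<Oplus>l\<in>UNIV. (of_bool (l = i) * cnj (H $ k $ j)) \<odot> p k l) = cnj (H $ k $ j) \<odot> p k i" by simp
  qed (simp_all add: p)
  finally show "(\<Oplus>k\<in>UNIV. cnj (H $ i $ k) \<odot> conjugate_by A H p j k) = (\<Oplus>k\<in>UNIV. cnj (H $ k $ j) \<odot> p k i)" .
qed

end

lemma (in star_algebra_hom) hom_conjugate_by:
  assumes "\<And>i j. p i j \<in> carrier A"
  shows "h (conjugate_by A H p i j) = conjugate_by B H (\<lambda>i j. h (p i j)) i j"
proof -
  have "h (conjugate_by A H p i j)
    = (\<Oplus>\<^bsub>B\<^esub>k\<in>UNIV. h (\<Oplus>\<^bsub>A\<^esub>l\<in>UNIV. (matrix_inv H $ i $ k * H $ l $ j) \<odot>\<^bsub>A\<^esub> p k l))"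
    unfolding conjugate_by_def by (rule hom_fs) (simp add: assms)
  also have "\<dots> = conjugate_by B H (\<lambda>i j. h (p i j)) i j"
    unfolding conjugate_by_def
  proof (rule B.fs_cong)
    fix k
    have "h (\<Oplus>\<^bsub>A\<^esub>l\<in>UNIV. (matrix_inv H $ i $ k * H $ l $ j) \<odot>\<^bsub>A\<^esub> p k l)
      = (\<Oplus>\<^bsub>B\<^esub>l\<in>UNIV. h ((matrix_inv H $ i $ k * H $ l $ j) \<odot>\<^bsub>A\<^esub> p k l))"
      by (rule hom_fs) (simp add: assms)
    then show "h (\<Oplus>\<^bsub>A\<^esub>l\<in>UNIV. (matrix_inv H $ i $ k * H $ l $ j) \<odot>\<^bsub>A\<^esub> p k l)
      = (\<Oplus>\<^bsub>B\<^esub>l\<in>UNIV. (matrix_inv H $ i $ k * H $ l $ j) \<odot>\<^bsub>B\<^esub> h (p k l))"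
      by (simp add: assms)
  qed (simp_all add: assms hom_closed)
  finally show ?thesis .
qed

lemma conjugate_by_complex:
  fixes H :: "complex^'n^'n"
  assumes "complex_hadamard H"
  shows "conjugate_by complex_star_alg H (\<lambda>i j. of_bool (i = j)) i j = of_bool (i = j)"
proof -
  have c: "x \<odot>\<^bsub>complex_star_alg\<^esub> y = x * y" for x y by (simp add: complex_star_alg_def)
  have "conjugate_by complex_star_alg H (\<lambda>i j. of_bool (i = j)) i j
    = (\<Sum>k\<in>UNIV. \<Sum>l\<in>UNIV. matrix_inv H $ i $ k * H $ l $ j * of_bool (k = l))"
    by (simp add: conjugate_by_def c)
  also have "\<dots> = (\<Sum>k\<in>UNIV. matrix_inv H $ i $ k * H $ k $ j)" by simp
  finally show ?thesis by (simp only: hadamard_inverse(3)[OF assms])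
qed

text \<open>The adjoint of a conjugate is the conjugate of the adjoint because H is unitary up to a
  scalar: conjugating the coefficients exchanges the roles of H and its inverse.\<close>

lemma conjugate_by_opposite:
  fixes H :: "complex^'n^'n"
  assumes A: "star_algebra A" and H: "complex_hadamard H" and p: "\<And>i j. p i j \<in> carrier A"
  shows "conjugate_by (opposite A) H (\<lambda>i j. star A (p j i)) i j = star A (conjugate_by A H p j i)"
proof -
  interpret star_algebra A by fact
  have o: "smult (opposite A) = smult A" by (simp add: opposite_def)
  have "star A (conjugate_by A H p j i)
    = (\<Oplus>\<^bsub>A\<^esub>k\<in>UNIV. \<Oplus>\<^bsub>A\<^esub>l\<in>UNIV. star A ((matrix_inv H $ j $ k * H $ l $ i) \<odot>\<^bsub>A\<^esub> p k l))"
    unfolding conjugate_by_def by (simp add: fs_star p)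
  also have "\<dots> = (\<Oplus>\<^bsub>A\<^esub>k\<in>UNIV. \<Oplus>\<^bsub>A\<^esub>l\<in>UNIV. (matrix_inv H $ i $ l * H $ k $ j) \<odot>\<^bsub>A\<^esub> star A (p k l))"
  proof (rule fs_cong2)
    fix k l
    have "cnj (matrix_inv H $ j $ k * H $ l $ i) = matrix_inv H $ i $ l * H $ k $ j"
      by (simp add: hadamard_inverse(1)[OF H])
    then show "star A ((matrix_inv H $ j $ k * H $ l $ i) \<odot>\<^bsub>A\<^esub> p k l) = (matrix_inv H $ i $ l * H $ k $ j) \<odot>\<^bsub>A\<^esub> star A (p k l)"
      by (simp only: star_scale[OF p])
  qed (simp add: p)
  also have "\<dots> = (\<Oplus>\<^bsub>A\<^esub>l\<in>UNIV. \<Oplus>\<^bsub>A\<^esub>k\<in>UNIV. (matrix_inv H $ i $ l * H $ k $ j) \<odot>\<^bsub>A\<^esub> star A (p k l))"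
    by (rule fs_swap) (simp_all add: p)
  finally show ?thesis by (simp add: conjugate_by_def o)
qed

lemma (in star_algebra_pair) t_sums:
  assumes "\<And>k. k \<in> S \<Longrightarrow> x k \<in> carrier A" "\<And>l. l \<in> S' \<Longrightarrow> y l \<in> carrier B"
  shows "t (\<Oplus>\<^bsub>A\<^esub>k\<in>S. c k \<odot>\<^bsub>A\<^esub> x k) (\<Oplus>\<^bsub>B\<^esub>l\<in>S'. d l \<odot>\<^bsub>B\<^esub> y l)
    = (\<Oplus>\<^bsub>T\<^esub>k\<in>S. \<Oplus>\<^bsub>T\<^esub>l\<in>S'. (c k * d l) \<odot>\<^bsub>T\<^esub> t (x k) (y l))"
proof -
  interpret T: star_algebra T by (rule star_algebra_T)
  have "t (\<Oplus>\<^bsub>A\<^esub>k\<in>S. c k \<odot>\<^bsub>A\<^esub> x k) (\<Oplus>\<^bsub>B\<^esub>l\<in>S'. d l \<odot>\<^bsub>B\<^esub> y l)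
    = (\<Oplus>\<^bsub>T\<^esub>k\<in>S. t (c k \<odot>\<^bsub>A\<^esub> x k) (\<Oplus>\<^bsub>B\<^esub>l\<in>S'. d l \<odot>\<^bsub>B\<^esub> y l))"
    by (rule t_fs_left) (use assms in simp_all)
  also have "\<dots> = (\<Oplus>\<^bsub>T\<^esub>k\<in>S. \<Oplus>\<^bsub>T\<^esub>l\<in>S'. (c k * d l) \<odot>\<^bsub>T\<^esub> t (x k) (y l))"
  proof (rule T.fs_cong)
    fix k assume k: "k \<in> S"
    have "t (c k \<odot>\<^bsub>A\<^esub> x k) (\<Oplus>\<^bsub>B\<^esub>l\<in>S'. d l \<odot>\<^bsub>B\<^esub> y l) = (\<Oplus>\<^bsub>T\<^esub>l\<in>S'. t (c k \<odot>\<^bsub>A\<^esub> x k) (d l \<odot>\<^bsub>B\<^esub> y l))"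
      by (rule t_fs_right) (use assms k in simp_all)
    also have "\<dots> = (\<Oplus>\<^bsub>T\<^esub>l\<in>S'. (c k * d l) \<odot>\<^bsub>T\<^esub> t (x k) (y l))"
      by (rule T.fs_cong) (use assms k in \<open>simp_all add: t_scale_left t_scale_right mult.commute\<close>)
    finally show "t (c k \<odot>\<^bsub>A\<^esub> x k) (\<Oplus>\<^bsub>B\<^esub>l\<in>S'. d l \<odot>\<^bsub>B\<^esub> y l) = (\<Oplus>\<^bsub>T\<^esub>l\<in>S'. (c k * d l) \<odot>\<^bsub>T\<^esub> t (x k) (y l))" .
  qed (use assms in simp_all)
  finally show ?thesis .
qed

text \<open>Between the tensor factors of the sum of q_im \<otimes> q_mj the product of H and its
  inverse appears and cancels; the outer coefficients remain.\<close>

lemma conjugate_by_tensor: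
  fixes H :: "complex^'n^'n"
  assumes A: "star_algebra A" and H: "complex_hadamard H" and p: "\<And>i j. p i j \<in> carrier A"
  shows "conjugate_by (tensor A A) H (\<lambda>i j. \<Oplus>\<^bsub>tensor A A\<^esub>k\<in>UNIV. pure_tensor A A (p i k) (p k j)) i j
    = (\<Oplus>\<^bsub>tensor A A\<^esub>k\<in>UNIV. pure_tensor A A (conjugate_by A H p i k) (conjugate_by A H p k j))"
proof -
  interpret star_algebra_pair A A by (intro star_algebra_pair.intro A)
  interpret T: star_algebra T by (rule star_algebra_T)
  let ?K = "matrix_inv H"
  note I = hadamard_inverse[OF H]
  \<comment> \<open>\<open>L l\<close> and \<open>R l\<close> are the entries of H^-1 p and p H in
    the fixed row \<open>i\<close> and column \<open>j\<close>, that is, \<open>q\<close> with the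
    outer matrix applied but not the inner one.\<close>
  define L where "L l = (\<Oplus>\<^bsub>A\<^esub>k\<in>UNIV. ?K $ i $ k \<odot>\<^bsub>A\<^esub> p k l)" for l
  define R where "R l = (\<Oplus>\<^bsub>A\<^esub>b\<in>UNIV. H $ b $ j \<odot>\<^bsub>A\<^esub> p l b)" for l
  have LR [simp]: "L l \<in> carrier A" "R l \<in> carrier A" for l by (simp_all add: L_def R_def p)
  have q1: "conjugate_by A H p i m = (\<Oplus>\<^bsub>A\<^esub>l\<in>UNIV. H $ l $ m \<odot>\<^bsub>A\<^esub> L l)" for m
  proof -
    have "conjugate_by A H p i m = (\<Oplus>\<^bsub>A\<^esub>l\<in>UNIV. \<Oplus>\<^bsub>A\<^esub>k\<in>UNIV. (?K $ i $ k * H $ l $ m) \<odot>\<^bsub>A\<^esub> p k l)"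
      unfolding conjugate_by_def by (rule A.fs_swap) (simp_all add: p)
    also have "\<dots> = (\<Oplus>\<^bsub>A\<^esub>l\<in>UNIV. H $ l $ m \<odot>\<^bsub>A\<^esub> L l)"
      unfolding L_def by (rule A.fs_cong) (simp_all add: p A.fs_scale mult.commute)
    finally show ?thesis .
  qed
  have q2: "conjugate_by A H p m j = (\<Oplus>\<^bsub>A\<^esub>a\<in>UNIV. ?K $ m $ a \<odot>\<^bsub>A\<^esub> R a)" for m
    unfolding conjugate_by_def R_def by (rule A.fs_cong) (simp_all add: p A.fs_scale)
  have "(\<Oplus>\<^bsub>T\<^esub>m\<in>UNIV. t (conjugate_by A H p i m) (conjugate_by A H p m j))
    = (\<Oplus>\<^bsub>T\<^esub>m\<in>UNIV. 1 \<odot>\<^bsub>T\<^esub> (\<Oplus>\<^bsub>T\<^esub>l\<in>UNIV. \<Oplus>\<^bsub>T\<^esub>a\<in>UNIV. (H $ l $ m * ?K $ m $ a) \<odot>\<^bsub>T\<^esub> t (L l) (R a)))"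
    unfolding q1 q2 by (rule T.fs_cong) (simp_all add: t_sums)
  also have "\<dots> = (\<Oplus>\<^bsub>T\<^esub>l\<in>UNIV. \<Oplus>\<^bsub>T\<^esub>a\<in>UNIV. (\<Sum>m\<in>UNIV. 1 * (H $ l $ m * ?K $ m $ a)) \<odot>\<^bsub>T\<^esub> t (L l) (R a))"
    by (rule T.fs_scale_double) simp_all
  also have "\<dots> = (\<Oplus>\<^bsub>T\<^esub>l\<in>UNIV. t (L l) (R l))"
  proof (rule T.fs_cong)
    fix l
    have "(\<Oplus>\<^bsub>T\<^esub>a\<in>UNIV. (\<Sum>m\<in>UNIV. 1 * (H $ l $ m * ?K $ m $ a)) \<odot>\<^bsub>T\<^esub> t (L l) (R a))
      = (\<Sum>m\<in>UNIV. 1 * (H $ l $ m * ?K $ m $ l)) \<odot>\<^bsub>T\<^esub> t (L l) (R l)"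
      by (rule T.fs_delta) (simp_all add: I(2))
    then show "(\<Oplus>\<^bsub>T\<^esub>a\<in>UNIV. (\<Sum>m\<in>UNIV. 1 * (H $ l $ m * ?K $ m $ a)) \<odot>\<^bsub>T\<^esub> t (L l) (R a)) = t (L l) (R l)"
      by (simp add: I(2))
  qed simp_all
  also have "\<dots> = (\<Oplus>\<^bsub>T\<^esub>l\<in>UNIV. \<Oplus>\<^bsub>T\<^esub>k\<in>UNIV. \<Oplus>\<^bsub>T\<^esub>b\<in>UNIV. (?K $ i $ k * H $ b $ j) \<odot>\<^bsub>T\<^esub> t (p k l) (p l b))"
    unfolding L_def R_def by (rule T.fs_cong) (simp_all add: t_sums p)
  also have "\<dots> = (\<Oplus>\<^bsub>T\<^esub>k\<in>UNIV. \<Oplus>\<^bsub>T\<^esub>l\<in>UNIV. \<Oplus>\<^bsub>T\<^esub>b\<in>UNIV. (?K $ i $ k * H $ b $ j) \<odot>\<^bsub>T\<^esub> t (p k l) (p l b))"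
    by (rule T.fs_swap) (simp_all add: p)
  also have "\<dots> = (\<Oplus>\<^bsub>T\<^esub>k\<in>UNIV. \<Oplus>\<^bsub>T\<^esub>b\<in>UNIV. \<Oplus>\<^bsub>T\<^esub>l\<in>UNIV. (?K $ i $ k * H $ b $ j) \<odot>\<^bsub>T\<^esub> t (p k l) (p l b))"
    by (rule T.fs_cong[OF refl T.fs_swap]) (simp_all add: p)
  also have "\<dots> = conjugate_by T H (\<lambda>i j. \<Oplus>\<^bsub>T\<^esub>k\<in>UNIV. t (p i k) (p k j)) i j"
    unfolding conjugate_by_def by (rule T.fs_cong2) (simp_all add: p T.fs_scale)
  finally show ?thesis by (rule sym)
qed

definition hadamard_relations ::
  "nat \<Rightarrow> complex^'n^'n \<Rightarrow> ('a, 'x) star_alg_scheme \<Rightarrow> ('n \<Rightarrow> 'n \<Rightarrow> 'a) \<Rightarrow> bool" where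
  "hadamard_relations s H A p \<longleftrightarrow> quantum_reflection_matrix A s UNIV p \<and>
     quantum_reflection_matrix A s UNIV (conjugate_by A H p)"

lemma hadamard_relations_closed: "hadamard_relations s H A p \<Longrightarrow> p i j \<in> carrier A"
  by (simp add: hadamard_relations_def quantum_reflection_matrix_def)

lemma hadamard_relations_transfer:
  fixes Q :: "('a, 'x) star_alg_scheme" and F :: "(('b, 'y) star_alg_scheme \<times> ('a \<Rightarrow> 'b)) set"
  assumes F: "jointly_injective Q F" and U: "\<And>i j. U i j \<in> carrier Q"
    and *: "\<And>B h. (B, h) \<in> F \<Longrightarrow> \<exists>W. hadamard_relations s H B W \<and> (\<forall>i\<in>UNIV. \<forall>j\<in>UNIV. h (U i j) = W i j)"
  shows "hadamard_relations s H Q U"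
proof -
  interpret Q: star_algebra Q using F by (simp add: jointly_injective_def)
  have R: "hadamard_relations s H B (\<lambda>i j. h (U i j))" if Bh: "(B, h) \<in> F" for B h
  proof -
    obtain W where W: "hadamard_relations s H B W" "\<forall>i\<in>UNIV. \<forall>j\<in>UNIV. h (U i j) = W i j"
      using *[OF Bh] by (elim exE conjE)
    have "(\<lambda>i j. h (U i j)) = W" using W(2) by (intro ext) simp
    then show ?thesis using W(1) by simp
  qed
  show ?thesis
    unfolding hadamard_relations_def
  proof
    show "quantum_reflection_matrix Q s UNIV U"
      by (rule quantum_reflection_matrix_transfer[OF F U]) (use R in \<open>simp add: hadamard_relations_def\<close>)
    show "quantum_reflection_matrix Q s UNIV (conjugate_by Q H U)"
    proof (rule quantum_reflection_matrix_transfer[OF F])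
      show "conjugate_by Q H U i j \<in> carrier Q" for i j by (simp add: U)
      fix B h assume Bh: "(B, h) \<in> F"
      interpret h: star_algebra_hom Q B h by (rule jointly_injective_hom[OF F Bh])
      have "(\<lambda>i j. h (conjugate_by Q H U i j)) = conjugate_by B H (\<lambda>i j. h (U i j))"
        by (intro ext h.hom_conjugate_by U)
      then show "quantum_reflection_matrix B s UNIV (\<lambda>i j. h (conjugate_by Q H U i j))"
        using R[OF Bh] by (simp add: hadamard_relations_def)
    qed
  qed
qed

lemma satisfies_hadamard_relations:
  assumes B: "star_algebra B" "reduced_star_alg B" and W: "hadamard_relations s H B W"
  shows "satisfies UNIV (hadamard_relations s H) B W"
  unfolding satisfies_def
proof (intro conjI allI impI B ballI)
  fix Q \<theta> v assume F: "jointly_injective Q {(B, \<theta>)}"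
    and v: "\<forall>i\<in>UNIV. \<forall>j\<in>UNIV. v i j \<in> carrier Q \<and> \<theta> (v i j) = W i j"
  show "hadamard_relations s H Q v"
    by (rule hadamard_relations_transfer[OF F]) (use v W in auto)
qed (rule hadamard_relations_closed[OF W])

lemma hadamard_relations_complex:
  fixes H :: "complex^'n^'n"
  assumes "s \<ge> 1" "complex_hadamard H"
  shows "hadamard_relations s H complex_star_alg (\<lambda>i j. of_bool (i = j))"
proof -
  have "conjugate_by complex_star_alg H (\<lambda>i j. of_bool (i = j)) = (\<lambda>i j. of_bool (i = j))"
    by (intro ext conjugate_by_complex assms)
  then show ?thesis
    unfolding hadamard_relations_def using assms(1) by (simp add: quantum_reflection_matrix_complex)
qed

lemma hadamard_relations_opposite:
  fixes H :: "complex^'n^'n"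
  assumes A: "star_algebra A" and H: "complex_hadamard H" and p: "hadamard_relations s H A p"
  shows "hadamard_relations s H (opposite A) (\<lambda>i j. star A (p j i))"
proof -
  have "conjugate_by (opposite A) H (\<lambda>i j. star A (p j i)) = (\<lambda>i j. star A (conjugate_by A H p j i))"
    by (intro ext conjugate_by_opposite A H hadamard_relations_closed[OF p])
  then show ?thesis
    using p unfolding hadamard_relations_def by (simp add: quantum_reflection_matrix_opposite[OF A])
qed

lemma hadamard_relations_tensor:
  fixes H :: "complex^'n^'n"
  assumes A: "star_algebra A" "reduced_star_alg A" and s: "s \<ge> 1" and H: "complex_hadamard H"
    and p: "hadamard_relations s H A p"
  shows "hadamard_relations s H (tensor A A) (\<lambda>i j. \<Oplus>\<^bsub>tensor A A\<^esub>k\<in>UNIV. pure_tensor A A (p i k) (p k j))"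
proof -
  have "conjugate_by (tensor A A) H (\<lambda>i j. \<Oplus>\<^bsub>tensor A A\<^esub>k\<in>UNIV. pure_tensor A A (p i k) (p k j))
    = (\<lambda>i j. \<Oplus>\<^bsub>tensor A A\<^esub>k\<in>UNIV. pure_tensor A A (conjugate_by A H p i k) (conjugate_by A H p k j))"
    by (intro ext conjugate_by_tensor A H hadamard_relations_closed[OF p])
  moreover have "quantum_reflection_matrix A s UNIV p" "quantum_reflection_matrix A s UNIV (conjugate_by A H p)"
    using p by (simp_all add: hadamard_relations_def)
  note this[THEN quantum_reflection_matrix_tensor[OF A s finite_class.finite_UNIV]]
  ultimately show ?thesis unfolding hadamard_relations_def by simp
qed

lemma matrix_hopf_hadamard:
  fixes H :: "complex^'n^'n"
  assumes s: "s \<ge> 1" and H: "complex_hadamard H"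
  shows "matrix_hopf UNIV (hadamard_relations s H)"
proof -
  interpret matrix_relations UNIV "hadamard_relations s H"
  proof
    show "satisfies UNIV (hadamard_relations s H) complex_star_alg (\<lambda>i j. of_bool (i = j))"
      by (intro satisfies_hadamard_relations star_algebra_complex reduced_complex hadamard_relations_complex s H)
    fix Q :: "'n coord star_alg" and v and F :: "('n coord star_alg \<times> ('n coord \<Rightarrow> 'n coord)) set"
    assume F: "jointly_injective Q F" and v: "\<And>i j. i \<in> UNIV \<Longrightarrow> j \<in> UNIV \<Longrightarrow> v i j \<in> carrier Q"
      and *: "\<And>B h. (B, h) \<in> F \<Longrightarrow> \<exists>w. hadamard_relations s H B w \<and> (\<forall>i\<in>UNIV. \<forall>j\<in>UNIV. h (v i j) = w i j)"
    show "hadamard_relations s H Q v"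
      using F v[OF UNIV_I UNIV_I] * by (rule hadamard_relations_transfer)
  qed simp
  have "satisfies UNIV (hadamard_relations s H) (opposite OG) (\<lambda>i j. star OG (u j i))"
    using star_algebra_opposite[OF star_algebra_O] reduced_opposite[OF star_algebra_O reduced_O]
      hadamard_relations_opposite[OF star_algebra_O H relations_O]
    by (rule satisfies_hadamard_relations)
  moreover have "satisfies UNIV (hadamard_relations s H) (tensor OG OG)
      (\<lambda>i j. \<Oplus>\<^bsub>tensor OG OG\<^esub>k\<in>UNIV. pure_tensor OG OG (u i k) (u k j))"
    using star_algebra_pair.star_algebra_T[OF pair_O] star_algebra_pair.reduced_T[OF pair_O reduced_O reduced_O]
      hadamard_relations_tensor[OF star_algebra_O reduced_O s H relations_O]
    by (rule satisfies_hadamard_relations)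
  ultimately show ?thesis
    by (intro matrix_hopf.intro matrix_hopf_axioms.intro matrix_relations_axioms)
qed

section \<open>The Hadamard graph\<close>

context star_algebra
begin

lemma fs_Times:
  assumes "finite S" "finite T" "\<And>a b. a \<in> S \<Longrightarrow> b \<in> T \<Longrightarrow> f (a, b) \<in> carrier A"
  shows "finsum A f (S \<times> T) = (\<Oplus>a\<in>S. \<Oplus>b\<in>T. f (a, b))"
  using assms(1,3)
proof (induction S)
  case (insert n S)
  have "insert n S \<times> T = ({n} \<times> T) \<union> (S \<times> T)" by auto
  then have "finsum A f (insert n S \<times> T) = finsum A f ({n} \<times> T) \<oplus> finsum A f (S \<times> T)"
    using insert assms(2) fs_Un[of "{n} \<times> T" "S \<times> T" f] by auto
  also have "finsum A f ({n} \<times> T) = (\<Oplus>b\<in>T. f (n, b))"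
    by (rule fs_reindex) (use insert in \<open>auto intro!: bij_betw_byWitness[of _ snd]\<close>)
  finally show ?case using insert by (simp add: fs_insert)
qed simp

lemma fs_sum_type:
  assumes "finite E" "\<And>e. e \<in> E \<Longrightarrow> f (Inl e) \<in> carrier A" "\<And>e. e \<in> E \<Longrightarrow> f (Inr e) \<in> carrier A"
  shows "finsum A f (Inl ` E \<union> Inr ` E) = (\<Oplus>e\<in>E. f (Inl e)) \<oplus> (\<Oplus>e\<in>E. f (Inr e))"
proof -
  have "finsum A f (Inl ` E \<union> Inr ` E) = finsum A f (Inl ` E) \<oplus> finsum A f (Inr ` E)"
    by (rule fs_Un) (use assms in auto)
  moreover have "finsum A f (Inl ` E) = (\<Oplus>e\<in>E. f (Inl e))"
    by (rule fs_reindex) (use assms in \<open>auto simp: bij_betw_def inj_on_def\<close>)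
  moreover have "finsum A f (Inr ` E) = (\<Oplus>e\<in>E. f (Inr e))"
    by (rule fs_reindex) (use assms in \<open>auto simp: bij_betw_def inj_on_def\<close>)
  ultimately show ?thesis by simp
qed

text \<open>A coefficient moves between eigenvalue and element: in the m-th power it contributes
  \<open>c k ^ m\<close>, which is the factor by which the Fourier weights of \<open>z / c k\<close>
  and \<open>z\<close> differ.\<close>

lemma spectral_projection_orthogonal_sum:
  assumes s: "s \<ge> 1" and S: "finite S" "\<And>k. k \<in> S \<Longrightarrow> x k \<in> carrier A"
    and orth: "\<And>k l. k \<in> S \<Longrightarrow> l \<in> S \<Longrightarrow> k \<noteq> l \<Longrightarrow> x k \<otimes> x l = \<zero>"
    and c: "\<And>k. k \<in> S \<Longrightarrow> c k \<noteq> 0"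
  shows "(\<Oplus>k\<in>S. spectral_projection A s (z / c k) (x k)) = spectral_projection A s z (\<Oplus>k\<in>S. c k \<odot> x k)"
proof -
  have "(\<Oplus>k\<in>S. spectral_projection A s (z / c k) (x k))
    = (\<Oplus>m\<in>{1..s}. \<Oplus>k\<in>S. (inverse (z / c k) ^ m / of_nat s) \<odot> (x k [^] m))"
    unfolding spectral_projection_def by (rule fs_swap) (use S in simp_all)
  also have "\<dots> = spectral_projection A s z (\<Oplus>k\<in>S. c k \<odot> x k)"
    unfolding spectral_projection_def
  proof (rule fs_cong)
    fix m assume "m \<in> {1..s}"
    then obtain n where n: "m = Suc n" by (cases m) auto
    have "(inverse z ^ m / of_nat s) \<odot> ((\<Oplus>k\<in>S. c k \<odot> x k) [^] m)
      = (inverse z ^ m / of_nat s) \<odot> (\<Oplus>k\<in>S. (c k ^ m) \<odot> (x k [^] m))"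
    proof -
      have "(\<Oplus>k\<in>S. c k \<odot> x k) [^] Suc n = (\<Oplus>k\<in>S. (c k ^ Suc n) \<odot> (x k [^] Suc n))"
        using S orth by (rule orthogonal_sum_pow)
      then show ?thesis by (simp only: n)
    qed
    also have "\<dots> = (\<Oplus>k\<in>S. (inverse z ^ m / of_nat s) \<odot> ((c k ^ m) \<odot> (x k [^] m)))"
      by (rule fs_scale) (use S in simp)
    also have "\<dots> = (\<Oplus>k\<in>S. (inverse (z / c k) ^ m / of_nat s) \<odot> (x k [^] m))"
    proof (rule fs_cong)
      fix k assume k: "k \<in> S"
      have eq: "inverse z ^ m / of_nat s * c k ^ m = inverse (z / c k) ^ m / of_nat s"
        by (simp add: divide_inverse power_mult_distrib)
      have "x k [^] m \<in> carrier A" using S k by simp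
      then show "(inverse z ^ m / of_nat s) \<odot> ((c k ^ m) \<odot> (x k [^] m)) = (inverse (z / c k) ^ m / of_nat s) \<odot> (x k [^] m)"
        by (simp only: scale_scale eq)
    qed (use S in simp_all)
    finally show "(\<Oplus>k\<in>S. (inverse (z / c k) ^ m / of_nat s) \<odot> (x k [^] m))
      = (inverse z ^ m / of_nat s) \<odot> ((\<Oplus>k\<in>S. c k \<odot> x k) [^] m)" by (rule sym)
  qed (use S in simp_all)
  finally show ?thesis .
qed

text \<open>Made for adjacency coefficients: a vertex of the Hadamard graph has exactly one
  neighbour over each index of the other part, and \<open>f\<close> gives its root of unity.\<close>

lemma fs_select:
  assumes "finite S" "finite T" "\<And>a b. a \<in> S \<Longrightarrow> b \<in> T \<Longrightarrow> g (a, b) \<in> carrier A"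
    and "\<And>a. a \<in> S \<Longrightarrow> f a \<in> T"
    and P: "\<And>a b. a \<in> S \<Longrightarrow> b \<in> T \<Longrightarrow> c (a, b) = of_bool (b = f a)"
  shows "(\<Oplus>p\<in>S \<times> T. c p \<odot> g p) = (\<Oplus>a\<in>S. g (a, f a))"
proof -
  have "(\<Oplus>p\<in>S \<times> T. c p \<odot> g p) = (\<Oplus>a\<in>S. \<Oplus>b\<in>T. c (a, b) \<odot> g (a, b))"
    by (rule fs_Times) (use assms in simp_all)
  also have "\<dots> = (\<Oplus>a\<in>S. g (a, f a))"
  proof (rule fs_cong)
    fix a assume a: "a \<in> S"
    have "(\<Oplus>b\<in>T. c (a, b) \<odot> g (a, b)) = c (a, f a) \<odot> g (a, f a)"
      by (rule fs_delta) (use assms a in simp_all)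
    then show "(\<Oplus>b\<in>T. c (a, b) \<odot> g (a, b)) = g (a, f a)" using assms a by simp
  qed (use assms in simp_all)
  finally show ?thesis .
qed

end

section \<open>Vertices and edges of the Hadamard graph\<close>

lemma bij_unity_roots_divide:
  assumes "s \<ge> 1" "z \<in> unity_roots s"
  shows "bij_betw (\<lambda>y. y / z) (unity_roots s) (unity_roots s)" "bij_betw (\<lambda>y. z / y) (unity_roots s) (unity_roots s)"
proof -
  note nz = unity_root_nonzero[OF assms(1)]
  show "bij_betw (\<lambda>y. y / z) (unity_roots s) (unity_roots s)"
    by (rule bij_betw_byWitness[of _ "\<lambda>y. y * z"])
      (use assms nz[OF assms(2)] in \<open>auto intro: unity_roots_mult unity_roots_divide\<close>)
  show "bij_betw (\<lambda>y. z / y) (unity_roots s) (unity_roots s)"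
    by (rule bij_betw_byWitness[of _ "\<lambda>y. z / y"])
      (use assms nz[OF assms(2)] nz in \<open>auto intro: unity_roots_divide\<close>)
qed

text \<open>It replaces exponents modulo s by the roots themselves, so that differences of exponents
  become quotients.\<close>

lemma range_root_of_unity:
  assumes "s \<ge> 1"
  shows "{exp (2 * of_real pi * \<i> / of_nat s) ^ k | k. k < s} = unity_roots s"
proof -
  have "exp (2 * of_real pi * \<i> / of_nat s) ^ k = exp (2 * of_real pi * \<i> * of_nat k / of_nat s)" for k
    by (simp flip: exp_of_nat_mult) (simp add: algebra_simps)
  then show ?thesis
    using complex_roots_unity[OF assms] by (simp add: unity_roots_def)
qed

abbreviation hadamard_half :: "nat \<Rightarrow> ('n \<times> complex) set" where
  "hadamard_half s \<equiv> UNIV \<times> unity_roots s"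

lemma pverts_hadamard_graph:
  assumes "s \<ge> 1"
  shows "pverts (hadamard_graph s H) = Inl ` hadamard_half s \<union> Inr ` hadamard_half s"
  unfolding range_root_of_unity[OF assms, symmetric] hadamard_graph_def Let_def by auto

lemma finite_hadamard_half: "s \<ge> 1 \<Longrightarrow> finite (hadamard_half s :: ('n::finite \<times> complex) set)"
  by (simp add: finite_unity_roots)

lemma adjacency_hadamard_graph:
  assumes "s \<ge> 1" "z \<in> unity_roots s" "y \<in> unity_roots s"
  shows "adjacency_matrix (hadamard_graph s H) (Inl (i, z)) (Inr (j, y)) = of_bool (z * H $ i $ j = y)"
    "adjacency_matrix (hadamard_graph s H) (Inr (j, y)) (Inl (i, z)) = of_bool (z * H $ i $ j = y)"
    "adjacency_matrix (hadamard_graph s H) (Inl a) (Inl b) = 0"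
    "adjacency_matrix (hadamard_graph s H) (Inr a) (Inr b) = 0"
proof -
  obtain k l where kl: "k < s" "z = exp (2 * of_real pi * \<i> / of_nat s) ^ k"
    "l < s" "y = exp (2 * of_real pi * \<i> / of_nat s) ^ l"
    using assms(2,3) unfolding range_root_of_unity[OF assms(1), symmetric] by blast
  show "adjacency_matrix (hadamard_graph s H) (Inl (i, z)) (Inr (j, y)) = of_bool (z * H $ i $ j = y)"
    "adjacency_matrix (hadamard_graph s H) (Inr (j, y)) (Inl (i, z)) = of_bool (z * H $ i $ j = y)"
    "adjacency_matrix (hadamard_graph s H) (Inl a) (Inl b) = 0"
    "adjacency_matrix (hadamard_graph s H) (Inr a) (Inr b) = 0"
    unfolding adjacency_matrix_def hadamard_graph_def Let_def kl(2,4)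
    using kl(1,3) by auto
qed

lemma symmetric_hadamard_graph: "(v, w) \<in> parcs (hadamard_graph s H) \<Longrightarrow> (w, v) \<in> parcs (hadamard_graph s H)"
  unfolding hadamard_graph_def Let_def by auto

text \<open>For \<open>q = H\<^sup>-\<^sup>1 p H\<close> this matrix commutes with the adjacency matrix of the Hadamard graph.\<close>
fun hadamard_magic :: "('a, 'x) star_alg_scheme \<Rightarrow> nat \<Rightarrow> ('n \<Rightarrow> 'n \<Rightarrow> 'a) \<Rightarrow> ('n \<Rightarrow> 'n \<Rightarrow> 'a)
    \<Rightarrow> 'n \<times> complex + 'n \<times> complex \<Rightarrow> 'n \<times> complex + 'n \<times> complex \<Rightarrow> 'a" where
  "hadamard_magic A s p q (Inl (i, z)) (Inl (j, y)) = spectral_projection A s (y / z) (p i j)"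
| "hadamard_magic A s p q (Inr (i, z)) (Inr (j, y)) = spectral_projection A s (y / z) (q i j)"
| "hadamard_magic A s p q (Inl _) (Inr _) = \<zero>\<^bsub>A\<^esub>"
| "hadamard_magic A s p q (Inr _) (Inl _) = \<zero>\<^bsub>A\<^esub>"

text \<open>One block of the magic unitary. It is instantiated twice below, for \<open>p\<close> on
  the row vertices and for the conjugate of \<open>p\<close> by \<open>H\<close> on the column
  vertices.\<close>

locale reflection_matrix = star_algebra A for A :: "('a, 'x) star_alg_scheme" (structure) +
  fixes s :: nat and p :: "'n::finite \<Rightarrow> 'n \<Rightarrow> 'a"
  assumes reduced: "reduced_star_alg A" and s: "s \<ge> 1" and p: "quantum_reflection_matrix A s UNIV p"
begin

lemma p_closed [simp, intro]: "p i j \<in> carrier A"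
  using quantum_reflection_matrixD(1)[OF p] by simp

lemma entry: "reflection A s (p i j)"
  by (rule reflection_entry[OF star_algebra_axioms s p]) simp_all

lemmas orthogonal = quantum_reflection_orthogonal[OF star_algebra_axioms reduced s finite_class.finite_UNIV p UNIV_I UNIV_I UNIV_I]

abbreviation "P z i j \<equiv> spectral_projection A s z (p i j)"

text \<open>Both y \<mapsto> y / z and y \<mapsto> z / y permute the roots of unity, so these are
  the total sums over the spectrum, arranged along a row or a column of the block.\<close>

lemma sum_P_divide:
  assumes "z \<in> unity_roots s"
  shows "(\<Oplus>y\<in>unity_roots s. P (y / z) i j) = p i j \<otimes> star A (p i j)"
    "(\<Oplus>y\<in>unity_roots s. P (z / y) i j) = p i j \<otimes> star A (p i j)"
    "(\<Oplus>y\<in>unity_roots s. (y / z) \<odot> P (y / z) i j) = p i j"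
    "(\<Oplus>y\<in>unity_roots s. (z / y) \<odot> P (z / y) i j) = p i j"
  using fs_reindex[OF bij_unity_roots_divide(1)[OF s assms], of "\<lambda>z. P z i j"]
    fs_reindex[OF bij_unity_roots_divide(2)[OF s assms], of "\<lambda>z. P z i j"]
    fs_reindex[OF bij_unity_roots_divide(1)[OF s assms], of "\<lambda>z. z \<odot> P z i j"]
    fs_reindex[OF bij_unity_roots_divide(2)[OF s assms], of "\<lambda>z. z \<odot> P z i j"]
    reflection.sum_P_eq_e[OF entry, of i j] reflection.sum_eigenvalue_P[OF entry, of i j] by simp_all

lemma row_sum:
  assumes z: "z \<in> unity_roots s"
  shows "(\<Oplus>e\<in>hadamard_half s. P (snd e / z) i (fst e)) = \<one>"
proof -
  have "(\<Oplus>e\<in>hadamard_half s. P (snd e / z) i (fst e)) = (\<Oplus>j\<in>UNIV. \<Oplus>y\<in>unity_roots s. P (y / z) i j)"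
    by (subst fs_Times) (simp_all add: finite_unity_roots[OF s])
  also have "\<dots> = (\<Oplus>j\<in>UNIV. p i j \<otimes> star A (p i j))"
    by (simp only: sum_P_divide(1)[OF z])
  also have "\<dots> = \<one>" using quantum_reflection_matrixD(2)[OF p UNIV_I UNIV_I, of i i] by simp
  finally show ?thesis .
qed

lemma column_sum:
  assumes z: "z \<in> unity_roots s"
  shows "(\<Oplus>e\<in>hadamard_half s. P (z / snd e) (fst e) i) = \<one>"
proof -
  have "(\<Oplus>e\<in>hadamard_half s. P (z / snd e) (fst e) i) = (\<Oplus>j\<in>UNIV. \<Oplus>y\<in>unity_roots s. P (z / y) j i)"
    by (subst fs_Times) (simp_all add: finite_unity_roots[OF s])
  also have "\<dots> = (\<Oplus>j\<in>UNIV. p j i \<otimes> star A (p j i))"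
    by (simp only: sum_P_divide(2)[OF z])
  also have "\<dots> = (\<Oplus>j\<in>UNIV. star A (p j i) \<otimes> p j i)"
    using quantum_reflection_matrixD(6)[OF p UNIV_I UNIV_I] by simp
  also have "\<dots> = \<one>" using quantum_reflection_matrixD(3)[OF p UNIV_I UNIV_I, of i i] by simp
  finally show ?thesis .
qed

end

locale hadamard_algebra = star_algebra A for A :: "('a, 'x) star_alg_scheme" (structure) +
  fixes s :: nat and H :: "complex^'n^'n" and p :: "'n \<Rightarrow> 'n \<Rightarrow> 'a"
  assumes reduced: "reduced_star_alg A" and s: "s \<ge> 1" and H: "complex_hadamard H"
    and H_root: "\<And>i j. (H $ i $ j) ^ s = 1" and p: "hadamard_relations s H A p"
begin

abbreviation "q \<equiv> conjugate_by A H p"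
abbreviation "W \<equiv> hadamard_magic A s p q"
abbreviation "\<Gamma> \<equiv> hadamard_graph s H"
abbreviation "E \<equiv> hadamard_half s :: ('n \<times> complex) set"

sublocale rows: reflection_matrix A s p
  using p reduced s by unfold_locales (simp_all add: hadamard_relations_def)

sublocale cols: reflection_matrix A s q
  using p reduced s by unfold_locales (simp_all add: hadamard_relations_def)

lemma V: "pverts \<Gamma> = Inl ` E \<union> Inr ` E"
  by (rule pverts_hadamard_graph[OF s])

lemma finite_V: "finite (pverts \<Gamma>)"
  unfolding V by (intro finite_UnI finite_imageI finite_hadamard_half s)

lemma H_in: "H $ i $ j \<in> unity_roots s"
  by (simp add: unity_roots_def H_root)

lemma vertex_cases:
  assumes "v \<in> pverts \<Gamma>"
  obtains i z where "z \<in> unity_roots s" "v = Inl (i, z)" | i z where "z \<in> unity_roots s" "v = Inr (i, z)"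
  using assms unfolding V by auto

lemma W_closed [simp, intro]: "W v w \<in> carrier A"
  by (cases "(A, s, p, q, v, w)" rule: hadamard_magic.cases) simp_all

lemma sum_V:
  assumes "\<And>v. f v \<in> carrier A"
  shows "finsum A f (pverts \<Gamma>) = (\<Oplus>e\<in>E. f (Inl e)) \<oplus> (\<Oplus>e\<in>E. f (Inr e))"
  unfolding V by (rule fs_sum_type) (simp_all add: assms finite_hadamard_half[OF s])

lemma magic:
  assumes "v \<in> pverts \<Gamma>" "w \<in> pverts \<Gamma>"
  shows "star A (W v w) = W v w" "W v w \<otimes> W v w = W v w"
  using assms
  by (auto elim!: vertex_cases simp: unity_roots_divide reflection.P_star[OF rows.entry]
      reflection.P_star[OF cols.entry] reflection.P_mult[OF rows.entry] reflection.P_mult[OF cols.entry])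

lemma W_pairs: "W (Inl (i, z)) (Inl e) = rows.P (snd e / z) i (fst e)" "W (Inr (i, z)) (Inr e) = cols.P (snd e / z) i (fst e)"
  "W (Inl e) (Inl (i, z)) = rows.P (z / snd e) (fst e) i" "W (Inr e) (Inr (i, z)) = cols.P (z / snd e) (fst e) i"
  by (cases e; simp)+

lemma W_sums:
  assumes v: "v \<in> pverts \<Gamma>"
  shows "finsum A (W v) (pverts \<Gamma>) = \<one>" "(\<Oplus>w\<in>pverts \<Gamma>. W w v) = \<one>"
  using v
proof -
  show "finsum A (W v) (pverts \<Gamma>) = \<one>"
    using v by (cases rule: vertex_cases)
      (simp_all only: sum_V W_closed, simp_all add: W_pairs rows.row_sum cols.row_sum)
  show "(\<Oplus>w\<in>pverts \<Gamma>. W w v) = \<one>"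
    using v by (cases rule: vertex_cases)
      (simp_all only: sum_V W_closed, simp_all add: W_pairs rows.column_sum cols.column_sum)
qed

text \<open>Within one part of the graph both sides vanish. Between the parts, each side is a sum of
  spectral projections over the neighbours of a vertex, and
  \<open>spectral_projection_orthogonal_sum\<close> merges it into a single one: at y / z for an
  entry of H q = p H, at z / y for an entry of q H^-1 = H^-1 p.\<close>

lemma W_commute:
  assumes v: "v \<in> pverts \<Gamma>" and w: "w \<in> pverts \<Gamma>"
  shows "(\<Oplus>x\<in>pverts \<Gamma>. adjacency_matrix \<Gamma> v x \<odot> W x w) = (\<Oplus>x\<in>pverts \<Gamma>. adjacency_matrix \<Gamma> x w \<odot> W v x)"
proof -
  note adj = adjacency_hadamard_graph[OF s]
  have sums: "(\<Oplus>x\<in>pverts \<Gamma>. adjacency_matrix \<Gamma> v x \<odot> W x w)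
      = (\<Oplus>e\<in>E. adjacency_matrix \<Gamma> v (Inl e) \<odot> W (Inl e) w) \<oplus> (\<Oplus>e\<in>E. adjacency_matrix \<Gamma> v (Inr e) \<odot> W (Inr e) w)"
    "(\<Oplus>x\<in>pverts \<Gamma>. adjacency_matrix \<Gamma> x w \<odot> W v x)
      = (\<Oplus>e\<in>E. adjacency_matrix \<Gamma> (Inl e) w \<odot> W v (Inl e)) \<oplus> (\<Oplus>e\<in>E. adjacency_matrix \<Gamma> (Inr e) w \<odot> W v (Inr e))"
    by (rule sum_V, simp)+
  have 00: "adjacency_matrix \<Gamma> (Inl a) (Inl b) = 0" "adjacency_matrix \<Gamma> (Inr a) (Inr b) = 0" for a b
    by (rule adj(3,4)[OF unity_roots_one unity_roots_one])+
  have fin: "finite (unity_roots s)" by (rule finite_unity_roots[OF s])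
  have nz: "z \<noteq> 0" if "z \<in> unity_roots s" for z by (rule unity_root_nonzero[OF s that])
  have Hc: "cnj (H $ i $ j) = inverse (H $ i $ j)" for i j by (rule unity_roots_cnj[OF s H_in])
  have pc: "p i j \<in> carrier A" for i j by simp
  note com = hadamard_commute[OF H pc]
  show ?thesis
    using v
  proof (cases rule: vertex_cases)
    case (1 i z)
    show ?thesis using w
    proof (cases rule: vertex_cases)
      case (1 j y)
      then show ?thesis using \<open>v = Inl (i, z)\<close> unfolding sums by (simp add: 00)
    next
      case (2 j y)
      \<comment> \<open>The neighbours of (r_i, z) are the vertices (c_k, z H_ik), one for each
        k.\<close>
      have "(\<Oplus>e\<in>E. adjacency_matrix \<Gamma> v (Inr e) \<odot> W (Inr e) w) = (\<Oplus>k\<in>UNIV. W (Inr (k, z * H $ i $ k)) w)"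
        by (rule fs_select) (use 1 2 in \<open>auto simp: fin adj unity_roots_mult H_in\<close>)
      also have "\<dots> = (\<Oplus>k\<in>UNIV. cols.P (y / z / H $ i $ k) k j)" using 2 by simp
      also have "\<dots> = spectral_projection A s (y / z) (\<Oplus>k\<in>UNIV. H $ i $ k \<odot> q k j)"
        by (rule spectral_projection_orthogonal_sum[OF s]) (simp_all add: cols.orthogonal nz[OF H_in])
      also have "\<dots> = spectral_projection A s (y / z) (\<Oplus>k\<in>UNIV. H $ k $ j \<odot> p i k)" by (simp only: com)
      also have "\<dots> = (\<Oplus>k\<in>UNIV. rows.P (y / z / H $ k $ j) i k)"
        by (rule spectral_projection_orthogonal_sum[OF s, symmetric]) (simp_all add: rows.orthogonal nz[OF H_in])
      also have "\<dots> = (\<Oplus>k\<in>UNIV. W v (Inl (k, y / H $ k $ j)))" using 1 by (simp add: divide_divide_eq_left mult.commute)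
      also have "\<dots> = (\<Oplus>e\<in>E. adjacency_matrix \<Gamma> (Inl e) w \<odot> W v (Inl e))"
        by (rule fs_select[symmetric]) (use 1 2 nz[OF H_in] in \<open>auto simp: fin adj unity_roots_divide H_in field_simps\<close>)
      finally show ?thesis using 1 2 unfolding sums by (simp add: 00)
    qed
  next
    case (2 j y)
    show ?thesis using w
    proof (cases rule: vertex_cases)
      case (2 j y)
      then show ?thesis using \<open>v = Inr _\<close> unfolding sums by (simp add: 00)
    next
      case (1 i z)
      have "(\<Oplus>e\<in>E. adjacency_matrix \<Gamma> v (Inl e) \<odot> W (Inl e) w) = (\<Oplus>k\<in>UNIV. W (Inl (k, y / H $ k $ j)) w)"
        by (rule fs_select) (use 1 2 nz[OF H_in] in \<open>auto simp: fin adj unity_roots_divide H_in field_simps\<close>)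
      \<comment> \<open>Entries of H are roots of unity; their inverses are written as conjugates to
        match the second identity of \<open>hadamard_commute\<close>.\<close>
      also have "\<dots> = (\<Oplus>k\<in>UNIV. rows.P (z / y / cnj (H $ k $ j)) k i)" using 1 by (simp add: Hc field_simps)
      also have "\<dots> = spectral_projection A s (z / y) (\<Oplus>k\<in>UNIV. cnj (H $ k $ j) \<odot> p k i)"
        by (rule spectral_projection_orthogonal_sum[OF s]) (simp_all add: rows.orthogonal nz[OF H_in])
      also have "\<dots> = spectral_projection A s (z / y) (\<Oplus>k\<in>UNIV. cnj (H $ i $ k) \<odot> q j k)" by (simp only: com)
      also have "\<dots> = (\<Oplus>k\<in>UNIV. cols.P (z / y / cnj (H $ i $ k)) j k)"
        by (rule spectral_projection_orthogonal_sum[OF s, symmetric]) (simp_all add: cols.orthogonal nz[OF H_in])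
      also have "\<dots> = (\<Oplus>k\<in>UNIV. W v (Inr (k, z * H $ i $ k)))" using 2 by (simp add: Hc field_simps)
      also have "\<dots> = (\<Oplus>e\<in>E. adjacency_matrix \<Gamma> (Inr e) w \<odot> W v (Inr e))"
        by (rule fs_select[symmetric]) (use 1 2 in \<open>auto simp: fin adj unity_roots_mult H_in\<close>)
      finally show ?thesis using 1 2 unfolding sums by (simp add: 00)
    qed
  qed
qed

lemma graph_relations_W: "graph_relations \<Gamma> A W"
  by (rule graph_relationsI) (simp_all add: magic W_sums W_commute)

text \<open>The entries of \<open>N\<close> in a row are orthogonal idempotents, as \<open>C\<close>
  is reduced, and by assumption they decompose \<open>h (p i j)\<close> and \<open>h (q i j)\<close>
  with the right eigenvalues. Uniqueness of such decompositions makes them the images of the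
  spectral projections. With suitable \<open>N\<close> this computes \<Delta>, \<epsilon> and S on
  the entries of \<open>W\<close>.\<close>

lemma hom_W:
  assumes hom: "star_algebra_hom A C h" and C: "reduced_star_alg C" and N: "graph_relations \<Gamma> C N"
    and mixed: "\<And>e e'. e \<in> E \<Longrightarrow> e' \<in> E \<Longrightarrow> N (Inl e) (Inr e') = \<zero>\<^bsub>C\<^esub>"
      "\<And>e e'. e \<in> E \<Longrightarrow> e' \<in> E \<Longrightarrow> N (Inr e) (Inl e') = \<zero>\<^bsub>C\<^esub>"
    and rows: "\<And>i j z. z \<in> unity_roots s \<Longrightarrow>
      h (p i j) = (\<Oplus>\<^bsub>C\<^esub>y\<in>unity_roots s. (y / z) \<odot>\<^bsub>C\<^esub> N (Inl (i, z)) (Inl (j, y)))"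
    and cols: "\<And>i j z. z \<in> unity_roots s \<Longrightarrow>
      h (q i j) = (\<Oplus>\<^bsub>C\<^esub>y\<in>unity_roots s. (y / z) \<odot>\<^bsub>C\<^esub> N (Inr (i, z)) (Inr (j, y)))"
    and vw: "v \<in> pverts \<Gamma>" "w \<in> pverts \<Gamma>"
  shows "h (W v w) = N v w"
proof -
  interpret h: star_algebra_hom A C h by fact
  note orth = graph_relations_orthogonal[OF h.B.star_algebra_axioms C finite_V N]
  note D = graph_relationsD[OF N]
  have spec: "h (spectral_projection A s z x) = spectral_projection C s z (h x)" if "x \<in> carrier A" for z x
    unfolding spectral_projection_def using that
    by (subst h.hom_fs) (auto intro!: h.B.fs_cong)
  have inj: "inj_on (\<lambda>y. y / z) (unity_roots s)" if "z \<in> unity_roots s" for z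
    using bij_unity_roots_divide(1)[OF s that] by (simp add: bij_betw_def)
  have mem: "Inl (i, z) \<in> pverts \<Gamma>" "Inr (i, z) \<in> pverts \<Gamma>" if "z \<in> unity_roots s" for i z
    unfolding V using that by auto
  have l: "h (rows.P (y / z) i j) = N (Inl (i, z)) (Inl (j, y))"
    if z: "z \<in> unity_roots s" and y: "y \<in> unity_roots s" for i j y z
  proof -
    have "spectral_projection C s (y / z) (h (p i j)) = N (Inl (i, z)) (Inl (j, y))"
      by (rule h.B.spectral_projection_unique[OF s finite_unity_roots[OF s] _ _ _ inj[OF z] _ rows[OF z] y])
        (use z y in \<open>simp_all add: D mem orth unity_roots_divide\<close>)
    then show ?thesis by (simp add: spec)
  qed
  have r: "h (cols.P (y / z) i j) = N (Inr (i, z)) (Inr (j, y))"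
    if z: "z \<in> unity_roots s" and y: "y \<in> unity_roots s" for i j y z
  proof -
    have "spectral_projection C s (y / z) (h (q i j)) = N (Inr (i, z)) (Inr (j, y))"
      by (rule h.B.spectral_projection_unique[OF s finite_unity_roots[OF s] _ _ _ inj[OF z] _ cols[OF z] y])
        (use z y in \<open>simp_all add: D mem orth unity_roots_divide\<close>)
    then show ?thesis by (simp add: spec)
  qed
  show ?thesis
    using vw(1)
  proof (cases rule: vertex_cases)
    case v: (1 i z)
    show ?thesis using vw(2) by (cases rule: vertex_cases) (simp_all add: v l mixed)
  next
    case v: (2 i z)
    show ?thesis using vw(2) by (cases rule: vertex_cases) (simp_all add: v r mixed)
  qed
qed

end

section \<open>Eigenvalue decompositions for the antipode and the comultiplication\<close>

lemma (in reflection_matrix) star_eigen: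
  assumes z: "z \<in> unity_roots s"
  shows "star A (p j i) = (\<Oplus>y\<in>unity_roots s. (y / z) \<odot> star A (P (z / y) j i))"
proof -
  have "star A (p j i) = star A (\<Oplus>y\<in>unity_roots s. (z / y) \<odot> P (z / y) j i)" by (simp only: sum_P_divide(4)[OF z])
  also have "\<dots> = (\<Oplus>y\<in>unity_roots s. star A ((z / y) \<odot> P (z / y) j i))" by (rule fs_star) simp
  also have "\<dots> = (\<Oplus>y\<in>unity_roots s. (y / z) \<odot> star A (P (z / y) j i))"
  proof (rule fs_cong)
    fix y assume y: "y \<in> unity_roots s"
    \<comment> \<open>The conjugate of the root of unity \<open>z / y\<close> is its inverse
      \<open>y / z\<close>.\<close>
    show "star A ((z / y) \<odot> P (z / y) j i) = (y / z) \<odot> star A (P (z / y) j i)"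
      using unity_roots_cnj[OF s unity_roots_divide[OF z y]] by (simp add: star_scale)
  qed simp_all
  finally show ?thesis .
qed

text \<open>At an intermediate vertex (k, x) the eigenvalue y / z factors as (x / z) (y / x).
  Summing over y restores p_kj in the right factor, and then summing over x restores p_ik in the
  left one.\<close>

lemma (in reflection_matrix) tensor_eigen:
  assumes z: "z \<in> unity_roots s"
  shows "(\<Oplus>\<^bsub>tensor A A\<^esub>k\<in>UNIV. pure_tensor A A (p i k) (p k j))
    = (\<Oplus>\<^bsub>tensor A A\<^esub>y\<in>unity_roots s. (y / z) \<odot>\<^bsub>tensor A A\<^esub>
        (\<Oplus>\<^bsub>tensor A A\<^esub>e\<in>hadamard_half s. pure_tensor A A (P (snd e / z) i (fst e)) (P (y / snd e) (fst e) j)))"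
proof -
  interpret star_algebra_pair A A by (intro star_algebra_pair.intro star_algebra_axioms)
  interpret T: star_algebra T by (rule star_algebra_T)
  let ?U = "unity_roots s"
  have fin: "finite ?U" by (rule finite_unity_roots[OF s])
  have "(\<Oplus>\<^bsub>T\<^esub>y\<in>?U. (y / z) \<odot>\<^bsub>T\<^esub> (\<Oplus>\<^bsub>T\<^esub>e\<in>hadamard_half s. t (P (snd e / z) i (fst e)) (P (y / snd e) (fst e) j)))
    = (\<Oplus>\<^bsub>T\<^esub>y\<in>?U. \<Oplus>\<^bsub>T\<^esub>e\<in>hadamard_half s. t ((snd e / z) \<odot>\<^bsub>A\<^esub> P (snd e / z) i (fst e)) ((y / snd e) \<odot>\<^bsub>A\<^esub> P (y / snd e) (fst e) j))"
  proof (rule T.fs_cong)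
    fix y
    have "(y / z) \<odot>\<^bsub>T\<^esub> (\<Oplus>\<^bsub>T\<^esub>e\<in>hadamard_half s. t (P (snd e / z) i (fst e)) (P (y / snd e) (fst e) j))
      = (\<Oplus>\<^bsub>T\<^esub>e\<in>hadamard_half s. (y / z) \<odot>\<^bsub>T\<^esub> t (P (snd e / z) i (fst e)) (P (y / snd e) (fst e) j))"
      by (rule T.fs_scale) simp
    also have "\<dots> = (\<Oplus>\<^bsub>T\<^esub>e\<in>hadamard_half s. t ((snd e / z) \<odot>\<^bsub>A\<^esub> P (snd e / z) i (fst e)) ((y / snd e) \<odot>\<^bsub>A\<^esub> P (y / snd e) (fst e) j))"
    proof (rule T.fs_cong)
      fix e :: "'n \<times> complex" assume "e \<in> hadamard_half s"
      then have "snd e \<noteq> 0" using unity_root_nonzero[OF s, of "snd e"] by (simp add: mem_Times_iff)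
      then have eq: "snd e / z * (y / snd e) = y / z" by simp
      have "t (c \<odot>\<^bsub>A\<^esub> a) (d \<odot>\<^bsub>A\<^esub> b) = (c * d) \<odot>\<^bsub>T\<^esub> t a b" if "a \<in> carrier A" "b \<in> carrier A" for a b c d
        using that by (simp add: t_scale_left t_scale_right mult.commute)
      from this[of "P (snd e / z) i (fst e)" "P (y / snd e) (fst e) j" "snd e / z" "y / snd e"]
      show "(y / z) \<odot>\<^bsub>T\<^esub> t (P (snd e / z) i (fst e)) (P (y / snd e) (fst e) j)
        = t ((snd e / z) \<odot>\<^bsub>A\<^esub> P (snd e / z) i (fst e)) ((y / snd e) \<odot>\<^bsub>A\<^esub> P (y / snd e) (fst e) j)"
        unfolding eq by simp
    qed simp_all
    finally show "(y / z) \<odot>\<^bsub>T\<^esub> (\<Oplus>\<^bsub>T\<^esub>e\<in>hadamard_half s. t (P (snd e / z) i (fst e)) (P (y / snd e) (fst e) j))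
      = (\<Oplus>\<^bsub>T\<^esub>e\<in>hadamard_half s. t ((snd e / z) \<odot>\<^bsub>A\<^esub> P (snd e / z) i (fst e)) ((y / snd e) \<odot>\<^bsub>A\<^esub> P (y / snd e) (fst e) j))" .
  qed simp_all
  also have "\<dots> = (\<Oplus>\<^bsub>T\<^esub>e\<in>hadamard_half s. \<Oplus>\<^bsub>T\<^esub>y\<in>?U. t ((snd e / z) \<odot>\<^bsub>A\<^esub> P (snd e / z) i (fst e)) ((y / snd e) \<odot>\<^bsub>A\<^esub> P (y / snd e) (fst e) j))"
    by (rule T.fs_swap) (simp_all add: fin)
  also have "\<dots> = (\<Oplus>\<^bsub>T\<^esub>e\<in>hadamard_half s. t ((snd e / z) \<odot>\<^bsub>A\<^esub> P (snd e / z) i (fst e)) (p (fst e) j))"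
  proof (rule T.fs_cong)
    fix e :: "'n \<times> complex" assume e: "e \<in> hadamard_half s"
    then have e': "snd e \<in> ?U" by (simp add: mem_Times_iff)
    have "(\<Oplus>\<^bsub>T\<^esub>y\<in>?U. t ((snd e / z) \<odot>\<^bsub>A\<^esub> P (snd e / z) i (fst e)) ((y / snd e) \<odot>\<^bsub>A\<^esub> P (y / snd e) (fst e) j))
      = t ((snd e / z) \<odot>\<^bsub>A\<^esub> P (snd e / z) i (fst e)) (\<Oplus>y\<in>?U. (y / snd e) \<odot>\<^bsub>A\<^esub> P (y / snd e) (fst e) j)"
      by (rule t_fs_right[symmetric]) simp_all
    then show "(\<Oplus>\<^bsub>T\<^esub>y\<in>?U. t ((snd e / z) \<odot>\<^bsub>A\<^esub> P (snd e / z) i (fst e)) ((y / snd e) \<odot>\<^bsub>A\<^esub> P (y / snd e) (fst e) j))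
      = t ((snd e / z) \<odot>\<^bsub>A\<^esub> P (snd e / z) i (fst e)) (p (fst e) j)"
      by (simp only: sum_P_divide(3)[OF e'])
  qed simp_all
  also have "\<dots> = (\<Oplus>\<^bsub>T\<^esub>k\<in>UNIV. \<Oplus>\<^bsub>T\<^esub>x\<in>?U. t ((x / z) \<odot>\<^bsub>A\<^esub> P (x / z) i k) (p k j))"
    by (subst T.fs_Times) (simp_all add: fin)
  also have "\<dots> = (\<Oplus>\<^bsub>T\<^esub>k\<in>UNIV. t (p i k) (p k j))"
    by (rule T.fs_cong) (simp_all add: sum_P_divide(3)[OF z] flip: t_fs_left)
  finally show ?thesis by (rule sym)
qed

theorem theorem6p1:
  fixes H :: "complex^'n^'n" and s :: nat
  assumes "s \<ge> 1"
    and "complex_hadamard H"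
    and "\<And>i j. (H $ i $ j) ^ s = 1"
  shows "quantum_subgroup (quantum_aut_hadamard s H) (quantum_aut_graph (hadamard_graph s H))"
proof -
  let ?\<Gamma> = "hadamard_graph s H"
  \<comment> \<open>The relations of the statement are instances of the predicates used here for
    algebras of any type.\<close>
  have G: "quantum_aut_graph ?\<Gamma> = matrix_quantum_group (pverts ?\<Gamma>) (graph_relations ?\<Gamma>)"
    unfolding quantum_aut_graph_def graph_relations_def[abs_def] ..
  have Q: "quantum_aut_hadamard s H = matrix_quantum_group UNIV (hadamard_relations s H)"
    unfolding quantum_aut_hadamard_def hadamard_relations_def[abs_def] ..
  interpret matrix_hopf UNIV "hadamard_relations s H" by (rule matrix_hopf_hadamard[OF assms(1,2)])
  interpret had: hadamard_algebra OG s H u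
    by (intro hadamard_algebra.intro hadamard_algebra_axioms.intro star_algebra_O reduced_O relations_O assms)
  interpret OO: star_algebra_pair OG OG by (rule pair_O)
  interpret T: star_algebra OO.T by (rule OO.star_algebra_T)
  interpret \<Delta>: star_algebra_hom OG OO.T "comult HO" by (rule comult)
  interpret \<epsilon>: star_algebra_hom OG complex_star_alg "counit HO" by (rule counit)
  interpret S: star_algebra_hom OG "opposite OG" "antipode HO" by (rule antipode)
  let ?V = "pverts ?\<Gamma>" and ?W = had.W and ?U = "unity_roots s"
  have mem: "Inl (i, z) \<in> ?V" "Inr (i, z) \<in> ?V" if "z \<in> ?U" for i z
    unfolding had.V using that by auto
  have uc: "u i j \<in> carrier OG" for i j by simp
  have fin: "finite ?U" by (rule finite_unity_roots[OF assms(1)])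
  have cs: "x \<odot>\<^bsub>complex_star_alg\<^esub> y = x * y" "\<zero>\<^bsub>complex_star_alg\<^esub> = 0" for x y by (simp_all add: complex_star_alg_def)
  have os: "smult (opposite OG) = smult OG" "zero (opposite OG) = zero OG" by (simp_all add: opposite_def)
  \<comment> \<open>Homomorphisms commute with conjugation by H, so the structure maps act on
    \<open>had.q\<close> by the same formulas as on \<open>u\<close>. This is needed for the block
    of the column vertices.\<close>
  have \<epsilon>q: "counit HO (had.q i j) = of_bool (i = j)" for i j
    using \<epsilon>.hom_conjugate_by[of u H i j] conjugate_by_complex[OF assms(2), of i j] by (simp add: counit(2))
  have Sq: "antipode HO (had.q i j) = star OG (had.q j i)" for i j
    using S.hom_conjugate_by[of u H i j] conjugate_by_opposite[OF star_algebra_O assms(2), of u i j]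
    by (simp add: antipode(2))
  have \<Delta>q: "comult HO (had.q i j) = (\<Oplus>\<^bsub>OO.T\<^esub>k\<in>UNIV. OO.t (had.q i k) (had.q k j))" for i j
    using \<Delta>.hom_conjugate_by[of u H i j] conjugate_by_tensor[OF star_algebra_O assms(2), of u i j]
    by (simp add: comult(2))
  show ?thesis
    unfolding G Q
  proof (rule quantum_subgroupI[OF matrix_hopf_graph matrix_hopf_axioms])
    show "finite ?V" by (rule had.finite_V)
    show "(w, v) \<in> parcs ?\<Gamma>" if "(v, w) \<in> parcs ?\<Gamma>" for v w using that by (rule symmetric_hadamard_graph)
    show "satisfies ?V (graph_relations ?\<Gamma>) OG ?W"
      by (intro satisfies_graph_relations star_algebra_O reduced_O had.graph_relations_W)
  next
    fix v w assume vw: "v \<in> ?V" "w \<in> ?V"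
    let ?N = "\<lambda>v w. \<Oplus>\<^bsub>OO.T\<^esub>x\<in>?V. OO.t (?W v x) (?W x w)"
    have NV: "?N v w = (\<Oplus>\<^bsub>OO.T\<^esub>e\<in>had.E. OO.t (?W v (Inl e)) (?W (Inl e) w)) \<oplus>\<^bsub>OO.T\<^esub>
      (\<Oplus>\<^bsub>OO.T\<^esub>e\<in>had.E. OO.t (?W v (Inr e)) (?W (Inr e) w))" for v w
      unfolding had.V by (rule T.fs_sum_type) (simp_all add: fin)
    show "comult HO (?W v w) = ?N v w"
    proof (rule had.hom_W[OF comult(1) OO.reduced_T[OF reduced_O reduced_O] _ _ _ _ _ vw])
      show "graph_relations ?\<Gamma> OO.T ?N"
        by (intro graph_relations_tensor star_algebra_O reduced_O had.finite_V had.graph_relations_W)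
      show "?N (Inl e) (Inr e') = \<zero>\<^bsub>OO.T\<^esub>" "?N (Inr e) (Inl e') = \<zero>\<^bsub>OO.T\<^esub>" for e e'
        unfolding NV by simp_all
      fix i j :: 'n and z assume z: "z \<in> ?U"
      have NL: "?N (Inl (i, z)) (Inl (j, y))
        = (\<Oplus>\<^bsub>OO.T\<^esub>e\<in>had.E. OO.t (had.rows.P (snd e / z) i (fst e)) (had.rows.P (y / snd e) (fst e) j))" for y
        unfolding NV by (simp add: had.W_pairs)
      have NR: "?N (Inr (i, z)) (Inr (j, y))
        = (\<Oplus>\<^bsub>OO.T\<^esub>e\<in>had.E. OO.t (had.cols.P (snd e / z) i (fst e)) (had.cols.P (y / snd e) (fst e) j))" for y
        unfolding NV by (simp add: had.W_pairs)
      show "comult HO (u i j) = (\<Oplus>\<^bsub>OO.T\<^esub>y\<in>?U. (y / z) \<odot>\<^bsub>OO.T\<^esub> ?N (Inl (i, z)) (Inl (j, y)))"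
        unfolding NL comult(2)[OF UNIV_I UNIV_I] by (rule had.rows.tensor_eigen[OF z])
      show "comult HO (had.q i j) = (\<Oplus>\<^bsub>OO.T\<^esub>y\<in>?U. (y / z) \<odot>\<^bsub>OO.T\<^esub> ?N (Inr (i, z)) (Inr (j, y)))"
        unfolding NR \<Delta>q by (rule had.cols.tensor_eigen[OF z])
    qed
  next
    fix v w assume vw: "v \<in> ?V" "w \<in> ?V"
    show "counit HO (?W v w) = of_bool (v = w)"
    proof (rule had.hom_W[OF counit(1) reduced_complex graph_relations_complex[OF had.finite_V] _ _ _ _ vw])
      fix i j :: 'n and z assume z: "z \<in> ?U"
      \<comment> \<open>Only y = z contributes, with eigenvalue 1.\<close>
      have *: "(\<Sum>y\<in>?U. y / z * of_bool (i = j \<and> z = y)) = of_bool (i = j)"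
      proof -
        have "(\<Sum>y\<in>?U. y / z * of_bool (i = j \<and> z = y)) = (\<Sum>y\<in>?U. if z = y then of_bool (i = j) else 0)"
          using unity_root_nonzero[OF assms(1) z] by (intro sum.cong) auto
        then show ?thesis using z by (simp add: fin)
      qed
      show "counit HO (u i j) = (\<Oplus>\<^bsub>complex_star_alg\<^esub>y\<in>?U. (y / z) \<odot>\<^bsub>complex_star_alg\<^esub> of_bool (Inl (i, z) = Inl (j, y)))"
        "counit HO (had.q i j) = (\<Oplus>\<^bsub>complex_star_alg\<^esub>y\<in>?U. (y / z) \<odot>\<^bsub>complex_star_alg\<^esub> of_bool (Inr (i, z) = Inr (j, y)))"
        using * by (simp_all add: cs \<epsilon>q counit(2))
    qed (simp_all add: cs)
  next
    fix v w assume vw: "v \<in> ?V" "w \<in> ?V"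
    show "antipode HO (?W v w) = star OG (?W w v)"
    proof (rule had.hom_W[OF antipode(1) reduced_opposite[OF star_algebra_O reduced_O] _ _ _ _ _ vw])
      show "graph_relations ?\<Gamma> (opposite OG) (\<lambda>v w. star OG (?W w v))"
        using symmetric_hadamard_graph by (intro graph_relations_opposite star_algebra_O had.graph_relations_W)
      fix i j :: 'n and z assume z: "z \<in> ?U"
      show "antipode HO (u i j) = (\<Oplus>\<^bsub>opposite OG\<^esub>y\<in>?U. (y / z) \<odot>\<^bsub>opposite OG\<^esub> star OG (?W (Inl (j, y)) (Inl (i, z))))"
        using had.rows.star_eigen[OF z, of j i] by (simp add: os antipode(2))
      show "antipode HO (had.q i j) = (\<Oplus>\<^bsub>opposite OG\<^esub>y\<in>?U. (y / z) \<odot>\<^bsub>opposite OG\<^esub> star OG (?W (Inr (j, y)) (Inr (i, z))))"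
        using had.cols.star_eigen[OF z, of j i] by (simp add: os Sq)
    qed (simp_all add: os)
  next
    fix i j :: 'n
    \<comment> \<open>The row of the vertex (r_i, 1) suffices to recover the generator: u_ij is the
      sum of y W((r_i, 1), (r_j, y)) over all roots y. The coefficients \<open>c\<close> vanish off
      these positions.\<close>
    define Z :: "(('n \<times> complex + 'n \<times> complex) \<times> ('n \<times> complex + 'n \<times> complex)) set" where "Z = {Inl (i, 1)} \<times> Inl ` ({j} \<times> ?U)"
    define c where "c vw = (if vw \<in> Z then snd (projl (snd vw)) else 0)" for vw
    have ZV: "Z \<subseteq> ?V \<times> ?V" unfolding Z_def had.V using unity_roots_one by auto
    have "(\<Oplus>\<^bsub>OG\<^esub>vw\<in>?V \<times> ?V. c vw \<odot>\<^bsub>OG\<^esub> ?W (fst vw) (snd vw)) = (\<Oplus>\<^bsub>OG\<^esub>vw\<in>Z. c vw \<odot>\<^bsub>OG\<^esub> ?W (fst vw) (snd vw))"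
      by (rule had.fs_superset[symmetric]) (simp_all add: ZV had.finite_V c_def)
    also have "\<dots> = (\<Oplus>\<^bsub>OG\<^esub>y\<in>?U. c (Inl (i, 1), Inl (j, y)) \<odot>\<^bsub>OG\<^esub> ?W (Inl (i, 1)) (Inl (j, y)))"
    proof -
      have "bij_betw (\<lambda>y. (Inl (i, 1), Inl (j, y))) ?U Z"
        unfolding Z_def by (auto simp: bij_betw_def inj_on_def)
      from had.fs_reindex[OF this, of "\<lambda>vw. c vw \<odot>\<^bsub>OG\<^esub> ?W (fst vw) (snd vw)"] show ?thesis by simp
    qed
    also have "\<dots> = (\<Oplus>\<^bsub>OG\<^esub>y\<in>?U. (y / 1) \<odot>\<^bsub>OG\<^esub> had.rows.P (y / 1) i j)"
      by (rule had.fs_cong) (simp_all add: c_def Z_def image_iff)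
    also have "\<dots> = u i j" by (rule had.rows.sum_P_divide(3)[OF unity_roots_one])
    finally show "\<exists>c. u i j = (\<Oplus>\<^bsub>OG\<^esub>vw\<in>?V \<times> ?V. c vw \<odot>\<^bsub>OG\<^esub> ?W (fst vw) (snd vw))"
      by (intro exI[of _ c]) (rule sym)
  qed
qed

end
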